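(* Let $M$ be a $d$-dimensional Poisson manifold with Poisson structure $\alpha$ such that in every chart $U$ (identified with an open subset of $\mathbb{R}^d$) there is a positive function $M_U$ with $|\partial^\beta\alpha^{ij}(x)|\le M_U(x)^{|\beta|+1}$ for all $x\in U$, all $i,j=1,\dots,d$ and all multi-indices $\beta\in\mathbb{N}^d$. Let $U$ be a chart, let $\epsilon\in[0,1)$, and let $$S_\epsilon(p_1,p_2,x)=\langle p_1+p_2,x\rangle+\sum_{n=1}^\infty\frac{\epsilon^n}{n!}\sum_{\Gamma\in T_{n,2}}W_\Gamma\hat B_\Gamma(p_1,p_2,x),$$ which converges for $(p_1,p_2,x)$ in a suitable neighborhood of $\{0\}\times\{0\}\times U$ in $(\mathbb{R}^d)^*\times(\mathbb{R}^d)^*\times U$; this neighborhood is fixed and is taken as the domain of $S_\epsilon$. Put $$s(p,q)=\nabla_{p_2}S_\epsilon(p,0,q),\qquad t(p,q)=\nabla_{p_1}S_\epsilon(0,p,q),\qquad B(x)=2\nabla_{p_1}\nabla_{p_2}S_\epsilon(0,0,x)=2\epsilon\alpha(x),$$ and let $$G_S(U)=\{(p,q)\in T^*U:\ s(p,q)\in U\ \text{and}\ t(p,q)\in U\}$$ (points at which $s$ and $t$ are defined and take their values in $U$), a neighborhood of the zero section $\{0\}\times U$ in $T^*U$. Let $(\bar p,\bar q)\in G_S(U)$. Then: (a) If $x(\cdot)$ is the solution of the Poisson equation $$\dot x^i(\tau)=\sum_{j=1}^dB^{ij}(x(\tau))\,\bar p_j,\qquad x(0)=s(\bar p,\bar q),$$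 then $x(1)=t(\bar p,\bar q)$. (b) Moreover, the Hamilton system on $G_S(U)$ $$\dot p=-\nabla_qH(p,q),\qquad \dot q=\nabla_pH(p,q)$$ associated to the Hamiltonian $H=-t^*l_{\bar p}$, where $l_{\bar p}(x)=\langle\bar p,x\rangle$, that is $H(p,q)=-\langle\bar p,t(p,q)\rangle$, takes the point $(0,s(\bar p,\bar q))$ to the point $(\bar p,\bar q)$ in time $1$.
   Context: **Kontsevich graphs and trees.** For $n\ge1$, $G_{n,2}$ is the set of labelled oriented graphs $\Gamma$ with vertex set $V_\Gamma=V_\Gamma^a\sqcup\{\bar1,\bar2\}$, where $V_\Gamma^a=\{1,\dots,n\}$ (aerial vertices) and $\bar1,\bar2$ are the ground vertices, such that no edge starts at a ground vertex and each aerial vertex $k$ has exactly two ordered outgoing edges $e_k^1,e_k^2$, ending at $\gamma^1(k),\gamma^2(k)\in V_\Gamma\setminus\{k\}$ with $\gamma^1(k)\ne\gamma^2(k)$. $\Delta(\Gamma)$ is the unoriented (multi)graph obtained by restricting $\Gamma$ to the aerial vertices. $T_{n,2}\subset G_{n,2}$ (Kontsevich trees) is the subset of $\Gamma$ for which $\Delta(\Gamma)$ is a tree (connected, no cycles; two opposite edges between the same two vertices count as a cycle). **Weights.** Let $\mathcal H$ be the upper half plane and $\phi^h(z,w)=\frac1{2i}\log\frac{(w-z)(\bar w-z)}{(w-\bar z)(\bar w-\bar z)}\in\mathbb{R}/2\pi\mathbb{Z}$ be the hyperbolic angle at $z$ between the geodesic from $z$ to $\infty$ and the geodesic from $z$ to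 $w$. Put $z_{\bar1}=0$, $z_{\bar2}=1$, and let $\mathcal H^n\setminus D^n$ be the set of $(z_1,\dots,z_n)\in\mathcal H^n$ with pairwise distinct entries. Then $$W_\Gamma=\frac1{(2\pi)^{2n}}\int_{\mathcal H^n\setminus D^n}\bigwedge_{k=1}^n d\phi^h(z_k,z_{\gamma^1(k)})\wedge d\phi^h(z_k,z_{\gamma^2(k)}).$$ **Symbols.** For $\Gamma\in G_{n,2}$ with edge set $E_\Gamma$, $$\hat B_\Gamma(p_1,p_2,x)=\sum_{I:E_\Gamma\to\{1,\dots,d\}}\Big[\prod_{k=1}^n\Big(\prod_{e\text{ ending at }k}\partial_{I(e)}\Big)\alpha^{I(e_k^1)I(e_k^2)}(x)\Big]\prod_{e\text{ ending at }\bar1}(p_1)_{I(e)}\prod_{e\text{ ending at }\bar2}(p_2)_{I(e)} .$$ Points of $T^*U$ are written $(p,q)$ with $p\in(\mathbb{R}^d)^*$, $q\in U$; the zero section is $\{0\}\times U$. *)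

theory Defs
  imports "HOL-Analysis.Analysis"
begin

section \<open>Partial derivatives and gradients\<close>

definition partial :: "'d \<Rightarrow> (real^'d::finite \<Rightarrow> real) \<Rightarrow> real^'d \<Rightarrow> real" where
  "partial i f x = deriv (\<lambda>t. f (x + t *\<^sub>R axis i 1)) 0"

fun iter_partial :: "'d list \<Rightarrow> (real^'d::finite \<Rightarrow> real) \<Rightarrow> real^'d \<Rightarrow> real" where
  "iter_partial [] f = f"
| "iter_partial (i # is) f = partial i (iter_partial is f)"

definition smooth_on :: "(real^'d::finite) set \<Rightarrow> (real^'d \<Rightarrow> real) \<Rightarrow> bool" where
  "smooth_on X f \<longleftrightarrow> (\<forall>is. iter_partial is f differentiable_on X)"

definition has_gradient_at :: "(real^'d::finite \<Rightarrow> real) \<Rightarrow> real^'d \<Rightarrow> bool" where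
  "has_gradient_at f x \<longleftrightarrow> (\<exists>D. GDERIV f x :> D)"

definition gradient :: "(real^'d::finite \<Rightarrow> real) \<Rightarrow> real^'d \<Rightarrow> real^'d" where
  "gradient f x = (THE D. GDERIV f x :> D)"


section \<open>Poisson manifolds\<close>

text \<open>The manifold is the whole type \<open>'m\<close>. A chart is a pair of its domain and its coordinate
  map; the open subset of \<open>\<real>\<^sup>d\<close> identified with the chart is \<open>chart_image\<close>.\<close>

type_synonym ('m, 'd) chart = "'m set \<times> ('m \<Rightarrow> real^'d)"

definition chart_image :: "('m, 'd::finite) chart \<Rightarrow> (real^'d) set" where
  "chart_image c = snd c ` fst c"

definition transition ::
  "('m, 'd::finite) chart \<Rightarrow> ('m, 'd) chart \<Rightarrow> real^'d \<Rightarrow> real^'d" where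
  "transition c c' = snd c' \<circ> inv_into (fst c) (snd c)"

definition chart_overlap :: "('m, 'd::finite) chart \<Rightarrow> ('m, 'd) chart \<Rightarrow> (real^'d) set" where
  "chart_overlap c c' = snd c ` (fst c \<inter> fst c')"

definition smooth_atlas ::
  "('m::{t2_space, second_countable_topology}, 'd::finite) chart set \<Rightarrow> bool" where
  "smooth_atlas A \<longleftrightarrow>
     (\<Union>c\<in>A. fst c) = UNIV \<and>
     (\<forall>c\<in>A. open (fst c) \<and> open (chart_image c) \<and>
        homeomorphism (fst c) (chart_image c) (snd c) (inv_into (fst c) (snd c))) \<and>
     (\<forall>c\<in>A. \<forall>c'\<in>A. \<forall>k. smooth_on (chart_overlap c c') (\<lambda>x. transition c c' x $ k))"

definition local_poisson :: "(real^'d::finite) set \<Rightarrow> (real^'d \<Rightarrow> real^'d^'d) \<Rightarrow> bool" where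
  "local_poisson U \<alpha> \<longleftrightarrow>
     (\<forall>i j. smooth_on U (\<lambda>x. \<alpha> x $ i $ j)) \<and>
     (\<forall>x\<in>U. \<forall>i j. \<alpha> x $ i $ j = - \<alpha> x $ j $ i) \<and>
     (\<forall>x\<in>U. \<forall>i j k. (\<Sum>l\<in>UNIV.
          \<alpha> x $ i $ l * partial l (\<lambda>y. \<alpha> y $ j $ k) x
        + \<alpha> x $ j $ l * partial l (\<lambda>y. \<alpha> y $ k $ i) x
        + \<alpha> x $ k $ l * partial l (\<lambda>y. \<alpha> y $ i $ j) x) = 0)"

text \<open>A Poisson structure is given by its components \<open>P c\<close> in each chart \<open>c\<close>, related by the
  transformation law of bivector fields.\<close>

definition poisson_structure ::
  "('m::{t2_space, second_countable_topology}, 'd::finite) chart set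
     \<Rightarrow> (('m, 'd) chart \<Rightarrow> real^'d \<Rightarrow> real^'d^'d) \<Rightarrow> bool" where
  "poisson_structure A P \<longleftrightarrow>
     (\<forall>c\<in>A. local_poisson (chart_image c) (P c)) \<and>
     (\<forall>c\<in>A. \<forall>c'\<in>A. \<forall>x\<in>chart_overlap c c'. \<forall>k l.
        P c' (transition c c' x) $ k $ l =
          (\<Sum>i\<in>UNIV. \<Sum>j\<in>UNIV.
             partial i (\<lambda>y. transition c c' y $ k) x *
             partial j (\<lambda>y. transition c c' y $ l) x * P c x $ i $ j))"

text \<open>A list \<open>is\<close> with \<open>count_list is i = \<beta> i\<close> for all \<open>i\<close> spells out the multi-index \<open>\<beta>\<close>; the
  order of differentiation is immaterial, as the components are smooth.\<close>

definition derivative_bound ::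
  "(real^'d::finite) set \<Rightarrow> (real^'d \<Rightarrow> real^'d^'d) \<Rightarrow> (real^'d \<Rightarrow> real) \<Rightarrow> bool" where
  "derivative_bound U \<alpha> M \<longleftrightarrow>
     (\<forall>x\<in>U. 0 < M x \<and>
       (\<forall>i j. \<forall>\<beta> :: 'd \<Rightarrow> nat. \<forall>is. (\<forall>r. count_list is r = \<beta> r) \<longrightarrow>
          \<bar>iter_partial is (\<lambda>y. \<alpha> y $ i $ j) x\<bar> \<le> M x ^ ((\<Sum>r\<in>UNIV. \<beta> r) + 1)))"


section \<open>Kontsevich graphs and trees\<close>

datatype kvertex = Aerial nat | Ground1 | Ground2

text \<open>The edge \<open>(k, a)\<close> is the \<open>a\<close>-th edge starting at the aerial vertex \<open>k\<close>. A graph is the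
  function sending each edge to its end point.\<close>

definition kedges :: "nat \<Rightarrow> (nat \<times> nat) set" where
  "kedges n = {1..n} \<times> {1..2}"

definition kgraphs :: "nat \<Rightarrow> (nat \<times> nat \<Rightarrow> kvertex) set" where
  "kgraphs n = {\<Gamma> \<in> kedges n \<rightarrow>\<^sub>E (Aerial ` {1..n} \<union> {Ground1, Ground2}).
     \<forall>k\<in>{1..n}. \<Gamma> (k, 1) \<noteq> Aerial k \<and> \<Gamma> (k, 2) \<noteq> Aerial k \<and> \<Gamma> (k, 1) \<noteq> \<Gamma> (k, 2)}"

lemma finite_kgraphs: "finite (kgraphs n)"
proof (rule finite_subset)
  show "kgraphs n \<subseteq> kedges n \<rightarrow>\<^sub>E (Aerial ` {1..n} \<union> {Ground1, Ground2})"
    by (auto simp: kgraphs_def)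
  show "finite (kedges n \<rightarrow>\<^sub>E (Aerial ` {1..n} \<union> {Ground1, Ground2}))"
    by (intro finite_PiE) (auto simp: kedges_def)
qed

definition joins :: "(nat \<times> nat \<Rightarrow> kvertex) \<Rightarrow> nat \<times> nat \<Rightarrow> nat \<Rightarrow> nat \<Rightarrow> bool" where
  "joins \<Gamma> e u v \<longleftrightarrow>
     (fst e = u \<and> \<Gamma> e = Aerial v) \<or> (fst e = v \<and> \<Gamma> e = Aerial u)"

definition aerial_connected :: "nat \<Rightarrow> (nat \<times> nat \<Rightarrow> kvertex) \<Rightarrow> bool" where
  "aerial_connected n \<Gamma> \<longleftrightarrow>
     (\<forall>u\<in>{1..n}. \<forall>v\<in>{1..n}. (u, v) \<in> {(a, b). \<exists>e\<in>kedges n. joins \<Gamma> e a b}\<^sup>*)"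

text \<open>Distinctness is required of the edges, not of the unordered pairs of end points, so two
  opposite edges between the same vertices form a cycle of length 2.\<close>

definition aerial_cycle ::
  "nat \<Rightarrow> (nat \<times> nat \<Rightarrow> kvertex) \<Rightarrow> nat list \<Rightarrow> (nat \<times> nat) list \<Rightarrow> bool" where
  "aerial_cycle n \<Gamma> vs es \<longleftrightarrow>
     vs \<noteq> [] \<and> length es = length vs \<and> distinct vs \<and> distinct es \<and> set es \<subseteq> kedges n \<and>
     (\<forall>i<length vs. joins \<Gamma> (es ! i) (vs ! i) (vs ! (Suc i mod length vs)))"

definition ktrees :: "nat \<Rightarrow> (nat \<times> nat \<Rightarrow> kvertex) set" where
  "ktrees n = {\<Gamma> \<in> kgraphs n. aerial_connected n \<Gamma> \<and> \<not> (\<exists>vs es. aerial_cycle n \<Gamma> vs es)}"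


section \<open>Weights\<close>

definition position :: "(nat \<Rightarrow> complex) \<Rightarrow> kvertex \<Rightarrow> complex" where
  "position z v = (case v of Aerial k \<Rightarrow> z k | Ground1 \<Rightarrow> 0 | Ground2 \<Rightarrow> 1)"

text \<open>The hyperbolic angle is \<open>\<phi>\<^sup>h = log (angle_ratio z w) / (2\<i>)\<close>. It is multivalued, but on every
  branch its differential is the logarithmic differential of \<open>angle_ratio\<close> divided by \<open>2\<i>\<close>. This
  number is real because \<open>angle_ratio\<close> has modulus 1.\<close>

definition angle_ratio :: "complex \<Rightarrow> complex \<Rightarrow> complex" where
  "angle_ratio z w = ((w - z) * (cnj w - z)) / ((w - cnj z) * (cnj w - cnj z))"

text \<open>The value of the one-form \<open>d\<phi>\<^sup>h(z\<^sub>k, z\<^sub>v)\<close> on the tangent vector that moves \<open>z\<^sub>l\<close> in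
  direction \<open>u\<close> and fixes the other points.\<close>

definition dangle :: "nat \<Rightarrow> kvertex \<Rightarrow> (nat \<Rightarrow> complex) \<Rightarrow> nat \<Rightarrow> complex \<Rightarrow> real" where
  "dangle k v z l u =
     Re (vector_derivative
           (\<lambda>t. let z' = z(l := z l + t *\<^sub>R u)
                in angle_ratio (position z' (Aerial k)) (position z' v)) (at 0)
         / (2 * \<i> * angle_ratio (position z (Aerial k)) (position z v)))"

text \<open>Coefficient of \<open>\<omega>\<^sub>0 \<and> \<dots> \<and> \<omega>\<^sub>m\<^sub>-\<^sub>1\<close> with respect to \<open>dx\<^sub>0 \<and> \<dots> \<and> dx\<^sub>m\<^sub>-\<^sub>1\<close>, where
  \<open>\<omega> r c\<close> is the \<open>dx\<^sub>c\<close>-component of the one-form \<open>\<omega>\<^sub>r\<close>.\<close>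

definition wedge_coeff :: "nat \<Rightarrow> (nat \<Rightarrow> nat \<Rightarrow> real) \<Rightarrow> real" where
  "wedge_coeff m \<omega> =
     (\<Sum>\<sigma> | \<sigma> permutes {..<m}. of_int (sign \<sigma>) * (\<Prod>r<m. \<omega> r (\<sigma> r)))"

text \<open>The one-forms are ordered \<open>e\<^sub>1\<^sup>1, e\<^sub>1\<^sup>2, e\<^sub>2\<^sup>1, e\<^sub>2\<^sup>2, \<dots>\<close> and the coordinates
  \<open>Re z\<^sub>1, Im z\<^sub>1, Re z\<^sub>2, Im z\<^sub>2, \<dots>\<close>; the latter order is the orientation of \<open>\<H>\<^sup>n\<close>.\<close>

definition weight_density ::
  "nat \<Rightarrow> (nat \<times> nat \<Rightarrow> kvertex) \<Rightarrow> (nat \<Rightarrow> complex) \<Rightarrow> real" where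
  "weight_density n \<Gamma> z =
     wedge_coeff (2 * n) (\<lambda>r c.
       dangle (r div 2 + 1) (\<Gamma> (r div 2 + 1, r mod 2 + 1)) z
              (c div 2 + 1) (if even c then 1 else \<i>))"

definition config_space :: "nat \<Rightarrow> (nat \<Rightarrow> complex) set" where
  "config_space n = {z \<in> {1..n} \<rightarrow>\<^sub>E {w. 0 < Im w}. inj_on z {1..n}}"

definition weight :: "nat \<Rightarrow> (nat \<times> nat \<Rightarrow> kvertex) \<Rightarrow> real" where
  "weight n \<Gamma> =
     set_lebesgue_integral (Pi\<^sub>M {1..n} (\<lambda>_. lborel)) (config_space n) (weight_density n \<Gamma>)
       / (2 * pi) ^ (2 * n)"


section \<open>Symbols and the generating function\<close>

definition kedge_list :: "nat \<Rightarrow> (nat \<times> nat) list" where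
  "kedge_list n = List.product [1..<Suc n] [1, 2]"

lemma set_kedge_list: "set (kedge_list n) = kedges n" "distinct (kedge_list n)"
proof -
  have "{1..2::nat} = {1, 2}" by auto
  then show "set (kedge_list n) = kedges n" by (auto simp: kedge_list_def kedges_def)
  show "distinct (kedge_list n)" by (simp add: kedge_list_def distinct_product)
qed

definition ksymbol ::
  "nat \<Rightarrow> (nat \<times> nat \<Rightarrow> kvertex) \<Rightarrow> (real^'d::finite \<Rightarrow> real^'d^'d)
     \<Rightarrow> real^'d \<Rightarrow> real^'d \<Rightarrow> real^'d \<Rightarrow> real" where
  "ksymbol n \<Gamma> \<alpha> p\<^sub>1 p\<^sub>2 x =
     (\<Sum>I \<in> kedges n \<rightarrow>\<^sub>E (UNIV :: 'd set).
        (\<Prod>k=1..n. iter_partial (map I (filter (\<lambda>e. \<Gamma> e = Aerial k) (kedge_list n)))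
                      (\<lambda>y. \<alpha> y $ I (k, 1) $ I (k, 2)) x)
        * (\<Prod>e \<in> {e \<in> kedges n. \<Gamma> e = Ground1}. p\<^sub>1 $ I e)
        * (\<Prod>e \<in> {e \<in> kedges n. \<Gamma> e = Ground2}. p\<^sub>2 $ I e))"

text \<open>Covectors are identified with vectors through the inner product of \<open>\<real>\<^sup>d\<close>.\<close>

definition genfun_term ::
  "real \<Rightarrow> (real^'d::finite \<Rightarrow> real^'d^'d) \<Rightarrow> nat
     \<Rightarrow> real^'d \<Rightarrow> real^'d \<Rightarrow> real^'d \<Rightarrow> real" where
  "genfun_term \<epsilon> \<alpha> n p\<^sub>1 p\<^sub>2 x =
     \<epsilon> ^ n / fact n * (\<Sum>\<Gamma>\<in>ktrees n. weight n \<Gamma> * ksymbol n \<Gamma> \<alpha> p\<^sub>1 p\<^sub>2 x)"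

definition genfun ::
  "real \<Rightarrow> (real^'d::finite \<Rightarrow> real^'d^'d) \<Rightarrow> real^'d \<Rightarrow> real^'d \<Rightarrow> real^'d \<Rightarrow> real" where
  "genfun \<epsilon> \<alpha> p\<^sub>1 p\<^sub>2 x = (p\<^sub>1 + p\<^sub>2) \<bullet> x + (\<Sum>n. genfun_term \<epsilon> \<alpha> (Suc n) p\<^sub>1 p\<^sub>2 x)"

text \<open>\<open>genfun\<close> is a total function; it is only meaningful on a set \<open>N\<close> as follows.\<close>

definition genfun_domain ::
  "real \<Rightarrow> (real^'d::finite \<Rightarrow> real^'d^'d) \<Rightarrow> (real^'d) set
     \<Rightarrow> ((real^'d) \<times> (real^'d) \<times> (real^'d)) set \<Rightarrow> bool" where
  "genfun_domain \<epsilon> \<alpha> U N \<longleftrightarrow>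
     open N \<and> {0} \<times> {0} \<times> U \<subseteq> N \<and> N \<subseteq> UNIV \<times> UNIV \<times> U \<and>
     (\<forall>(p\<^sub>1, p\<^sub>2, x)\<in>N. summable (\<lambda>n. genfun_term \<epsilon> \<alpha> (Suc n) p\<^sub>1 p\<^sub>2 x))"

definition source_map ::
  "real \<Rightarrow> (real^'d::finite \<Rightarrow> real^'d^'d) \<Rightarrow> real^'d \<Rightarrow> real^'d \<Rightarrow> real^'d" where
  "source_map \<epsilon> \<alpha> p q = gradient (\<lambda>p\<^sub>2. genfun \<epsilon> \<alpha> p p\<^sub>2 q) 0"

definition target_map ::
  "real \<Rightarrow> (real^'d::finite \<Rightarrow> real^'d^'d) \<Rightarrow> real^'d \<Rightarrow> real^'d \<Rightarrow> real^'d" where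
  "target_map \<epsilon> \<alpha> p q = gradient (\<lambda>p\<^sub>1. genfun \<epsilon> \<alpha> p\<^sub>1 p q) 0"

definition B_field ::
  "real \<Rightarrow> (real^'d::finite \<Rightarrow> real^'d^'d) \<Rightarrow> real^'d \<Rightarrow> real^'d^'d" where
  "B_field \<epsilon> \<alpha> x =
     (\<chi> i j. 2 * partial i (\<lambda>p\<^sub>1. partial j (\<lambda>p\<^sub>2. genfun \<epsilon> \<alpha> p\<^sub>1 p\<^sub>2 x) 0) 0)"

definition G_S ::
  "real \<Rightarrow> (real^'d::finite \<Rightarrow> real^'d^'d) \<Rightarrow> (real^'d) set
     \<Rightarrow> ((real^'d) \<times> (real^'d) \<times> (real^'d)) set \<Rightarrow> ((real^'d) \<times> (real^'d)) set" where
  "G_S \<epsilon> \<alpha> U N = {(p, q).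
     (p, 0, q) \<in> N \<and> has_gradient_at (\<lambda>p\<^sub>2. genfun \<epsilon> \<alpha> p p\<^sub>2 q) 0 \<and>
     (0, p, q) \<in> N \<and> has_gradient_at (\<lambda>p\<^sub>1. genfun \<epsilon> \<alpha> p\<^sub>1 p q) 0 \<and>
     source_map \<epsilon> \<alpha> p q \<in> U \<and> target_map \<epsilon> \<alpha> p q \<in> U}"


section \<open>The two differential equations, on the time interval from 0 to 1\<close>

definition poisson_solution ::
  "(real^'d::finite) set \<Rightarrow> (real^'d \<Rightarrow> real^'d^'d) \<Rightarrow> real^'d \<Rightarrow> real^'d
     \<Rightarrow> (real \<Rightarrow> real^'d) \<Rightarrow> bool" where
  "poisson_solution U B p x0 x \<longleftrightarrow>
     x 0 = x0 \<and>
     (\<forall>\<tau>\<in>{0..1}. x \<tau> \<in> U \<and> (x has_vector_derivative B (x \<tau>) *v p) (at \<tau> within {0..1}))"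

definition hamilton_solution ::
  "((real^'d::finite) \<times> (real^'d)) set \<Rightarrow> (real^'d \<Rightarrow> real^'d \<Rightarrow> real) \<Rightarrow> (real^'d) \<times> (real^'d)
     \<Rightarrow> (real \<Rightarrow> real^'d) \<Rightarrow> (real \<Rightarrow> real^'d) \<Rightarrow> bool" where
  "hamilton_solution G H y0 p q \<longleftrightarrow>
     (p 0, q 0) = y0 \<and>
     (\<forall>\<tau>\<in>{0..1}. (p \<tau>, q \<tau>) \<in> G \<and>
        has_gradient_at (\<lambda>q'. H (p \<tau>) q') (q \<tau>) \<and>
        has_gradient_at (\<lambda>p'. H p' (q \<tau>)) (p \<tau>) \<and>
        (p has_vector_derivative - gradient (\<lambda>q'. H (p \<tau>) q') (q \<tau>)) (at \<tau> within {0..1}) \<and>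
        (q has_vector_derivative gradient (\<lambda>p'. H p' (q \<tau>)) (p \<tau>)) (at \<tau> within {0..1}))"

end

theory Submission
  imports Defs
begin

text \<open>Only trees with exactly one edge ending at the second ground vertex contribute to the source
  map, so they are rooted trees. Integrating out the aerial vertices from the leaves, with the angle
  of the parent as parameter, shows that the weight of a rooted tree is obtained by iterating the
  operator taking a function on \<open>[0, 1]\<close> to its primitive of mean zero. The recursion of rooted trees
  then identifies the generating series with the curve \<open>X' = 2 \<epsilon> \<alpha>(X) p\<close> on \<open>[0, 1]\<close> of mean
  \<open>\<integral> X = q\<close>, and \<open>s(p, q) = X(0)\<close>. Exchanging the ground vertices by \<open>z \<mapsto> 1 - cnj z\<close> changes
  \<open>\<epsilon>\<close> to \<open>- \<epsilon>\<close>, which reverses the curve: \<open>t(p, q) = X(1)\<close>. This is (a).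

  For (b), integration by parts and the antisymmetry of \<open>\<alpha>\<close> give, for every \<open>\<tau>\<close>,
  \<open>\<langle>a, t(p, q)\<rangle> = \<langle>a, q\<rangle> - 2 \<epsilon> \<langle>p - \<tau> a, \<integral> u \<alpha>(X(u)) a du\<rangle>\<close>. Hence the Hamiltonian flow
  has \<open>p(\<tau>) = \<tau> a\<close>, and \<open>q(\<tau>)\<close> is the mean of the curve \<open>u \<mapsto> X(\<tau> u)\<close>.
  The bounds \<open>M\<close> need not be locally bounded; a Baire category argument makes them so, after
  which they are encoded in a 1-Lipschitz radius. The Jacobi identity plays no role.\<close>

section \<open>Rooted trees and primitives of mean zero\<close>

text \<open>Where \<open>mean_prim\<close> comes from: a leaf z joined to the ground point 0 and to
  its parent w is integrated along the rays from 0. Along the ray of argument pi * s, the argument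
  of \<open>(z - w) * (z - cnj w)\<close> changes by 2 * pi * s, less one full turn if the ray lies
  beyond w. What remains is s minus the indicator of s \<ge> u, where pi * u is the argument of w,
  and this is the kernel of the primitive of mean zero. The root is joined to the ground point 1, of
  argument 0; hence the value X(0). The tree sums are matched with the curve as power series in
  \<epsilon>. Sums with extra derivatives at the root obey a chain rule of their own, an infinite
  linear system that has only one solution within geometric bounds; this takes the place of an
  expansion of the flow. All sizes are measured by the radius at a point: momenta below a small
  multiple of its square make the curve short on that scale. Solutions of the Hamilton system must
  stay inside \<open>G_S\<close>, so the domain is cut out by a condition at X(0), a point that does
  not change along the flow.\<close>

definition mean_prim :: "(real \<Rightarrow> real) \<Rightarrow> real \<Rightarrow> real" where
  "mean_prim g u = integral {0..1} (\<lambda>s. s * g s) - integral {u..1} g"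

lemma mean_prim_deriv:
  assumes "continuous_on {0..1} g" "u \<in> {0..1}"
  shows "(mean_prim g has_vector_derivative g u) (at u within {0..1})"
proof -
  have "((\<lambda>u. integral {0..u} g) has_vector_derivative g u) (at u within {0..1})"
    using integral_has_vector_derivative[OF assms] .
  then have "((\<lambda>u. integral {0..1} (\<lambda>s. s * g s) - integral {0..1} g + integral {0..u} g)
      has_vector_derivative g u) (at u within {0..1})"
    using has_vector_derivative_add[OF has_vector_derivative_const] by fastforce
  then show ?thesis
  proof (rule has_vector_derivative_transform[OF assms(2), rotated])
    fix x :: real assume x: "x \<in> {0..1}"
    have "integral {0..x} g + integral {x..1} g = integral {0..1} g"
      using x by (intro Henstock_Kurzweil_Integration.integral_combine)
        (auto intro: integrable_continuous_real assms)
    then show "mean_prim g x =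
      integral {0..1} (\<lambda>s. s * g s) - integral {0..1} g + integral {0..x} g"
      by (simp add: mean_prim_def)
  qed
qed

lemma mean_prim_cont: "continuous_on {0..1} g \<Longrightarrow> continuous_on {0..1} (mean_prim g)"
  using mean_prim_deriv by (meson continuous_on_vector_derivative)

lemma mean_prim_sum:
  assumes "finite A" "\<And>a. a \<in> A \<Longrightarrow> continuous_on {0..1} (g a)" "u \<in> {0..1}"
  shows "mean_prim (\<lambda>s. \<Sum>a\<in>A. g a s * c a) u = (\<Sum>a\<in>A. mean_prim (g a) u * c a)"
proof -
  have 1: "(\<lambda>s. s * g a s) integrable_on {0..1}" if "a \<in> A" for a
    using assms that by (intro integrable_continuous_real continuous_intros) auto
  have 2: "g a integrable_on {u..1}" if "a \<in> A" for a
    using assms that by (intro integrable_continuous_real continuous_on_subset[OF assms(2)]) auto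
  have "integral {0..1} (\<lambda>s. s * (\<Sum>a\<in>A. g a s * c a)) =
    integral {0..1} (\<lambda>s. \<Sum>a\<in>A. (s * g a s) * c a)"
    by (simp add: sum_distrib_left mult.assoc)
  also have "\<dots> = (\<Sum>a\<in>A. integral {0..1} (\<lambda>s. s * g a s) * c a)"
    by (subst Henstock_Kurzweil_Integration.integral_sum) (use assms 1 in \<open>auto intro: integrable_on_mult_left\<close>)
  finally have "integral {0..1} (\<lambda>s. s * (\<Sum>a\<in>A. g a s * c a)) = (\<Sum>a\<in>A. integral {0..1} (\<lambda>s. s * g a s) * c a)" .
  moreover have "integral {u..1} (\<lambda>s. \<Sum>a\<in>A. g a s * c a) = (\<Sum>a\<in>A. integral {u..1} (g a) * c a)"
    by (subst Henstock_Kurzweil_Integration.integral_sum) (use assms 2 in \<open>auto intro: integrable_on_mult_left\<close>)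
  ultimately show ?thesis
    by (simp add: mean_prim_def sum_subtractf left_diff_distrib)
qed

lemma mean_prim_cong:
  assumes "\<And>s. s \<in> {0..1} \<Longrightarrow> g s = h s" "u \<in> {0..1}"
  shows "mean_prim g u = mean_prim h u"
proof -
  have "integral {u..1} g = integral {u..1} h"
    using assms by (intro integral_cong) auto
  moreover have "integral {0..1} (\<lambda>s. s * g s) = integral {0..1} (\<lambda>s. s * h s)"
    using assms by (intro integral_cong) auto
  ultimately show ?thesis by (simp add: mean_prim_def)
qed

text \<open>A rooted tree as a parent function: a vertex is sent to its parent, together with the
  tensor index carried by the edge between them.\<close>

type_synonym 'd decoration = "nat \<Rightarrow> nat \<times> 'd"

definition kids :: "nat set \<Rightarrow> nat \<Rightarrow> 'd decoration \<Rightarrow> nat \<Rightarrow> nat set" where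
  "kids S r g k = {c \<in> S - {r}. fst (g c) = k}"

text \<open>A rank that drops from each vertex to its parent excludes cycles of the parent function,
  so every path upwards ends at \<open>r\<close>.\<close>

definition dtrees :: "nat set \<Rightarrow> nat \<Rightarrow> ('d::finite) decoration set" where
  "dtrees S r = {g \<in> (S - {r}) \<rightarrow>\<^sub>E S \<times> UNIV. \<exists>\<rho>::nat \<Rightarrow> nat. \<forall>k\<in>S - {r}. \<rho> (fst (g k)) < \<rho> k}"

text \<open>Up to normalization, \<open>F k\<close> is what the branch hanging at \<open>k\<close>
  contributes once all its vertices are integrated out, as a function of the angle of the parent of
  \<open>k\<close>.\<close>

definition branch_family :: "nat set \<Rightarrow> nat \<Rightarrow> 'd decoration \<Rightarrow> (nat \<Rightarrow> real \<Rightarrow> real) \<Rightarrow> bool" where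
  "branch_family S r g F \<longleftrightarrow>
     (\<forall>k\<in>S - {r}. \<forall>u. F k u = mean_prim (\<lambda>u. \<Prod>c\<in>kids S r g k. F c u) u)"

text \<open>The root itself is not integrated out: \<open>u\<close> is its own angle, divided by pi.
  The choice of the family is harmless by \<open>branch_family_unique\<close>.\<close>

definition twt :: "nat set \<Rightarrow> nat \<Rightarrow> 'd decoration \<Rightarrow> real \<Rightarrow> real" where
  "twt S r g u = (\<Prod>c\<in>kids S r g r. (SOME F. branch_family S r g F) c u)"

text \<open>\<open>dv M i\<close> stands for the derivative, by the indices in \<open>M\<close>, of
  component \<open>i\<close> of a vector field. The argument \<open>M\<close> of the root collects
  derivatives coming from outside the tree, so that branches can be cut off while their mark on the
  root is kept.\<close>

definition tsym :: "('d multiset \<Rightarrow> 'd \<Rightarrow> real) \<Rightarrow> nat set \<Rightarrow> nat \<Rightarrow> 'd decoration \<Rightarrow>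
    'd multiset \<Rightarrow> 'd \<Rightarrow> real" where
  "tsym dv S r g M i =
     (\<Prod>k\<in>S. dv (image_mset (snd \<circ> g) (mset_set (kids S r g k)) + (if k = r then M else {#}))
              (if k = r then i else snd (g k)))"

definition theta :: "('d::finite multiset \<Rightarrow> 'd \<Rightarrow> real) \<Rightarrow> nat set \<Rightarrow> nat \<Rightarrow>
    'd multiset \<Rightarrow> 'd \<Rightarrow> real \<Rightarrow> real" where
  "theta dv S r M i u = (\<Sum>g\<in>dtrees S r. twt S r g u * tsym dv S r g M i)"

lemma finite_kids: "finite S \<Longrightarrow> finite (kids S r g k)"
  by (simp add: kids_def)

lemma finite_dtrees: "finite S \<Longrightarrow> finite (dtrees S r :: ('d::finite) decoration set)"
  by (rule finite_subset[of _ "(S - {r}) \<rightarrow>\<^sub>E S \<times> UNIV"]) (auto simp: dtrees_def intro!: finite_PiE)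

text \<open>The vertex of lowest rank in \<open>B\<close> has its parent outside \<open>B\<close>,
  so no other equation of \<open>B\<close> refers to it and its function can be defined
  last.\<close>

lemma branch_family_exists:
  assumes "finite S" "\<forall>k\<in>S - {r}. \<rho> (fst (g k)) < (\<rho> k::nat)"
  shows "\<exists>F. branch_family S r g F"
proof -
  have "\<exists>F. \<forall>k\<in>B. \<forall>u. F k u = mean_prim (\<lambda>u. \<Prod>c\<in>{c\<in>B. fst (g c) = k}. F c u) u"
    if "finite B" "B \<subseteq> S - {r}" for B
    using that
  proof (induction "card B" arbitrary: B)
    case 0
    then show ?case by auto
  next
    case (Suc n)
    then have ne: "B \<noteq> {}" by auto
    define b where "b = arg_min_on \<rho> B"
    have b: "b \<in> B" "\<And>c. c \<in> B \<Longrightarrow> \<rho> b \<le> \<rho> c"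
      using arg_min_if_finite[OF Suc.prems(1) ne, of \<rho>] by (auto simp: b_def not_less)
    obtain F where F: "\<forall>k\<in>B-{b}. \<forall>u. F k u = mean_prim (\<lambda>u. \<Prod>c\<in>{c\<in>B-{b}. fst (g c) = k}. F c u) u"
    proof -
      have "n = card (B - {b})" "finite (B - {b})" "B - {b} \<subseteq> S - {r}"
        using Suc.hyps(2) Suc.prems b by auto
      then show ?thesis using Suc.hyps(1) that by blast
    qed
    have nb: "fst (g b) \<notin> B" using b Suc.prems assms(2)
      by (meson in_mono leD)
    define F' where "F' = F(b := mean_prim (\<lambda>u. \<Prod>c\<in>{c\<in>B. fst (g c) = b}. F c u))"
    have "F' k u = mean_prim (\<lambda>u. \<Prod>c\<in>{c\<in>B. fst (g c) = k}. F' c u) u" if "k \<in> B" for k u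
    proof -
      have "(\<lambda>u. \<Prod>c\<in>{c\<in>B. fst (g c) = k}. F' c u) = (\<lambda>u. \<Prod>c\<in>{c\<in>B. fst (g c) = k}. F c u)"
        using nb that by (intro ext prod.cong) (auto simp: F'_def)
      moreover have "{c\<in>B-{b}. fst (g c) = k} = {c\<in>B. fst (g c) = k}" using nb that by auto
      ultimately show ?thesis using F that by (auto simp: F'_def)
    qed
    then show ?case by blast
  qed
  from this[of "S - {r}"] show ?thesis using assms(1)
    unfolding branch_family_def kids_def by auto
qed

text \<open>Induction from the leaves: children have higher rank, and the maximal rank bounds the
  descent.\<close>

lemma branch_family_unique:
  assumes "finite S" "\<forall>k\<in>S - {r}. \<rho> (fst (g k)) < (\<rho> k::nat)"
    and "branch_family S r g F" "branch_family S r g F'" "k \<in> S - {r}"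
  shows "F k = F' k"
  using assms(5)
proof (induction "Max (\<rho> ` S) - \<rho> k" arbitrary: k rule: less_induct)
  case (less k)
  have "F c = F' c" if c: "c \<in> kids S r g k" for c
  proof (rule less.hyps)
    have "\<rho> k < \<rho> c" "c \<in> S" using c assms(2) by (auto simp: kids_def)
    moreover have "\<rho> c \<le> Max (\<rho> ` S)" using \<open>c \<in> S\<close> assms(1) by auto
    ultimately show "Max (\<rho> ` S) - \<rho> c < Max (\<rho> ` S) - \<rho> k" by linarith
  qed (use c in \<open>auto simp: kids_def\<close>)
  then have "(\<lambda>u. \<Prod>c\<in>kids S r g k. F c u) = (\<lambda>u. \<Prod>c\<in>kids S r g k. F' c u)"
    by (intro ext prod.cong) auto
  then show ?case using assms(3,4) less.prems unfolding branch_family_def by (auto simp: fun_eq_iff)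
qed

lemma branch_family_cont:
  assumes "finite S" "\<forall>k\<in>S - {r}. \<rho> (fst (g k)) < (\<rho> k::nat)"
    and "branch_family S r g F" "k \<in> S - {r}"
  shows "continuous_on {0..1} (F k)"
  using assms(4)
proof (induction "Max (\<rho> ` S) - \<rho> k" arbitrary: k rule: less_induct)
  case (less k)
  have "continuous_on {0..1} (F c)" if c: "c \<in> kids S r g k" for c
  proof (rule less.hyps)
    have "\<rho> k < \<rho> c" "c \<in> S" using c assms(2) by (auto simp: kids_def)
    moreover have "\<rho> c \<le> Max (\<rho> ` S)" using \<open>c \<in> S\<close> assms(1) by auto
    ultimately show "Max (\<rho> ` S) - \<rho> c < Max (\<rho> ` S) - \<rho> k" by linarith
  qed (use c in \<open>auto simp: kids_def\<close>)
  then have "continuous_on {0..1} (\<lambda>u. \<Prod>c\<in>kids S r g k. F c u)"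
    by (intro continuous_on_prod) auto
  moreover have "F k = mean_prim (\<lambda>u. \<Prod>c\<in>kids S r g k. F c u)"
    using assms(3) less.prems unfolding branch_family_def by auto
  ultimately show ?case by (simp add: mean_prim_cont)
qed

lemma twt_eq:
  assumes "finite S" "\<forall>k\<in>S - {r}. \<rho> (fst (g k)) < (\<rho> k::nat)" "branch_family S r g F"
  shows "twt S r g = (\<lambda>u. \<Prod>c\<in>kids S r g r. F c u)"
proof -
  have "branch_family S r g (SOME F. branch_family S r g F)"
    by (rule someI[of "branch_family S r g"]) (rule assms(3))
  then have "(SOME F. branch_family S r g F) c = F c" if "c \<in> S - {r}" for c
    using branch_family_unique[OF assms(1,2)] assms(3) that by blast
  then show ?thesis unfolding twt_def by (intro ext prod.cong) (auto simp: kids_def)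
qed

lemma twt_cont:
  assumes "finite S" "g \<in> dtrees S r"
  shows "continuous_on {0..1} (twt S r g)"
proof -
  obtain \<rho> where \<rho>: "\<forall>k\<in>S - {r}. \<rho> (fst (g k)) < (\<rho> k::nat)"
    using assms by (auto simp: dtrees_def)
  obtain F where F: "branch_family S r g F"
    using branch_family_exists[OF assms(1) \<rho>] by blast
  show ?thesis unfolding twt_eq[OF assms(1) \<rho> F]
    by (intro continuous_on_prod branch_family_cont[OF assms(1) \<rho> F]) (auto simp: kids_def)
qed

definition graft :: "nat \<Rightarrow> nat set \<times> 'd \<times> nat \<times> 'd decoration \<times> 'd decoration \<Rightarrow>
    nat \<Rightarrow> nat \<times> 'd" where
  "graft r = (\<lambda>(C, j, r', g1, g2) k. if k = r' then (r, j) else if k \<in> C then g2 k else g1 k)"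

text \<open>A tree on \<open>S\<close> is cut at the root branch that contains the marked vertex
  \<open>m\<close>: \<open>C\<close> is the vertex set of that branch, \<open>r'\<close> its top,
  \<open>j\<close> the index of the edge from \<open>r'\<close> to \<open>r\<close>,
  \<open>g1\<close> the remaining tree and \<open>g2\<close> the branch. The mark singles out one
  branch, which makes \<open>graft r\<close> a bijection.\<close>

definition graft_data :: "nat set \<Rightarrow> nat \<Rightarrow> nat \<Rightarrow>
    (nat set \<times> 'd::finite \<times> nat \<times> 'd decoration \<times> 'd decoration) set" where
  "graft_data S r m = (SIGMA C:{C. m \<in> C \<and> C \<subseteq> S - {r}}. UNIV \<times>
     (SIGMA r':C. dtrees (S - C) r \<times> dtrees C r'))"

context
  fixes S :: "nat set" and r m :: nat
  assumes S: "finite S" "r \<in> S" "m \<in> S - {r}"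
begin

lemma graft_facts:
  assumes "(C, j, r', g1, g2) \<in> graft_data S r m" "g = graft r (C, j, r', g1, g2)"
  shows "m \<in> C" "C \<subseteq> S - {r}" "r' \<in> C" "g r' = (r, j)"
    "\<And>k. k \<in> C - {r'} \<Longrightarrow> fst (g k) \<in> C \<and> g k = g2 k"
    "\<And>k. k \<in> S - C - {r} \<Longrightarrow> fst (g k) \<in> S - C \<and> g k = g1 k"
    "g1 = restrict g (S - C - {r})" "g2 = restrict g (C - {r'})"
    "g1 \<in> dtrees (S - C) r" "g2 \<in> dtrees C r'"
proof -
  show *: "m \<in> C" "C \<subseteq> S - {r}" "r' \<in> C" and d: "g1 \<in> dtrees (S - C) r" "g2 \<in> dtrees C r'"
    using assms(1) by (auto simp: graft_data_def)
  show "g r' = (r, j)" using assms(2) by (simp add: graft_def)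
  have g1: "g1 \<in> (S - C - {r}) \<rightarrow>\<^sub>E (S - C) \<times> UNIV" and g2: "g2 \<in> (C - {r'}) \<rightarrow>\<^sub>E C \<times> UNIV"
    using d by (auto simp: dtrees_def)
  show a: "\<And>k. k \<in> C - {r'} \<Longrightarrow> fst (g k) \<in> C \<and> g k = g2 k"
    using PiE_mem[OF g2] assms(2) by (fastforce simp: graft_def)
  show b: "\<And>k. k \<in> S - C - {r} \<Longrightarrow> fst (g k) \<in> S - C \<and> g k = g1 k"
    using PiE_mem[OF g1] assms(2) * by (fastforce simp: graft_def)
  show "g1 = restrict g (S - C - {r})" "g2 = restrict g (C - {r'})"
    using a b PiE_arb[OF g1] PiE_arb[OF g2] by (auto simp: restrict_def fun_eq_iff)
qed

lemma graft_rank: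
  assumes "(C, j, r', g1, g2) \<in> graft_data S r m" "g = graft r (C, j, r', g1, g2)"
  shows "\<exists>\<rho>::nat\<Rightarrow>nat. \<forall>k\<in>S - {r}. \<rho> (fst (g k)) < \<rho> k"
proof -
  note f = graft_facts[OF assms]
  obtain \<rho>1 where \<rho>1: "\<forall>k\<in>S - C - {r}. \<rho>1 (fst (g1 k)) < (\<rho>1 k::nat)"
    using f(9) by (auto simp: dtrees_def)
  obtain \<rho>2 where \<rho>2: "\<forall>k\<in>C - {r'}. \<rho>2 (fst (g2 k)) < (\<rho>2 k::nat)"
    using f(10) by (auto simp: dtrees_def)
  \<comment> \<open>The ranks of the branch are lifted above that of \<open>r\<close>, to which its
    top is attached.\<close>
  define \<rho> where "\<rho> k = (if k \<in> C then \<rho>2 k + \<rho>1 r + 1 else \<rho>1 k)" for k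
  have "\<rho> (fst (g k)) < \<rho> k" if k: "k \<in> S - {r}" for k
  proof -
    consider "k = r'" | "k \<in> C - {r'}" | "k \<in> S - C - {r}" using k by blast
    then show ?thesis
    proof cases
      case 1 then show ?thesis using f(2,3,4) by (auto simp: \<rho>_def)
    next
      case 2 then show ?thesis using f(5)[OF 2] \<rho>2 by (auto simp: \<rho>_def)
    next
      case 3 then show ?thesis using f(6)[OF 3] \<rho>1 by (auto simp: \<rho>_def)
    qed
  qed
  then show ?thesis by blast
qed

lemma graft_inj: "inj_on (graft r) (graft_data S r m :: (nat set \<times> 'd::finite \<times> _) set)"
proof (rule inj_onI)
  fix x y :: "nat set \<times> 'd \<times> nat \<times> 'd decoration \<times> 'd decoration"
  assume x: "x \<in> graft_data S r m" and y: "y \<in> graft_data S r m" and e: "graft r x = graft r y"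
  obtain C j r' g1 g2 where xx: "x = (C, j, r', g1, g2)" by (cases x) auto
  obtain D i s' h1 h2 where yy: "y = (D, i, s', h1, h2)" by (cases y) auto
  define g where "g = graft r x"
  note f = graft_facts[OF x[unfolded xx], of g, folded xx, OF g_def]
  note f' = graft_facts[OF y[unfolded yy], of g, folded yy, OF g_def[unfolded e]]
  obtain \<rho> :: "nat \<Rightarrow> nat" where \<rho>: "\<forall>k\<in>S - {r}. \<rho> (fst (g k)) < \<rho> k"
    using graft_rank[OF x[unfolded xx], folded xx, OF g_def] by blast
  have fin: "finite C" "finite D" using finite_subset[OF f(2)] finite_subset[OF f'(2)] S(1) by simp_all
  have "r' = s'"
  proof -
    \<comment> \<open>The lowest vertex common to both branches: unless it tops one of them, its
      parent would be a lower common vertex.\<close>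
    define k where "k = arg_min_on \<rho> (C \<inter> D)"
    have ne: "C \<inter> D \<noteq> {}" using f(1) f'(1) by auto
    have k: "k \<in> C \<inter> D" "\<And>c. c \<in> C \<inter> D \<Longrightarrow> \<rho> k \<le> \<rho> c"
      using arg_min_if_finite[of "C \<inter> D" \<rho>, OF _ ne] fin by (auto simp: k_def not_less)
    have "k = r' \<or> k = s'"
    proof (rule ccontr)
      assume "\<not> (k = r' \<or> k = s')"
      then have "fst (g k) \<in> C \<inter> D" using f(5)[of k] f'(5)[of k] k by auto
      moreover have "\<rho> (fst (g k)) < \<rho> k" using \<rho> k f(2) by blast
      ultimately show False using k(2)[of "fst (g k)"] by linarith
    qed
    then show ?thesis
    proof
      assume "k = r'"
      then have "fst (g k) \<notin> D" using f(4) f'(2) by auto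
      then show ?thesis using f'(5)[of k] k(1) \<open>k = r'\<close> by auto
    next
      assume "k = s'"
      then have "fst (g k) \<notin> C" using f'(4) f(2) by auto
      then show ?thesis using f(5)[of k] k(1) \<open>k = s'\<close> by auto
    qed
  qed
  \<comment> \<open>The lowest vertex of \<open>C'\<close> outside \<open>D'\<close> is not the
    common top \<open>r'\<close>, so its parent lies in \<open>C'\<close> as well, and outside
    \<open>D'\<close>: a contradiction.\<close>
  have sub: "C' \<subseteq> D'" if C': "C' \<subseteq> S - {r}" "finite C'" "r' \<in> D'" "\<And>k. k \<in> C' - {r'} \<Longrightarrow> fst (g k) \<in> C'"
    "\<And>k. k \<in> S - D' - {r} \<Longrightarrow> fst (g k) \<in> S - D'" for C' D'
  proof (rule ccontr)
    assume "\<not> C' \<subseteq> D'"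
    then have ne: "C' - D' \<noteq> {}" by auto
    define k where "k = arg_min_on \<rho> (C' - D')"
    have k: "k \<in> C' - D'" "\<And>c. c \<in> C' - D' \<Longrightarrow> \<rho> k \<le> \<rho> c"
      using arg_min_if_finite[of "C' - D'" \<rho>, OF _ ne] C'(2) by (auto simp: k_def not_less)
    have "fst (g k) \<in> C' - D'" using C'(3) C'(4)[of k] C'(5)[of k] C'(1) k by auto
    moreover have "\<rho> (fst (g k)) < \<rho> k" using \<rho> k C'(1) by blast
    ultimately show False using k(2)[of "fst (g k)"] by linarith
  qed
  have "C = D"
  proof
    show "C \<subseteq> D" by (rule sub) (use f(2) f(5)[THEN conjunct1] f'(3) f'(6)[THEN conjunct1] fin(1) \<open>r' = s'\<close> in auto)
    show "D \<subseteq> C" by (rule sub) (use f'(2) f'(5)[THEN conjunct1] f(3) f(6)[THEN conjunct1] fin(2) \<open>r' = s'\<close> in auto)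
  qed
  moreover have "g1 = h1" "g2 = h2" using f(7,8) f'(7,8) \<open>C = D\<close> \<open>r' = s'\<close> by metis+
  moreover have "i = j" using f(4) f'(4) \<open>r' = s'\<close> by simp
  ultimately show "x = y" using \<open>r' = s'\<close> by (simp add: xx yy)
qed

lemma graft_image:
  "graft r ` graft_data S r m = (dtrees S r :: ('d::finite) decoration set)"
proof
  show "graft r ` graft_data S r m \<subseteq> (dtrees S r :: 'd decoration set)"
  proof
    fix g :: "'d decoration" assume "g \<in> graft r ` graft_data S r m"
    then obtain C j r' g1 g2 where x: "(C, j, r', g1, g2) \<in> graft_data S r m"
      and g: "g = graft r (C, j, r', g1, g2)" by auto
    note f = graft_facts[OF x g]
    have "g \<in> (S - {r}) \<rightarrow>\<^sub>E S \<times> UNIV"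
    proof (rule PiE_I)
      fix k assume k: "k \<in> S - {r}"
      consider "k = r'" | "k \<in> C - {r'}" | "k \<in> S - C - {r}" using k by blast
      then have "fst (g k) \<in> S"
      proof cases
        case 1 then show ?thesis using f(4) S(2) by simp
      next
        case 2 then show ?thesis using f(5)[OF 2] f(2) by auto
      next
        case 3 then show ?thesis using f(6)[OF 3] by auto
      qed
      then show "g k \<in> S \<times> UNIV" by (cases "g k") auto
    next
      fix k assume "k \<notin> S - {r}"
      then have "k \<noteq> r'" "k \<notin> C" "k \<notin> S - C - {r}" using f(2,3) by auto
      moreover have "g1 k = undefined"
        using \<open>k \<notin> S - C - {r}\<close> f(9) by (auto simp: dtrees_def intro: PiE_arb)
      ultimately show "g k = undefined" by (simp add: g graft_def)
    qed
    then show "g \<in> dtrees S r" using graft_rank[OF x g] by (auto simp: dtrees_def)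
  qed
next
  show "(dtrees S r :: 'd decoration set) \<subseteq> graft r ` graft_data S r m"
  proof
    fix g :: "'d decoration" assume "g \<in> dtrees S r"
    then obtain \<rho> :: "nat \<Rightarrow> nat" where g: "g \<in> (S - {r}) \<rightarrow>\<^sub>E S \<times> UNIV"
      and \<rho>: "\<forall>k\<in>S - {r}. \<rho> (fst (g k)) < \<rho> k"
      by (auto simp: dtrees_def)
    have gS: "fst (g k) \<in> S" if "k \<in> S - {r}" for k using PiE_mem[OF g that] by auto
    define R where "R = {(k, fst (g k)) |k. k \<in> S - {r}}"
    \<comment> \<open>\<open>m\<close> and its ancestors below the root. The lowest in rank is the
      child of \<open>r\<close> on whose branch \<open>m\<close> lies; \<open>C\<close> collects the
      vertices from which that child is reached.\<close>
    define A where "A = {k \<in> S - {r}. (m, k) \<in> R\<^sup>*}"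
    have A: "finite A" "A \<noteq> {}" using S by (auto simp: A_def)
    define r' where "r' = arg_min_on \<rho> A"
    have r': "r' \<in> A" "\<And>c. c \<in> A \<Longrightarrow> \<rho> r' \<le> \<rho> c"
      using arg_min_if_finite[of A \<rho>, OF A] by (auto simp: r'_def not_less)
    have r'S: "r' \<in> S - {r}" using r' by (auto simp: A_def)
    have r'r: "fst (g r') = r"
    proof (rule ccontr)
      assume "fst (g r') \<noteq> r"
      moreover have "(r', fst (g r')) \<in> R" using r'S by (auto simp: R_def)
      ultimately have "fst (g r') \<in> A" using r'(1) gS[OF r'S] by (auto simp: A_def)
      then have "\<rho> r' \<le> \<rho> (fst (g r'))" by (rule r'(2))
      moreover have "\<rho> (fst (g r')) < \<rho> r'" using \<rho> r'S by blast
      ultimately show False by simp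
    qed
    define C where "C = {k \<in> S - {r}. (k, r') \<in> R\<^sup>*}"
    have rr: "(r, r') \<notin> R\<^sup>*"
    proof
      assume "(r, r') \<in> R\<^sup>*"
      then show False using r'S by (cases rule: converse_rtranclE) (auto simp: R_def)
    qed
    have C1: "m \<in> C" "r' \<in> C" "C \<subseteq> S - {r}" using r' S(3) by (auto simp: C_def A_def)
    have C2: "fst (g k) \<in> C" if k: "k \<in> C - {r'}" for k
    proof -
      have "(k, r') \<in> R\<^sup>*" "k \<noteq> r'" using k by (auto simp: C_def)
      then obtain p where p: "(k, p) \<in> R" "(p, r') \<in> R\<^sup>*" by (meson converse_rtranclE)
      then have "p = fst (g k)" by (auto simp: R_def)
      then show ?thesis using p rr gS[of k] k by (auto simp: C_def)
    qed
    have C3: "fst (g k) \<in> S - C" if k: "k \<in> S - C - {r}" for k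
    proof -
      have "(k, fst (g k)) \<in> R" using k by (auto simp: R_def)
      then have "fst (g k) \<notin> C" using k by (auto simp: C_def intro: converse_rtrancl_into_rtrancl)
      then show ?thesis using gS k by auto
    qed
    define g1 where "g1 = restrict g (S - C - {r})"
    define g2 where "g2 = restrict g (C - {r'})"
    have m: "z \<in> B \<times> UNIV" if "fst z \<in> B" for z :: "nat \<times> 'd" and B using that by (cases z) auto
    have "g1 \<in> dtrees (S - C) r"
      using C3 \<rho> by (auto simp: dtrees_def g1_def intro!: m exI[of _ \<rho>])
    moreover have "g2 \<in> dtrees C r'"
      using C2 \<rho> C1 by (auto simp: dtrees_def g2_def intro!: m exI[of _ \<rho>])
    ultimately have "(C, snd (g r'), r', g1, g2) \<in> graft_data S r m"
      using C1 by (auto simp: graft_data_def)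
    moreover have "g = graft r (C, snd (g r'), r', g1, g2)"
    proof
      fix k show "g k = graft r (C, snd (g r'), r', g1, g2) k"
        using r'r C1 PiE_arb[OF g, of k] by (cases "k \<in> S - {r}") (auto simp: graft_def g1_def g2_def prod_eq_iff)
    qed
    ultimately show "g \<in> graft r ` graft_data S r m" by blast
  qed
qed

lemma kids_graft:
  assumes "(C, j, r', g1, g2) \<in> graft_data S r m" "g = graft r (C, j, r', g1, g2)"
  shows "k \<in> C \<Longrightarrow> kids S r g k = kids C r' g2 k"
    "k \<in> S - C - {r} \<Longrightarrow> kids S r g k = kids (S - C) r g1 k"
    "kids S r g r = insert r' (kids (S - C) r g1 r)"
    "r' \<notin> kids (S - C) r g1 r"
proof -
  note f = graft_facts[OF assms]
  show "kids S r g k = kids C r' g2 k" if k: "k \<in> C"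
  proof -
    have "c \<in> kids S r g k \<longleftrightarrow> c \<in> kids C r' g2 k" for c
      using f(2,3,4) f(5)[of c] f(6)[of c] k by (cases "c = r'"; cases "c \<in> C") (auto simp: kids_def)
    then show ?thesis by blast
  qed
  show "kids S r g k = kids (S - C) r g1 k" if k: "k \<in> S - C - {r}"
  proof -
    have "c \<in> kids S r g k \<longleftrightarrow> c \<in> kids (S - C) r g1 k" for c
      using f(2,3,4) f(5)[of c] f(6)[of c] k by (cases "c = r'"; cases "c \<in> C") (auto simp: kids_def)
    then show ?thesis by blast
  qed
  have "c \<in> kids S r g r \<longleftrightarrow> c \<in> insert r' (kids (S - C) r g1 r)" for c
    using f(2,3,4) f(5)[of c] f(6)[of c] by (cases "c = r'"; cases "c \<in> C") (auto simp: kids_def)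
  then show "kids S r g r = insert r' (kids (S - C) r g1 r)" by blast
  show "r' \<notin> kids (S - C) r g1 r" using f(3) by (auto simp: kids_def)
qed

text \<open>A branch family for the whole tree is glued from families of the two pieces, with
  \<open>mean_prim\<close> supplying the function at the top of the branch.\<close>

lemma twt_graft:
  assumes "(C, j, r', g1, g2) \<in> graft_data S r m" "g = graft r (C, j, r', g1, g2)"
  shows "twt S r g u = twt (S - C) r g1 u * mean_prim (twt C r' g2) u"
proof -
  note f = graft_facts[OF assms] and k = kids_graft[OF assms]
  have fin: "finite C" "finite (S - C)" using f(2) S(1) by (auto intro: finite_subset)
  obtain \<rho>1 where \<rho>1: "\<forall>k\<in>S - C - {r}. \<rho>1 (fst (g1 k)) < (\<rho>1 k::nat)"
    using f(9) by (auto simp: dtrees_def)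
  obtain \<rho>2 where \<rho>2: "\<forall>k\<in>C - {r'}. \<rho>2 (fst (g2 k)) < (\<rho>2 k::nat)"
    using f(10) by (auto simp: dtrees_def)
  obtain \<rho> :: "nat \<Rightarrow> nat" where \<rho>: "\<forall>k\<in>S - {r}. \<rho> (fst (g k)) < \<rho> k"
    using graft_rank[OF assms] by blast
  obtain F1 where F1: "branch_family (S - C) r g1 F1" using branch_family_exists[OF fin(2) \<rho>1] by blast
  obtain F2 where F2: "branch_family C r' g2 F2" using branch_family_exists[OF fin(1) \<rho>2] by blast
  define F where "F k = (if k = r' then mean_prim (twt C r' g2) else if k \<in> C then F2 k else F1 k)" for k
  have FC: "(\<Prod>c\<in>kids C r' g2 k. F c u) = (\<Prod>c\<in>kids C r' g2 k. F2 c u)" for k u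
    by (intro prod.cong) (auto simp: kids_def F_def)
  have FS: "(\<Prod>c\<in>kids (S - C) r g1 k. F c u) = (\<Prod>c\<in>kids (S - C) r g1 k. F1 c u)" for k u
    using f(3) by (intro prod.cong) (auto simp: kids_def F_def)
  have "branch_family S r g F"
    unfolding branch_family_def
  proof (intro ballI allI)
    fix k' u assume k': "k' \<in> S - {r}"
    consider "k' = r'" | "k' \<in> C - {r'}" | "k' \<in> S - C - {r}" using k' by blast
    then show "F k' u = mean_prim (\<lambda>u. \<Prod>c\<in>kids S r g k'. F c u) u"
    proof cases
      case 1
      then have "(\<lambda>u. \<Prod>c\<in>kids S r g k'. F c u) = twt C r' g2"
        using k(1) f(3) FC twt_eq[OF fin(1) \<rho>2 F2] by simp
      with 1 show ?thesis by (simp add: F_def)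
    next
      case 2
      then show ?thesis using k(1)[of k'] FC F2 by (auto simp: F_def branch_family_def)
    next
      case 3
      then show ?thesis using k(2)[of k'] FS F1 f(3) by (auto simp: F_def branch_family_def)
    qed
  qed
  from twt_eq[OF S(1) \<rho> this]
  have "twt S r g u = F r' u * (\<Prod>c\<in>kids (S - C) r g1 r. F c u)"
  proof -
    have "finite (kids (S - C) r g1 r)" using fin(2) by (rule finite_kids)
    then show ?thesis using k(3,4) \<open>twt S r g = _\<close> by simp
  qed
  then show ?thesis using FS twt_eq[OF fin(2) \<rho>1 F1] by (simp add: F_def)
qed

text \<open>Cutting the branch removes one child of the root; the index of its edge survives in the
  multiset of outside derivatives.\<close>

lemma tsym_graft:
  assumes "(C, j, r', g1, g2) \<in> graft_data S r m" "g = graft r (C, j, r', g1, g2)"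
  shows "tsym dv S r g M i = tsym dv (S - C) r g1 (M + {#j#}) i * tsym dv C r' g2 {#} j"
proof -
  note f = graft_facts[OF assms] and k = kids_graft[OF assms]
  define h where "h k = dv (image_mset (snd \<circ> g) (mset_set (kids S r g k)) + (if k = r then M else {#}))
              (if k = r then i else snd (g k))" for k
  have fin: "finite C" "finite (S - C)" using f(2) S(1) by (auto intro: finite_subset)
  have "tsym dv S r g M i = prod h S" by (simp add: tsym_def h_def)
  also have "\<dots> = prod h (S - C) * prod h C"
    using f(2) S(1) by (intro prod.subset_diff) auto
  also have "prod h C = tsym dv C r' g2 {#} j"
    unfolding tsym_def
  proof (intro prod.cong refl)
    fix k' assume k': "k' \<in> C"
    have "image_mset (snd \<circ> g) (mset_set (kids S r g k')) = image_mset (snd \<circ> g2) (mset_set (kids C r' g2 k'))"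
    proof (unfold k(1)[OF k'], intro image_mset_cong)
      have "finite (kids C r' g2 k')" using fin(1) by (rule finite_kids)
      then show "(snd \<circ> g) x = (snd \<circ> g2) x" if "x \<in># mset_set (kids C r' g2 k')" for x
        using f(5)[of x] that by (auto simp: kids_def)
    qed
    moreover have "k' \<noteq> r" using k' f(2) by auto
    ultimately show "h k' = dv (image_mset (snd \<circ> g2) (mset_set (kids C r' g2 k')) + (if k' = r' then {#} else {#}))
         (if k' = r' then j else snd (g2 k'))"
      using f(4) f(5)[of k'] k' by (auto simp: h_def)
  qed
  also have "prod h (S - C) = tsym dv (S - C) r g1 (M + {#j#}) i"
    unfolding tsym_def
  proof (intro prod.cong refl)
    fix k' assume k': "k' \<in> S - C"
    have 1: "image_mset (snd \<circ> g) (mset_set (kids (S - C) r g1 k')) = image_mset (snd \<circ> g1) (mset_set (kids (S - C) r g1 k'))"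
    proof (intro image_mset_cong)
      have "finite (kids (S - C) r g1 k')" using fin(2) by (rule finite_kids)
      then show "(snd \<circ> g) x = (snd \<circ> g1) x" if "x \<in># mset_set (kids (S - C) r g1 k')" for x
        using f(6)[of x] that by (auto simp: kids_def)
    qed
    show "h k' = dv (image_mset (snd \<circ> g1) (mset_set (kids (S - C) r g1 k')) + (if k' = r then M + {#j#} else {#}))
         (if k' = r then i else snd (g1 k'))"
    proof (cases "k' = r")
      case True
      have "finite (kids (S - C) r g1 r)" using fin(2) by (rule finite_kids)
      then show ?thesis using True k(3,4) 1 f(4) by (auto simp: h_def)
    next
      case False
      then show ?thesis using k(2)[of k'] k' 1 f(6)[of k'] by (auto simp: h_def)
    qed
  qed
  finally show ?thesis .
qed

text \<open>Once \<open>C\<close> and \<open>j\<close> are fixed, weight and symbol factorize over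
  the two pieces. From this recursion follow both the independence of labels and, after division by
  factorials, the differential equation of the series.\<close>

lemma theta_graft:
  fixes dv :: "'d::finite multiset \<Rightarrow> 'd \<Rightarrow> real"
  assumes u: "u \<in> {0..1}"
  shows "theta dv S r M i u = (\<Sum>C | m \<in> C \<and> C \<subseteq> S - {r}. \<Sum>j\<in>UNIV.
           theta dv (S - C) r (M + {#j#}) i u * (\<Sum>r'\<in>C. mean_prim (theta dv C r' {#} j) u))"
proof -
  let ?CC = "{C. m \<in> C \<and> C \<subseteq> S - {r}}"
  have finCC: "finite ?CC" using S(1) by (intro finite_subset[of ?CC "Pow S"]) auto
  have fin: "finite C" "finite (S - C)" if "C \<in> ?CC" for C
    using that S(1) by (auto intro: finite_subset)
  have "theta dv S r M i u = (\<Sum>x\<in>graft_data S r m. twt S r (graft r x) u * tsym dv S r (graft r x) M i)"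
    unfolding theta_def graft_image[symmetric]
    by (subst sum.reindex[OF graft_inj]) (simp add: o_def)
  also have "\<dots> = (\<Sum>(C, j, r', g1, g2)\<in>graft_data S r m.
     (twt (S - C) r g1 u * mean_prim (twt C r' g2) u) *
     (tsym dv (S - C) r g1 (M + {#j#}) i * tsym dv C r' g2 {#} j))"
  proof (rule sum.cong[OF refl])
    fix x :: "nat set \<times> 'd \<times> nat \<times> 'd decoration \<times> 'd decoration"
    assume x: "x \<in> graft_data S r m"
    obtain C j r' g1 g2 where xx: "x = (C, j, r', g1, g2)" by (cases x) auto
    show "twt S r (graft r x) u * tsym dv S r (graft r x) M i =
      (case x of (C, j, r', g1, g2) \<Rightarrow> (twt (S - C) r g1 u * mean_prim (twt C r' g2) u) *
     (tsym dv (S - C) r g1 (M + {#j#}) i * tsym dv C r' g2 {#} j))"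
      using twt_graft[OF x[unfolded xx] refl, of u] tsym_graft[OF x[unfolded xx] refl, of dv M i]
      by (simp only: xx prod.case)
  qed
  also have "\<dots> = (\<Sum>C\<in>?CC. \<Sum>j\<in>UNIV. \<Sum>r'\<in>C. \<Sum>g1\<in>dtrees (S - C) r. \<Sum>g2\<in>dtrees C r'.
     (twt (S - C) r g1 u * mean_prim (twt C r' g2) u) *
     (tsym dv (S - C) r g1 (M + {#j#}) i * tsym dv C r' g2 {#} j))"
    unfolding graft_data_def using finCC fin
    by (simp add: sum.Sigma finite_SigmaI finite_dtrees sum.cartesian_product case_prod_unfold finite_cartesian_product)
  also have "\<dots> = (\<Sum>C\<in>?CC. \<Sum>j\<in>UNIV.
           theta dv (S - C) r (M + {#j#}) i u * (\<Sum>r'\<in>C. mean_prim (theta dv C r' {#} j) u))"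
  proof (intro sum.cong refl)
    fix C j assume C: "C \<in> ?CC"
    have "mean_prim (theta dv C r' {#} j) u = (\<Sum>g2\<in>dtrees C r'. mean_prim (twt C r' g2) u * tsym dv C r' g2 {#} j)" for r'
      unfolding theta_def using fin[OF C] u
      by (intro mean_prim_sum finite_dtrees twt_cont) auto
    then show "(\<Sum>r'\<in>C. \<Sum>g1\<in>dtrees (S - C) r. \<Sum>g2\<in>dtrees C r'.
     (twt (S - C) r g1 u * mean_prim (twt C r' g2) u) *
     (tsym dv (S - C) r g1 (M + {#j#}) i * tsym dv C r' g2 {#} j)) =
      theta dv (S - C) r (M + {#j#}) i u * (\<Sum>r'\<in>C. mean_prim (theta dv C r' {#} j) u)"
      unfolding theta_def sum_distrib_left
      by (intro sum.cong refl) (simp add: sum_product mult_ac, rule sum.swap)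
  qed
  finally show ?thesis .
qed

end

lemma sum_card_subsets:
  fixes h :: "nat \<Rightarrow> real"
  assumes "finite A" "m \<in> A"
  shows "(\<Sum>C | m \<in> C \<and> C \<subseteq> A. h (card C)) = (\<Sum>k = 1..card A. of_nat ((card A - 1) choose (k - 1)) * h k)"
proof -
  let ?CC = "{C. m \<in> C \<and> C \<subseteq> A}"
  have fin: "finite ?CC" using assms by (intro finite_subset[of ?CC "Pow A"]) auto
  have img: "card ` ?CC \<subseteq> {1..card A}"
  proof
    fix k assume "k \<in> card ` ?CC"
    then obtain C where C: "m \<in> C" "C \<subseteq> A" "k = card C" by auto
    moreover have "finite C" using C(2) assms(1) by (rule finite_subset)
    ultimately have "card C \<noteq> 0" by auto
    then show "k \<in> {1..card A}" using C card_mono[OF assms(1) C(2)] by auto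
  qed
  have "(\<Sum>C\<in>?CC. h (card C)) = (\<Sum>k=1..card A. \<Sum>C | C \<in> ?CC \<and> card C = k. h (card C))"
    by (rule sum.group[symmetric, OF fin _ img]) simp
  also have "\<dots> = (\<Sum>k = 1..card A. of_nat ((card A - 1) choose (k - 1)) * h k)"
  proof (intro sum.cong refl)
    fix k assume k: "k \<in> {1..card A}"
    have fA: "finite C" if "C \<subseteq> A" for C using that assms(1) by (rule finite_subset)
    have "bij_betw (insert m) {D. D \<subseteq> A - {m} \<and> card D = k - 1} {C. C \<in> ?CC \<and> card C = k}"
    proof (rule bij_betwI[where g = "\<lambda>C. C - {m}"])
      show "insert m \<in> {D. D \<subseteq> A - {m} \<and> card D = k - 1} \<rightarrow> {C. C \<in> ?CC \<and> card C = k}"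
      proof
        fix D assume D: "D \<in> {D. D \<subseteq> A - {m} \<and> card D = k - 1}"
        then have "D \<subseteq> A" "m \<notin> D" by auto
        moreover from this(1) have "finite D" by (rule fA)
        ultimately show "insert m D \<in> {C. C \<in> ?CC \<and> card C = k}"
          using D k assms(2) by simp
      qed
      show "(\<lambda>C. C - {m}) \<in> {C. C \<in> ?CC \<and> card C = k} \<rightarrow> {D. D \<subseteq> A - {m} \<and> card D = k - 1}"
        by (auto simp: card_Diff_singleton)
      show "insert m D - {m} = D" if "D \<in> {D. D \<subseteq> A - {m} \<and> card D = k - 1}" for D
        using that by auto
      show "insert m (C - {m}) = C" if "C \<in> {C. C \<in> ?CC \<and> card C = k}" for C
        using that by auto
    qed
    then have "card {C. C \<in> ?CC \<and> card C = k} = card {D. D \<subseteq> A - {m} \<and> card D = k - 1}"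
      by (rule bij_betw_same_card[symmetric])
    also have "\<dots> = (card A - 1) choose (k - 1)"
      using n_subsets[of "A - {m}" "k - 1"] assms by simp
    finally show "(\<Sum>C | C \<in> ?CC \<and> card C = k. h (card C)) = of_nat ((card A - 1) choose (k - 1)) * h k"
      by simp
  qed
  finally show ?thesis .
qed

lemma theta_singleton:
  fixes dv :: "'d::finite multiset \<Rightarrow> 'd \<Rightarrow> real"
  shows "theta dv {r} r M i u = dv M i"
proof -
  have "(dtrees {r} r :: 'd decoration set) = {\<lambda>_. undefined}"
    by (auto simp: dtrees_def)
  then show ?thesis
    by (simp add: theta_def twt_def tsym_def kids_def)
qed

text \<open>No tree is relabelled: the recursion of \<open>theta_graft\<close> refers to smaller
  sets only through their sizes, so induction on the size suffices.\<close>

lemma theta_card: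
  fixes dv :: "'d::finite multiset \<Rightarrow> 'd \<Rightarrow> real"
  assumes "finite S" "r \<in> S" "finite S'" "r' \<in> S'" "card S = card S'" "u \<in> {0..1}"
  shows "theta dv S r M i u = theta dv S' r' M i u"
  using assms
proof (induction "card S" arbitrary: S r S' r' M i u rule: less_induct)
  case less
  define n where "n = card S"
  show ?case
  proof (cases "n = 1")
    case True
    then have "S = {r}" "S' = {r'}" using less.prems n_def by (metis card_1_singletonE singletonD)+
    then show ?thesis by (simp add: theta_singleton)
  next
    case False
    have "n \<noteq> 0" using less.prems n_def by auto
    then have n2: "n \<ge> 2" using False by auto
    define th where "th k = theta dv {1..k::nat} 1" for k
    have IH: "theta dv T t N j v = th (card T) N j v"
      if "card T < n" "finite T" "t \<in> T" "v \<in> {0..1}" for T t N j v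
    proof -
      have "card T \<noteq> 0" using that by auto
      then have "Suc 0 \<le> card T" by simp
      then show ?thesis
        unfolding th_def using that by (intro less.hyps) (auto simp: n_def)
    qed
    have *: "theta dv T t M i u = (\<Sum>k=1..n - 1. of_nat ((n - 2) choose (k - 1)) *
       (\<Sum>j\<in>UNIV. th (n - k) (M + {#j#}) i u * (of_nat k * mean_prim (th k {#} j) u)))"
      if T: "finite T" "t \<in> T" "card T = n" for T t
    proof -
      have "T - {t} \<noteq> {}" using T n2 card_1_singleton_iff[of T] by (metis Diff_eq_empty_iff One_nat_def
        Suc_1 card.empty empty_iff le_zero_eq not_less_eq_eq subset_singletonD)
      then obtain m where m: "m \<in> T - {t}" by blast
      have "theta dv T t M i u = (\<Sum>C | m \<in> C \<and> C \<subseteq> T - {t}. \<Sum>j\<in>UNIV.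
           theta dv (T - C) t (M + {#j#}) i u * (\<Sum>r'\<in>C. mean_prim (theta dv C r' {#} j) u))"
        using T m less.prems by (intro theta_graft)
      also have "\<dots> = (\<Sum>C | m \<in> C \<and> C \<subseteq> T - {t}. \<Sum>j\<in>UNIV.
           th (n - card C) (M + {#j#}) i u * (of_nat (card C) * mean_prim (th (card C) {#} j) u))"
      proof (intro sum.cong refl)
        fix C j assume C: "C \<in> {C. m \<in> C \<and> C \<subseteq> T - {t}}"
        have fC: "finite C" using C T by (auto intro: finite_subset)
        have cC: "card (T - C) = n - card C" using C T fC by (subst card_Diff_subset) auto
        have "card C \<le> card (T - {t})" using C T by (intro card_mono) auto
        also have "card (T - {t}) = n - 1" using T by simp
        finally have lt: "card C < n" using n2 by linarith
        have "card C \<noteq> 0" using C fC by auto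
        then have lt2: "card (T - C) < n" using cC n2 by linarith
        have 1: "theta dv (T - C) t (M + {#j#}) i u = th (n - card C) (M + {#j#}) i u"
          using IH[OF lt2, of t u] C T less.prems cC by auto
        have 2: "mean_prim (theta dv C r' {#} j) u = mean_prim (th (card C) {#} j) u" if "r' \<in> C" for r'
          using IH[OF lt fC that] less.prems by (intro mean_prim_cong) auto
        show "theta dv (T - C) t (M + {#j#}) i u * (\<Sum>r'\<in>C. mean_prim (theta dv C r' {#} j) u) =
          th (n - card C) (M + {#j#}) i u * (of_nat (card C) * mean_prim (th (card C) {#} j) u)"
          using 1 2 by simp
      qed
      also have "\<dots> = (\<Sum>k=1..card (T - {t}). of_nat ((card (T - {t}) - 1) choose (k - 1)) *
       (\<Sum>j\<in>UNIV. th (n - k) (M + {#j#}) i u * (of_nat k * mean_prim (th k {#} j) u)))"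
        using sum_card_subsets[of "T - {t}" m "\<lambda>k. (\<Sum>j\<in>UNIV. th (n - k) (M + {#j#}) i u * (of_nat k * mean_prim (th k {#} j) u))"] T m
        by simp
      also have "card (T - {t}) = n - 1" using T by simp
      finally show ?thesis by (simp add: numeral_2_eq_2)
    qed
    show ?thesis using *[of S r] *[of S' r'] less.prems by (simp add: n_def)
  qed
qed

definition th :: "('d::finite multiset \<Rightarrow> 'd \<Rightarrow> real) \<Rightarrow> nat \<Rightarrow> 'd multiset \<Rightarrow> 'd \<Rightarrow> real \<Rightarrow> real" where
  "th dv n = theta dv {1..n} 1"

lemma theta_eq_th:
  fixes dv :: "'d::finite multiset \<Rightarrow> 'd \<Rightarrow> real"
  assumes "finite S" "r \<in> S" "u \<in> {0..1}"
  shows "theta dv S r M i u = th dv (card S) M i u"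
  unfolding th_def using assms card_gt_0_iff[of S] by (intro theta_card) auto

lemma th_1: "th dv (Suc 0) M i u = dv M i"
  by (simp add: th_def theta_singleton)

text \<open>Vertex 2 is the marked one; the binomial coefficient counts the vertex sets of its
  branch, and the factor \<open>Suc k\<close> the possible tops of a branch with
  \<open>Suc k\<close> vertices.\<close>

lemma th_rec:
  fixes dv :: "'d::finite multiset \<Rightarrow> 'd \<Rightarrow> real"
  assumes u: "u \<in> {0..1}"
  shows "th dv (Suc (Suc n)) M i u = (\<Sum>k\<le>n. of_nat (n choose k) *
       (\<Sum>j\<in>UNIV. th dv (Suc n - k) (M + {#j#}) i u * (of_nat (Suc k) * mean_prim (th dv (Suc k) {#} j) u)))"
proof -
  let ?S = "{1..Suc (Suc n)}"
  let ?h = "\<lambda>k. (\<Sum>j\<in>UNIV. th dv (Suc (Suc n) - k) (M + {#j#}) i u * (of_nat k * mean_prim (th dv k {#} j) u))"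
  have "th dv (Suc (Suc n)) M i u = (\<Sum>C | 2 \<in> C \<and> C \<subseteq> ?S - {1}. \<Sum>j\<in>UNIV.
           theta dv (?S - C) 1 (M + {#j#}) i u * (\<Sum>r'\<in>C. mean_prim (theta dv C r' {#} j) u))"
    unfolding th_def using u by (intro theta_graft) auto
  also have "\<dots> = (\<Sum>C | 2 \<in> C \<and> C \<subseteq> ?S - {1}. ?h (card C))"
  proof (intro sum.cong refl)
    fix C j assume C: "C \<in> {C. 2 \<in> C \<and> C \<subseteq> ?S - {1}}"
    have fC: "finite C" using C by (auto intro: finite_subset)
    have cC: "card (?S - C) = Suc (Suc n) - card C" using C fC by (subst card_Diff_subset) auto
    have 1: "theta dv (?S - C) 1 (M + {#j#}) i u = th dv (Suc (Suc n) - card C) (M + {#j#}) i u"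
      using theta_eq_th[of "?S - C" 1 u dv] C u cC by auto
    have 2: "mean_prim (theta dv C r' {#} j) u = mean_prim (th dv (card C) {#} j) u" if "r' \<in> C" for r'
      using theta_eq_th[OF fC that] u by (intro mean_prim_cong) auto
    show "theta dv (?S - C) 1 (M + {#j#}) i u * (\<Sum>r'\<in>C. mean_prim (theta dv C r' {#} j) u) =
      th dv (Suc (Suc n) - card C) (M + {#j#}) i u * (of_nat (card C) * mean_prim (th dv (card C) {#} j) u)"
      using 1 2 by simp
  qed
  also have "\<dots> = (\<Sum>k=1..Suc n. of_nat (n choose (k - 1)) * ?h k)"
    using sum_card_subsets[of "?S - {1}" 2 ?h] by simp
  also have "\<dots> = (\<Sum>k\<le>n. of_nat (n choose k) * ?h (Suc k))"
    by (simp only: One_nat_def sum.shift_bounds_cl_Suc_ivl atMost_atLeast0) simp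
  finally show ?thesis by simp
qed

lemma th_cont: "continuous_on {0..1} (th dv n M i)"
  unfolding th_def theta_def
  by (intro continuous_on_sum continuous_on_mult continuous_on_const twt_cont) auto

section \<open>Integrals over the upper half plane\<close>

text \<open>The derivative in \<open>z\<close> of the logarithm of
  \<open>(z - w) * (z - cnj w)\<close>. For fixed \<open>w\<close>, the differential of the
  hyperbolic angle at \<open>z\<close> maps a tangent vector \<open>v\<close> to
  \<open>Im (dlog w z * v)\<close>.\<close>

definition dlog :: "complex \<Rightarrow> complex \<Rightarrow> complex" where
  "dlog w z = 1 / (z - w) + 1 / (z - cnj w)"

text \<open>The density of the wedge product of the two angle forms at \<open>z\<close> with targets
  \<open>a\<close> and \<open>b\<close>: the wedge of \<open>Im (A * v)\<close> and
  \<open>Im (B * v)\<close> has coefficient \<open>Im (A * cnj B)\<close>. The indicator lets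
  integrals run over the whole plane.\<close>

definition kern :: "complex \<Rightarrow> complex \<Rightarrow> complex \<Rightarrow> real" where
  "kern a b z = indicator {z. 0 < Im z} z * Im (dlog a z * cnj (dlog b z))"

text \<open>On the upper half plane this is the argument divided by pi. The value 0 on the real axis
  is the argument of the ground point 1.\<close>

definition frac_arg :: "complex \<Rightarrow> real" where
  "frac_arg w = (if Im w = 0 then 0 else 1 / 2 - arctan (Re w / Im w) / pi)"

lemma lborel_complex_eq: "lborel = distr (lborel \<Otimes>\<^sub>M lborel) borel (\<lambda>(x, y). Complex x y)"
proof (rule lborel_eqI)
  have m: "(\<lambda>(x, y). Complex x y) \<in> borel_measurable (lborel \<Otimes>\<^sub>M lborel)"
    by (simp add: case_prod_unfold Complex_eq)
  fix l u :: complex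
  assume "\<And>b. b \<in> Basis \<Longrightarrow> l \<bullet> b \<le> u \<bullet> b"
  from this[of 1] this[of \<i>] have le: "Re l \<le> Re u" "Im l \<le> Im u"
    by (simp_all add: Basis_complex_def inner_complex_def)
  have "(\<lambda>(x, y). Complex x y) -` box l u \<inter> space (lborel \<Otimes>\<^sub>M lborel) = {Re l<..<Re u} \<times> {Im l<..<Im u}"
    by (auto simp: box_def Basis_complex_def space_pair_measure)
  then have "emeasure (distr (lborel \<Otimes>\<^sub>M lborel) borel (\<lambda>(x, y). Complex x y)) (box l u)
     = emeasure (lborel \<Otimes>\<^sub>M lborel) ({Re l<..<Re u} \<times> {Im l<..<Im u})"
    using m by (subst emeasure_distr) auto
  also have "\<dots> = ennreal (Re u - Re l) * ennreal (Im u - Im l)"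
    using le by (subst lborel.emeasure_pair_measure_Times) auto
  also have "\<dots> = ennreal ((Re u - Re l) * (Im u - Im l))"
    using le by (simp add: ennreal_mult)
  also have "(Re u - Re l) * (Im u - Im l) = (\<Prod>b\<in>Basis. (u - l) \<bullet> b)"
    by (simp add: Basis_complex_def)
  finally show "emeasure (distr (lborel \<Otimes>\<^sub>M lborel) borel (\<lambda>(x, y). Complex x y)) (box l u) = (\<Prod>b\<in>Basis. (u - l) \<bullet> b)" .
qed simp

text \<open>Every ray from the origin (and its opposite) is the line of all \<open>y * (c + \<i>)\<close> for a fixed slope
  parameter \<open>c\<close>, so these coordinates replace polar coordinates.\<close>

lemma measurable_cnj [measurable]: "cnj \<in> borel_measurable borel"
  by (intro borel_measurable_continuous_onI continuous_intros)

lemma nn_integral_complex_rays: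
  assumes f: "f \<in> borel_measurable borel"
  shows "(\<integral>\<^sup>+z. f z \<partial>lborel) =
    (\<integral>\<^sup>+c. (\<integral>\<^sup>+y. ennreal \<bar>y\<bar> * f (Complex (y * c) y) \<partial>lborel) \<partial>lborel)"
proof -
  have m: "(\<lambda>(x, y). Complex x y) \<in> borel_measurable (lborel \<Otimes>\<^sub>M lborel)"
    by (simp add: case_prod_unfold Complex_eq)
  have m2: "(\<lambda>x. Complex x y) \<in> borel_measurable borel" for y
    by (simp add: Complex_eq)
  have m3: "(\<lambda>(c, y). ennreal \<bar>y\<bar> * f (Complex (y * c) y)) \<in> borel_measurable (lborel \<Otimes>\<^sub>M lborel)"
  proof -
    have "(\<lambda>p. Complex (snd p * fst p) (snd p)) \<in> borel_measurable (lborel \<Otimes>\<^sub>M (lborel :: real measure))"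
      by (simp add: Complex_eq)
    then have "(\<lambda>p. f (Complex (snd p * fst p) (snd p))) \<in> borel_measurable (lborel \<Otimes>\<^sub>M (lborel :: real measure))"
      using f by (rule measurable_compose)
    then show ?thesis by (simp add: case_prod_unfold)
  qed
  have "(\<integral>\<^sup>+z. f z \<partial>lborel) = (\<integral>\<^sup>+p. f (case p of (x, y) \<Rightarrow> Complex x y) \<partial>(lborel \<Otimes>\<^sub>M lborel))"
    by (subst lborel_complex_eq, subst nn_integral_distr[OF m]) (use f in auto)
  also have "\<dots> = (\<integral>\<^sup>+y. (\<integral>\<^sup>+x. f (Complex x y) \<partial>lborel) \<partial>lborel)"
    using measurable_compose[OF m f]
    by (subst lborel_pair.nn_integral_snd[symmetric]) (auto simp: case_prod_unfold)
  also have "\<dots> = (\<integral>\<^sup>+y. (\<integral>\<^sup>+c. ennreal \<bar>y\<bar> * f (Complex (y * c) y) \<partial>lborel) \<partial>lborel)"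
  proof (rule nn_integral_cong_AE)
    have "AE y in lborel. y \<noteq> (0::real)" by (rule AE_lborel_singleton)
    then show "AE y in lborel. (\<integral>\<^sup>+x. f (Complex x y) \<partial>lborel) =
       (\<integral>\<^sup>+c. ennreal \<bar>y\<bar> * f (Complex (y * c) y) \<partial>lborel)"
    proof eventually_elim
      case (elim y)
      have "(\<lambda>x. f (Complex x y)) \<in> borel_measurable borel"
        using measurable_compose[OF m2 f] .
      then have "(\<integral>\<^sup>+x. f (Complex x y) \<partial>lborel) = ennreal \<bar>y\<bar> * (\<integral>\<^sup>+c. f (Complex (0 + y * c) y) \<partial>lborel)"
        using elim by (intro nn_integral_real_affine) auto
      moreover have "(\<lambda>c. f (Complex (y * c) y)) \<in> borel_measurable borel"
        by (intro measurable_compose[OF _ f]) (simp add: Complex_eq)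
      ultimately show ?case by (simp add: nn_integral_cmult)
    qed
  qed
  also have "\<dots> = (\<integral>\<^sup>+c. (\<integral>\<^sup>+y. ennreal \<bar>y\<bar> * f (Complex (y * c) y) \<partial>lborel) \<partial>lborel)"
    using m3 by (intro lborel_pair.Fubini') (auto simp: case_prod_unfold)
  finally show ?thesis .
qed

lemma complex_rays_measure:
  "(lborel :: complex measure) = distr (density (lborel \<Otimes>\<^sub>M lborel) (\<lambda>(c, y). ennreal \<bar>y\<bar>)) borel
     (\<lambda>(c, y). Complex (y * c) y)" (is "_ = ?M")
proof (rule measure_eqI)
  have m: "(\<lambda>(c, y). Complex (y * c) y) \<in> borel_measurable (lborel \<Otimes>\<^sub>M lborel)"
    by (simp add: case_prod_unfold Complex_eq)
  fix A :: "complex set" assume A: "A \<in> sets lborel"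
  have m3: "(\<lambda>p. indicator A (Complex (snd p * fst p) (snd p)) :: ennreal) \<in> borel_measurable (lborel \<Otimes>\<^sub>M (lborel :: real measure))"
    using m A by (intro measurable_compose[OF _ borel_measurable_indicator[of A]]) (auto simp: case_prod_unfold)
  have "emeasure lborel A = (\<integral>\<^sup>+z. indicator A z \<partial>lborel)" using A by simp
  also have "\<dots> = (\<integral>\<^sup>+c. (\<integral>\<^sup>+y. ennreal \<bar>y\<bar> * indicator A (Complex (y * c) y) \<partial>lborel) \<partial>lborel)"
    using A by (intro nn_integral_complex_rays) auto
  also have "\<dots> = (\<integral>\<^sup>+p. ennreal \<bar>snd p\<bar> * indicator A (Complex (snd p * fst p) (snd p)) \<partial>(lborel \<Otimes>\<^sub>M lborel))"
    using m3 by (subst lborel.nn_integral_fst[symmetric]) auto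
  also have "\<dots> = (\<integral>\<^sup>+p. indicator A (Complex (snd p * fst p) (snd p))
       \<partial>density (lborel \<Otimes>\<^sub>M lborel) (\<lambda>(c, y). ennreal \<bar>y\<bar>))"
    using m3 by (subst nn_integral_density) (auto simp: case_prod_unfold)
  also have "\<dots> = (\<integral>\<^sup>+z. indicator A z \<partial>?M)"
    using m A by (subst nn_integral_distr) (auto simp: case_prod_unfold)
  finally show "emeasure lborel A = emeasure ?M A" using A by simp
qed simp

lemma integral_complex_rays:
  fixes f :: "complex \<Rightarrow> real"
  assumes "integrable lborel f"
  shows "(\<integral>z. f z \<partial>lborel) = (\<integral>c. (\<integral>y. \<bar>y\<bar> * f (Complex (y * c) y) \<partial>lborel) \<partial>lborel)"
proof -
  have fm: "f \<in> borel_measurable borel" using assms by auto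
  have m: "(\<lambda>(c, y). Complex (y * c) y) \<in> borel_measurable (lborel \<Otimes>\<^sub>M lborel)"
    by (simp add: case_prod_unfold Complex_eq)
  have m': "(\<lambda>p. f (Complex (snd p * fst p) (snd p))) \<in> borel_measurable (lborel \<Otimes>\<^sub>M (lborel :: real measure))"
    using measurable_compose[OF m fm] by (simp add: case_prod_unfold)
  let ?D = "density (lborel \<Otimes>\<^sub>M lborel) (\<lambda>(c, y). ennreal \<bar>y\<bar>) :: (real \<times> real) measure"
  have 1: "integrable ?D (\<lambda>(c, y). f (Complex (y * c) y))"
    using assms m fm by (subst (asm) complex_rays_measure, subst (asm) integrable_distr_eq) (auto simp: case_prod_unfold)
  then have 2: "integrable (lborel \<Otimes>\<^sub>M lborel) (\<lambda>p. \<bar>snd p\<bar> * f (Complex (snd p * fst p) (snd p)))"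
  proof -
    have "integrable (density (lborel \<Otimes>\<^sub>M lborel) (\<lambda>p. ennreal \<bar>snd p\<bar>)) (\<lambda>p. f (Complex (snd p * fst p) (snd p)))"
      using 1 by (simp add: case_prod_unfold)
    then show ?thesis using m' by (subst (asm) integrable_density) auto
  qed
  have "(\<integral>z. f z \<partial>lborel) = (\<integral>p. f (case p of (c, y) \<Rightarrow> Complex (y * c) y) \<partial>?D)"
    using m fm by (subst complex_rays_measure, subst integral_distr) auto
  also have "\<dots> = (\<integral>p. \<bar>snd p\<bar> * f (Complex (snd p * fst p) (snd p)) \<partial>(lborel \<Otimes>\<^sub>M lborel))"
  proof -
    have "(\<integral>p. f (Complex (snd p * fst p) (snd p)) \<partial>density (lborel \<Otimes>\<^sub>M lborel) (\<lambda>p. ennreal \<bar>snd p\<bar>)) =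
      (\<integral>p. \<bar>snd p\<bar> *\<^sub>R f (Complex (snd p * fst p) (snd p)) \<partial>(lborel \<Otimes>\<^sub>M lborel))"
      using m' by (intro integral_density) auto
    then show ?thesis by (simp add: case_prod_unfold)
  qed
  also have "\<dots> = (\<integral>c. (\<integral>y. \<bar>y\<bar> * f (Complex (y * c) y) \<partial>lborel) \<partial>lborel)"
    using lborel_pair.integral_fst'[OF 2] by simp
  finally show ?thesis .
qed

section \<open>Absolute integrability of the kernel of one vertex\<close>

lemma nn_integral_lorentz:
  assumes "0 < A" "0 < \<beta>"
  shows "(\<integral>\<^sup>+y. ennreal (A * \<beta> / ((A * y - m)\<^sup>2 + \<beta>\<^sup>2)) * indicator {0..} y \<partial>lborel) =
    ennreal (pi / 2 + arctan (m / \<beta>))"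
proof -
  have "(\<integral>\<^sup>+y. ennreal (A * \<beta> / ((A * y - m)\<^sup>2 + \<beta>\<^sup>2)) * indicator {0..} y \<partial>lborel)
    = ennreal (pi / 2 - arctan ((A * 0 - m) / \<beta>))"
  proof (rule nn_integral_FTC_atLeast)
    show "((\<lambda>y. arctan ((A * y - m) / \<beta>)) has_real_derivative A * \<beta> / ((A * y - m)\<^sup>2 + \<beta>\<^sup>2)) (at y)" for y
    proof -
      have "inverse (1 + ((A * y - m) / \<beta>)\<^sup>2) * (A / \<beta>) = A * \<beta> / ((A * y - m)\<^sup>2 + \<beta>\<^sup>2)"
      proof -
        have "1 + ((A * y - m) / \<beta>)\<^sup>2 = ((A * y - m)\<^sup>2 + \<beta>\<^sup>2) / \<beta>\<^sup>2"
          using assms by (simp add: field_simps power2_eq_square)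
        then show ?thesis using assms by (simp add: power2_eq_square divide_simps)
      qed
      moreover have "((\<lambda>y. arctan ((A * y - m) / \<beta>)) has_real_derivative inverse (1 + ((A * y - m) / \<beta>)\<^sup>2) * (A / \<beta>)) (at y)"
        using assms by (auto intro!: derivative_eq_intros)
      ultimately show ?thesis by simp
    qed
    show "((\<lambda>y. arctan ((A * y - m) / \<beta>)) \<longlongrightarrow> pi / 2) at_top"
    proof (rule filterlim_compose[OF tendsto_arctan_at_top])
      have "filterlim (\<lambda>y. - (m / \<beta>) + (A / \<beta>) * y) at_top at_top"
        using assms by (intro filterlim_tendsto_add_at_top[OF tendsto_const] filterlim_tendsto_pos_mult_at_top[OF tendsto_const] filterlim_ident) auto
      then show "LIM y at_top. (A * y - m) / \<beta> :> at_top"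
        by (simp add: diff_divide_distrib)
    qed
  qed (use assms in auto)
  then show ?thesis by (simp add: arctan_minus)
qed

lemma nn_integral_lorentz_UNIV:
  assumes "0 < A" "0 < \<beta>"
  shows "(\<integral>\<^sup>+y. ennreal (A * \<beta> / ((A * y - m)\<^sup>2 + \<beta>\<^sup>2)) \<partial>lborel) \<le> ennreal pi"
proof -
  let ?f = "\<lambda>m y. ennreal (A * \<beta> / ((A * y - m)\<^sup>2 + \<beta>\<^sup>2))"
  have "(\<integral>\<^sup>+y. ?f m y \<partial>lborel) \<le> (\<integral>\<^sup>+y. ?f m y * indicator {0..} y + ?f m y * indicator {..0} y \<partial>lborel)"
    by (intro nn_integral_mono) (auto simp: indicator_def)
  also have "\<dots> = (\<integral>\<^sup>+y. ?f m y * indicator {0..} y \<partial>lborel) + (\<integral>\<^sup>+y. ?f m y * indicator {..0} y \<partial>lborel)"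
    by (intro nn_integral_add) auto
  also have "(\<integral>\<^sup>+y. ?f m y * indicator {..0} y \<partial>lborel) =
      ennreal \<bar>-1\<bar> * (\<integral>\<^sup>+y. ?f m (0 + (-1) * y) * indicator {..0} (0 + (-1) * y) \<partial>lborel)"
    by (rule nn_integral_real_affine) auto
  also have "\<dots> = (\<integral>\<^sup>+y. ?f (- m) y * indicator {0..} y \<partial>lborel)"
  proof -
    have "(A * (0 + (-1) * y) - m)\<^sup>2 = (A * y - (- m))\<^sup>2" for y by (simp add: power2_eq_square algebra_simps)
    moreover have "indicator {..0} (0 + (-1) * y) = (indicator {0..} y :: ennreal)" for y :: real
      by (simp add: indicator_def)
    ultimately show ?thesis by simp
  qed
  also have "(\<integral>\<^sup>+y. ?f m y * indicator {0..} y \<partial>lborel) + \<dots> =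
     ennreal (pi / 2 + arctan (m / \<beta>)) + ennreal (pi / 2 + arctan (- m / \<beta>))"
    unfolding nn_integral_lorentz[OF assms] ..
  also have "\<dots> = ennreal pi"
    using arctan_lbound[of "m / \<beta>"] arctan_ubound[of "m / \<beta>"]
    by (subst ennreal_plus[symmetric]) (auto simp: arctan_minus)
  finally show ?thesis .
qed

text \<open>A Lorentz profile in \<open>y\<close>. Up to scaling, \<open>\<beta>\<close> is the
  signed distance of \<open>w\<close> from the line of the points \<open>Complex (y * c) y\<close>,
  and \<open>m\<close> locates the foot of the perpendicular from \<open>w\<close>.\<close>

lemma Im_ray:
  assumes "\<beta> = c * Im w - Re w" "m = c * Re w + Im w"
  shows "Im (Complex c 1 / (Complex (y * c) y - w)) = (1 + c\<^sup>2) * \<beta> / (((1 + c\<^sup>2) * y - m)\<^sup>2 + \<beta>\<^sup>2)"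
proof (cases "Complex (y * c) y = w")
  case True
  then have "w = Complex (y * c) y" by simp
  then have "\<beta> = 0" "(1 + c\<^sup>2) * y - m = 0"
    using assms by (auto simp: power2_eq_square algebra_simps)
  then show ?thesis using True by simp
next
  case False
  have p: "(y * c - Re w)\<^sup>2 + (y - Im w)\<^sup>2 \<noteq> 0"
    using False by (auto simp: complex_eq_iff sum_power2_eq_zero_iff)
  have e: "((1 + c\<^sup>2) * y - m)\<^sup>2 + \<beta>\<^sup>2 = (1 + c\<^sup>2) * ((y * c - Re w)\<^sup>2 + (y - Im w)\<^sup>2)"
    unfolding assms by (simp add: power2_eq_square algebra_simps)
  have c: "1 + c\<^sup>2 \<noteq> 0" by (metis add.commute power_one sum_power2_eq_zero_iff zero_neq_one)
  have n: "1 * (y * c - Re w) - c * (y - Im w) = \<beta>"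
    using assms by (simp add: algebra_simps)
  have "Im (Complex c 1 / (Complex (y * c) y - w)) = \<beta> / ((y * c - Re w)\<^sup>2 + (y - Im w)\<^sup>2)"
    using n by (simp add: Im_divide)
  also have "\<dots> = (1 + c\<^sup>2) * \<beta> / ((1 + c\<^sup>2) * ((y * c - Re w)\<^sup>2 + (y - Im w)\<^sup>2))"
    using c by simp
  finally show ?thesis by (simp only: e)
qed

lemma nn_integral_arctan_deriv: "(\<integral>\<^sup>+c. ennreal (1 / (1 + c\<^sup>2)) \<partial>lborel) \<le> ennreal pi"
  using nn_integral_lorentz_UNIV[of 1 1 0] by (simp add: add.commute)

text \<open>On the line, 1 / z decays like 1 / y and so cancels the Jacobian; the factor 1 / (1 +
  c^2) left over is integrable over all directions.\<close>

lemma Im_recip_mult_cnj: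
  fixes c y :: real
  assumes "y \<noteq> 0"
  shows "\<bar>y\<bar> * \<bar>Im (1 / Complex (y * c) y * cnj (1 / (Complex (y * c) y - w)))\<bar>
     = 1 / (1 + c\<^sup>2) * \<bar>Im (Complex c 1 / (Complex (y * c) y - w))\<bar>"
proof -
  define d where "d = Complex (y * c) y - w"
  have "1 / Complex (y * c) y = cnj (Complex c 1) / of_real (y * (1 + c\<^sup>2))"
  proof -
    have e: "Complex (y * c) y = of_real y * Complex c 1" by (simp add: complex_eq_iff)
    have "Complex c 1 * cnj (Complex c 1) = of_real (1 + c\<^sup>2)"
      by (simp add: complex_eq_iff power2_eq_square)
    moreover have "Complex c 1 \<noteq> 0" by (simp add: complex_eq_iff)
    ultimately have k: "cnj (Complex c 1) = of_real (1 + c\<^sup>2) / Complex c 1"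
      by (metis nonzero_mult_div_cancel_left)
    have "1 + c\<^sup>2 \<noteq> 0" by (metis add.commute power_one sum_power2_eq_zero_iff zero_neq_one)
    then have "complex_of_real (1 + c\<^sup>2) \<noteq> 0" unfolding of_real_eq_0_iff .
    then show ?thesis unfolding e k of_real_mult using assms by (simp del: of_real_add)
  qed
  then have "1 / Complex (y * c) y * cnj (1 / d) = cnj (Complex c 1 / d) / of_real (y * (1 + c\<^sup>2))"
    by simp
  then have "Im (1 / Complex (y * c) y * cnj (1 / d)) = - Im (Complex c 1 / d) / (y * (1 + c\<^sup>2))"
    by (simp only: Im_divide_of_real cnj.simps)
  then show ?thesis
    using assms unfolding d_def[symmetric] by (simp add: abs_mult abs_divide)
qed

text \<open>One factor pi comes from the Lorentz integral along each line, the other from the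
  directions. Uniformity in \<open>w\<close> is the point: it allows the vertices to be integrated
  out one by one.\<close>

lemma nn_integral_Im_recip_0:
  "(\<integral>\<^sup>+z. ennreal \<bar>Im (1 / z * cnj (1 / (z - w)))\<bar> \<partial>lborel) \<le> ennreal (pi\<^sup>2)"
proof -
  have "(\<integral>\<^sup>+z. ennreal \<bar>Im (1 / z * cnj (1 / (z - w)))\<bar> \<partial>lborel) =
    (\<integral>\<^sup>+c. (\<integral>\<^sup>+y. ennreal \<bar>y\<bar> * ennreal \<bar>Im (1 / Complex (y * c) y * cnj (1 / (Complex (y * c) y - w)))\<bar> \<partial>lborel) \<partial>lborel)"
    by (rule nn_integral_complex_rays) measurable
  also have "\<dots> \<le> (\<integral>\<^sup>+c. ennreal (1 / (1 + c\<^sup>2)) * ennreal pi \<partial>lborel)"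
  proof (rule nn_integral_mono)
    fix c :: real
    define \<beta> where "\<beta> = c * Im w - Re w"
    define m where "m = c * Re w + Im w"
    have c: "0 < 1 + c\<^sup>2" by (simp add: add_pos_nonneg)
    have "(\<integral>\<^sup>+y. ennreal \<bar>y\<bar> * ennreal \<bar>Im (1 / Complex (y * c) y * cnj (1 / (Complex (y * c) y - w)))\<bar> \<partial>lborel)
      \<le> (\<integral>\<^sup>+y. ennreal (1 / (1 + c\<^sup>2)) * ennreal ((1 + c\<^sup>2) * \<bar>\<beta>\<bar> / (((1 + c\<^sup>2) * y - m)\<^sup>2 + \<bar>\<beta>\<bar>\<^sup>2)) \<partial>lborel)"
    proof (rule nn_integral_mono)
      fix y :: real
      show "ennreal \<bar>y\<bar> * ennreal \<bar>Im (1 / Complex (y * c) y * cnj (1 / (Complex (y * c) y - w)))\<bar>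
        \<le> ennreal (1 / (1 + c\<^sup>2)) * ennreal ((1 + c\<^sup>2) * \<bar>\<beta>\<bar> / (((1 + c\<^sup>2) * y - m)\<^sup>2 + \<bar>\<beta>\<bar>\<^sup>2))"
      proof (cases "y = 0")
        case False
        have "\<bar>y\<bar> * \<bar>Im (1 / Complex (y * c) y * cnj (1 / (Complex (y * c) y - w)))\<bar> =
           1 / (1 + c\<^sup>2) * ((1 + c\<^sup>2) * \<bar>\<beta>\<bar> / (((1 + c\<^sup>2) * y - m)\<^sup>2 + \<bar>\<beta>\<bar>\<^sup>2))"
          unfolding Im_recip_mult_cnj[OF False] Im_ray[OF \<beta>_def m_def]
          using c by (simp add: abs_mult abs_divide)
        then show ?thesis using c by (simp add: ennreal_mult[symmetric])
      qed simp
    qed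
    also have "\<dots> = ennreal (1 / (1 + c\<^sup>2)) * (\<integral>\<^sup>+y. ennreal ((1 + c\<^sup>2) * \<bar>\<beta>\<bar> / (((1 + c\<^sup>2) * y - m)\<^sup>2 + \<bar>\<beta>\<bar>\<^sup>2)) \<partial>lborel)"
      by (rule nn_integral_cmult) measurable
    also have "(\<integral>\<^sup>+y. ennreal ((1 + c\<^sup>2) * \<bar>\<beta>\<bar> / (((1 + c\<^sup>2) * y - m)\<^sup>2 + \<bar>\<beta>\<bar>\<^sup>2)) \<partial>lborel) \<le> ennreal pi"
    proof (cases "\<beta> = 0")
      case False
      then show ?thesis using c by (intro nn_integral_lorentz_UNIV) auto
    qed simp
    finally show "(\<integral>\<^sup>+y. ennreal \<bar>y\<bar> * ennreal \<bar>Im (1 / Complex (y * c) y * cnj (1 / (Complex (y * c) y - w)))\<bar> \<partial>lborel)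
      \<le> ennreal (1 / (1 + c\<^sup>2)) * ennreal pi" by (simp add: mult_left_mono)
  qed
  also have "\<dots> = (\<integral>\<^sup>+c. ennreal (1 / (1 + c\<^sup>2)) \<partial>lborel) * ennreal pi"
    by (rule nn_integral_multc) measurable
  also have "\<dots> \<le> ennreal pi * ennreal pi"
    by (intro mult_right_mono nn_integral_arctan_deriv) auto
  also have "\<dots> = ennreal (pi\<^sup>2)" by (simp add: ennreal_mult[symmetric] power2_eq_square)
  finally show ?thesis .
qed

lemma nn_integral_Im_recip:
  "(\<integral>\<^sup>+z. ennreal \<bar>Im (1 / (z - a) * cnj (1 / (z - b)))\<bar> \<partial>lborel) \<le> ennreal (pi\<^sup>2)"
proof -
  have "(\<integral>\<^sup>+z. ennreal \<bar>Im (1 / (z - a) * cnj (1 / (z - b)))\<bar> \<partial>lborel) =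
     (\<integral>\<^sup>+z. ennreal \<bar>Im (1 / (z - a) * cnj (1 / (z - b)))\<bar> \<partial>distr lborel borel ((+) a))"
    by (simp add: lborel_distr_plus)
  also have "\<dots> = (\<integral>\<^sup>+z. ennreal \<bar>Im (1 / z * cnj (1 / (z - (b - a))))\<bar> \<partial>lborel)"
    by (subst nn_integral_distr) (measurable, simp add: add_diff_eq diff_diff_eq2 add.commute)
  also have "\<dots> \<le> ennreal (pi\<^sup>2)" by (rule nn_integral_Im_recip_0)
  finally show ?thesis .
qed

lemma measurable_dlog [measurable]:
  assumes [measurable]: "f \<in> borel_measurable M" "g \<in> borel_measurable M"
  shows "(\<lambda>x. dlog (f x) (g x)) \<in> borel_measurable M"
proof -
  show ?thesis unfolding dlog_def by measurable
qed

lemma measurable_kern [measurable]: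
  assumes [measurable]: "f \<in> borel_measurable M" "g \<in> borel_measurable M" "h \<in> borel_measurable M"
  shows "(\<lambda>x. kern (f x) (g x) (h x)) \<in> borel_measurable M"
proof -
  show ?thesis unfolding kern_def by measurable
qed

text \<open>Each \<open>dlog\<close> has two poles, which gives four terms of at most pi^2. The
  total is (2 pi)^2, exactly the normalization of a weight per vertex, so weights of trees will be
  bounded by 1.\<close>

lemma nn_integral_kern: "(\<integral>\<^sup>+z. ennreal \<bar>kern a b z\<bar> \<partial>lborel) \<le> ennreal (4 * pi\<^sup>2)"
proof -
  let ?t = "\<lambda>a b z. ennreal \<bar>Im (1 / (z - a) * cnj (1 / (z - b)))\<bar>"
  have "(\<integral>\<^sup>+z. ennreal \<bar>kern a b z\<bar> \<partial>lborel) \<le>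
     (\<integral>\<^sup>+z. (?t a b z + ?t a (cnj b) z) + (?t (cnj a) b z + ?t (cnj a) (cnj b) z) \<partial>lborel)"
  proof (rule nn_integral_mono)
    fix z
    let ?r = "\<lambda>a b. Im (1 / (z - a) * cnj (1 / (z - b)))"
    have "Im (dlog a z * cnj (dlog b z)) = (?r a b + ?r a (cnj b)) + (?r (cnj a) b + ?r (cnj a) (cnj b))"
      unfolding dlog_def by (simp only: complex_cnj_add distrib_left distrib_right plus_complex.sel)
    then have "\<bar>kern a b z\<bar> \<le> (\<bar>?r a b\<bar> + \<bar>?r a (cnj b)\<bar>) + (\<bar>?r (cnj a) b\<bar> + \<bar>?r (cnj a) (cnj b)\<bar>)"
    proof -
      assume e: "Im (dlog a z * cnj (dlog b z)) = (?r a b + ?r a (cnj b)) + (?r (cnj a) b + ?r (cnj a) (cnj b))"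
      have "\<bar>kern a b z\<bar> \<le> \<bar>Im (dlog a z * cnj (dlog b z))\<bar>"
        by (simp add: kern_def indicator_def del: times_complex.sel)
      then show ?thesis unfolding e by linarith
    qed
    then show "ennreal \<bar>kern a b z\<bar> \<le> (?t a b z + ?t a (cnj b) z) + (?t (cnj a) b z + ?t (cnj a) (cnj b) z)"
      by (simp add: ennreal_plus[symmetric] ennreal_leI del: ennreal_plus)
  qed
  also have "\<dots> = ((\<integral>\<^sup>+z. ?t a b z \<partial>lborel) + (\<integral>\<^sup>+z. ?t a (cnj b) z \<partial>lborel)) +
     ((\<integral>\<^sup>+z. ?t (cnj a) b z \<partial>lborel) + (\<integral>\<^sup>+z. ?t (cnj a) (cnj b) z \<partial>lborel))"
  proof -
    have [measurable]: "?t a b \<in> borel_measurable lborel" for a b by measurable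
    show ?thesis by (simp only: nn_integral_add borel_measurable_add \<open>\<And>b a. ?t a b \<in> borel_measurable lborel\<close>)
  qed
  also have "\<dots> \<le> (ennreal (pi\<^sup>2) + ennreal (pi\<^sup>2)) + (ennreal (pi\<^sup>2) + ennreal (pi\<^sup>2))"
    by (intro add_mono nn_integral_Im_recip)
  also have "\<dots> = ennreal (4 * pi\<^sup>2)" by (simp add: ennreal_plus[symmetric] del: ennreal_plus)
  finally show ?thesis .
qed

lemma integrable_kern: "integrable lborel (kern a b)"
proof (rule integrableI_bounded)
  show "(\<integral>\<^sup>+z. ennreal (norm (kern a b z)) \<partial>lborel) < \<infinity>"
    using nn_integral_kern[of a b] by (auto simp: le_less_trans[OF _ ennreal_less_top] less_top)
qed measurable

section \<open>The angle swept along a ray from the origin\<close>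

lemma arctan_cot:
  "0 < x \<Longrightarrow> x < pi \<Longrightarrow> arctan (cos x / sin x) = pi / 2 - x"
  "- pi < x \<Longrightarrow> x < 0 \<Longrightarrow> arctan (cos x / sin x) = - pi / 2 - x"
proof -
  have *: "arctan (cos x / sin x) = pi / 2 - x" if "0 < x" "x < pi" for x
    using that by (intro arctan_unique) (auto simp: tan_def sin_diff cos_diff)
  show "0 < x \<Longrightarrow> x < pi \<Longrightarrow> arctan (cos x / sin x) = pi / 2 - x" by (rule *)
  assume "- pi < x" "x < 0"
  then have "arctan (cos (- x) / sin (- x)) = pi / 2 - (- x)" by (intro *) auto
  then have "- arctan (cos x / sin x) = pi / 2 + x" by (simp add: arctan_minus)
  then show "arctan (cos x / sin x) = - pi / 2 - x" by simp
qed

lemma sgn_arctan_cot: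
  assumes "x \<noteq> 0" "- pi < x" "x < pi" "0 < k" "\<beta> = k * sin x" "m = k * cos x"
  shows "sgn \<beta> * (pi / 2) + arctan (m / \<beta>) = sgn x * pi - x"
proof -
  have "m / \<beta> = cos x / sin x" using assms by simp
  moreover have "sgn \<beta> = sgn x"
    using assms sin_gt_zero[of x] sin_gt_zero[of "- x"] by (cases "x > 0") (auto simp: sgn_mult)
  ultimately show ?thesis using arctan_cot[of x] assms by (cases "x > 0") (auto simp: sgn_if)
qed

lemma has_integral_ray:
  assumes "\<beta> = c * Im w - Re w" "m = c * Re w + Im w" "\<beta> \<noteq> 0"
  shows "has_bochner_integral lborel (\<lambda>y. indicator {0..} y * Im (Complex c 1 / (Complex (y * c) y - w)))
     (sgn \<beta> * (pi / 2) + arctan (m / \<beta>))"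
proof -
  let ?f = "\<lambda>y. (1 + c\<^sup>2) * \<bar>\<beta>\<bar> / (((1 + c\<^sup>2) * y - m)\<^sup>2 + \<bar>\<beta>\<bar>\<^sup>2)"
  have c: "0 < 1 + c\<^sup>2" by (simp add: add_pos_nonneg)
  have "has_bochner_integral lborel (\<lambda>y. ?f y * indicator {0..} y) (pi / 2 + arctan (m / \<bar>\<beta>\<bar>))"
  proof (rule has_bochner_integral_nn_integral)
    have "(\<integral>\<^sup>+y. ennreal (?f y * indicator {0..} y) \<partial>lborel) = (\<integral>\<^sup>+y. ennreal (?f y) * indicator {0..} y \<partial>lborel)"
      by (intro nn_integral_cong) (simp add: indicator_def)
    also have "\<dots> = ennreal (pi / 2 + arctan (m / \<bar>\<beta>\<bar>))"
      using assms(3) c by (intro nn_integral_lorentz) auto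
    finally show "(\<integral>\<^sup>+y. ennreal (?f y * indicator {0..} y) \<partial>lborel) = ennreal (pi / 2 + arctan (m / \<bar>\<beta>\<bar>))" .
  qed (use c arctan_lbound[of "m / \<bar>\<beta>\<bar>"] in \<open>auto simp: AE_I2 less_imp_le\<close>)
  then have "has_bochner_integral lborel (\<lambda>y. sgn \<beta> * (?f y * indicator {0..} y)) (sgn \<beta> * (pi / 2 + arctan (m / \<bar>\<beta>\<bar>)))"
    by (rule has_bochner_integral_mult_right)
  moreover have "sgn \<beta> * (?f y * indicator {0..} y) = indicator {0..} y * Im (Complex c 1 / (Complex (y * c) y - w))" for y
    unfolding Im_ray[OF assms(1,2)] by (simp add: sgn_if)
  moreover have "sgn \<beta> * (pi / 2 + arctan (m / \<bar>\<beta>\<bar>)) = sgn \<beta> * (pi / 2) + arctan (m / \<beta>)"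
    using assms(3) arctan_minus[of "m / \<beta>"] by (auto simp: sgn_if)
  ultimately show ?thesis by simp
qed

definition ray_frac :: "real \<Rightarrow> real" where
  "ray_frac c = 1 / 2 - arctan c / pi"

lemma ray_frac_bounds: "0 < ray_frac c" "ray_frac c < 1"
  using arctan_lbound[of c] arctan_ubound[of c] by (auto simp: ray_frac_def field_simps)

lemma frac_arg_ray: "y \<noteq> 0 \<Longrightarrow> frac_arg (Complex (y * c) y) = ray_frac c"
  by (simp add: frac_arg_def ray_frac_def)

lemma frac_arg_bounds: "frac_arg w \<in> {0..1}"
  using ray_frac_bounds[of "Re w / Im w"] by (auto simp: frac_arg_def ray_frac_def)

text \<open>The integral is the change of the argument of \<open>(z - w) * (z - cnj w)\<close> while
  z runs along the ray from 0 to infinity. The product starts at a positive number and ends with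
  twice the argument of the ray; one turn is lost once the ray lies beyond \<open>w\<close>. The
  excluded directions are those of the lines through \<open>w\<close> or
  \<open>cnj w\<close>.\<close>

lemma has_integral_dlog_ray:
  assumes w: "0 < Im w \<or> w = 1"
    and c: "c * Im w \<noteq> Re w" "c * Im w \<noteq> - Re w"
  shows "has_bochner_integral lborel (\<lambda>y. indicator {0..} y * Im (Complex c 1 * dlog w (Complex (y * c) y)))
     (2 * pi * (ray_frac c - indicator {frac_arg w..} (ray_frac c)))"
proof -
  define s where "s \<beta> m = sgn \<beta> * (pi / 2) + arctan (m / \<beta>)" for \<beta> m :: real
  have "has_bochner_integral lborel (\<lambda>y. indicator {0..} y * Im (Complex c 1 / (Complex (y * c) y - w)) +
      indicator {0..} y * Im (Complex c 1 / (Complex (y * c) y - cnj w)))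
    (s (c * Im w - Re w) (c * Re w + Im w) + s (c * Im (cnj w) - Re (cnj w)) (c * Re (cnj w) + Im (cnj w)))"
    unfolding s_def using c by (intro has_bochner_integral_add has_integral_ray refl) auto
  moreover have "indicator {0..} y * Im (Complex c 1 / (Complex (y * c) y - w)) +
      indicator {0..} y * Im (Complex c 1 / (Complex (y * c) y - cnj w)) =
      indicator {0..} y * Im (Complex c 1 * dlog w (Complex (y * c) y))" for y
  proof -
    have "Complex c 1 * dlog w (Complex (y * c) y) = Complex c 1 / (Complex (y * c) y - w) + Complex c 1 / (Complex (y * c) y - cnj w)"
      by (simp add: dlog_def distrib_left)
    then show ?thesis by (simp only: plus_complex.sel distrib_left)
  qed
  moreover have "s (c * Im w - Re w) (c * Re w + Im w) + s (c * Im (cnj w) - Re (cnj w)) (c * Re (cnj w) + Im (cnj w)) =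
    2 * pi * (ray_frac c - indicator {frac_arg w..} (ray_frac c))"
  proof -
    define t where "t = arctan c"
    have tb: "- pi / 2 < t" "t < pi / 2" using arctan_lbound[of c] arctan_ubound[of c] by (auto simp: t_def)
    have ct: "cos t \<noteq> 0" "cos t > 0" using tb by (auto simp: cos_gt_zero_pi less_imp_neq[symmetric])
    have tc: "c = sin t / cos t" using tan_arctan[of c] by (simp add: t_def tan_def)
    show ?thesis
    proof (cases "Im w > 0")
      case True
      define tw where "tw = arctan (Re w / Im w)"
      have twb: "- pi / 2 < tw" "tw < pi / 2" using arctan_lbound[of "Re w / Im w"] arctan_ubound[of "Re w / Im w"] by (auto simp: tw_def)
      have ctw: "cos tw \<noteq> 0" "cos tw > 0" using twb by (auto simp: cos_gt_zero_pi less_imp_neq[symmetric])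
      have twc: "Re w = Im w * (sin tw / cos tw)" using tan_arctan[of "Re w / Im w"] True by (simp add: tw_def tan_def field_simps)
      \<comment> \<open>\<open>t\<close> and \<open>tw\<close> are the angles of the ray and of
        \<open>w\<close> from the vertical. The quantities of \<open>has_integral_ray\<close> become
        \<open>k\<close> times sine and cosine of their difference for the pole \<open>w\<close>
        and, up to sign, of their sum for the pole \<open>cnj w\<close>.\<close>
      define k where "k = Im w / (cos t * cos tw)"
      have k: "k > 0" using True ct ctw by (simp add: k_def)
      have i1: "c * Im w - Re w = k * sin (t - tw)" "c * Re w + Im w = k * cos (t - tw)"
        and i2: "c * Im w + Re w = k * sin (t + tw)" "Im w - c * Re w = k * cos (t + tw)"
        unfolding tc twc k_def using ct ctw by (simp_all add: sin_diff cos_diff sin_add cos_add field_simps)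
      have n1: "t - tw \<noteq> 0" using i1 c by auto
      have n2: "t + tw \<noteq> 0" using i2 c by auto
      have s1: "s (c * Im w - Re w) (c * Re w + Im w) = sgn (t - tw) * pi - (t - tw)"
        unfolding s_def by (rule sgn_arctan_cot[OF n1 _ _ k i1]) (use tb twb in auto)
      have "s (c * Im w + Re w) (Im w - c * Re w) = sgn (t + tw) * pi - (t + tw)"
        unfolding s_def by (rule sgn_arctan_cot[OF n2 _ _ k i2]) (use tb twb in auto)
      moreover have "sgn (c * Im w + Re w) = sgn (t + tw)"
      proof -
        have "sin (t + tw) > 0" if "t + tw > 0" using that tb twb by (intro sin_gt_zero) auto
        moreover have "sin (t + tw) < 0" if "t + tw < 0"
          using sin_gt_zero[of "- (t + tw)"] that tb twb unfolding sin_minus by simp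
        ultimately show ?thesis using n2 k unfolding i2(1) sgn_mult
          by (cases "t + tw > 0") auto
      qed
      ultimately have "arctan ((Im w - c * Re w) / (c * Im w + Re w)) = sgn (t + tw) * (pi / 2) - (t + tw)"
        by (simp add: s_def)
      moreover have "arctan ((c * Re (cnj w) + Im (cnj w)) / (c * Im (cnj w) - Re (cnj w))) = arctan ((Im w - c * Re w) / (c * Im w + Re w))"
      proof -
        have "(c * Re (cnj w) + Im (cnj w)) / (c * Im (cnj w) - Re (cnj w)) = (Im w - c * Re w) / (c * Im w + Re w)"
          using c by (simp add: field_simps)
        then show ?thesis by simp
      qed
      moreover have "sgn (c * Im (cnj w) - Re (cnj w)) = - sgn (t + tw)"
        using \<open>sgn (c * Im w + Re w) = sgn (t + tw)\<close> by (metis add.commute cnj.simps minus_add_distrib mult_minus_right sgn_minus uminus_add_conv_diff)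
      \<comment> \<open>Conjugation flips the sign of the distance while the quotient keeps the form
        found before, so here the two half turns cancel instead of adding up.\<close>
      ultimately have s2: "s (c * Im (cnj w) - Re (cnj w)) (c * Re (cnj w) + Im (cnj w)) = - (t + tw)"
        by (simp only: s_def)
      have "frac_arg w \<le> ray_frac c \<longleftrightarrow> t \<le> tw"
        using True by (simp add: frac_arg_def ray_frac_def t_def tw_def divide_right_mono divide_le_cancel)
      then show ?thesis unfolding s1 s2 using n1
        by (auto simp: sgn_if indicator_def ray_frac_def t_def[symmetric] field_simps)
    next
      case False
      then have w1: "w = 1" using w by auto
      have s1: "s (- 1) c = - pi / 2 - t"
        by (simp add: s_def arctan_minus t_def)
      have "frac_arg w \<le> ray_frac c" using ray_frac_bounds[of c] by (simp add: frac_arg_def w1)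
      then have "2 * pi * (ray_frac c - indicator {frac_arg w..} (ray_frac c)) = - pi - 2 * t"
        by (simp add: ray_frac_def t_def[symmetric] algebra_simps)
      then show ?thesis by (simp add: w1 s1)
    qed
  qed
  ultimately show ?thesis by simp
qed

lemma kern_ray:
  assumes "0 < y"
  shows "\<bar>y\<bar> * kern 0 w (Complex (y * c) y) = - (2 / (1 + c\<^sup>2)) * Im (Complex c 1 * dlog w (Complex (y * c) y))"
proof -
  define d where "d = dlog w (Complex (y * c) y)"
  have c: "0 < 1 + c\<^sup>2" by (simp add: add_pos_nonneg)
  have e: "Complex (y * c) y = of_real y * Complex c 1" by (simp add: complex_eq_iff)
  have "Complex c 1 * cnj (Complex c 1) = of_real (1 + c\<^sup>2)"
    by (simp add: complex_eq_iff power2_eq_square)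
  moreover have "Complex c 1 \<noteq> 0" by (simp add: complex_eq_iff)
  ultimately have k: "cnj (Complex c 1) = of_real (1 + c\<^sup>2) / Complex c 1"
    by (metis nonzero_mult_div_cancel_left)
  have nz: "complex_of_real (1 + c\<^sup>2) \<noteq> 0" using c unfolding of_real_eq_0_iff by simp
  have "dlog 0 (Complex (y * c) y) = of_real (2 / (y * (1 + c\<^sup>2))) * cnj (Complex c 1)"
  proof -
    have "dlog 0 (Complex (y * c) y) = 2 / (of_real y * Complex c 1)" by (simp add: dlog_def e)
    then show ?thesis unfolding k of_real_divide of_real_mult using nz by (simp del: of_real_add)
  qed
  then have "dlog 0 (Complex (y * c) y) * cnj d = of_real (2 / (y * (1 + c\<^sup>2))) * cnj (Complex c 1 * d)"
    by simp
  have aux: "Im (of_real r * z) = r * Im z" for r z by simp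
  from \<open>dlog 0 (Complex (y * c) y) * cnj d = _\<close>
  have q: "Im (dlog 0 (Complex (y * c) y) * cnj d) = (2 / (y * (1 + c\<^sup>2))) * - Im (Complex c 1 * d)"
    by (simp only: aux cnj.simps)
  have "\<bar>y\<bar> * kern 0 w (Complex (y * c) y) = y * Im (dlog 0 (Complex (y * c) y) * cnj d)"
    using assms by (simp add: kern_def d_def del: times_complex.sel)
  also have "\<dots> = - (2 / (1 + c\<^sup>2)) * Im (Complex c 1 * d)"
    unfolding q using assms by (simp del: times_complex.sel)
  finally show ?thesis by (simp only: d_def)
qed

lemma measurable_frac_arg [measurable]: "frac_arg \<in> borel_measurable borel"
  unfolding frac_arg_def by measurable

lemma integral_ray_frac:
  fixes h :: "real \<Rightarrow> real"
  assumes [measurable]: "h \<in> borel_measurable borel" and "h absolutely_integrable_on {0<..<1}"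
  shows "(\<integral>c. h (ray_frac c) / (1 + c\<^sup>2) \<partial>lborel) = pi * integral {0<..<1} h"
proof -
  have c: "0 < 1 + c\<^sup>2" for c :: real by (simp add: add_pos_nonneg)
  have d: "(ray_frac has_vector_derivative - 1 / (pi * (1 + x\<^sup>2))) (at x within UNIV)" for x
    unfolding has_real_derivative_iff_has_vector_derivative[symmetric] ray_frac_def[abs_def]
  proof -
    have "((\<lambda>c. 1 / 2 - arctan c / pi) has_real_derivative - (inverse (1 + x\<^sup>2) / pi)) (at x)"
      by (auto intro!: derivative_eq_intros)
    then show "((\<lambda>c. 1 / 2 - arctan c / pi) has_real_derivative - 1 / (pi * (1 + x\<^sup>2))) (at x)"
      by (simp add: inverse_eq_divide mult.commute)
  qed
  have inj: "inj_on ray_frac UNIV"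
    by (auto simp: inj_on_def ray_frac_def) (metis tan_arctan)
  have img: "range ray_frac = {0<..<1}"
  proof
    show "{0<..<1} \<subseteq> range ray_frac"
    proof
      fix s :: real assume s: "s \<in> {0<..<1}"
      then have "- (pi / 2) < pi * (1 / 2 - s)" "pi * (1 / 2 - s) < pi / 2"
        using mult_strict_left_mono[of s 1 pi] by (auto simp: algebra_simps)
      then have "arctan (tan (pi * (1 / 2 - s))) = pi * (1 / 2 - s)" by (intro arctan_tan) auto
      then have "ray_frac (tan (pi * (1 / 2 - s))) = s" by (simp add: ray_frac_def)
      then show "s \<in> range ray_frac" by (metis rangeI)
    qed
  qed (use ray_frac_bounds in auto)
  have ab: "\<bar>- 1 / (pi * (1 + x\<^sup>2))\<bar> = 1 / (pi * (1 + x\<^sup>2))" for x :: real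
    using c[of x] by (simp add: abs_divide abs_mult)
  have 1: "(\<lambda>x. \<bar>- 1 / (pi * (1 + x\<^sup>2))\<bar> * h (ray_frac x)) absolutely_integrable_on UNIV \<and>
     integral UNIV (\<lambda>x. \<bar>- 1 / (pi * (1 + x\<^sup>2))\<bar> * h (ray_frac x)) = integral {0<..<1} h"
  proof (rule has_absolute_integral_change_of_variables_1'[where g = ray_frac and f = h, THEN iffD2])
    show "(ray_frac has_field_derivative - 1 / (pi * (1 + x\<^sup>2))) (at x within UNIV)" for x
      using d by (simp add: has_real_derivative_iff_has_vector_derivative)
    show "h absolutely_integrable_on range ray_frac \<and> integral (range ray_frac) h = integral {0<..<1} h"
      using assms(2) unfolding img by simp
  qed (use inj in auto)
  have [measurable]: "ray_frac \<in> borel_measurable borel" unfolding ray_frac_def by measurable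
  have i: "integrable lborel (\<lambda>x. h (ray_frac x) / (pi * (1 + x\<^sup>2)))"
    using 1[THEN conjunct1] unfolding absolutely_integrable_on_def ab set_integrable_def
    by (subst (asm) integrable_completion) auto
  have "(\<integral>c. h (ray_frac c) / (1 + c\<^sup>2) \<partial>lborel) = (\<integral>c. pi * (h (ray_frac c) / (pi * (1 + c\<^sup>2))) \<partial>lborel)"
    by simp
  also have "\<dots> = pi * (\<integral>c. h (ray_frac c) / (pi * (1 + c\<^sup>2)) \<partial>lborel)"
    by (rule integral_mult_right_zero)
  also have "(\<integral>c. h (ray_frac c) / (pi * (1 + c\<^sup>2)) \<partial>lborel) = integral {0<..<1} h"
    using integral_lborel[OF i] 1[THEN conjunct2] unfolding ab by simp
  finally show ?thesis .
qed

text \<open>On each ray from 0 the factor \<open>g\<close> is constant, so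
  \<open>has_integral_dlog_ray\<close> gives the inner integral. Integrating s minus the indicator
  of s \<ge> u against \<open>g\<close> over all rays is \<open>mean_prim\<close>; the constant is 2
  from \<open>kern_ray\<close>, 2 pi from the ray and pi from the directions.\<close>

lemma leaf_integral:
  assumes w: "0 < Im w \<or> w = 1" and g: "continuous_on {0..1} g"
  shows "integrable lborel (\<lambda>z. kern 0 w z * g (frac_arg z))"
    "(\<integral>z. kern 0 w z * g (frac_arg z) \<partial>lborel) = - (4 * pi\<^sup>2) * mean_prim g (frac_arg w)"
proof -
  \<comment> \<open>\<open>g\<close> is controlled on the unit interval only; cut off outside it
    becomes Borel measurable and keeps its values at every \<open>frac_arg\<close>.\<close>
  define g' where "g' s = indicator {0..1} s * g s" for s
  have g'm [measurable]: "g' \<in> borel_measurable borel"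
    unfolding g'_def using borel_measurable_continuous_on_indicator[of "{0..1}" g] g by simp
  have g': "g (frac_arg z) = g' (frac_arg z)" for z using frac_arg_bounds[of z] by (simp add: g'_def)
  have "bounded (g ` {0..1})"
    by (intro compact_imp_bounded compact_continuous_image g) simp
  then obtain K where "\<forall>y\<in>g ` {0..1}. norm y \<le> K" unfolding bounded_iff by blast
  then have K: "\<And>s. s \<in> {0..1} \<Longrightarrow> \<bar>g s\<bar> \<le> K" by simp
  have K0: "0 \<le> K" using K[of 0] by auto
  show int: "integrable lborel (\<lambda>z. kern 0 w z * g (frac_arg z))"
  proof (rule Bochner_Integration.integrable_bound)
    show "integrable lborel (\<lambda>z. K * kern 0 w z)" using integrable_kern by simp
    show "AE z in lborel. norm (kern 0 w z * g (frac_arg z)) \<le> norm (K * kern 0 w z)"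
      using K[OF frac_arg_bounds] K0 by (intro AE_I2) (auto simp: abs_mult mult.commute[of "\<bar>kern 0 w _\<bar>"] intro!: mult_right_mono)
  qed (simp add: g')
  define h where "h s = g' s * (s - indicator {frac_arg w..} s)" for s
  have "(\<integral>z. kern 0 w z * g (frac_arg z) \<partial>lborel) =
    (\<integral>c. (\<integral>y. \<bar>y\<bar> * (kern 0 w (Complex (y * c) y) * g (frac_arg (Complex (y * c) y))) \<partial>lborel) \<partial>lborel)"
    by (rule integral_complex_rays[OF int])
  also have "\<dots> = (\<integral>c. - (4 * pi) * (h (ray_frac c) / (1 + c\<^sup>2)) \<partial>lborel)"
  proof (rule integral_cong_AE)
    have "AE c in lborel. c \<noteq> Re w / Im w \<and> c \<noteq> - Re w / Im w"
      using AE_lborel_singleton[of "Re w / Im w"] AE_lborel_singleton[of "- Re w / Im w"] by eventually_elim auto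
    then show "AE c in lborel. (\<integral>y. \<bar>y\<bar> * (kern 0 w (Complex (y * c) y) * g (frac_arg (Complex (y * c) y))) \<partial>lborel) =
      - (4 * pi) * (h (ray_frac c) / (1 + c\<^sup>2))"
    proof eventually_elim
      case (elim c)
      have cc: "c * Im w \<noteq> Re w" "c * Im w \<noteq> - Re w" using elim w by (auto simp: field_simps)
      have "(\<integral>y. \<bar>y\<bar> * (kern 0 w (Complex (y * c) y) * g (frac_arg (Complex (y * c) y))) \<partial>lborel) =
        (\<integral>y. - (2 / (1 + c\<^sup>2)) * g (ray_frac c) * (indicator {0..} y * Im (Complex c 1 * dlog w (Complex (y * c) y))) \<partial>lborel)"
      proof (rule Bochner_Integration.integral_cong_AE)
        have "AE y in lborel. y \<noteq> (0::real)" by (rule AE_lborel_singleton)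
        then show "AE y in lborel. \<bar>y\<bar> * (kern 0 w (Complex (y * c) y) * g (frac_arg (Complex (y * c) y))) =
          - (2 / (1 + c\<^sup>2)) * g (ray_frac c) * (indicator {0..} y * Im (Complex c 1 * dlog w (Complex (y * c) y)))"
        proof eventually_elim
          case (elim y)
          show ?case
          proof (cases "y > 0")
            case True
            then show ?thesis using kern_ray[OF True, of w c] frac_arg_ray[of y c]
              by (simp add: mult.assoc[symmetric] del: times_complex.sel)
          next
            case False
            then show ?thesis using elim by (simp add: kern_def)
          qed
        qed
        show "(\<lambda>y. \<bar>y\<bar> * (kern 0 w (Complex (y * c) y) * g (frac_arg (Complex (y * c) y)))) \<in> borel_measurable lborel"
          unfolding g' Complex_eq by measurable
        show "(\<lambda>y. - (2 / (1 + c\<^sup>2)) * g (ray_frac c) * (indicator {0..} y * Im (Complex c 1 * dlog w (Complex (y * c) y)))) \<in> borel_measurable lborel"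
          unfolding Complex_eq by measurable
      qed
      also have "\<dots> = - (2 / (1 + c\<^sup>2)) * g (ray_frac c) * (2 * pi * (ray_frac c - indicator {frac_arg w..} (ray_frac c)))"
        using has_bochner_integral_integral_eq[OF has_integral_dlog_ray[OF w cc]] by simp
      also have "\<dots> = - (4 * pi) * (h (ray_frac c) / (1 + c\<^sup>2))"
        using ray_frac_bounds[of c] by (simp add: h_def g'_def)
      finally show ?case .
    qed
    have [measurable]: "ray_frac \<in> borel_measurable borel" unfolding ray_frac_def by measurable
    show "(\<lambda>c. - (4 * pi) * (h (ray_frac c) / (1 + c\<^sup>2))) \<in> borel_measurable lborel"
      unfolding h_def by measurable
    show "(\<lambda>c. (\<integral>y. \<bar>y\<bar> * (kern 0 w (Complex (y * c) y) * g (frac_arg (Complex (y * c) y))) \<partial>lborel)) \<in> borel_measurable lborel"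
    proof -
      have "(\<lambda>(c, y). \<bar>y\<bar> * (kern 0 w (Complex (y * c) y) * g (frac_arg (Complex (y * c) y)))) \<in> borel_measurable (lborel \<Otimes>\<^sub>M lborel)"
        unfolding g' Complex_eq case_prod_unfold by measurable
      then show ?thesis by (rule lborel.borel_measurable_lebesgue_integral)
    qed
  qed
  also have "\<dots> = - (4 * pi) * (\<integral>c. h (ray_frac c) / (1 + c\<^sup>2) \<partial>lborel)"
    by (rule integral_mult_right_zero)
  also have "(\<integral>c. h (ray_frac c) / (1 + c\<^sup>2) \<partial>lborel) = pi * integral {0<..<1} h"
  proof (rule integral_ray_frac)
    show "h \<in> borel_measurable borel" unfolding h_def by measurable
    show "h absolutely_integrable_on {0<..<1}"
      unfolding absolutely_integrable_on_def set_integrable_def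
    proof (rule integrable_completion[THEN iffD2])
      show "(\<lambda>x. indicat_real {0<..<1} x *\<^sub>R h x) \<in> borel_measurable lborel" unfolding h_def by measurable
      show "integrable lborel (\<lambda>x. indicat_real {0<..<1} x *\<^sub>R h x)"
      proof (rule integrableI_bounded_set[where A = "{0..1}" and B = K])
        show "AE x\<in>{0..1} in lborel. norm (indicat_real {0<..<1} x *\<^sub>R h x) \<le> K"
        proof (rule AE_I2, rule impI)
          fix x :: real assume x: "x \<in> {0..1}"
          have "\<bar>g x\<bar> * \<bar>x - indicator {frac_arg w..} x\<bar> \<le> K * 1"
            using K[OF x] K0 x by (intro mult_mono) (auto simp: indicator_def)
          then show "norm (indicat_real {0<..<1} x *\<^sub>R h x) \<le> K" using K0 x
            by (auto simp: h_def g'_def abs_mult indicator_def)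
        qed
        show "(\<lambda>x. indicat_real {0<..<1} x *\<^sub>R h x) \<in> borel_measurable lborel" unfolding h_def by measurable
      qed auto
    qed
  qed
  also have "integral {0<..<1} h = mean_prim g (frac_arg w)"
  proof -
    define u where "u = frac_arg w"
    have u: "u \<in> {0..1}" unfolding u_def by (rule frac_arg_bounds)
    have gi: "g integrable_on {0..1}" "(\<lambda>s. s * g s) integrable_on {0..1}"
      using g by (auto intro!: integrable_continuous_real continuous_intros)
    have I: "{u..1} \<inter> {0..1} = {u..1}" "{0..1} \<inter> {u..1} = {u..1}" using u by auto
    have gu: "g integrable_on {u..1}" using gi(1) u by (intro integrable_subinterval_real[OF gi(1)]) auto
    have "integral {0<..<1} h = integral {0..1} h"
      by (simp add: integral_open_interval_real)
    also have "\<dots> = integral {0..1} (\<lambda>s. s * g s - (if s \<in> {u..1} then g s else 0))"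
      by (intro integral_cong) (auto simp: h_def g'_def u_def indicator_def algebra_simps)
    also have "\<dots> = integral {0..1} (\<lambda>s. s * g s) - integral {0..1} (\<lambda>s. if s \<in> {u..1} then g s else 0)"
    proof (intro Henstock_Kurzweil_Integration.integral_diff gi(2))
      show "(\<lambda>s. if s \<in> {u..1} then g s else 0) integrable_on {0..1}"
        unfolding integrable_restrict_Int I using gu .
    qed
    also have "integral {0..1} (\<lambda>s. if s \<in> {u..1} then g s else 0) = integral {u..1} g"
      unfolding integral_restrict_Int I ..
    finally show ?thesis by (simp add: mean_prim_def u_def)
  qed
  finally show "(\<integral>z. kern 0 w z * g (frac_arg z) \<partial>lborel) = - (4 * pi\<^sup>2) * mean_prim g (frac_arg w)"
    by (simp add: power2_eq_square)
qed

section \<open>Integrating out the vertices of a graph one by one\<close>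

interpretation lborel_product: product_sigma_finite "\<lambda>_::nat. lborel :: complex measure"
  by (simp add: product_sigma_finite_def lborel.sigma_finite_measure_axioms)

abbreviation cspace :: "nat set \<Rightarrow> (nat \<Rightarrow> complex) measure" where
  "cspace S \<equiv> Pi\<^sub>M S (\<lambda>_. lborel)"

lemma measurable_cspace_component: "k \<in> S \<Longrightarrow> (\<lambda>z. z k) \<in> borel_measurable (cspace S)"
  using measurable_component_singleton[of k S "\<lambda>_. lborel :: complex measure"] by simp

lemma measurable_position:
  "v \<in> Aerial ` S \<union> {Ground1, Ground2} \<Longrightarrow> (\<lambda>z. position z v) \<in> borel_measurable (cspace S)"
  by (auto simp: position_def measurable_cspace_component)

lemma position_upd: "v \<noteq> Aerial k \<Longrightarrow> position (z(k := y)) v = position z v"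
  by (auto simp: position_def split: kvertex.splits)

text \<open>\<open>e\<close> selects one outgoing edge per vertex. As ranks drop along these edges,
  none of them ends at a vertex of highest rank, whose integral can therefore be carried out
  first.\<close>

definition targets_below :: "(nat \<Rightarrow> nat) \<Rightarrow> nat set \<Rightarrow> (nat \<Rightarrow> kvertex) \<Rightarrow> bool" where
  "targets_below \<rho> S e \<longleftrightarrow>
     (\<forall>k\<in>S. e k \<in> Aerial ` S \<union> {Ground1, Ground2} \<and> (\<forall>j. e k = Aerial j \<longrightarrow> \<rho> j < \<rho> k))"

lemma targets_below_remove:
  assumes "targets_below \<rho> (insert k S) e" "\<And>j. j \<in> S \<Longrightarrow> \<rho> j \<le> \<rho> k"
  shows "targets_below \<rho> S e" "j \<in> insert k S \<Longrightarrow> e j \<noteq> Aerial k"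
proof -
  show *: "e j \<noteq> Aerial k" if "j \<in> insert k S" for j
  proof
    assume "e j = Aerial k"
    then have "\<rho> k < \<rho> j" using assms(1) that unfolding targets_below_def by blast
    then show False using assms(2)[of j] that by auto
  qed
  show "targets_below \<rho> S e"
    using assms(1) * unfolding targets_below_def by fastforce
qed

lemma obtain_top:
  fixes \<rho> :: "nat \<Rightarrow> nat"
  assumes "finite S" "S \<noteq> {}"
  obtains k T where "S = insert k T" "k \<notin> T" "\<And>j. j \<in> T \<Longrightarrow> \<rho> j \<le> \<rho> k"
proof -
  have "Max (\<rho> ` S) \<in> \<rho> ` S" using assms by (intro Max_in) auto
  then obtain k where k: "k \<in> S" "\<rho> k = Max (\<rho> ` S)" by force
  have "\<rho> j \<le> \<rho> k" if "j \<in> S - {k}" for j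
    unfolding k(2) using assms that by (intro Max_ge) auto
  then show ?thesis using k(1) that[of k "S - {k}"] by auto
qed

text \<open>The vertex of highest rank occurs in its own kernel only, and the integral of that
  kernel is bounded uniformly in the positions of its two targets.\<close>

lemma nn_integral_kern_prod:
  assumes "finite S" "targets_below \<rho> S e1" "targets_below \<rho> S e2"
  shows "(\<integral>\<^sup>+z. (\<Prod>k\<in>S. ennreal \<bar>kern (position z (e1 k)) (position z (e2 k)) (z k)\<bar>) \<partial>cspace S)
    \<le> ennreal (4 * pi\<^sup>2) ^ card S"
  using assms
proof (induction "card S" arbitrary: S)
  case 0
  then have "S = {}" by simp
  then show ?case by (simp add: PiM_empty nn_integral_count_space_finite)
next
  case (Suc n)
  then have "S \<noteq> {}" by auto
  then obtain k T where T: "S = insert k T" "k \<notin> T" and top: "\<And>j. j \<in> T \<Longrightarrow> \<rho> j \<le> \<rho> k"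
    using obtain_top[of S \<rho>] Suc.prems(1) by metis
  note r1 = targets_below_remove[OF Suc.prems(2)[unfolded T(1)] top]
  note r2 = targets_below_remove[OF Suc.prems(3)[unfolded T(1)] top]
  have fT: "finite T" using Suc.prems(1) T by simp
  have [measurable]: "(\<lambda>z. position z (e1 j)) \<in> borel_measurable (cspace S)"
    "(\<lambda>z. position z (e2 j)) \<in> borel_measurable (cspace S)" "(\<lambda>z. z j) \<in> borel_measurable (cspace S)" if "j \<in> S" for j
    using Suc.prems that by (auto simp: targets_below_def intro!: measurable_position measurable_cspace_component)
  let ?f = "\<lambda>j z. ennreal \<bar>kern (position z (e1 j)) (position z (e2 j)) (z j)\<bar>"
  have m: "?f j \<in> borel_measurable (cspace S)" if "j \<in> S" for j
    using that by measurable
  have "(\<integral>\<^sup>+z. (\<Prod>k\<in>S. ?f k z) \<partial>cspace S) = (\<integral>\<^sup>+z. (\<integral>\<^sup>+y. (\<Prod>j\<in>S. ?f j (z(k := y))) \<partial>lborel) \<partial>cspace T)"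
    unfolding T(1) using fT T(2) m unfolding T(1)
    by (intro lborel_product.product_nn_integral_insert borel_measurable_prod_ennreal) auto
  also have "\<dots> = (\<integral>\<^sup>+z. (\<Prod>j\<in>T. ?f j z) * (\<integral>\<^sup>+y. ennreal \<bar>kern (position z (e1 k)) (position z (e2 k)) y\<bar> \<partial>lborel) \<partial>cspace T)"
  proof (rule nn_integral_cong)
    fix z :: "nat \<Rightarrow> complex"
    have "(\<Prod>j\<in>S. ?f j (z(k := y))) = (\<Prod>j\<in>T. ?f j z) * ennreal \<bar>kern (position z (e1 k)) (position z (e2 k)) y\<bar>" for y
    proof -
      have "(\<Prod>j\<in>T. ?f j (z(k := y))) = (\<Prod>j\<in>T. ?f j z)"
        using r1(2) r2(2) T(2) by (intro prod.cong refl) (auto simp: position_upd)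
      then show ?thesis using T fT r1(2)[of k] r2(2)[of k] by (simp add: position_upd mult.commute)
    qed
    then show "(\<integral>\<^sup>+y. (\<Prod>j\<in>S. ?f j (z(k := y))) \<partial>lborel) = (\<Prod>j\<in>T. ?f j z) * (\<integral>\<^sup>+y. ennreal \<bar>kern (position z (e1 k)) (position z (e2 k)) y\<bar> \<partial>lborel)"
      by (simp add: nn_integral_cmult)
  qed
  also have "\<dots> \<le> (\<integral>\<^sup>+z. (\<Prod>j\<in>T. ?f j z) * ennreal (4 * pi\<^sup>2) \<partial>cspace T)"
    by (intro nn_integral_mono mult_left_mono nn_integral_kern) auto
  also have "\<dots> = (\<integral>\<^sup>+z. (\<Prod>j\<in>T. ?f j z) \<partial>cspace T) * ennreal (4 * pi\<^sup>2)"
  proof (rule nn_integral_multc)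
    have [measurable]: "(\<lambda>z. position z (e1 j)) \<in> borel_measurable (cspace T)"
      "(\<lambda>z. position z (e2 j)) \<in> borel_measurable (cspace T)" "(\<lambda>z. z j) \<in> borel_measurable (cspace T)" if "j \<in> T" for j
      using r1(1) r2(1) that by (auto simp: targets_below_def intro!: measurable_position measurable_cspace_component)
    show "(\<lambda>z. \<Prod>j\<in>T. ?f j z) \<in> borel_measurable (cspace T)"
      by (intro borel_measurable_prod_ennreal) measurable
  qed
  also have "\<dots> \<le> ennreal (4 * pi\<^sup>2) ^ card T * ennreal (4 * pi\<^sup>2)"
    using Suc.hyps(1)[of T] Suc.hyps(2) Suc.prems(1) T fT r1(1) r2(1) by (intro mult_right_mono) auto
  also have "\<dots> = ennreal (4 * pi\<^sup>2) ^ card S" using T fT by (simp add: mult.commute)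
  finally show ?case .
qed

lemma integrable_kern_prod:
  assumes "finite S" "targets_below \<rho> S e1" "targets_below \<rho> S e2"
    and g: "\<And>k. k \<in> S \<Longrightarrow> continuous_on {0..1} (g k)"
  shows "integrable (cspace S) (\<lambda>z. \<Prod>k\<in>S. kern (position z (e1 k)) (position z (e2 k)) (z k) * g k (frac_arg (z k)))"
proof (rule integrableI_bounded)
  define h where "h k s = indicator {0..1} s * g k s" for k s
  have hm [measurable]: "h k \<in> borel_measurable borel" if "k \<in> S" for k
    unfolding h_def using borel_measurable_continuous_on_indicator[of "{0..1}" "g k"] g[OF that] by simp
  have h: "g k (frac_arg w) = h k (frac_arg w)" for w k using frac_arg_bounds[of w] by (simp add: h_def)
  have [measurable]: "(\<lambda>z. position z (e1 j)) \<in> borel_measurable (cspace S)"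
    "(\<lambda>z. position z (e2 j)) \<in> borel_measurable (cspace S)" "(\<lambda>z. z j) \<in> borel_measurable (cspace S)" if "j \<in> S" for j
    using assms that by (auto simp: targets_below_def intro!: measurable_position measurable_cspace_component)
  show "(\<lambda>z. \<Prod>k\<in>S. kern (position z (e1 k)) (position z (e2 k)) (z k) * g k (frac_arg (z k))) \<in> borel_measurable (cspace S)"
    unfolding h by (intro borel_measurable_prod) measurable
  have "\<exists>K. \<forall>s\<in>{0..1}. \<bar>g k s\<bar> \<le> K" if "k \<in> S" for k
  proof -
    have "bounded (g k ` {0..1})"
      by (intro compact_imp_bounded compact_continuous_image g that) simp
    then show ?thesis unfolding bounded_iff by auto
  qed
  then obtain K where K: "\<And>k s. k \<in> S \<Longrightarrow> s \<in> {0..1} \<Longrightarrow> \<bar>g k s\<bar> \<le> K k" by metis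
  have K0: "0 \<le> K k" if "k \<in> S" for k using K[OF that, of 0] by auto
  let ?f = "\<lambda>z. \<Prod>k\<in>S. ennreal \<bar>kern (position z (e1 k)) (position z (e2 k)) (z k)\<bar>"
  have "(\<integral>\<^sup>+z. ennreal (norm (\<Prod>k\<in>S. kern (position z (e1 k)) (position z (e2 k)) (z k) * g k (frac_arg (z k)))) \<partial>cspace S)
     \<le> (\<integral>\<^sup>+z. ennreal (\<Prod>k\<in>S. K k) * ?f z \<partial>cspace S)"
  proof (rule nn_integral_mono)
    fix z
    have "norm (\<Prod>k\<in>S. kern (position z (e1 k)) (position z (e2 k)) (z k) * g k (frac_arg (z k)))
      \<le> (\<Prod>k\<in>S. \<bar>kern (position z (e1 k)) (position z (e2 k)) (z k)\<bar> * K k)"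
      unfolding prod_norm[symmetric] using K[OF _ frac_arg_bounds]
      by (intro prod_mono) (auto simp: abs_mult intro!: mult_left_mono)
    also have "\<dots> = (\<Prod>k\<in>S. K k) * (\<Prod>k\<in>S. \<bar>kern (position z (e1 k)) (position z (e2 k)) (z k)\<bar>)"
      by (simp add: prod.distrib mult.commute)
    finally show "ennreal (norm (\<Prod>k\<in>S. kern (position z (e1 k)) (position z (e2 k)) (z k) * g k (frac_arg (z k))))
       \<le> ennreal (\<Prod>k\<in>S. K k) * ?f z"
      using K0 by (simp add: prod_ennreal ennreal_mult[symmetric] prod_nonneg ennreal_leI)
  qed
  also have "\<dots> = ennreal (\<Prod>k\<in>S. K k) * (\<integral>\<^sup>+z. ?f z \<partial>cspace S)"
    by (intro nn_integral_cmult borel_measurable_prod_ennreal) measurable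
  also have "\<dots> \<le> ennreal (\<Prod>k\<in>S. K k) * ennreal (4 * pi\<^sup>2) ^ card S"
    using assms by (intro mult_left_mono nn_integral_kern_prod) auto
  also have "\<dots> = ennreal ((\<Prod>k\<in>S. K k) * (4 * pi\<^sup>2) ^ card S)"
    by (subst ennreal_mult) (simp_all add: prod_nonneg K0 ennreal_power)
  also have "\<dots> < \<infinity>" by simp
  finally show "(\<integral>\<^sup>+z. ennreal (norm (\<Prod>k\<in>S. kern (position z (e1 k)) (position z (e2 k)) (z k) * g k (frac_arg (z k)))) \<partial>cspace S) < \<infinity>" .
qed

text \<open>Integrating out a leaf multiplies the function attached to its parent by the function
  of the leaf, which by \<open>leaf_integral\<close> depends on the argument of the parent only.\<close>

lemma integral_kern_tree:
  assumes "finite S" "targets_below \<rho> S e" "\<And>k. k \<in> S \<Longrightarrow> e k \<noteq> Ground1"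
    and "\<And>k. k \<in> S \<Longrightarrow> continuous_on {0..1} (g k)"
    and "\<And>k. k \<in> S \<Longrightarrow> continuous_on {0..1} (F k)"
    and "\<And>k u. k \<in> S \<Longrightarrow> u \<in> {0..1} \<Longrightarrow>
      F k u = mean_prim (\<lambda>u. g k u * (\<Prod>c | c \<in> S \<and> e c = Aerial k. F c u)) u"
  shows "(\<integral>z. (\<Prod>k\<in>S. kern 0 (position z (e k)) (z k) * g k (frac_arg (z k))) \<partial>cspace S) =
     (- (4 * pi\<^sup>2)) ^ card S * (\<Prod>c | c \<in> S \<and> e c = Ground2. F c 0)"
  using assms
proof (induction "card S" arbitrary: S g)
  case 0
  then have "S = {}" by simp
  then show ?case by (simp add: PiM_empty lebesgue_integral_count_space_finite)
next
  case (Suc n)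
  then have "S \<noteq> {}" by auto
  then obtain k T where T: "S = insert k T" "k \<notin> T" and top: "\<And>j. j \<in> T \<Longrightarrow> \<rho> j \<le> \<rho> k"
    using obtain_top[of S \<rho>] Suc.prems(1) by metis
  note r = targets_below_remove[OF Suc.prems(2)[unfolded T(1)] top]
  have fT: "finite T" using Suc.prems(1) T by simp
  have g0: "targets_below \<rho> S (\<lambda>_. Ground1)" by (simp add: targets_below_def)
  have pos0: "position z Ground1 = 0" "position z Ground2 = 1" for z by (simp_all add: position_def)
  have Fk: "F k u = mean_prim (g k) u" if "u \<in> {0..1}" for u
  proof -
    have e: "{c. c \<in> S \<and> e c = Aerial k} = {}" using r(2) T by auto
    have "k \<in> S" using T by simp
    from Suc.prems(6)[OF this that] show ?thesis unfolding e by simp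
  qed
  define g' where "g' j = (if e k = Aerial j then (\<lambda>u. g j u * F k u) else g j)" for j
  let ?f = "\<lambda>g j z. kern 0 (position z (e j)) (z j) * g j (frac_arg (z j))"
  have "(\<integral>z. (\<Prod>j\<in>S. ?f g j z) \<partial>cspace S) = (\<integral>z. (\<integral>y. (\<Prod>j\<in>S. ?f g j (z(k := y))) \<partial>lborel) \<partial>cspace T)"
    unfolding T(1)
    using integrable_kern_prod[OF Suc.prems(1) g0 Suc.prems(2,4)] fT T(2)
    by (intro lborel_product.product_integral_insert) (auto simp: pos0 T(1))
  also have "\<dots> = (\<integral>z. - (4 * pi\<^sup>2) * (if e k = Ground2 then F k 0 else 1) * (\<Prod>j\<in>T. ?f g' j z) \<partial>cspace T)"
  proof (rule Bochner_Integration.integral_cong[OF refl])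
    fix z :: "nat \<Rightarrow> complex"
    have "(\<Prod>j\<in>S. ?f g j (z(k := y))) = (\<Prod>j\<in>T. ?f g j z) * (kern 0 (position z (e k)) y * g k (frac_arg y))" for y
    proof -
      have "(\<Prod>j\<in>T. ?f g j (z(k := y))) = (\<Prod>j\<in>T. ?f g j z)"
        using r(2) T(2) by (intro prod.cong refl) (auto simp: position_upd)
      then show ?thesis using T fT r(2)[of k] by (simp add: position_upd mult.commute)
    qed
    then have *: "(\<integral>y. (\<Prod>j\<in>S. ?f g j (z(k := y))) \<partial>lborel) =
      (\<Prod>j\<in>T. ?f g j z) * (\<integral>y. kern 0 (position z (e k)) y * g k (frac_arg y) \<partial>lborel)"
      by simp
    have gk: "continuous_on {0..1} (g k)" using Suc.prems(4) T by simp
    consider "e k = Ground2" | j where "e k = Aerial j" "j \<in> T"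
      using Suc.prems(2,3) T r(2)[of k] by (auto simp: targets_below_def)
    then show "(\<integral>y. (\<Prod>j\<in>S. ?f g j (z(k := y))) \<partial>lborel) =
       - (4 * pi\<^sup>2) * (if e k = Ground2 then F k 0 else 1) * (\<Prod>j\<in>T. ?f g' j z)"
    proof cases
      case 1
      \<comment> \<open>The root is joined to the point 1, whose angle is 0; this is the origin of
        the value at 0.\<close>
      have "g' = g" using 1 by (simp add: g'_def fun_eq_iff)
      moreover have "frac_arg 1 = 0" by (simp add: frac_arg_def)
      ultimately show ?thesis
        using leaf_integral(2)[OF _ gk, of 1] Fk[of 0] unfolding * 1 pos0 by simp
    next
      case (2 j)
      have pz: "position z (e k) = z j" using 2 by (simp add: position_def)
      have prod': "(\<Prod>j\<in>T. ?f g' j z) = (\<Prod>j\<in>T. ?f g j z) * F k (frac_arg (z j))"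
      proof -
        have "(\<Prod>j\<in>T. ?f g' j z) = (\<Prod>i\<in>T. ?f g i z * (if i = j then F k (frac_arg (z j)) else 1))"
          using 2 by (intro prod.cong refl) (auto simp: g'_def)
        then show ?thesis using 2 fT by (simp add: prod.distrib)
      qed
      show ?thesis
      proof (cases "0 < Im (z j)")
        case True
        then show ?thesis
          using leaf_integral(2)[OF _ gk, of "z j"] Fk[OF frac_arg_bounds[of "z j"]] 2 prod' unfolding * pz by simp
      next
        \<comment> \<open>Here \<open>leaf_integral\<close> does not apply, but the parent outside
          the half plane has a vanishing kernel.\<close>
        case False
        then have "kern 0 (position z (e j)) (z j) = 0" by (simp add: kern_def)
        then have "(\<Prod>j\<in>T. ?f g j z) = 0" using 2 fT by (auto intro!: prod_zero bexI[of _ j])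
        then show ?thesis using prod' unfolding * by simp
      qed
    qed
  qed
  also have "\<dots> = - (4 * pi\<^sup>2) * (if e k = Ground2 then F k 0 else 1) * (\<integral>z. (\<Prod>j\<in>T. ?f g' j z) \<partial>cspace T)"
    by simp
  also have "(\<integral>z. (\<Prod>j\<in>T. ?f g' j z) \<partial>cspace T) = (- (4 * pi\<^sup>2)) ^ card T * (\<Prod>c | c \<in> T \<and> e c = Ground2. F c 0)"
  proof (rule Suc.hyps(1))
    show "n = card T" using Suc.hyps(2) T fT by simp
    show "continuous_on {0..1} (g' j)" if "j \<in> T" for j
      using that T Suc.prems(4,5) by (auto simp: g'_def intro!: continuous_intros)
    fix j u assume j: "j \<in> T" and u: "u \<in> {0..(1::real)}"
    have "F j u = mean_prim (\<lambda>u. g j u * (\<Prod>c | c \<in> S \<and> e c = Aerial j. F c u)) u"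
      using Suc.prems(6) T j u by simp
    also have "(\<lambda>u. g j u * (\<Prod>c | c \<in> S \<and> e c = Aerial j. F c u)) = (\<lambda>u. g' j u * (\<Prod>c | c \<in> T \<and> e c = Aerial j. F c u))"
    proof (cases "e k = Aerial j")
      case True
      then have "{c. c \<in> S \<and> e c = Aerial j} = insert k {c. c \<in> T \<and> e c = Aerial j}" using T by auto
      then show ?thesis using True T fT by (simp add: g'_def mult.assoc)
    next
      case False
      then have "{c. c \<in> S \<and> e c = Aerial j} = {c. c \<in> T \<and> e c = Aerial j}" using T by auto
      then show ?thesis using False by (simp add: g'_def)
    qed
    finally show "F j u = mean_prim (\<lambda>u. g' j u * (\<Prod>c | c \<in> T \<and> e c = Aerial j. F c u)) u" .
  qed (use Suc.prems T fT r(1) in auto)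
  finally have "(\<integral>z. (\<Prod>j\<in>S. ?f g j z) \<partial>cspace S) =
    - (4 * pi\<^sup>2) * (if e k = Ground2 then F k 0 else 1) * ((- (4 * pi\<^sup>2)) ^ card T * (\<Prod>c | c \<in> T \<and> e c = Ground2. F c 0))" .
  moreover have "(if e k = Ground2 then F k 0 else 1) * (\<Prod>c | c \<in> T \<and> e c = Ground2. F c 0) = (\<Prod>c | c \<in> S \<and> e c = Ground2. F c 0)"
  proof (cases "e k = Ground2")
    case True
    then have "{c. c \<in> S \<and> e c = Ground2} = insert k {c. c \<in> T \<and> e c = Ground2}" using T by auto
    then show ?thesis using True T fT by simp
  next
    case False
    then have "{c. c \<in> S \<and> e c = Ground2} = {c. c \<in> T \<and> e c = Ground2}" using T by auto
    then show ?thesis using False by simp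
  qed
  ultimately show ?case using T fT by (simp add: mult_ac)
qed

section \<open>Weights of trees\<close>

abbreviation edges_to :: "nat \<Rightarrow> (nat \<times> nat \<Rightarrow> kvertex) \<Rightarrow> kvertex \<Rightarrow> (nat \<times> nat) set" where
  "edges_to n \<Gamma> v \<equiv> {e \<in> kedges n. \<Gamma> e = v}"

abbreviation edge_list_to :: "nat \<Rightarrow> (nat \<times> nat \<Rightarrow> kvertex) \<Rightarrow> nat \<Rightarrow> (nat \<times> nat) list" where
  "edge_list_to n \<Gamma> k \<equiv> filter (\<lambda>e. \<Gamma> e = Aerial k) (kedge_list n)"

text \<open>The denominator of \<open>angle_ratio\<close> is the conjugate of its numerator, so its
  logarithmic derivative is a number minus its conjugate, and division by \<open>2 * \<i>\<close>
  leaves an imaginary part.\<close>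

lemma angle_ratio_derivative:
  assumes "0 < Im z" "0 \<le> Im w" "z \<noteq> w"
  shows "Re (vector_derivative (\<lambda>t. angle_ratio (z + t *\<^sub>R u) w) (at 0) / (2 * \<i> * angle_ratio z w)) = Im (dlog w z * u)"
proof -
  define A where "A = w - z"
  define B where "B = cnj w - z"
  have nz: "A \<noteq> 0" "B \<noteq> 0" "cnj A \<noteq> 0" "cnj B \<noteq> 0"
    using assms by (auto simp: A_def B_def complex_eq_iff)
  define G where "G s = ((A - s * u) * (B - s * u)) / ((cnj B - s * cnj u) * (cnj A - s * cnj u))" for s
  define R where "R = A * B / (cnj B * cnj A)"
  have R: "R \<noteq> 0" using nz by (simp add: R_def)
  have "(G has_field_derivative R * (- u / A - u / B + cnj u / cnj B + cnj u / cnj A)) (at (of_real 0))"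
    unfolding G_def R_def
    by (rule derivative_eq_intros refl | use nz in \<open>simp; fail\<close>)+ (use nz in \<open>simp add: field_simps\<close>)
  then have "((\<lambda>t. G (of_real t)) has_vector_derivative R * (- u / A - u / B + cnj u / cnj B + cnj u / cnj A)) (at 0)"
    using has_vector_derivative_real_field by blast
  moreover have "G (of_real t) = angle_ratio (z + t *\<^sub>R u) w" for t
    by (simp add: G_def angle_ratio_def A_def B_def scaleR_conv_of_real diff_diff_eq)
  ultimately have vd: "vector_derivative (\<lambda>t. angle_ratio (z + t *\<^sub>R u) w) (at 0) =
      R * (- u / A - u / B + cnj u / cnj B + cnj u / cnj A)"
    by (auto intro: vector_derivative_at)
  have "angle_ratio z w = R" by (simp add: angle_ratio_def R_def A_def B_def)
  moreover have "- u / A - u / B + cnj u / cnj B + cnj u / cnj A = 2 * \<i> * of_real (Im (dlog w z * u))"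
  proof -
    have "dlog w z * u = - u / A - u / B"
    proof -
      have "z - w = - A" "z - cnj w = - B" by (simp_all add: A_def B_def)
      then show ?thesis by (simp add: dlog_def distrib_right left_diff_distrib)
    qed
    moreover have "- u / A - u / B + cnj u / cnj B + cnj u / cnj A = (- u / A - u / B) - cnj (- u / A - u / B)"
      by simp
    ultimately show ?thesis by (simp only: complex_diff_cnj) (simp add: mult_ac)
  qed
  ultimately show ?thesis unfolding vd using R by simp
qed

lemma dangle_self:
  assumes "v \<noteq> Aerial k" "0 < Im (z k)" "0 \<le> Im (position z v)" "z k \<noteq> position z v"
  shows "dangle k v z k u = Im (dlog (position z v) (z k) * u)"
proof -
  have "position (z(k := y)) v = position z v" for y using assms(1) by (rule position_upd)
  then show ?thesis using angle_ratio_derivative[OF assms(2-4), of u]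
    by (simp add: dangle_def Let_def position_def del: times_complex.sel)
qed

lemma dangle_other:
  assumes "l \<noteq> k" "v \<noteq> Aerial l"
  shows "dangle k v z l u = 0"
proof -
  have "position (z(l := y)) v = position z v" for y using assms(2) by (rule position_upd)
  moreover have "position (z(l := y)) (Aerial k) = position z (Aerial k)" for y using assms(1) by (intro position_upd) auto
  ultimately show ?thesis by (simp add: dangle_def Let_def)
qed

text \<open>The sum of the ranks over all positions is invariant under a permutation; one that never
  raises a rank can therefore never lower one.\<close>

lemma permutes_block_triangular:
  fixes \<rho> :: "nat \<Rightarrow> nat"
  assumes "\<sigma> permutes {..<2 * n}"
    and "\<And>r. r < 2 * n \<Longrightarrow> \<sigma> r div 2 = r div 2 \<or> \<rho> (\<sigma> r div 2) < \<rho> (r div 2)"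
  shows "\<forall>r<2 * n. \<sigma> r div 2 = r div 2"
proof (rule ccontr)
  assume "\<not> ?thesis"
  then obtain r where r: "r < 2 * n" "\<sigma> r div 2 \<noteq> r div 2" by auto
  have "(\<Sum>r<2 * n. \<rho> (\<sigma> r div 2)) < (\<Sum>r<2 * n. \<rho> (r div 2))"
  proof (rule sum_strict_mono_ex1)
    show "\<forall>x\<in>{..<2 * n}. \<rho> (\<sigma> x div 2) \<le> \<rho> (x div 2)"
    proof
      fix x assume "x \<in> {..<2 * n}"
      then have "\<sigma> x div 2 = x div 2 \<or> \<rho> (\<sigma> x div 2) < \<rho> (x div 2)" using assms(2)[of x] by blast
      then show "\<rho> (\<sigma> x div 2) \<le> \<rho> (x div 2)" by (elim disjE) simp_all
    qed
    show "\<exists>a\<in>{..<2 * n}. \<rho> (\<sigma> a div 2) < \<rho> (a div 2)" using assms(2)[of r] r by auto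
  qed simp
  moreover have "(\<Sum>r<2 * n. \<rho> (\<sigma> r div 2)) = (\<Sum>r<2 * n. \<rho> (r div 2))"
    using sum.permute[OF assms(1), of "\<lambda>r. \<rho> (r div 2)"] by (simp add: o_def)
  ultimately show False by simp
qed

definition block_perms :: "nat \<Rightarrow> (nat \<Rightarrow> nat) set" where
  "block_perms n = {\<sigma>. \<sigma> permutes {..<2 * n} \<and> (\<forall>r<2 * n. \<sigma> r div 2 = r div 2)}"

lemma block_perms_Suc:
  "block_perms (Suc n) = block_perms n \<union> (\<lambda>\<sigma>. Transposition.transpose (2 * n) (2 * n + 1) \<circ> \<sigma>) ` block_perms n" (is "_ = ?B \<union> ?t ` ?B")
proof
  let ?\<tau> = "Transposition.transpose (2 * n) (2 * n + 1)"
  have \<tau>: "?\<tau> permutes {..<2 * Suc n}" by (intro permutes_swap_id) auto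
  have \<tau>d: "?\<tau> r div 2 = r div 2" for r by (auto simp: Transposition.transpose_def)
  have sub: "?B \<subseteq> block_perms (Suc n)"
  proof
    fix \<sigma> assume s: "\<sigma> \<in> ?B"
    then have "\<sigma> permutes {..<2 * Suc n}" by (auto simp: block_perms_def intro: permutes_subset)
    moreover have "\<sigma> r div 2 = r div 2" for r
      using s by (cases "r < 2 * n") (auto simp: block_perms_def permutes_def)
    ultimately show "\<sigma> \<in> block_perms (Suc n)" by (simp add: block_perms_def)
  qed
  have tsub: "?\<tau> \<circ> \<sigma> \<in> block_perms (Suc n)" if "\<sigma> \<in> block_perms (Suc n)" for \<sigma>
    using that permutes_compose[OF _ \<tau>, of \<sigma>] \<tau>d by (auto simp: block_perms_def)
  show "?B \<union> ?t ` ?B \<subseteq> block_perms (Suc n)" using sub tsub by auto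
  have fix_in: "\<sigma> \<in> ?B" if s: "\<sigma> \<in> block_perms (Suc n)" and e: "\<sigma> (2 * n) = 2 * n" for \<sigma>
  proof -
    have p: "\<sigma> permutes {..<2 * Suc n}" and d: "\<And>r. r < 2 * Suc n \<Longrightarrow> \<sigma> r div 2 = r div 2"
      using s by (auto simp: block_perms_def)
    have "\<sigma> (2 * n + 1) \<noteq> \<sigma> (2 * n)" unfolding inj_eq[OF permutes_inj[OF p]] by simp
    moreover have "\<sigma> (2 * n + 1) div 2 = n" using d[of "2 * n + 1"] by simp
    ultimately have "\<sigma> (2 * n + 1) = 2 * n + 1" using e by presburger
    then have "\<sigma> permutes {..<2 * n}"
      using p e by (intro permutes_superset[OF p]) (auto simp: less_Suc_eq)
    then show ?thesis using d by (simp add: block_perms_def)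
  qed
  show "block_perms (Suc n) \<subseteq> ?B \<union> ?t ` ?B"
  proof
    fix \<sigma> assume s: "\<sigma> \<in> block_perms (Suc n)"
    have "\<sigma> (2 * n) div 2 = n" using s by (simp add: block_perms_def)
    then consider "\<sigma> (2 * n) = 2 * n" | "\<sigma> (2 * n) = 2 * n + 1" by linarith
    then show "\<sigma> \<in> ?B \<union> ?t ` ?B"
    proof cases
      case 1 then show ?thesis using fix_in[OF s] by simp
    next
      case 2
      then have "?\<tau> \<circ> \<sigma> \<in> ?B" using fix_in[OF tsub[OF s]] by simp
      moreover have "\<sigma> = ?\<tau> \<circ> (?\<tau> \<circ> \<sigma>)" by (auto simp: fun_eq_iff)
      ultimately show ?thesis by blast
    qed
  qed
qed

lemma sum_block_perms:
  "(\<Sum>\<sigma>\<in>block_perms n. of_int (sign \<sigma>) * (\<Prod>r<2 * n. \<omega> r (\<sigma> r))) =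
   (\<Prod>k<n. \<omega> (2 * k) (2 * k) * \<omega> (2 * k + 1) (2 * k + 1) - \<omega> (2 * k) (2 * k + 1) * \<omega> (2 * k + 1) (2 * k) :: real)"
proof (induction n)
  case 0
  have "block_perms 0 = {id}" by (auto simp: block_perms_def permutes_def fun_eq_iff)
  then show ?case by simp
next
  case (Suc n)
  let ?\<tau> = "Transposition.transpose (2 * n) (2 * n + 1)"
  let ?t = "\<lambda>\<sigma>. ?\<tau> \<circ> \<sigma>"
  let ?s = "\<lambda>n \<sigma>. of_int (sign \<sigma>) * (\<Prod>r<2 * n. \<omega> r (\<sigma> r))"
  have fin: "finite (block_perms n)"
    by (rule finite_subset[OF _ finite_permutations[of "{..<2 * n}"]]) (auto simp: block_perms_def)
  have fixed: "\<sigma> (2 * n) = 2 * n" "\<sigma> (2 * n + 1) = 2 * n + 1" if "\<sigma> \<in> block_perms n" for \<sigma>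
    using that by (auto simp: block_perms_def permutes_def)
  have dis: "block_perms n \<inter> ?t ` block_perms n = {}"
  proof -
    have False if "\<sigma> \<in> block_perms n" "?t \<sigma> \<in> block_perms n" for \<sigma>
      using fixed(1)[OF that(1)] fixed(1)[OF that(2)] by simp
    then show ?thesis by auto
  qed
  have inj: "inj_on ?t (block_perms n)"
    by (rule inj_onI) (metis comp_assoc id_comp transpose_comp_involutory)
  have A: "?s (Suc n) \<sigma> = ?s n \<sigma> * (\<omega> (2 * n) (2 * n) * \<omega> (2 * n + 1) (2 * n + 1))" if "\<sigma> \<in> block_perms n" for \<sigma>
    using fixed[OF that] by (simp add: mult_ac)
  have B: "?s (Suc n) (?t \<sigma>) = - (?s n \<sigma> * (\<omega> (2 * n) (2 * n + 1) * \<omega> (2 * n + 1) (2 * n)))" if s: "\<sigma> \<in> block_perms n" for \<sigma>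
  proof -
    have p: "\<sigma> permutes {..<2 * n}" using s by (simp add: block_perms_def)
    have "permutation \<sigma>" using p by (auto simp: permutation_permutes)
    moreover have "permutation ?\<tau>" by (rule permutation_swap_id)
    ultimately have sg: "sign (?t \<sigma>) = - sign \<sigma>" by (simp add: sign_compose sign_swap_id)
    have "(\<Prod>r<2 * n. \<omega> r (?t \<sigma> r)) = (\<Prod>r<2 * n. \<omega> r (\<sigma> r))"
    proof (intro prod.cong refl)
      fix r assume "r \<in> {..<2 * n}"
      then have "\<sigma> r < 2 * n" using permutes_in_image[OF p, of r] by simp
      then show "\<omega> r (?t \<sigma> r) = \<omega> r (\<sigma> r)" by (simp add: Transposition.transpose_def)
    qed
    then show ?thesis using fixed[OF s] sg by (simp add: mult_ac)
  qed
  have "(\<Sum>\<sigma>\<in>block_perms (Suc n). ?s (Suc n) \<sigma>) =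
    (\<Sum>\<sigma>\<in>block_perms n. ?s (Suc n) \<sigma>) + (\<Sum>\<sigma>\<in>block_perms n. ?s (Suc n) (?t \<sigma>))"
    unfolding block_perms_Suc using fin dis inj by (subst sum.union_disjoint) (auto simp: sum.reindex o_def)
  also have "\<dots> = (\<Sum>\<sigma>\<in>block_perms n. ?s n \<sigma>) * (\<omega> (2 * n) (2 * n) * \<omega> (2 * n + 1) (2 * n + 1))
     - (\<Sum>\<sigma>\<in>block_perms n. ?s n \<sigma>) * (\<omega> (2 * n) (2 * n + 1) * \<omega> (2 * n + 1) (2 * n))"
  proof -
    have "(\<Sum>\<sigma>\<in>block_perms n. ?s (Suc n) \<sigma>) = (\<Sum>\<sigma>\<in>block_perms n. ?s n \<sigma> * (\<omega> (2 * n) (2 * n) * \<omega> (2 * n + 1) (2 * n + 1)))"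
      by (rule sum.cong[OF refl A])
    moreover have "(\<Sum>\<sigma>\<in>block_perms n. ?s (Suc n) (?t \<sigma>)) = (\<Sum>\<sigma>\<in>block_perms n. - (?s n \<sigma> * (\<omega> (2 * n) (2 * n + 1) * \<omega> (2 * n + 1) (2 * n))))"
      by (rule sum.cong[OF refl B])
    ultimately show ?thesis by (simp only: sum_negf sum_distrib_right[symmetric])
  qed
  finally show ?case using Suc.IH by (simp add: algebra_simps)
qed

text \<open>A block triangular determinant with blocks of size 2: by
  \<open>permutes_block_triangular\<close>, only permutations preserving every block survive in the
  Leibniz sum.\<close>

lemma wedge_coeff_block_triangular:
  fixes \<rho> :: "nat \<Rightarrow> nat"
  assumes "\<And>r c. r < 2 * n \<Longrightarrow> c < 2 * n \<Longrightarrow> \<omega> r c \<noteq> 0 \<Longrightarrow> c div 2 = r div 2 \<or> \<rho> (c div 2) < \<rho> (r div 2)"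
  shows "wedge_coeff (2 * n) \<omega> =
    (\<Prod>k<n. \<omega> (2 * k) (2 * k) * \<omega> (2 * k + 1) (2 * k + 1) - \<omega> (2 * k) (2 * k + 1) * \<omega> (2 * k + 1) (2 * k))"
proof -
  have "wedge_coeff (2 * n) \<omega> = (\<Sum>\<sigma>\<in>block_perms n. of_int (sign \<sigma>) * (\<Prod>r<2 * n. \<omega> r (\<sigma> r)))"
    unfolding wedge_coeff_def
  proof (rule sum.mono_neutral_right)
    show "\<forall>\<sigma>\<in>{\<sigma>. \<sigma> permutes {..<2 * n}} - block_perms n. of_int (sign \<sigma>) * (\<Prod>r<2 * n. \<omega> r (\<sigma> r)) = 0"
    proof
      fix \<sigma> assume s: "\<sigma> \<in> {\<sigma>. \<sigma> permutes {..<2 * n}} - block_perms n"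
      have "\<exists>r<2 * n. \<omega> r (\<sigma> r) = 0"
      proof (rule ccontr)
        assume nz: "\<not> ?thesis"
        have "\<sigma> r div 2 = r div 2 \<or> \<rho> (\<sigma> r div 2) < \<rho> (r div 2)" if "r < 2 * n" for r
          using that nz s permutes_in_image[of \<sigma> "{..<2 * n}" r] by (intro assms) auto
        then have "\<forall>r<2 * n. \<sigma> r div 2 = r div 2"
          using s by (intro permutes_block_triangular[where \<rho> = \<rho>]) auto
        then show False using s by (auto simp: block_perms_def)
      qed
      then have "(\<Prod>r<2 * n. \<omega> r (\<sigma> r)) = 0" by (auto intro: prod_zero)
      then show "of_int (sign \<sigma>) * (\<Prod>r<2 * n. \<omega> r (\<sigma> r)) = 0" by simp
    qed
  qed (auto simp: block_perms_def finite_permutations)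
  then show ?thesis using sum_block_perms by simp
qed

definition graph_rank :: "nat \<Rightarrow> (nat \<times> nat \<Rightarrow> kvertex) \<Rightarrow> (nat \<Rightarrow> nat) \<Rightarrow> bool" where
  "graph_rank n \<Gamma> \<rho> \<longleftrightarrow> (\<forall>k\<in>{1..n}. \<forall>a\<in>{1,2}. \<forall>j. \<Gamma> (k, a) = Aerial j \<longrightarrow> \<rho> j < \<rho> k)"

text \<open>Moving one vertex changes only the angles at that vertex and at the sources of edges
  ending there, which have higher rank. So the matrix of the angle forms is block triangular, and
  each diagonal block has the kernel of one vertex as its determinant.\<close>

lemma weight_density_eq:
  assumes G: "\<Gamma> \<in> kgraphs n" and r: "graph_rank n \<Gamma> \<rho>" and z: "z \<in> config_space n"
  shows "weight_density n \<Gamma> z = (\<Prod>k\<in>{1..n}. kern (position z (\<Gamma> (k, 1))) (position z (\<Gamma> (k, 2))) (z k))"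
proof -
  let ?\<omega> = "\<lambda>r c. dangle (r div 2 + 1) (\<Gamma> (r div 2 + 1, r mod 2 + 1)) z (c div 2 + 1) (if even c then 1 else \<i>)"
  have tr: "c div 2 = r div 2 \<or> \<rho> (c div 2 + 1) < \<rho> (r div 2 + 1)" if "r < 2 * n" "c < 2 * n" "?\<omega> r c \<noteq> 0" for r c
  proof (rule ccontr)
    assume n: "\<not> ?thesis"
    then have "\<Gamma> (r div 2 + 1, r mod 2 + 1) \<noteq> Aerial (c div 2 + 1)"
    proof -
      have "r div 2 + 1 \<in> {1..n}" "r mod 2 + 1 \<in> {1, 2}" using that(1) by auto
      then show ?thesis using r n unfolding graph_rank_def by blast
    qed
    then show False using dangle_other[of "c div 2 + 1" "r div 2 + 1"] n that(3) by auto
  qed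
  have "weight_density n \<Gamma> z = (\<Prod>k<n. ?\<omega> (2 * k) (2 * k) * ?\<omega> (2 * k + 1) (2 * k + 1) - ?\<omega> (2 * k) (2 * k + 1) * ?\<omega> (2 * k + 1) (2 * k))"
    unfolding weight_density_def by (rule wedge_coeff_block_triangular[where \<rho> = "\<lambda>k. \<rho> (k + 1)"]) (rule tr)
  also have "\<dots> = (\<Prod>k<n. kern (position z (\<Gamma> (k + 1, 1))) (position z (\<Gamma> (k + 1, 2))) (z (k + 1)))"
  proof (intro prod.cong refl)
    fix k assume "k \<in> {..<n}"
    then have k: "k + 1 \<in> {1..n}" by auto
    have zk: "0 < Im (z (k + 1))" using z k by (auto simp: config_space_def)
    have d: "dangle (k + 1) (\<Gamma> (k + 1, a)) z (k + 1) u = Im (dlog (position z (\<Gamma> (k + 1, a))) (z (k + 1)) * u)"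
      if a: "a \<in> {1, 2}" for a u
    proof (rule dangle_self)
      show ne: "\<Gamma> (k + 1, a) \<noteq> Aerial (k + 1)" using G a k by (auto simp: kgraphs_def)
      have "(k + 1, a) \<in> kedges n" using a k by (auto simp: kedges_def)
      then have "\<Gamma> (k + 1, a) \<in> Aerial ` {1..n} \<union> {Ground1, Ground2}" using G by (auto simp: kgraphs_def)
      then consider "\<Gamma> (k + 1, a) = Ground1" | "\<Gamma> (k + 1, a) = Ground2" | j where "\<Gamma> (k + 1, a) = Aerial j" "j \<in> {1..n}" by auto
      then have "0 \<le> Im (position z (\<Gamma> (k + 1, a))) \<and> z (k + 1) \<noteq> position z (\<Gamma> (k + 1, a))"
      proof cases
        case (3 j)
        have "inj_on z {1..n}" "z j \<in> {w. 0 < Im w}" using z 3 by (auto simp: config_space_def)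
        moreover have "j \<noteq> k + 1" using 3 ne by auto
        ultimately have "0 < Im (z j)" "z j \<noteq> z (k + 1)"
          using 3 k inj_on_eq_iff[of z "{1..n}" j "k + 1"] by auto
        then show ?thesis using 3 by (simp add: position_def)
      qed (use zk in \<open>auto simp: position_def\<close>)
      then show "0 \<le> Im (position z (\<Gamma> (k + 1, a)))" "z (k + 1) \<noteq> position z (\<Gamma> (k + 1, a))" by auto
    qed (rule zk)
    define A where "A = dlog (position z (\<Gamma> (k + 1, 1))) (z (k + 1))"
    define B where "B = dlog (position z (\<Gamma> (k + 1, 2))) (z (k + 1))"
    have "?\<omega> (2 * k) (2 * k) = Im A" "?\<omega> (2 * k + 1) (2 * k + 1) = Re B" "?\<omega> (2 * k) (2 * k + 1) = Re A" "?\<omega> (2 * k + 1) (2 * k) = Im B"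
    proof -
      have "(2 * k) div 2 = k" "(2 * k + 1) div 2 = k" "(2 * k) mod 2 + 1 = 1" "(2 * k + 1) mod 2 + 1 = (2::nat)"
        "even (2 * k)" "\<not> even (2 * k + 1)" by simp_all
      note e = this
      show "?\<omega> (2 * k) (2 * k) = Im A" "?\<omega> (2 * k + 1) (2 * k + 1) = Re B" "?\<omega> (2 * k) (2 * k + 1) = Re A" "?\<omega> (2 * k + 1) (2 * k) = Im B"
        unfolding e A_def B_def by (simp_all only: d insertI1 insertI2 if_True if_False) simp_all
    qed
    then show "?\<omega> (2 * k) (2 * k) * ?\<omega> (2 * k + 1) (2 * k + 1) - ?\<omega> (2 * k) (2 * k + 1) * ?\<omega> (2 * k + 1) (2 * k) =
       kern (position z (\<Gamma> (k + 1, 1))) (position z (\<Gamma> (k + 1, 2))) (z (k + 1))"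
      using zk by (simp only: kern_def A_def[symmetric] B_def[symmetric]) simp
  qed
  also have "\<dots> = (\<Prod>k\<in>{1..n}. kern (position z (\<Gamma> (k, 1))) (position z (\<Gamma> (k, 2))) (z k))"
    by (rule prod.reindex_bij_witness[of _ "\<lambda>k. k - 1" "\<lambda>k. k + 1"]) auto
  finally show ?thesis .
qed

lemma AE_cspace_distinct:
  assumes "finite S" "i \<in> S" "j \<in> S" "i \<noteq> j"
  shows "AE z in cspace S. z i \<noteq> z j"
proof -
  obtain T where T: "S = insert i T" "i \<notin> T" using assms(2) by (meson mk_disjoint_insert)
  have j: "j \<in> T" and fT: "finite T" using T assms by auto
  have [measurable]: "(\<lambda>z. z k) \<in> borel_measurable (cspace S)" if "k \<in> S" for k
    using that by (rule measurable_cspace_component)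
  have m: "{z \<in> space (cspace S). z i = z j} \<in> sets (cspace S)"
    using assms by measurable
  have "emeasure (cspace S) {z \<in> space (cspace S). z i = z j} = (\<integral>\<^sup>+z. indicator {z \<in> space (cspace S). z i = z j} z \<partial>cspace S)"
    using m by simp
  also have "\<dots> = (\<integral>\<^sup>+z. (\<integral>\<^sup>+y. indicator {z \<in> space (cspace S). z i = z j} (z(i := y)) \<partial>lborel) \<partial>cspace T)"
    unfolding T(1) using fT T(2) m by (intro lborel_product.product_nn_integral_insert) (auto simp: T(1))
  also have "\<dots> \<le> (\<integral>\<^sup>+z. (\<integral>\<^sup>+y. indicator {z j} y \<partial>lborel) \<partial>cspace T)"
    using assms(4) by (intro nn_integral_mono) (auto simp: indicator_def)
  also have "\<dots> = 0" by simp
  finally show ?thesis using m by (subst AE_iff_measurable[OF _ refl]) auto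
qed

text \<open>The kernels vanish outside the half plane and coincidences of points form a null set, so
  the configuration space may be replaced by the full product space.\<close>

lemma weight_eq:
  assumes G: "\<Gamma> \<in> kgraphs n" and r: "graph_rank n \<Gamma> \<rho>"
  shows "weight n \<Gamma> = (\<integral>z. (\<Prod>k\<in>{1..n}. kern (position z (\<Gamma> (k, 1))) (position z (\<Gamma> (k, 2))) (z k)) \<partial>cspace {1..n}) / (2 * pi) ^ (2 * n)"
proof -
  let ?K = "\<lambda>z. \<Prod>k\<in>{1..n}. kern (position z (\<Gamma> (k, 1))) (position z (\<Gamma> (k, 2))) (z k)"
  have tgt: "\<Gamma> (k, a) \<in> Aerial ` {1..n} \<union> {Ground1, Ground2}" if "k \<in> {1..n}" "a \<in> {1, 2}" for k a
  proof -
    have "(k, a) \<in> kedges n" using that by (auto simp: kedges_def)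
    then show ?thesis using G by (auto simp: kgraphs_def)
  qed
  have mp [measurable]: "(\<lambda>z. position z (\<Gamma> (k, 1))) \<in> borel_measurable (cspace {1..n})"
     "(\<lambda>z. position z (\<Gamma> (k, 2))) \<in> borel_measurable (cspace {1..n})"
     "(\<lambda>z. z k) \<in> borel_measurable (cspace {1..n})" if "k \<in> {1..n}" for k
    using tgt[OF that, of 1] tgt[OF that, of 2] that by (auto intro!: measurable_position measurable_cspace_component)
  have mK [measurable]: "?K \<in> borel_measurable (cspace {1..n})"
    by (intro borel_measurable_prod) measurable
  \<comment> \<open>The indicator of pairwise distinct positions, as a finite product of measurable
    functions.\<close>
  let ?D = "\<lambda>z. \<Prod>i\<in>{1..n}. \<Prod>j\<in>{1..n} - {i}. indicat_real {w. fst w \<noteq> snd w} (z i, z j)"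
  have mD [measurable]: "?D \<in> borel_measurable (cspace {1..n})"
  proof (intro borel_measurable_prod)
    fix i j assume "i \<in> {1..n}" "j \<in> {1..n} - {i}"
    then have ij: "i \<in> {1..n}" "j \<in> {1..n}" by blast+
    have [measurable]: "(\<lambda>z. z i) \<in> borel_measurable (cspace {1..n})" "(\<lambda>z. z j) \<in> borel_measurable (cspace {1..n})"
      by (rule mp(3)[OF ij(1)], rule mp(3)[OF ij(2)])
    have "(\<lambda>z. indicat_real {w. fst w \<noteq> snd w} (z i, z j)) = (\<lambda>z::nat \<Rightarrow> complex. if z i = z j then 0 else 1)"
      by (auto simp: indicator_def)
    moreover have "(\<lambda>z::nat \<Rightarrow> complex. if z i = z j then 0 else 1 :: real) \<in> borel_measurable (cspace {1..n})"
      by measurable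
    ultimately show "(\<lambda>z. indicat_real {w. fst w \<noteq> snd w} (z i, z j)) \<in> borel_measurable (cspace {1..n})"
      by (simp only:)
  qed
  have "set_lebesgue_integral (cspace {1..n}) (config_space n) (weight_density n \<Gamma>) = (\<integral>z. ?D z * ?K z \<partial>cspace {1..n})"
    unfolding set_lebesgue_integral_def
  proof (rule Bochner_Integration.integral_cong[OF refl])
    fix z assume z: "z \<in> space (cspace {1..n})"
    show "indicat_real (config_space n) z *\<^sub>R weight_density n \<Gamma> z = ?D z * ?K z"
    proof (cases "z \<in> config_space n")
      case True
      then have inj: "inj_on z {1..n}" by (simp add: config_space_def)
      have "?D z = 1"
      proof (intro prod.neutral ballI)
        fix i j assume "i \<in> {1..n}" "j \<in> {1..n} - {i}"
        then show "indicat_real {w. fst w \<noteq> snd w} (z i, z j) = 1"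
          using inj_on_eq_iff[OF inj, of i j] by simp
      qed
      then show ?thesis using weight_density_eq[OF G r True] True by simp
    next
      case False
      then consider k where "k \<in> {1..n}" "Im (z k) \<le> 0" | i j where "i \<in> {1..n}" "j \<in> {1..n}" "i \<noteq> j" "z i = z j"
        using z by (force simp: config_space_def inj_on_def space_PiM PiE_iff not_less)
      then have "?D z * ?K z = 0"
      proof cases
        case (1 k)
        then have "?K z = 0" by (intro prod_zero) (auto simp: kern_def intro!: bexI[of _ k])
        then show ?thesis by simp
      next
        case (2 i j)
        then have "(\<Prod>j\<in>{1..n} - {i}. indicat_real {w. fst w \<noteq> snd w} (z i, z j)) = 0"
        proof (intro prod_zero)
          show "\<exists>a\<in>{1..n} - {i}. indicat_real {w. fst w \<noteq> snd w} (z i, z a) = 0"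
            using 2 by (intro bexI[of _ j]) auto
        qed simp
        then have "?D z = 0" by (intro prod_zero[OF finite_atLeastAtMost] bexI[OF _ 2(1)])
        then show ?thesis by simp
      qed
      then show ?thesis using False by simp
    qed
  qed
  also have "\<dots> = (\<integral>z. ?K z \<partial>cspace {1..n})"
  proof (rule Bochner_Integration.integral_cong_AE)
    have "AE z in cspace {1..n}. \<forall>i\<in>{1..n}. \<forall>j\<in>{1..n}. i \<noteq> j \<longrightarrow> z i \<noteq> z j"
      using AE_cspace_distinct[of "{1..n}"] by (intro AE_finite_allI) auto
    then show "AE z in cspace {1..n}. ?D z * ?K z = ?K z"
    proof eventually_elim
      case (elim z)
      then have "?D z = 1" by (intro prod.neutral ballI) (auto simp: indicator_def)
      then show ?case by simp
    qed
  qed measurable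
  finally show ?thesis by (simp add: weight_def)
qed

lemma graph_targets_below:
  assumes G: "\<Gamma> \<in> kgraphs n" and r: "graph_rank n \<Gamma> \<rho>" and a: "a \<in> {1, 2}"
  shows "targets_below \<rho> {1..n} (\<lambda>k. \<Gamma> (k, a))"
  unfolding targets_below_def
proof (intro ballI conjI allI impI)
  fix k assume k: "k \<in> {1..n}"
  have "(k, a) \<in> kedges n" using k a by (auto simp: kedges_def)
  then show "\<Gamma> (k, a) \<in> Aerial ` {1..n} \<union> {Ground1, Ground2}" using G by (auto simp: kgraphs_def)
  show "\<rho> j < \<rho> k" if "\<Gamma> (k, a) = Aerial j" for j using that r k a by (auto simp: graph_rank_def)
qed

lemma weight_bound:
  assumes G: "\<Gamma> \<in> kgraphs n" and r: "graph_rank n \<Gamma> \<rho>"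
  shows "\<bar>weight n \<Gamma>\<bar> \<le> 1"
proof -
  let ?K = "\<lambda>z. \<Prod>k\<in>{1..n}. kern (position z (\<Gamma> (k, 1))) (position z (\<Gamma> (k, 2))) (z k)"
  note t = graph_targets_below[OF G r]
  have int: "integrable (cspace {1..n}) ?K"
    using integrable_kern_prod[OF _ t[of 1] t[of 2], of "\<lambda>_ _. 1"] by simp
  have "ennreal \<bar>integral\<^sup>L (cspace {1..n}) ?K\<bar> \<le> (\<integral>\<^sup>+z. ennreal (norm (?K z)) \<partial>cspace {1..n})"
    using integral_norm_bound_ennreal[OF int] by simp
  also have "\<dots> = (\<integral>\<^sup>+z. (\<Prod>k\<in>{1..n}. ennreal \<bar>kern (position z (\<Gamma> (k, 1))) (position z (\<Gamma> (k, 2))) (z k)\<bar>) \<partial>cspace {1..n})"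
    by (simp add: prod_ennreal abs_prod)
  also have "\<dots> \<le> ennreal (4 * pi\<^sup>2) ^ card {1..n}"
    by (intro nn_integral_kern_prod[where \<rho> = \<rho>] t) auto
  also have "\<dots> = ennreal ((2 * pi) ^ (2 * n))"
    by (simp add: ennreal_power power_mult power_mult_distrib)
  finally have "\<bar>integral\<^sup>L (cspace {1..n}) ?K\<bar> \<le> (2 * pi) ^ (2 * n)"
    by (simp add: ennreal_le_iff)
  then show ?thesis unfolding weight_eq[OF G r] by (simp add: abs_divide)
qed

section \<open>Exchange of the two ground vertices\<close>

text \<open>The reflection \<open>z \<mapsto> 1 - cnj z\<close> exchanges the two ground points.\<close>

lemma kern_reflect: "kern (1 - cnj a) (1 - cnj b) (1 - cnj z) = - kern a b z"
proof -
  have d: "dlog (1 - cnj w) (1 - cnj z) = - cnj (dlog w z)" for w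
  proof -
    have "1 - cnj z - (1 - cnj w) = - cnj (z - w)" "1 - cnj z - cnj (1 - cnj w) = - cnj (z - cnj w)" by simp_all
    then show ?thesis unfolding dlog_def by (simp del: complex_cnj_diff)
  qed
  show ?thesis unfolding kern_def d by (simp add: indicator_def)
qed

lemma distr_lborel_reflect: "distr lborel borel (\<lambda>z. 1 - cnj z) = (lborel :: complex measure)"
proof -
  have m: "(\<lambda>z::complex. 1 - cnj z) \<in> borel_measurable borel" by measurable
  have "lborel = distr lborel borel (\<lambda>z::complex. 1 - cnj z)"
  proof (rule lborel_eqI)
    fix l u :: complex
    assume le: "\<And>b. b \<in> Basis \<Longrightarrow> l \<bullet> b \<le> u \<bullet> b"
    define l' where "l' = Complex (1 - Re u) (Im l)"
    define u' where "u' = Complex (1 - Re l) (Im u)"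
    have "(\<lambda>z. 1 - cnj z) -` box l u = box l' u'"
      by (auto simp: box_def Basis_complex_def l'_def u'_def inner_complex_def)
    then have "emeasure (distr lborel borel (\<lambda>z. 1 - cnj z)) (box l u) = emeasure lborel (box l' u')"
      using m by (subst emeasure_distr) auto
    also have "\<dots> = (\<Prod>b\<in>Basis. (u' - l') \<bullet> b)"
      using le[of 1] le[of \<i>]
      by (intro emeasure_lborel_box) (auto simp: Basis_complex_def l'_def u'_def inner_complex_def)
    also have "\<dots> = (\<Prod>b\<in>Basis. (u - l) \<bullet> b)"
      by (simp add: Basis_complex_def l'_def u'_def inner_complex_def)
    finally show "emeasure (distr lborel borel (\<lambda>z. 1 - cnj z)) (box l u) = (\<Prod>b\<in>Basis. (u - l) \<bullet> b)" .
  qed simp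
  then show ?thesis ..
qed

lemma distr_cspace_reflect:
  assumes "finite S"
  shows "distr (cspace S) (cspace S) (\<lambda>z. \<lambda>i\<in>S. 1 - cnj (z i)) = cspace S" (is "distr _ _ ?T = _")
proof (rule lborel_product.PiM_eqI[OF assms])
  have mT: "?T \<in> measurable (cspace S) (cspace S)"
    using measurable_cspace_component by (intro measurable_restrict) auto
  show "sets (distr (cspace S) (cspace S) ?T) = sets (cspace S)" by simp
  fix A :: "nat \<Rightarrow> complex set" assume A: "\<And>i. i \<in> S \<Longrightarrow> A i \<in> sets lborel"
  define B where "B i = (\<lambda>z. 1 - cnj z) -` A i" for i
  have m: "(\<lambda>z::complex. 1 - cnj z) \<in> borel_measurable borel" by measurable
  have B: "B i \<in> sets lborel" "emeasure lborel (B i) = emeasure lborel (A i)" if "i \<in> S" for i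
  proof -
    show "B i \<in> sets lborel" using measurable_sets[OF m, of "A i"] A[OF that] by (simp add: B_def)
    have "emeasure lborel (A i) = emeasure (distr lborel borel (\<lambda>z. 1 - cnj z)) (A i)" by (simp add: distr_lborel_reflect)
    also have "\<dots> = emeasure lborel (B i)" using m A[OF that] by (subst emeasure_distr) (auto simp: B_def)
    finally show "emeasure lborel (B i) = emeasure lborel (A i)" ..
  qed
  have "?T -` Pi\<^sub>E S A \<inter> space (cspace S) = Pi\<^sub>E S B"
    by (auto simp: B_def space_PiM PiE_iff)
  then have "emeasure (distr (cspace S) (cspace S) ?T) (Pi\<^sub>E S A) = emeasure (cspace S) (Pi\<^sub>E S B)"
    using mT A assms by (subst emeasure_distr) (auto intro!: sets_PiM_I_finite)
  also have "\<dots> = (\<Prod>i\<in>S. emeasure lborel (B i))" using B assms by (intro lborel_product.emeasure_PiM) auto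
  also have "\<dots> = (\<Prod>i\<in>S. emeasure lborel (A i))" using B by simp
  finally show "emeasure (distr (cspace S) (cspace S) ?T) (Pi\<^sub>E S A) = (\<Prod>i\<in>S. emeasure lborel (A i))" .
qed

fun swap_ground :: "kvertex \<Rightarrow> kvertex" where
  "swap_ground Ground1 = Ground2"
| "swap_ground Ground2 = Ground1"
| "swap_ground (Aerial k) = Aerial k"

lemma swap_ground_swap [simp]: "swap_ground (swap_ground v) = v"
  by (cases v) auto

lemma swap_ground_Aerial [simp]: "swap_ground v = Aerial k \<longleftrightarrow> v = Aerial k"
  by (cases v) auto

lemma swap_ground_eq [simp]: "swap_ground v = Ground1 \<longleftrightarrow> v = Ground2" "swap_ground v = Ground2 \<longleftrightarrow> v = Ground1"
  "swap_ground v = swap_ground w \<longleftrightarrow> v = w"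
  by (cases v; cases w; auto)+

definition swap_graph :: "nat \<Rightarrow> (nat \<times> nat \<Rightarrow> kvertex) \<Rightarrow> nat \<times> nat \<Rightarrow> kvertex" where
  "swap_graph n \<Gamma> = restrict (swap_ground \<circ> \<Gamma>) (kedges n)"

lemma swap_graph_edge: "e \<in> kedges n \<Longrightarrow> swap_graph n \<Gamma> e = swap_ground (\<Gamma> e)"
  by (simp add: swap_graph_def)

lemma kedges_pair: "k \<in> {1..n} \<Longrightarrow> a \<in> {1, 2} \<Longrightarrow> (k, a) \<in> kedges n"
  by (auto simp: kedges_def)

lemma swap_graph_kgraphs:
  assumes "\<Gamma> \<in> kgraphs n"
  shows "swap_graph n \<Gamma> \<in> kgraphs n"
proof -
  have "swap_ground v \<in> Aerial ` {1..n} \<union> {Ground1, Ground2}" if "v \<in> Aerial ` {1..n} \<union> {Ground1, Ground2}" for v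
    using that by (cases v) auto
  then have "swap_graph n \<Gamma> \<in> kedges n \<rightarrow>\<^sub>E (Aerial ` {1..n} \<union> {Ground1, Ground2})"
    using assms unfolding swap_graph_def kgraphs_def by (intro restrict_PiE_iff[THEN iffD2] ballI) (simp add: PiE_iff)
  moreover have "swap_graph n \<Gamma> (k, a) = swap_ground (\<Gamma> (k, a))" if "k \<in> {1..n}" "a \<in> {1, 2}" for k a
    using that by (intro swap_graph_edge kedges_pair)
  ultimately show ?thesis using assms unfolding kgraphs_def by simp
qed

lemma swap_graph_swap:
  assumes "\<Gamma> \<in> kgraphs n"
  shows "swap_graph n (swap_graph n \<Gamma>) = \<Gamma>"
proof -
  have "\<Gamma> \<in> extensional (kedges n)" using assms by (auto simp: kgraphs_def PiE_def)
  then show ?thesis by (auto simp: swap_graph_def fun_eq_iff extensional_def)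
qed

lemma joins_swap: "e \<in> kedges n \<Longrightarrow> joins (swap_graph n \<Gamma>) e u v \<longleftrightarrow> joins \<Gamma> e u v"
  by (simp add: joins_def swap_graph_edge)

lemma swap_graph_ktrees:
  assumes "\<Gamma> \<in> ktrees n"
  shows "swap_graph n \<Gamma> \<in> ktrees n"
proof -
  have "aerial_cycle n (swap_graph n \<Gamma>) vs es \<longleftrightarrow> aerial_cycle n \<Gamma> vs es" for vs es
    unfolding aerial_cycle_def by (metis joins_swap nth_mem subsetD)
  moreover have "{(a, b). \<exists>e\<in>kedges n. joins (swap_graph n \<Gamma>) e a b} = {(a, b). \<exists>e\<in>kedges n. joins \<Gamma> e a b}"
    using joins_swap by blast
  ultimately show ?thesis using assms swap_graph_kgraphs by (simp add: ktrees_def aerial_connected_def)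
qed

text \<open>The reflection preserves Lebesgue measure, and \<open>kern_reflect\<close> contributes
  one sign per aerial vertex.\<close>

lemma weight_swap:
  assumes G: "\<Gamma> \<in> kgraphs n" and r: "graph_rank n \<Gamma> \<rho>"
  shows "weight n (swap_graph n \<Gamma>) = (-1) ^ n * weight n \<Gamma>"
proof -
  have e: "swap_graph n \<Gamma> (k, a) = swap_ground (\<Gamma> (k, a))" if "k \<in> {1..n}" "a \<in> {1, 2}" for k a
    using that by (intro swap_graph_edge kedges_pair)
  have r': "graph_rank n (swap_graph n \<Gamma>) \<rho>"
    using r e unfolding graph_rank_def by simp
  let ?K = "\<lambda>\<Gamma> z. \<Prod>k\<in>{1..n}. kern (position z (\<Gamma> (k, 1))) (position z (\<Gamma> (k, 2))) (z k)"
  let ?T = "\<lambda>z. \<lambda>i\<in>{1..n}. 1 - cnj (z i) :: complex"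
  note t = graph_targets_below[OF G r] and t' = graph_targets_below[OF swap_graph_kgraphs[OF G] r']
  have int: "integrable (cspace {1..n}) (?K (swap_graph n \<Gamma>))"
    using integrable_kern_prod[OF _ t'[of 1] t'[of 2], of "\<lambda>_ _. 1"] by simp
  have pos: "position (?T z) (swap_ground v) = 1 - cnj (position z v)" if "v \<in> Aerial ` {1..n} \<union> {Ground1, Ground2}" for z v
    using that by (cases v) (auto simp: position_def)
  have mT: "?T \<in> measurable (cspace {1..n}) (cspace {1..n})"
    using measurable_cspace_component by (intro measurable_restrict) auto
  have "(\<integral>z. ?K (swap_graph n \<Gamma>) z \<partial>cspace {1..n}) = (\<integral>z. ?K (swap_graph n \<Gamma>) z \<partial>distr (cspace {1..n}) (cspace {1..n}) ?T)"
    by (subst distr_cspace_reflect) auto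
  also have "\<dots> = (\<integral>z. ?K (swap_graph n \<Gamma>) (?T z) \<partial>cspace {1..n})"
    using int by (intro integral_distr mT) auto
  also have "\<dots> = (\<integral>z. (-1) ^ n * ?K \<Gamma> z \<partial>cspace {1..n})"
  proof (rule Bochner_Integration.integral_cong[OF refl])
    fix z
    have "?K (swap_graph n \<Gamma>) (?T z) = (\<Prod>k\<in>{1..n}. - kern (position z (\<Gamma> (k, 1))) (position z (\<Gamma> (k, 2))) (z k))"
    proof (intro prod.cong refl)
      fix k assume k: "k \<in> {1..n}"
      have "\<Gamma> (k, 1) \<in> Aerial ` {1..n} \<union> {Ground1, Ground2}" "\<Gamma> (k, 2) \<in> Aerial ` {1..n} \<union> {Ground1, Ground2}"
        using t[of 1] t[of 2] k by (auto simp: targets_below_def)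
      from this[THEN pos] have "position (?T z) (swap_graph n \<Gamma> (k, 1)) = 1 - cnj (position z (\<Gamma> (k, 1)))"
        "position (?T z) (swap_graph n \<Gamma> (k, 2)) = 1 - cnj (position z (\<Gamma> (k, 2)))"
        by (simp_all only: e[OF k] insertI1 insertI2)
      moreover have "?T z k = 1 - cnj (z k)" using k by simp
      ultimately show "kern (position (?T z) (swap_graph n \<Gamma> (k, 1))) (position (?T z) (swap_graph n \<Gamma> (k, 2))) (?T z k) =
        - kern (position z (\<Gamma> (k, 1))) (position z (\<Gamma> (k, 2))) (z k)"
        by (simp only: kern_reflect)
    qed
    also have "\<dots> = (-1) ^ n * ?K \<Gamma> z"
      using prod.distrib[of "\<lambda>_. -1" "\<lambda>k. kern (position z (\<Gamma> (k, 1))) (position z (\<Gamma> (k, 2))) (z k)" "{1..n}"] by simp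
    finally show "?K (swap_graph n \<Gamma>) (?T z) = (-1) ^ n * ?K \<Gamma> z" .
  qed
  finally show ?thesis unfolding weight_eq[OF G r] weight_eq[OF swap_graph_kgraphs[OF G] r'] by simp
qed

section \<open>Counting Kontsevich trees\<close>

text \<open>A dart is a vertex with an edge by which it is left. If each dart can be continued by
  one with a different edge, there is an infinite walk without backtracking in a finite set, and its
  shortest return closes a cycle.\<close>

lemma dart_cycle:
  assumes fin: "finite D" and ne: "D \<noteq> {}" and ed: "snd ` D \<subseteq> kedges n"
    and step: "\<And>d. d \<in> D \<Longrightarrow> \<exists>d'\<in>D. joins \<Gamma> (snd d) (fst d) (fst d') \<and> snd d' \<noteq> snd d"
  shows "\<exists>vs es. aerial_cycle n \<Gamma> vs es"
proof -
  obtain h where h: "\<And>d. d \<in> D \<Longrightarrow> h d \<in> D \<and> joins \<Gamma> (snd d) (fst d) (fst (h d)) \<and> snd (h d) \<noteq> snd d"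
    using step by metis
  obtain d0 where d0: "d0 \<in> D" using ne by auto
  define d where "d i = (h ^^ i) d0" for i
  have dD: "d i \<in> D" for i by (induction i) (auto simp: d_def d0 h)
  define v where "v i = fst (d i)" for i
  define e where "e i = snd (d i)" for i
  have ds: "d (Suc i) = h (d i)" for i by (simp add: d_def)
  have j: "joins \<Gamma> (e i) (v i) (v (Suc i))" and nb: "e (Suc i) \<noteq> e i" for i
    using h[OF dD[of i]] by (simp_all add: v_def e_def ds)
  have eK: "e i \<in> kedges n" for i using ed dD by (auto simp: e_def)
  have "\<exists>L>0. \<exists>i. v i = v (i + L)"
  proof -
    have "finite (range v)" using fin dD by (intro finite_subset[of "range v" "fst ` D"]) (auto simp: v_def)
    then have "\<not> inj v" using finite_imageD infinite_UNIV_nat by blast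
    then obtain a b where "a \<noteq> b" "v a = v b" by (auto simp: inj_def)
    then have "\<exists>a b. a < b \<and> v a = v b" by (metis linorder_neqE_nat)
    then obtain a b where "a < b" "v a = v b" by blast
    then show ?thesis by (intro exI[of _ "b - a"]) (auto intro!: exI[of _ a])
  qed
  \<comment> \<open>The least gap between two visits of one vertex: it makes the vertices of the
    closed piece distinct.\<close>
  define L where "L = (LEAST L. L > 0 \<and> (\<exists>i. v i = v (i + L)))"
  have L: "L > 0 \<and> (\<exists>i. v i = v (i + L))"
    unfolding L_def by (rule LeastI_ex) (use \<open>\<exists>L>0. _\<close> in blast)
  have Lmin: "v a \<noteq> v b" if "a < b" "b < a + L" for a b
  proof
    assume eq: "v a = v b"
    have "b - a > 0 \<and> (\<exists>i. v i = v (i + (b - a)))" using that eq by (auto intro!: exI[of _ a])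
    then have "L \<le> b - a" unfolding L_def by (rule Least_le)
    then show False using that by simp
  qed
  obtain i where i: "v i = v (i + L)" using L by blast
  define vs where "vs = map v [i..<i + L]"
  define es where "es = map e [i..<i + L]"
  have "inj_on v {i..<i + L}"
  proof (rule linorder_inj_onI)
    fix a b assume "a < b" "a \<in> {i..<i + L}" "b \<in> {i..<i + L}"
    then show "v a \<noteq> v b" by (intro Lmin) auto
  qed auto
  then have dv: "distinct vs" by (simp add: vs_def distinct_map)
  have "inj_on e {i..<i + L}"
  proof (rule linorder_inj_onI)
    fix a b assume ab: "a < b" "a \<in> {i..<i + L}" "b \<in> {i..<i + L}"
    \<comment> \<open>Equal edges left from distinct vertices are traversed in opposite directions,
      so the second starts where the first ends; minimality of \<open>L\<close> then makes them
      consecutive, which is backtracking.\<close>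
    show "e a \<noteq> e b"
    proof
      assume eq: "e a = e b"
      have "v a \<noteq> v b" using ab by (intro Lmin) auto
      moreover have "joins \<Gamma> (e a) (v b) (v (Suc b))" using j[of b] eq by simp
      ultimately have *: "v (Suc a) = v b" using j[of a] by (auto simp: joins_def)
      have "Suc a = b"
      proof (rule ccontr)
        assume "Suc a \<noteq> b"
        then have "v (Suc a) \<noteq> v b" using ab by (intro Lmin) auto
        then show False using * by simp
      qed
      then show False using nb[of a] eq by simp
    qed
  qed auto
  then have de: "distinct es" by (simp add: es_def distinct_map)
  have "joins \<Gamma> (es ! k) (vs ! k) (vs ! (Suc k mod length vs))" if "k < length vs" for k
  proof -
    have k: "k < L" using that by (simp add: vs_def)
    have "vs ! (Suc k mod length vs) = v (Suc (i + k))"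
    proof (cases "Suc k = L")
      case True
      then have "vs ! (Suc k mod length vs) = v i" using L by (simp add: vs_def)
      moreover have "Suc (i + k) = i + L" using True by simp
      ultimately show ?thesis by (simp only: i)
    next
      case False
      then show ?thesis using k by (simp add: vs_def)
    qed
    then show ?thesis using j[of "i + k"] k by (simp add: vs_def es_def)
  qed
  then have "aerial_cycle n \<Gamma> vs es"
    using dv de L eK by (auto simp: aerial_cycle_def vs_def es_def)
  then show ?thesis by blast
qed

lemma kgraphs_target:
  assumes "\<Gamma> \<in> kgraphs n" "e \<in> kedges n" "\<Gamma> e = Aerial j"
  shows "j \<in> {1..n}" "j \<noteq> fst e"
proof -
  have "\<Gamma> e \<in> Aerial ` {1..n} \<union> {Ground1, Ground2}" using assms(1,2) by (auto simp: kgraphs_def)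
  then show "j \<in> {1..n}" using assms(3) by auto
  have "snd e = 1 \<or> snd e = 2" "fst e \<in> {1..n}" using assms(2) by (auto simp: kedges_def)
  then have "\<Gamma> e \<noteq> Aerial (fst e)" using assms(1) by (cases e) (auto simp: kgraphs_def)
  then show "j \<noteq> fst e" using assms(3) by auto
qed

text \<open>A directed cycle is also an undirected one, two opposite edges included. Once directed
  cycles are excluded, the number of vertices reachable from a vertex is a rank.\<close>

lemma ktree_rank:
  assumes G: "\<Gamma> \<in> kgraphs n" and nc: "\<not> (\<exists>vs es. aerial_cycle n \<Gamma> vs es)"
  shows "\<exists>\<rho>. graph_rank n \<Gamma> \<rho>"
proof -
  define R where "R = {(k, j). \<exists>a. (k, a) \<in> kedges n \<and> \<Gamma> (k, a) = Aerial j}"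
  have Rsub: "R \<subseteq> {1..n} \<times> {1..n}"
  proof
    fix p assume "p \<in> R"
    then obtain k a j where p: "p = (k, j)" "(k, a) \<in> kedges n" "\<Gamma> (k, a) = Aerial j" by (auto simp: R_def)
    then show "p \<in> {1..n} \<times> {1..n}" using kgraphs_target(1)[OF G p(2,3)] by (auto simp: kedges_def)
  qed
  have finR: "finite R" using Rsub by (rule finite_subset) simp
  have irr: "k \<noteq> j" if "(k, j) \<in> R" for k j using that kgraphs_target(2)[OF G, of "(k, _)" j] by (auto simp: R_def)
  have "acyclic R"
  proof (rule ccontr)
    assume "\<not> acyclic R"
    then obtain x where "(x, x) \<in> R\<^sup>+" by (auto simp: acyclic_def)
    then obtain y where y: "(x, y) \<in> R" "(y, x) \<in> R\<^sup>*" by (meson tranclD)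
    define D where "D = {(k, k, a) | k a. \<exists>j. (k, a) \<in> kedges n \<and> \<Gamma> (k, a) = Aerial j \<and> (j, k) \<in> R\<^sup>*}"
    have "D \<subseteq> {1..n} \<times> kedges n" by (auto simp: D_def kedges_def)
    then have finD: "finite D" by (rule finite_subset) (simp add: kedges_def)
    have neD: "D \<noteq> {}" using y by (auto simp: D_def R_def)
    have "\<exists>vs es. aerial_cycle n \<Gamma> vs es"
    proof (rule dart_cycle[OF finD neD])
      show "snd ` D \<subseteq> kedges n" by (auto simp: D_def)
      fix d assume "d \<in> D"
      then obtain k a j where d: "d = (k, k, a)" "(k, a) \<in> kedges n" "\<Gamma> (k, a) = Aerial j" "(j, k) \<in> R\<^sup>*"
        by (auto simp: D_def)
      have kj: "(k, j) \<in> R" using d by (auto simp: R_def)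
      then have "j \<noteq> k" using irr by auto
      then obtain j' where j': "(j, j') \<in> R" "(j', k) \<in> R\<^sup>*" using d(4) by (meson converse_rtranclE)
      then obtain a' where a': "(j, a') \<in> kedges n" "\<Gamma> (j, a') = Aerial j'" by (auto simp: R_def)
      have "(j', j) \<in> R\<^sup>*" using j'(2) kj by simp
      then have "(j, j, a') \<in> D" using a' by (auto simp: D_def)
      then show "\<exists>d'\<in>D. joins \<Gamma> (snd d) (fst d) (fst d') \<and> snd d' \<noteq> snd d"
        using d \<open>j \<noteq> k\<close> by (intro bexI[of _ "(j, j, a')"]) (auto simp: joins_def)
    qed
    then show False using nc by blast
  qed
  define \<rho> where "\<rho> k = card {j. (k, j) \<in> R\<^sup>+}" for k
  have "\<rho> j < \<rho> k" if "(k, j) \<in> R" for k j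
    unfolding \<rho>_def
  proof (rule psubset_card_mono)
    have "{i. (k, i) \<in> R\<^sup>+} \<subseteq> snd ` (R\<^sup>+)" by force
    then show "finite {i. (k, i) \<in> R\<^sup>+}" using finR by (simp add: finite_subset)
    have "{i. (j, i) \<in> R\<^sup>+} \<subseteq> {i. (k, i) \<in> R\<^sup>+}" using that by (auto intro: trancl_into_trancl2)
    moreover have "j \<in> {i. (k, i) \<in> R\<^sup>+}" using that by auto
    moreover have "j \<notin> {i. (j, i) \<in> R\<^sup>+}" using \<open>acyclic R\<close> by (auto simp: acyclic_def)
    ultimately show "{i. (j, i) \<in> R\<^sup>+} \<subset> {i. (k, i) \<in> R\<^sup>+}" by blast
  qed
  moreover have "(k, j) \<in> R" if "k \<in> {1..n}" "a \<in> {1, 2}" "\<Gamma> (k, a) = Aerial j" for k a j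
    using that kedges_pair[of k n a] unfolding R_def by blast
  ultimately have "graph_rank n \<Gamma> \<rho>" unfolding graph_rank_def by blast
  then show ?thesis by blast
qed

lemma finite_kedges: "finite (kedges n)" and card_kedges: "card (kedges n) = 2 * n"
  by (simp_all add: kedges_def card_cartesian_product)

text \<open>A vertex with at most one incident edge can be deleted without spoiling the inequality.
  If there is none, every dart can be continued and \<open>dart_cycle\<close> applies.\<close>

lemma many_edges_cycle:
  assumes G: "\<Gamma> \<in> kgraphs n"
  shows "V \<subseteq> {1..n} \<Longrightarrow> V \<noteq> {} \<Longrightarrow> card V \<le> card {e \<in> kedges n. fst e \<in> V \<and> \<Gamma> e \<in> Aerial ` V} \<Longrightarrow>
    \<exists>vs es. aerial_cycle n \<Gamma> vs es"
proof (induction "card V" arbitrary: V rule: less_induct)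
  case less
  define E where "E V = {e \<in> kedges n. fst e \<in> V \<and> \<Gamma> e \<in> Aerial ` V}" for V
  define inc where "inc v = {e \<in> E V. fst e = v \<or> \<Gamma> e = Aerial v}" for v
  have finV: "finite V" using less.prems(1) finite_subset by blast
  have finE: "finite (E V)" for V using finite_kedges by (simp add: E_def)
  have le: "card V \<le> card (E V)" using less.prems(3) by (simp add: E_def)
  show ?case
  proof (cases "\<exists>v\<in>V. card (inc v) \<le> 1")
    case True
    then obtain v where v: "v \<in> V" "card (inc v) \<le> 1" by blast
    have e: "E (V - {v}) = E V - inc v"
    proof -
      have "e \<in> E (V - {v}) \<longleftrightarrow> e \<in> E V - inc v" for e
        using v(1) by (auto simp: E_def inc_def)
      then show ?thesis by blast
    qed
    have cV: "card (V - {v}) = card V - 1" using v finV by simp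
    have "card (E (V - {v})) = card (E V) - card (inc v)"
      unfolding e using finE by (intro card_Diff_subset) (auto simp: inc_def)
    then have le': "card (V - {v}) \<le> card (E (V - {v}))" using le v(2) cV by simp
    have "V - {v} \<noteq> {}"
    proof
      assume "V - {v} = {}"
      then have V: "V = {v}" using v by auto
      have "E V = {}"
      proof -
        have False if "e \<in> E V" for e
          using that kgraphs_target(2)[OF G, of e v] V by (auto simp: E_def)
        then show ?thesis by blast
      qed
      then show False using le V by simp
    qed
    moreover have "card (V - {v}) < card V" using v finV by (meson card_Diff1_less)
    ultimately show ?thesis
      using less.hyps[of "V - {v}"] less.prems(1) le' by (auto simp: E_def)
  next
    case False
    define D where "D = {(v, e). v \<in> V \<and> e \<in> inc v}"
    have "D \<subseteq> V \<times> kedges n" by (auto simp: D_def inc_def E_def)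
    then have finD: "finite D" by (rule finite_subset) (simp add: finV finite_kedges)
    have two: "\<exists>e'\<in>inc v. e' \<noteq> e" if "v \<in> V" for v e
    proof (rule ccontr)
      assume "\<not> ?thesis"
      then have "inc v \<subseteq> {e}" by auto
      then have "card (inc v) \<le> card {e}" by (intro card_mono) auto
      then show False using False that by auto
    qed
    obtain v0 where "v0 \<in> V" using less.prems(2) by blast
    then have neD: "D \<noteq> {}" using two[of v0] by (auto simp: D_def)
    show ?thesis
    proof (rule dart_cycle[OF finD neD])
      show "snd ` D \<subseteq> kedges n" by (auto simp: D_def inc_def E_def)
      fix d assume "d \<in> D"
      then obtain v e where d: "d = (v, e)" "v \<in> V" "e \<in> inc v" by (auto simp: D_def)
      have "\<exists>w\<in>V. joins \<Gamma> e v w \<and> e \<in> inc w"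
      proof -
        have "e \<in> E V" "fst e = v \<or> \<Gamma> e = Aerial v" using d by (auto simp: inc_def)
        show ?thesis
        proof (cases "fst e = v")
          case True
          obtain w where "w \<in> V" "\<Gamma> e = Aerial w" using \<open>e \<in> E V\<close> by (auto simp: E_def)
          then show ?thesis using True \<open>e \<in> E V\<close> by (intro bexI[of _ w]) (simp_all add: joins_def inc_def)
        next
          case False
          then show ?thesis using \<open>e \<in> E V\<close> \<open>fst e = v \<or> _\<close> by (intro bexI[of _ "fst e"]) (auto simp: joins_def inc_def E_def)
        qed
      qed
      then obtain w where w: "w \<in> V" "joins \<Gamma> e v w" by blast
      obtain e' where "e' \<in> inc w" "e' \<noteq> e" using two[OF w(1)] by blast
      then show "\<exists>d'\<in>D. joins \<Gamma> (snd d) (fst d) (fst d') \<and> snd d' \<noteq> snd d"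
        using w d by (intro bexI[of _ "(w, e')"]) (auto simp: D_def)
    qed
  qed
qed

lemma ktree_aerial_edges:
  assumes "\<Gamma> \<in> ktrees n" "1 \<le> n"
  shows "card {e \<in> kedges n. \<exists>j. \<Gamma> e = Aerial j} < n"
proof (rule ccontr)
  have G: "\<Gamma> \<in> kgraphs n" using assms by (simp add: ktrees_def)
  assume "\<not> ?thesis"
  moreover have "{e \<in> kedges n. \<exists>j. \<Gamma> e = Aerial j} = {e \<in> kedges n. fst e \<in> {1..n} \<and> \<Gamma> e \<in> Aerial ` {1..n}}"
  proof -
    have "fst e \<in> {1..n}" if "e \<in> kedges n" for e using that by (auto simp: kedges_def)
    then show ?thesis using kgraphs_target(1)[OF G] by blast
  qed
  ultimately have "card {1..n} \<le> card {e \<in> kedges n. fst e \<in> {1..n} \<and> \<Gamma> e \<in> Aerial ` {1..n}}"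
    by simp
  then have "\<exists>vs es. aerial_cycle n \<Gamma> vs es" using assms(2) by (intro many_edges_cycle[OF G, of "{1..n}"]) auto
  then show False using assms(1) by (simp add: ktrees_def)
qed

lemma ktree_rank': "\<Gamma> \<in> ktrees n \<Longrightarrow> \<exists>\<rho>. graph_rank n \<Gamma> \<rho>"
  using ktree_rank by (auto simp: ktrees_def)

text \<open>The two edges of a vertex end at different points, so at most one of them ends at
  \<open>Ground1\<close>.\<close>

lemma ground_card_le:
  assumes "\<Gamma> \<in> kgraphs n"
  shows "card (edges_to n \<Gamma> Ground1) \<le> n" "inj_on fst (edges_to n \<Gamma> Ground1)"
proof -
  have ne: "\<Gamma> (k, 1) \<noteq> \<Gamma> (k, 2)" if "k \<in> {1..n}" for k using assms that by (auto simp: kgraphs_def)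
  have "a = b" if "(k, a) \<in> kedges n" "(k, b) \<in> kedges n" "\<Gamma> (k, a) = Ground1" "\<Gamma> (k, b) = Ground1" for k a b
  proof -
    have "a = 1 \<or> a = 2" "b = 1 \<or> b = 2" "k \<in> {1..n}" using that by (auto simp: kedges_def)
    then show ?thesis using ne[of k] that by auto
  qed
  then show inj: "inj_on fst (edges_to n \<Gamma> Ground1)"
    by (auto simp: inj_on_def)
  have "card (fst ` (edges_to n \<Gamma> Ground1)) \<le> card {1..n}"
    by (intro card_mono) (auto simp: kedges_def)
  then show "card (edges_to n \<Gamma> Ground1) \<le> n" using card_image[OF inj] by simp
qed

lemma edge_counts:
  "card {e \<in> kedges n. \<exists>j. \<Gamma> e = Aerial j} + card (edges_to n \<Gamma> Ground1) + card (edges_to n \<Gamma> Ground2) = 2 * n"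
proof -
  let ?A = "{e \<in> kedges n. \<exists>j. \<Gamma> e = Aerial j}" and ?B = "(edges_to n \<Gamma> Ground1)" and ?C = "(edges_to n \<Gamma> Ground2)"
  have "kedges n = ?A \<union> ?B \<union> ?C"
  proof -
    have "(\<exists>j. v = Aerial j) \<or> v = Ground1 \<or> v = Ground2" for v by (cases v) auto
    then show ?thesis by blast
  qed
  then have "2 * n = card (?A \<union> ?B \<union> ?C)" by (simp add: card_kedges[symmetric])
  also have "\<dots> = card (?A \<union> ?B) + card ?C" using finite_kedges by (intro card_Un_disjoint) auto
  also have "card (?A \<union> ?B) = card ?A + card ?B" using finite_kedges by (intro card_Un_disjoint) auto
  finally show ?thesis by simp
qed

text \<open>At most 4^n choices for the set of aerial edges, n^n for their end points and 4^n for
  the ground ends of the others. That there are at most n aerial edges keeps the growth at n^n,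
  which the n! of the generating function can absorb.\<close>

lemma card_ktrees:
  assumes "1 \<le> n"
  shows "card (ktrees n) \<le> 16 ^ n * n ^ n"
proof -
  define T where "T A = (\<Pi>\<^sub>E e\<in>kedges n. if e \<in> A then Aerial ` {1..n} else {Ground1, Ground2})" for A
  let ?P = "{A. A \<subseteq> kedges n \<and> card A \<le> n}"
  have finP: "finite ?P" using finite_kedges by (intro finite_subset[of ?P "Pow (kedges n)"]) auto
  have finT: "finite (T A)" for A unfolding T_def using finite_kedges by (intro finite_PiE) auto
  have "ktrees n \<subseteq> (\<Union>A\<in>?P. T A)"
  proof
    fix \<Gamma> assume G: "\<Gamma> \<in> ktrees n"
    let ?A = "{e \<in> kedges n. \<exists>j. \<Gamma> e = Aerial j}"
    have "\<Gamma> \<in> kedges n \<rightarrow>\<^sub>E (Aerial ` {1..n} \<union> {Ground1, Ground2})" using G by (simp add: ktrees_def kgraphs_def)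
    then have "\<Gamma> \<in> T ?A" by (fastforce simp: T_def PiE_iff)
    moreover have "?A \<in> ?P" using ktree_aerial_edges[OF G assms] by auto
    ultimately show "\<Gamma> \<in> (\<Union>A\<in>?P. T A)" by blast
  qed
  then have "card (ktrees n) \<le> card (\<Union>A\<in>?P. T A)" using finP finT by (intro card_mono) auto
  also have "\<dots> \<le> (\<Sum>A\<in>?P. card (T A))" by (rule card_UN_le[OF finP])
  also have "\<dots> \<le> (\<Sum>A\<in>?P. n ^ n * 4 ^ n)"
  proof (rule sum_mono)
    fix A assume A: "A \<in> ?P"
    have finA: "finite A" using A finite_kedges finite_subset by blast
    have "card (T A) = (\<Prod>e\<in>kedges n. if e \<in> A then n else 2)"
      unfolding T_def by (subst card_PiE[OF finite_kedges]) (auto intro!: prod.cong simp: card_image inj_on_def)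
    also have "\<dots> = (\<Prod>e\<in>A. n) * (\<Prod>e\<in>kedges n - A. 2)"
      using A finite_kedges by (subst prod.If_cases) (auto simp: Int_absorb1 Diff_eq)
    also have "\<dots> \<le> n ^ n * 2 ^ (2 * n)"
    proof (rule mult_mono)
      show "(\<Prod>e\<in>A. n) \<le> n ^ n" using A assms by (simp add: power_increasing)
      have "card (kedges n - A) \<le> 2 * n" using card_mono[of "kedges n" "kedges n - A"] finite_kedges card_kedges by auto
      then show "(\<Prod>e\<in>kedges n - A. 2::nat) \<le> 2 ^ (2 * n)" by (simp add: power_increasing)
    qed auto
    finally show "card (T A) \<le> n ^ n * 4 ^ n" by (simp add: power_mult)
  qed
  also have "\<dots> = card ?P * (n ^ n * 4 ^ n)" by simp
  also have "card ?P \<le> card (Pow (kedges n))" using finite_kedges by (intro card_mono) auto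
  also have "card (Pow (kedges n)) = 4 ^ n" by (simp add: card_Pow finite_kedges card_kedges power_mult)
  finally have "card (ktrees n) \<le> 4 ^ n * (n ^ n * 4 ^ n)" by simp
  moreover have "(4::nat) ^ n * 4 ^ n = 16 ^ n" by (simp add: power_mult_distrib[symmetric])
  ultimately show ?thesis by (simp add: mult_ac)
qed

text \<open>n^n / n! is one term of the series of exp n, and exp 1 \<le> 3.\<close>

lemma power_self_le_fact: "real n ^ n \<le> 3 ^ n * fact n"
proof -
  have "real n ^ n / fact n \<le> (\<Sum>k\<le>n. real n ^ k / fact k)"
    by (rule member_le_sum) auto
  also have "\<dots> \<le> exp (real n)"
  proof -
    have "(\<Sum>k\<le>n. real n ^ k /\<^sub>R fact k) \<le> (\<Sum>k. real n ^ k /\<^sub>R fact k)"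
      by (rule sum_le_suminf[OF summable_exp_generic]) auto
    then show ?thesis by (simp add: exp_def divide_inverse mult.commute)
  qed
  also have "\<dots> = exp 1 ^ n" by (simp add: exp_of_nat_mult[symmetric])
  also have "\<dots> \<le> 3 ^ n" using exp_le by (intro power_mono) auto
  finally show ?thesis by (simp add: field_simps)
qed

section \<open>Trees with one edge to the second ground vertex\<close>

text \<open>\<open>b k\<close> tells which of the two edges of \<open>k\<close> leads to its parent,
  or to \<open>Ground2\<close> if \<open>k\<close> is the root; the other edge ends at
  \<open>Ground1\<close> and receives the index \<open>h k\<close> in
  \<open>src_index\<close>.\<close>

definition src_graph :: "nat \<Rightarrow> (nat \<Rightarrow> nat) \<Rightarrow> nat \<Rightarrow> 'd decoration \<Rightarrow> nat \<times> nat \<Rightarrow> kvertex" where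
  "src_graph n b r g = restrict (\<lambda>e. if snd e = b (fst e) then (if fst e = r then Ground2 else Aerial (fst (g (fst e)))) else Ground1) (kedges n)"

definition src_index :: "nat \<Rightarrow> (nat \<Rightarrow> nat) \<Rightarrow> nat \<Rightarrow> 'd \<Rightarrow> 'd decoration \<Rightarrow> (nat \<Rightarrow> 'd) \<Rightarrow> nat \<times> nat \<Rightarrow> 'd" where
  "src_index n b r j g h = restrict (\<lambda>e. if snd e = b (fst e) then (if fst e = r then j else snd (g (fst e))) else h (fst e)) (kedges n)"

text \<open>For n \<ge> 1, counting edges forces n edges to \<open>Ground1\<close>, one from each
  vertex; what is left is a rooted tree as in \<open>src_graph\<close>. These trees give the terms
  linear in the second momentum.\<close>

definition stree :: "nat \<Rightarrow> (nat \<times> nat \<Rightarrow> kvertex) set" where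
  "stree n = {\<Gamma> \<in> ktrees n. card (edges_to n \<Gamma> Ground2) = 1}"

definition src_data :: "nat \<Rightarrow> ((nat \<Rightarrow> nat) \<times> nat \<times> ('d::finite) decoration \<times> (nat \<Rightarrow> 'd)) set" where
  "src_data n = ({1..n} \<rightarrow>\<^sub>E {1, 2}) \<times> (SIGMA r:{1..n}. dtrees {1..n} r \<times> ({1..n} \<rightarrow>\<^sub>E UNIV))"

text \<open>With the basis covector \<open>j\<close> as second momentum, only index functions with
  value \<open>j\<close> at the edge to \<open>Ground2\<close> contribute.\<close>

definition src_pairs :: "nat \<Rightarrow> 'd \<Rightarrow> ((nat \<times> nat \<Rightarrow> kvertex) \<times> (nat \<times> nat \<Rightarrow> 'd)) set" where
  "src_pairs n j = {(\<Gamma>, I). \<Gamma> \<in> stree n \<and> I \<in> kedges n \<rightarrow>\<^sub>E UNIV \<and> (\<forall>e\<in>kedges n. \<Gamma> e = Ground2 \<longrightarrow> I e = j)}"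

definition src_map :: "nat \<Rightarrow> 'd \<Rightarrow> (nat \<Rightarrow> nat) \<times> nat \<times> 'd decoration \<times> (nat \<Rightarrow> 'd) \<Rightarrow>
    (nat \<times> nat \<Rightarrow> kvertex) \<times> (nat \<times> nat \<Rightarrow> 'd)" where
  "src_map n j = (\<lambda>(b, r, g, h). (src_graph n b r g, src_index n b r j g h))"

context
  fixes n :: nat and b :: "nat \<Rightarrow> nat" and r :: nat and g :: "nat \<Rightarrow> nat \<times> 'd::finite"
  assumes b: "b \<in> {1..n} \<rightarrow>\<^sub>E {1, 2}" and r: "r \<in> {1..n}" and g: "g \<in> dtrees {1..n} r"
begin

lemma b12: "k \<in> {1..n} \<Longrightarrow> b k = 1 \<or> b k = 2" "k \<in> {1..n} \<Longrightarrow> 3 - b k \<noteq> b k"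
    "k \<in> {1..n} \<Longrightarrow> b k \<in> {1, 2}" "k \<in> {1..n} \<Longrightarrow> 3 - b k \<in> {1, 2}"
  using PiE_mem[OF b, of k] by auto

lemma edge_cases: "(k, a) \<in> kedges n \<Longrightarrow> k \<in> {1..n} \<and> (a = b k \<or> a = 3 - b k)"
  using b12(1)[of k] by (auto simp: kedges_def)

lemma src_graph_edge:
  assumes "k \<in> {1..n}"
  shows "src_graph n b r g (k, b k) = (if k = r then Ground2 else Aerial (fst (g k)))"
    "src_graph n b r g (k, 3 - b k) = Ground1"
  using kedges_pair[OF assms b12(3)[OF assms]] kedges_pair[OF assms b12(4)[OF assms]] b12(2)[OF assms]
  by (simp_all add: src_graph_def)

lemma src_index_edge:
  assumes "k \<in> {1..n}"
  shows "src_index n b r j g h (k, b k) = (if k = r then j else snd (g k))"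
    "src_index n b r j g h (k, 3 - b k) = h k"
  using kedges_pair[OF assms b12(3)[OF assms]] kedges_pair[OF assms b12(4)[OF assms]] b12(2)[OF assms]
  by (simp_all add: src_index_def)

lemma dtree_target: "k \<in> {1..n} - {r} \<Longrightarrow> fst (g k) \<in> {1..n}"
  using g by (auto simp: dtrees_def PiE_iff mem_Times_iff)

lemma dtree_rank: "\<exists>\<rho>::nat\<Rightarrow>nat. \<forall>k\<in>{1..n} - {r}. \<rho> (fst (g k)) < \<rho> k"
  using g by (auto simp: dtrees_def)

lemma src_graph_Aerial:
  assumes "e \<in> kedges n" "src_graph n b r g e = Aerial i"
  shows "e = (fst e, b (fst e))" "fst e \<in> {1..n} - {r}" "i = fst (g (fst e))"
proof -
  obtain k a where e: "e = (k, a)" by (cases e)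
  note c = edge_cases[OF assms(1)[unfolded e]]
  have "a \<noteq> 3 - b k" using src_graph_edge(2)[of k] c assms(2) e by auto
  then have a: "a = b k" using c by simp
  then show "e = (fst e, b (fst e))" using e by simp
  have "(if k = r then Ground2 else Aerial (fst (g k))) = Aerial i"
    using src_graph_edge(1)[of k] c assms(2) e a by simp
  then show "fst e \<in> {1..n} - {r}" "i = fst (g (fst e))" using c e by (auto split: if_splits)
qed

lemma src_graph_kgraphs: "src_graph n b r g \<in> kgraphs n"
proof -
  obtain \<rho> :: "nat \<Rightarrow> nat" where \<rho>: "\<forall>k\<in>{1..n} - {r}. \<rho> (fst (g k)) < \<rho> k" using dtree_rank by blast
  have "src_graph n b r g \<in> kedges n \<rightarrow>\<^sub>E Aerial ` {1..n} \<union> {Ground1, Ground2}"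
  proof (rule PiE_I)
    fix e assume e: "e \<in> kedges n"
    have "i \<in> {1..n}" if "src_graph n b r g e = Aerial i" for i
      using src_graph_Aerial[OF e that] dtree_target[of "fst e"] by simp
    then show "src_graph n b r g e \<in> Aerial ` {1..n} \<union> {Ground1, Ground2}"
      by (cases "src_graph n b r g e") auto
  qed (simp add: src_graph_def)
  moreover have "src_graph n b r g (k, 1) \<noteq> Aerial k \<and> src_graph n b r g (k, 2) \<noteq> Aerial k \<and>
    src_graph n b r g (k, 1) \<noteq> src_graph n b r g (k, 2)" if k: "k \<in> {1..n}" for k
  proof -
    have "fst (g k) \<noteq> k" if "k \<noteq> r"
    proof -
      have "\<rho> (fst (g k)) < \<rho> k" using \<rho> k that by blast
      then show ?thesis by auto
    qed
    then show ?thesis using src_graph_edge[OF k] b12(1)[OF k] by (auto split: if_splits)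
  qed
  ultimately show ?thesis by (auto simp: kgraphs_def)
qed

lemma src_graph_rank:
  assumes "\<forall>k\<in>{1..n} - {r}. \<rho> (fst (g k)) < \<rho> k"
  shows "graph_rank n (src_graph n b r g) \<rho>"
  unfolding graph_rank_def
proof (intro ballI allI impI)
  fix k a i assume "k \<in> {1..n}" "a \<in> {1, 2::nat}" "src_graph n b r g (k, a) = Aerial i"
  then show "\<rho> i < \<rho> k" using src_graph_Aerial[of "(k, a)" i] kedges_pair[of k n a] assms by auto
qed

lemma src_graph_stree: "src_graph n b r g \<in> stree n"
proof -
  let ?G = "src_graph n b r g"
  obtain \<rho> :: "nat \<Rightarrow> nat" where \<rho>: "\<forall>k\<in>{1..n} - {r}. \<rho> (fst (g k)) < \<rho> k" using dtree_rank by blast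
  \<comment> \<open>An edge traversed from \<open>u\<close> either is the parent edge of
    \<open>u\<close> and descends in rank, or it ascends.\<close>
  have jr: "(u = fst e \<and> e = (u, b u) \<and> \<rho> v < \<rho> u) \<or> \<rho> u < \<rho> v" if "joins ?G e u v" "e \<in> kedges n" for e u v
  proof -
    have "\<rho> i < \<rho> (fst e) \<and> e = (fst e, b (fst e))" if "?G e = Aerial i" for i
      using src_graph_Aerial[OF \<open>e \<in> kedges n\<close> that] \<rho> by auto
    then show ?thesis using that(1) by (auto simp: joins_def)
  qed
  have nocyc: "\<not> aerial_cycle n ?G vs es" for vs es
  proof
    assume c: "aerial_cycle n ?G vs es"
    define L where "L = length vs"
    have L: "L > 0" "length es = L" "distinct es" and ek: "\<And>i. i < L \<Longrightarrow> es ! i \<in> kedges n"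
      and jo: "\<And>i. i < L \<Longrightarrow> joins ?G (es ! i) (vs ! i) (vs ! (Suc i mod L))"
      using c nth_mem[of _ es] by (auto simp: aerial_cycle_def L_def)
    \<comment> \<open>At a vertex of highest rank on the cycle, both adjacent cycle edges have to be
      its parent edge, so they coincide.\<close>
    define m where "m = Max ((\<lambda>i. \<rho> (vs ! i)) ` {..<L})"
    have "m \<in> (\<lambda>i. \<rho> (vs ! i)) ` {..<L}" unfolding m_def using L by (intro Max_in) auto
    then obtain i where i: "i < L" "m = \<rho> (vs ! i)" by auto
    have top: "\<rho> (vs ! k) \<le> \<rho> (vs ! i)" if "k < L" for k
      unfolding i(2)[symmetric] m_def using that by (intro Max_ge) auto
    define p where "p = (if i = 0 then L - 1 else i - 1)"
    have p: "p < L" "Suc p mod L = i" using i L by (auto simp: p_def)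
    have "joins ?G (es ! p) (vs ! p) (vs ! i)" using jo[OF p(1)] p(2) by simp
    then have "joins ?G (es ! p) (vs ! i) (vs ! p)" by (auto simp: joins_def)
    then have e1: "es ! p = (vs ! i, b (vs ! i))" using jr[OF _ ek[OF p(1)]] top[OF p(1)] by fastforce
    have "Suc i mod L < L" using L by simp
    then have e2: "es ! i = (vs ! i, b (vs ! i)) \<and> \<rho> (vs ! (Suc i mod L)) < \<rho> (vs ! i)"
      using jr[OF jo[OF i(1)] ek[OF i(1)]] top by fastforce
    then have "i = p" using e1 nth_eq_iff_index_eq[OF L(3)] i p L by metis
    then show False using e2 p(2) by simp
  qed
  have conn: "aerial_connected n ?G"
  proof -
    define R where "R = {(a, c). \<exists>e\<in>kedges n. joins ?G e a c}"
    have symR: "sym R" unfolding R_def by (auto simp: sym_def joins_def)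
    have reach: "(k, r) \<in> R\<^sup>*" if "k \<in> {1..n}" for k
      using that
    proof (induction "\<rho> k" arbitrary: k rule: less_induct)
      case less
      show ?case
      proof (cases "k = r")
        case False
        then have "(k, fst (g k)) \<in> R" unfolding R_def
          using src_graph_edge(1)[OF less.prems] kedges_pair[OF less.prems b12(3)[OF less.prems]]
          by (auto simp: joins_def intro!: bexI[of _ "(k, b k)"])
        moreover have "(fst (g k), r) \<in> R\<^sup>*"
          using False less.prems \<rho> dtree_target[of k] by (intro less.hyps) auto
        ultimately show ?thesis by (rule converse_rtrancl_into_rtrancl)
      qed simp
    qed
    have "(u, v) \<in> R\<^sup>*" if "u \<in> {1..n}" "v \<in> {1..n}" for u v
      using reach[OF that(1)] symD[OF sym_rtrancl[OF symR] reach[OF that(2)]] by (rule rtrancl_trans)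
    then show ?thesis by (simp add: aerial_connected_def R_def)
  qed
  have "{e \<in> kedges n. ?G e = Ground2} = {(r, b r)}"
  proof -
    have "e = (r, b r)" if "e \<in> kedges n" "?G e = Ground2" for e
    proof -
      obtain k a where e: "e = (k, a)" by (cases e)
      show ?thesis using edge_cases[of k a] src_graph_edge[of k] that e by (auto split: if_splits)
    qed
    moreover have "(r, b r) \<in> kedges n" "?G (r, b r) = Ground2"
      using kedges_pair[OF r b12(3)[OF r]] src_graph_edge(1)[OF r] by auto
    ultimately show ?thesis by blast
  qed
  then show ?thesis using nocyc conn src_graph_kgraphs by (simp add: stree_def ktrees_def)
qed

lemma kern_swap: "kern u v z = - kern v u z"
  by (simp add: kern_def algebra_simps)

text \<open>Moving the edge to 0 into the first place costs a sign for each \<open>k\<close> with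
  \<open>b k = 1\<close>. The factors \<open>- (4 * pi\<^sup>2)\<close> of
  \<open>integral_kern_tree\<close> lose their modulus to the normalization and leave a sign for
  every vertex. Together, exactly the vertices with \<open>b k = 2\<close> keep one.\<close>

lemma weight_src_graph:
  "weight n (src_graph n b r g) = (\<Prod>k\<in>{1..n}. if b k = 1 then 1 else -1) * mean_prim (twt {1..n} r g) 0"
proof -
  let ?G = "src_graph n b r g"
  let ?S = "{1..n}"
  obtain \<rho> :: "nat \<Rightarrow> nat" where \<rho>: "\<forall>k\<in>?S - {r}. \<rho> (fst (g k)) < \<rho> k" using dtree_rank by blast
  note rank = src_graph_rank[OF \<rho>]
  obtain F where F: "branch_family ?S r g F" using branch_family_exists[OF _ \<rho>] by blast
  define F' where "F' = F(r := mean_prim (twt ?S r g))"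
  define e where "e k = ?G (k, b k)" for k
  have e: "e k = (if k = r then Ground2 else Aerial (fst (g k)))" if "k \<in> ?S" for k
    using src_graph_edge(1)[OF that] by (simp add: e_def)
  have pos1: "position z Ground1 = 0" for z by (simp add: position_def)
  have kd: "{c. c \<in> ?S \<and> e c = Aerial k} = kids ?S r g k" for k
    using e by (auto simp: kids_def split: if_splits)
  have kids_r: "r \<notin> kids ?S r g k" for k by (simp add: kids_def)
  have int: "(\<integral>z. (\<Prod>k\<in>?S. kern 0 (position z (e k)) (z k) * (1::real)) \<partial>cspace ?S) =
     (- (4 * pi\<^sup>2)) ^ card ?S * (\<Prod>c | c \<in> ?S \<and> e c = Ground2. F' c 0)"
  proof (rule integral_kern_tree[where \<rho> = \<rho> and g = "\<lambda>_ _. 1"])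
    show "targets_below \<rho> ?S e"
      unfolding targets_below_def
    proof
      fix k assume k: "k \<in> ?S"
      show "e k \<in> Aerial ` ?S \<union> {Ground1, Ground2} \<and> (\<forall>j. e k = Aerial j \<longrightarrow> \<rho> j < \<rho> k)"
        using e[OF k] \<rho> dtree_target[of k] k by auto
    qed
    show "e k \<noteq> Ground1" if "k \<in> ?S" for k using e[OF that] by simp
    show "continuous_on {0..1} (F' k)" if "k \<in> ?S" for k
    proof (cases "k = r")
      case True
      then show ?thesis using twt_cont[of ?S g r] g by (simp add: F'_def mean_prim_cont)
    next
      case False
      then show ?thesis using branch_family_cont[OF _ \<rho> F] that by (simp add: F'_def)
    qed
    show "F' k u = mean_prim (\<lambda>u. 1 * (\<Prod>c | c \<in> ?S \<and> e c = Aerial k. F' c u)) u" if "k \<in> ?S" for k u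
    proof -
      have "(\<lambda>u. 1 * (\<Prod>c | c \<in> ?S \<and> e c = Aerial k. F' c u)) = (\<lambda>u. \<Prod>c\<in>kids ?S r g k. F c u)"
        unfolding kd using kids_r by (auto simp: F'_def intro!: prod.cong ext)
      moreover have "F' k u = mean_prim (\<lambda>u. \<Prod>c\<in>kids ?S r g k. F c u) u"
      proof (cases "k = r")
        case True
        have "twt ?S r g = (\<lambda>u. \<Prod>c\<in>kids ?S r g r. F c u)" by (rule twt_eq[OF _ \<rho> F]) simp
        then show ?thesis using True by (simp add: F'_def)
      next
        case False
        then have "k \<in> ?S - {r}" using that by simp
        then have "F k u = mean_prim (\<lambda>u. \<Prod>c\<in>kids ?S r g k. F c u) u" using F unfolding branch_family_def by blast
        then show ?thesis using False by (simp add: F'_def)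
      qed
      ultimately show ?thesis by (simp only:)
    qed
  qed auto
  have "{c. c \<in> ?S \<and> e c = Ground2} = {r}" using e r by (auto split: if_splits)
  then have int2: "(\<integral>z. (\<Prod>k\<in>?S. kern 0 (position z (e k)) (z k)) \<partial>cspace ?S) = (- (4 * pi\<^sup>2)) ^ n * mean_prim (twt ?S r g) 0"
    using int by (simp add: F'_def)
  define s where "s k = (if b k = 1 then 1 else -1 :: real)" for k
  have "(\<Prod>k\<in>?S. kern (position z (?G (k, 1))) (position z (?G (k, 2))) (z k)) =
     (\<Prod>k\<in>?S. - s k) * (\<Prod>k\<in>?S. kern 0 (position z (e k)) (z k))" for z
    unfolding prod.distrib[symmetric]
  proof (intro prod.cong refl)
    fix k assume k: "k \<in> ?S"
    consider "b k = 1" | "b k = 2" using b12(1)[OF k] by blast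
    then show "kern (position z (?G (k, 1))) (position z (?G (k, 2))) (z k) = - s k * kern 0 (position z (e k)) (z k)"
    proof cases
      case 1
      then have "?G (k, 2) = Ground1" "?G (k, 1) = e k" using src_graph_edge(2)[OF k] by (simp_all add: e_def)
      then show ?thesis using 1 kern_swap[of "position z (e k)" 0] by (simp add: s_def pos1)
    next
      case 2
      then have "?G (k, 1) = Ground1" "?G (k, 2) = e k" using src_graph_edge(2)[OF k] by (simp_all add: e_def)
      then show ?thesis using 2 by (simp add: s_def pos1)
    qed
  qed
  then have "weight n ?G = (\<Prod>k\<in>?S. - s k) * ((- (4 * pi\<^sup>2)) ^ n * mean_prim (twt ?S r g) 0) / (2 * pi) ^ (2 * n)"
    unfolding weight_eq[OF src_graph_kgraphs rank] int2[symmetric] by (simp only: integral_mult_right_zero)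
  also have "(\<Prod>k\<in>?S. - s k) = (-1) ^ n * (\<Prod>k\<in>?S. s k)"
    using prod.distrib[of "\<lambda>_. -1" s ?S] by simp
  also have "(2 * pi) ^ (2 * n) = (4 * pi\<^sup>2) ^ n" by (simp add: power_mult power_mult_distrib)
  also have "(- (4 * pi\<^sup>2)) ^ n = (-1) ^ n * (4 * pi\<^sup>2) ^ n" by (rule power_minus)
  also have "(-1) ^ n * prod s ?S * ((-1) ^ n * (4 * pi\<^sup>2) ^ n * mean_prim (twt ?S r g) 0) / (4 * pi\<^sup>2) ^ n
     = ((-1) ^ n * (-1) ^ n) * prod s ?S * mean_prim (twt ?S r g) 0"
    by simp
  also have "(-1) ^ n * (-1) ^ n = (1::real)" by (simp add: power_mult_distrib[symmetric])
  finally show ?thesis by (simp add: s_def)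
qed

end

lemma src_map_inj: "inj_on (src_map n j) (src_data n :: (_ \<times> _ \<times> ('d::finite) decoration \<times> _) set)"
proof (rule inj_onI)
  fix x y :: "(nat \<Rightarrow> nat) \<times> nat \<times> 'd decoration \<times> (nat \<Rightarrow> 'd)"
  assume x: "x \<in> src_data n" and y: "y \<in> src_data n" and eq: "src_map n j x = src_map n j y"
  obtain b r g h where xx: "x = (b, r, g, h)" by (cases x) auto
  obtain b' r' g' h' where yy: "y = (b', r', g', h')" by (cases y) auto
  have d: "b \<in> {1..n} \<rightarrow>\<^sub>E {1, 2}" "r \<in> {1..n}" "g \<in> dtrees {1..n} r" "h \<in> {1..n} \<rightarrow>\<^sub>E UNIV"
    using x by (auto simp: xx src_data_def)
  have d': "b' \<in> {1..n} \<rightarrow>\<^sub>E {1, 2}" "r' \<in> {1..n}" "g' \<in> dtrees {1..n} r'" "h' \<in> {1..n} \<rightarrow>\<^sub>E UNIV"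
    using y by (auto simp: yy src_data_def)
  have e: "src_graph n b r g = src_graph n b' r' g'" "src_index n b r j g h = src_index n b' r' j g' h'"
    using eq by (auto simp: src_map_def xx yy)
  note E = src_graph_edge[OF d(1-3)] src_index_edge[OF d(1-3), of _ j h]
  note E' = src_graph_edge[OF d'(1-3)] src_index_edge[OF d'(1-3), of _ j h']
  have bk: "b k = b' k" if k: "k \<in> {1..n}" for k
  proof (rule ccontr)
    assume "b k \<noteq> b' k"
    then have "b' k = 3 - b k" using b12(1)[OF d(1-3) k] b12(1)[OF d'(1-3) k] by auto
    then show False using E(2)[OF k] E'(1)[OF k] e by (auto split: if_splits)
  qed
  have b: "b = b'"
  proof
    fix k show "b k = b' k" using bk PiE_arb[OF d(1)] PiE_arb[OF d'(1)] by (cases "k \<in> {1..n}") auto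
  qed
  have rr: "r = r'" using E(1)[OF d(2)] E'(1)[OF d(2)] e b by (auto split: if_splits)
  have "g = g'"
  proof
    fix k
    show "g k = g' k"
    proof (cases "k \<in> {1..n} - {r}")
      case True
      then show ?thesis using E(1,3)[of k] E'(1,3)[of k] e b rr by (auto simp: prod_eq_iff)
    next
      case False
      have "g \<in> ({1..n} - {r}) \<rightarrow>\<^sub>E {1..n} \<times> UNIV" "g' \<in> ({1..n} - {r}) \<rightarrow>\<^sub>E {1..n} \<times> UNIV"
        using d(3) d'(3) rr by (simp_all add: dtrees_def)
      then show ?thesis using PiE_arb[OF _ False] by metis
    qed
  qed
  moreover have "h = h'"
  proof
    fix k show "h k = h' k" using E(4)[of k] E'(4)[of k] e b PiE_arb[OF d(4), of k] PiE_arb[OF d'(4), of k]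
      by (cases "k \<in> {1..n}") auto
  qed
  ultimately show "x = y" using b rr by (simp add: xx yy)
qed

lemma src_map_image:
  assumes n: "1 \<le> n"
  shows "src_map n j ` src_data n = (src_pairs n j :: (_ \<times> (nat \<times> nat \<Rightarrow> 'd::finite)) set)"
proof
  show "src_map n j ` src_data n \<subseteq> (src_pairs n j :: (_ \<times> (nat \<times> nat \<Rightarrow> 'd)) set)"
  proof
    fix y :: "(nat \<times> nat \<Rightarrow> kvertex) \<times> (nat \<times> nat \<Rightarrow> 'd)" assume "y \<in> src_map n j ` src_data n"
    then obtain b r and g :: "'d decoration" and h where x: "(b, r, g, h) \<in> src_data n" and y: "y = src_map n j (b, r, g, h)"
      by auto
    have d: "b \<in> {1..n} \<rightarrow>\<^sub>E {1, 2}" "r \<in> {1..n}" "g \<in> dtrees {1..n} r"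
      using x by (auto simp: src_data_def)
    have "src_index n b r j g h \<in> kedges n \<rightarrow>\<^sub>E UNIV" by (simp add: src_index_def)
    moreover have "src_index n b r j g h e = j" if e: "e \<in> kedges n" "src_graph n b r g e = Ground2" for e
    proof -
      obtain k a where ka: "e = (k, a)" by (cases e)
      show ?thesis using edge_cases[OF d, of k a] e ka src_graph_edge[OF d, of k] src_index_edge[OF d, of k j h]
        by (auto split: if_splits)
    qed
    ultimately show "y \<in> src_pairs n j" using src_graph_stree[OF d] by (simp add: y src_map_def src_pairs_def)
  qed
  show "(src_pairs n j :: (_ \<times> (nat \<times> nat \<Rightarrow> 'd)) set) \<subseteq> src_map n j ` src_data n"
  proof
    fix y :: "(nat \<times> nat \<Rightarrow> kvertex) \<times> (nat \<times> nat \<Rightarrow> 'd)" assume y: "y \<in> src_pairs n j"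
    obtain \<Gamma> I where yy: "y = (\<Gamma>, I)" by (cases y)
    have T: "\<Gamma> \<in> ktrees n" and c2: "card (edges_to n \<Gamma> Ground2) = 1"
      and I: "I \<in> kedges n \<rightarrow>\<^sub>E UNIV" "\<And>e. e \<in> kedges n \<Longrightarrow> \<Gamma> e = Ground2 \<Longrightarrow> I e = j"
      using y by (auto simp: yy src_pairs_def stree_def)
    have G: "\<Gamma> \<in> kgraphs n" using T by (simp add: ktrees_def)
    obtain e2 where e2: "(edges_to n \<Gamma> Ground2) = {e2}" using c2 card_1_singletonE by metis
    define r where "r = fst e2"
    have "e2 \<in> kedges n" using e2 by blast
    then have r: "r \<in> {1..n}" by (auto simp: r_def kedges_def)
    \<comment> \<open>Of the 2n edges fewer than n are aerial and one ends at
      \<open>Ground2\<close>; so every vertex has an edge to \<open>Ground1\<close>.\<close>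
    have "n \<le> card (edges_to n \<Gamma> Ground1)"
      using edge_counts[of n \<Gamma>] ktree_aerial_edges[OF T n] c2 by linarith
    then have "card (fst ` (edges_to n \<Gamma> Ground1)) = card {1..n}"
      using ground_card_le[OF G] by (simp add: card_image)
    then have img: "fst ` (edges_to n \<Gamma> Ground1) = {1..n}"
      by (intro card_subset_eq) (auto simp: kedges_def)
    have ne: "\<Gamma> (k, 1) \<noteq> \<Gamma> (k, 2)" if "k \<in> {1..n}" for k using G that by (auto simp: kgraphs_def)
    define b where "b = restrict (\<lambda>k. if \<Gamma> (k, 1) = Ground1 then 2 else 1 :: nat) {1..n}"
    have b: "b \<in> {1..n} \<rightarrow>\<^sub>E {1, 2}" by (auto simp: b_def)
    have gb: "\<Gamma> (k, 3 - b k) = Ground1" "\<Gamma> (k, b k) \<noteq> Ground1" if k: "k \<in> {1..n}" for k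
    proof -
      obtain a where a: "(k, a) \<in> kedges n" "\<Gamma> (k, a) = Ground1" using img k by force
      then have "a = 1 \<or> a = 2" by (auto simp: kedges_def)
      then show "\<Gamma> (k, 3 - b k) = Ground1" "\<Gamma> (k, b k) \<noteq> Ground1" using a ne[OF k] k by (auto simp: b_def)
    qed
    have bK: "(k, b k) \<in> kedges n" "(k, 3 - b k) \<in> kedges n" if "k \<in> {1..n}" for k
      using that by (auto simp: b_def intro!: kedges_pair)
    have ec: "k \<in> {1..n} \<and> (a = b k \<or> a = 3 - b k)" if "(k, a) \<in> kedges n" for k a
      using that by (auto simp: kedges_def b_def)
    have gr: "\<Gamma> (k, b k) = Ground2 \<longleftrightarrow> k = r" if k: "k \<in> {1..n}" for k
    proof
      assume "\<Gamma> (k, b k) = Ground2"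
      then have "(k, b k) = e2" using e2 bK[OF k] by blast
      then show "k = r" by (auto simp: r_def)
    next
      assume kr: "k = r"
      have "e2 \<in> kedges n" "\<Gamma> e2 = Ground2" using e2 by blast+
      then have "(k, snd e2) \<in> kedges n" "\<Gamma> (k, snd e2) = Ground2" using kr by (simp_all add: r_def)
      then show "\<Gamma> (k, b k) = Ground2" using ec[of k "snd e2"] gb(1)[OF k] by auto
    qed
    define f where "f k = (case \<Gamma> (k, b k) of Aerial i \<Rightarrow> i | _ \<Rightarrow> 0)" for k
    have f: "\<Gamma> (k, b k) = Aerial (f k)" if k: "k \<in> {1..n} - {r}" for k
      using gb(2)[of k] gr[of k] k by (cases "\<Gamma> (k, b k)") (auto simp: f_def)
    define g where "g = restrict (\<lambda>k. (f k, I (k, b k))) ({1..n} - {r})"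
    define h where "h = restrict (\<lambda>k. I (k, 3 - b k)) {1..n}"
    obtain \<rho> where \<rho>: "graph_rank n \<Gamma> \<rho>" using ktree_rank'[OF T] by blast
    have fr: "\<rho> (f k) < \<rho> k" if k: "k \<in> {1..n} - {r}" for k
    proof -
      have "b k \<in> {1, 2}" using k by (auto simp: b_def)
      then show ?thesis using f[OF k] \<rho> k unfolding graph_rank_def by blast
    qed
    have fS: "f k \<in> {1..n}" if k: "k \<in> {1..n} - {r}" for k
      using kgraphs_target(1)[OF G bK(1) f[OF k]] k by auto
    have g: "g \<in> dtrees {1..n} r"
      unfolding dtrees_def
    proof (rule CollectI, intro conjI exI[of _ \<rho>] ballI)
      show "g \<in> ({1..n} - {r}) \<rightarrow>\<^sub>E {1..n} \<times> UNIV" using fS by (simp add: g_def del: atLeastAtMost_iff)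
      show "\<rho> (fst (g k)) < \<rho> k" if "k \<in> {1..n} - {r}" for k using fr[OF that] that by (simp add: g_def)
    qed
    have "(b, r, g, h) \<in> src_data n" using b r g by (simp add: src_data_def h_def)
    moreover have "src_map n j (b, r, g, h) = y"
    proof -
      note d = b r g
      have "src_graph n b r g e = \<Gamma> e \<and> src_index n b r j g h e = I e" for e
      proof (cases "e \<in> kedges n")
        case False
        have "\<Gamma> e = undefined" using G False by (auto simp: kgraphs_def intro: PiE_arb)
        then show ?thesis using False PiE_arb[OF I(1) False] by (simp add: src_graph_def src_index_def)
      next
        case True
        obtain k a where e: "e = (k, a)" by (cases e)
        have k: "k \<in> {1..n}" using ec True e by auto
        note E = src_graph_edge[OF d k] src_index_edge[OF d k, of j h]
        consider "a = b k" "k = r" | "a = b k" "k \<noteq> r" | "a = 3 - b k" using ec[of k a] True e by auto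
        then show ?thesis
        proof cases
          case 1
          then have "\<Gamma> e = Ground2" using gr[OF k] e by simp
          then show ?thesis using 1 E e I(2)[OF True] by simp
        next
          case 2
          then show ?thesis using E(1,3) e f[of k] k by (simp add: g_def)
        next
          case 3
          then show ?thesis using E(2,4) e gb(1)[OF k] k by (simp add: h_def)
        qed
      qed
      then show ?thesis by (simp add: src_map_def yy fun_eq_iff)
    qed
    ultimately show "y \<in> src_map n j ` src_data n" by (metis imageI)
  qed
qed

text \<open>Any list with these entries; for partial derivatives of smooth functions the choice is
  immaterial by \<open>iter_partial_perm\<close>.\<close>

definition mlist :: "'d multiset \<Rightarrow> 'd list" where
  "mlist M = (SOME xs. mset xs = M)"

lemma mset_mlist: "mset (mlist M) = M"
  unfolding mlist_def using ex_mset by (rule someI_ex)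

text \<open>The signs of \<open>weight_src_graph\<close> are cancelled by the antisymmetry of
  \<open>D\<close>, so the 2^n choices of \<open>b\<close> become a factor 2 at each vertex. Summing
  over the indices of the edges to \<open>Ground1\<close> contracts each vertex with
  \<open>p\<close>, and the n possible roots contribute equally by
  \<open>theta_eq_th\<close>.\<close>

lemma source_tree_sum:
  fixes \<alpha> :: "real^'d::finite \<Rightarrow> real^'d^'d" and p q :: "real^'d"
  defines "D \<equiv> \<lambda>is i j. iter_partial is (\<lambda>y. \<alpha> y $ i $ j) q"
  assumes n: "1 \<le> n"
    and perm: "\<And>is js i j. mset is = mset js \<Longrightarrow> D is i j = D js i j"
    and anti: "\<And>is i j. D is i j = - D is j i"
  shows "(\<Sum>\<Gamma>\<in>stree n. weight n \<Gamma> * ksymbol n \<Gamma> \<alpha> p (axis j 1) q) =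
    real n * mean_prim (th (\<lambda>M i. 2 * (\<Sum>l\<in>UNIV. D (mlist M) i l * p $ l)) n {#} j) 0"
proof -
  let ?S = "{1..n}"
  define dv where "dv M i = 2 * (\<Sum>l\<in>UNIV. D (mlist M) i l * p $ l)" for M i
  let ?W = "\<lambda>\<Gamma> I. weight n \<Gamma> * ((\<Prod>k=1..n. D (map I (edge_list_to n \<Gamma> k)) (I (k, 1)) (I (k, 2)))
        * (\<Prod>e \<in> (edges_to n \<Gamma> Ground1). p $ I e)
        * (\<Prod>e \<in> (edges_to n \<Gamma> Ground2). axis j 1 $ I e))"
  have finT: "finite (stree n)"
    using finite_kgraphs by (rule finite_subset[rotated]) (auto simp: stree_def ktrees_def)
  have finI: "finite (kedges n \<rightarrow>\<^sub>E (UNIV :: 'd set))" by (intro finite_PiE finite_kedges) auto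
  have "(\<Sum>\<Gamma>\<in>stree n. weight n \<Gamma> * ksymbol n \<Gamma> \<alpha> p (axis j 1) q) = (\<Sum>\<Gamma>\<in>stree n. \<Sum>I\<in>kedges n \<rightarrow>\<^sub>E UNIV. ?W \<Gamma> I)"
    unfolding ksymbol_def D_def by (simp add: sum_distrib_left)
  also have "\<dots> = (\<Sum>(\<Gamma>, I)\<in>stree n \<times> (kedges n \<rightarrow>\<^sub>E UNIV). ?W \<Gamma> I)"
    by (rule sum.cartesian_product)
  also have "\<dots> = (\<Sum>(\<Gamma>, I)\<in>src_pairs n j. ?W \<Gamma> I)"
  proof (rule sum.mono_neutral_right)
    show "\<forall>x\<in>stree n \<times> (kedges n \<rightarrow>\<^sub>E UNIV) - src_pairs n j. (case x of (\<Gamma>, I) \<Rightarrow> ?W \<Gamma> I) = 0"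
    proof (clarify)
      fix \<Gamma> I assume "\<Gamma> \<in> stree n" "I \<in> kedges n \<rightarrow>\<^sub>E (UNIV :: 'd set)" "(\<Gamma>, I) \<notin> src_pairs n j"
      then obtain e where e: "e \<in> kedges n" "\<Gamma> e = Ground2" "I e \<noteq> j" by (auto simp: src_pairs_def)
      have "(\<Prod>e \<in> (edges_to n \<Gamma> Ground2). axis j (1::real) $ I e) = 0"
        using finite_kedges e by (intro prod_zero bexI[of _ e]) (auto simp: axis_def)
      then show "?W \<Gamma> I = 0" by simp
    qed
  qed (use finT finI in \<open>auto simp: src_pairs_def\<close>)
  also have "\<dots> = (\<Sum>x\<in>src_data n. case src_map n j x of (\<Gamma>, I) \<Rightarrow> ?W \<Gamma> I)"
    unfolding src_map_image[OF n, symmetric] by (subst sum.reindex[OF src_map_inj]) (simp add: o_def)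
  also have "\<dots> = (\<Sum>(b, r, g, h)\<in>src_data n. mean_prim (twt ?S r g) 0 *
     (\<Prod>k\<in>?S. D (mlist (image_mset (snd \<circ> g) (mset_set (kids ?S r g k)))) (if k = r then j else snd (g k)) (h k) * p $ h k))"
  proof (rule sum.cong[OF refl])
    fix x :: "(nat \<Rightarrow> nat) \<times> nat \<times> 'd decoration \<times> (nat \<Rightarrow> 'd)" assume x: "x \<in> src_data n"
    obtain b r g h where xx: "x = (b, r, g, h)" by (cases x) auto
    have d: "b \<in> ?S \<rightarrow>\<^sub>E {1, 2}" "r \<in> ?S" "g \<in> dtrees ?S r"
      using x by (auto simp: xx src_data_def)
    define \<Gamma> where "\<Gamma> = src_graph n b r g"
    define I where "I = src_index n b r j g h"
    note E = src_graph_edge[OF d, folded \<Gamma>_def] src_index_edge[OF d, of _ j h, folded I_def]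
    note bb = b12[OF d]
    define s where "s k = (if b k = 1 then 1 else -1 :: real)" for k
    have G1: "(edges_to n \<Gamma> Ground1) = (\<lambda>k. (k, 3 - b k)) ` ?S"
    proof -
      have "e \<in> (\<lambda>k. (k, 3 - b k)) ` ?S" if e: "e \<in> kedges n" "\<Gamma> e = Ground1" for e
      proof -
        obtain k a where ka: "e = (k, a)" by (cases e)
        show ?thesis using edge_cases[OF d, of k a] e ka E(1)[of k] by (auto split: if_splits)
      qed
      moreover have "(k, 3 - b k) \<in> kedges n" "\<Gamma> (k, 3 - b k) = Ground1" if "k \<in> ?S" for k
        using kedges_pair[OF that bb(4)[OF that]] E(2)[OF that] by simp_all
      ultimately show ?thesis by blast
    qed
    have G2: "(edges_to n \<Gamma> Ground2) = {(r, b r)}"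
    proof -
      have "e = (r, b r)" if e: "e \<in> kedges n" "\<Gamma> e = Ground2" for e
      proof -
        obtain k a where ka: "e = (k, a)" by (cases e)
        show ?thesis using edge_cases[OF d, of k a] e ka E(1,2)[of k] by (auto split: if_splits)
      qed
      moreover have "(r, b r) \<in> kedges n" "\<Gamma> (r, b r) = Ground2"
        using kedges_pair[OF d(2) bb(3)[OF d(2)]] E(1)[OF d(2)] by simp_all
      ultimately show ?thesis by blast
    qed
    have p1: "(\<Prod>e \<in> (edges_to n \<Gamma> Ground1). p $ I e) = (\<Prod>k\<in>?S. p $ h k)"
      unfolding G1 using E(4) by (subst prod.reindex) (auto simp: inj_on_def intro!: prod.cong)
    have p2: "(\<Prod>e \<in> (edges_to n \<Gamma> Ground2). axis j (1::real) $ I e) = 1"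
      unfolding G2 using E(3)[OF d(2)] by (simp add: axis_def)
    have Dk: "D (map I (edge_list_to n \<Gamma> k)) (I (k, 1)) (I (k, 2)) =
      s k * D (mlist (image_mset (snd \<circ> g) (mset_set (kids ?S r g k)))) (if k = r then j else snd (g k)) (h k)"
      if k: "k \<in> ?S" for k
    proof -
      have set: "(edges_to n \<Gamma> (Aerial k)) = (\<lambda>c. (c, b c)) ` kids ?S r g k"
      proof -
        have "e \<in> (\<lambda>c. (c, b c)) ` kids ?S r g k" if e: "e \<in> kedges n" "\<Gamma> e = Aerial k" for e
          using src_graph_Aerial[OF d e(1) e(2)[unfolded \<Gamma>_def]] by (auto simp: kids_def)
        moreover have "(c, b c) \<in> kedges n \<and> \<Gamma> (c, b c) = Aerial k" if "c \<in> kids ?S r g k" for c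
          using that E(1)[of c] kedges_pair[OF _ bb(3), of c] by (auto simp: kids_def)
        ultimately show ?thesis by blast
      qed
      have "mset (edge_list_to n \<Gamma> k) = mset_set (set (edge_list_to n \<Gamma> k))"
        by (rule mset_set_set[symmetric]) (simp add: set_kedge_list(2))
      also have "\<dots> = mset_set ((\<lambda>c. (c, b c)) ` kids ?S r g k)"
        by (simp add: set_kedge_list(1) set)
      also have "\<dots> = image_mset (\<lambda>c. (c, b c)) (mset_set (kids ?S r g k))"
        by (rule image_mset_mset_set[symmetric]) (simp add: inj_on_def)
      finally have "mset (map I (edge_list_to n \<Gamma> k)) =
          image_mset (\<lambda>c. I (c, b c)) (mset_set (kids ?S r g k))"
        by (simp add: image_mset.compositionality o_def)
      also have "\<dots> = image_mset (snd \<circ> g) (mset_set (kids ?S r g k))"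
        using E(3) finite_kids[of ?S r g k] by (intro image_mset_cong) (auto simp: kids_def)
      finally have m: "mset (map I (edge_list_to n \<Gamma> k)) = mset (mlist (image_mset (snd \<circ> g) (mset_set (kids ?S r g k))))"
        by (simp add: mset_mlist)
      consider "b k = 1" | "b k = 2" using bb(1)[OF k] by blast
      then show ?thesis
      proof cases
        case 1
        then have "I (k, 1) = (if k = r then j else snd (g k))" "I (k, 2) = h k"
          using E(3)[OF k] E(4)[OF k] by simp_all
        then show ?thesis using 1 perm[OF m] by (simp add: s_def)
      next
        case 2
        then have "I (k, 2) = (if k = r then j else snd (g k))" "I (k, 1) = h k"
          using E(3)[OF k] E(4)[OF k] by simp_all
        then show ?thesis using 2 perm[OF m] anti[of _ "h k"] by (simp add: s_def)
      qed
    qed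
    have ss: "(\<Prod>k\<in>?S. s k) * (\<Prod>k\<in>?S. s k) = 1"
      unfolding prod.distrib[symmetric] by (intro prod.neutral) (auto simp: s_def)
    have "(case src_map n j x of (\<Gamma>, I) \<Rightarrow> ?W \<Gamma> I) = ?W \<Gamma> I"
      by (simp add: xx src_map_def \<Gamma>_def I_def)
    also have "\<dots> = (\<Prod>k\<in>?S. s k) * mean_prim (twt ?S r g) 0 *
      ((\<Prod>k\<in>?S. s k * D (mlist (image_mset (snd \<circ> g) (mset_set (kids ?S r g k)))) (if k = r then j else snd (g k)) (h k)) * (\<Prod>k\<in>?S. p $ h k))"
    proof -
      have "weight n \<Gamma> = (\<Prod>k\<in>?S. s k) * mean_prim (twt ?S r g) 0"
        unfolding \<Gamma>_def s_def by (rule weight_src_graph[OF d])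
      moreover have "(\<Prod>k\<in>?S. D (map I (edge_list_to n \<Gamma> k)) (I (k, 1)) (I (k, 2))) =
        (\<Prod>k\<in>?S. s k * D (mlist (image_mset (snd \<circ> g) (mset_set (kids ?S r g k)))) (if k = r then j else snd (g k)) (h k))"
        by (rule prod.cong[OF refl Dk])
      ultimately show ?thesis by (simp only: p1 p2 mult_1_right)
    qed
    also have "\<dots> = ((\<Prod>k\<in>?S. s k) * (\<Prod>k\<in>?S. s k)) * mean_prim (twt ?S r g) 0 *
     (\<Prod>k\<in>?S. D (mlist (image_mset (snd \<circ> g) (mset_set (kids ?S r g k)))) (if k = r then j else snd (g k)) (h k) * p $ h k)"
      by (simp only: prod.distrib mult_ac)
    finally show "(case src_map n j x of (\<Gamma>, I) \<Rightarrow> ?W \<Gamma> I) = (case x of (b, r, g, h) \<Rightarrow> mean_prim (twt ?S r g) 0 *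
     (\<Prod>k\<in>?S. D (mlist (image_mset (snd \<circ> g) (mset_set (kids ?S r g k)))) (if k = r then j else snd (g k)) (h k) * p $ h k))"
      unfolding ss by (simp add: xx)
  qed
  also have "\<dots> = (\<Sum>b\<in>?S \<rightarrow>\<^sub>E {1, 2::nat}. \<Sum>r\<in>?S. \<Sum>g\<in>dtrees ?S r. \<Sum>h\<in>?S \<rightarrow>\<^sub>E UNIV. mean_prim (twt ?S r g) 0 *
     (\<Prod>k\<in>?S. D (mlist (image_mset (snd \<circ> g) (mset_set (kids ?S r g k)))) (if k = r then j else snd (g k)) (h k) * p $ h k))"
  proof -
    have fin: "finite (dtrees ?S r \<times> (?S \<rightarrow>\<^sub>E (UNIV :: 'd set)) :: ('d decoration \<times> _) set)" for r
      by (intro finite_cartesian_product finite_dtrees finite_PiE) auto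
    have *: "(\<Sum>x\<in>src_data n. f x) = (\<Sum>b\<in>?S \<rightarrow>\<^sub>E {1, 2::nat}. \<Sum>r\<in>?S. \<Sum>g\<in>dtrees ?S r. \<Sum>h\<in>?S \<rightarrow>\<^sub>E UNIV. f (b, r, g, h))"
      for f :: "(nat \<Rightarrow> nat) \<times> nat \<times> 'd decoration \<times> (nat \<Rightarrow> 'd) \<Rightarrow> real"
      unfolding src_data_def sum.cartesian_product'
    proof (intro sum.cong refl)
      fix b :: "nat \<Rightarrow> nat"
      show "(\<Sum>y\<in>(SIGMA r:?S. dtrees ?S r \<times> (?S \<rightarrow>\<^sub>E UNIV)). f (b, y)) =
        (\<Sum>r\<in>?S. \<Sum>g\<in>dtrees ?S r. \<Sum>h\<in>?S \<rightarrow>\<^sub>E UNIV. f (b, r, g, h))"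
        using sum.Sigma[of ?S "\<lambda>r. dtrees ?S r \<times> (?S \<rightarrow>\<^sub>E UNIV)" "\<lambda>r z. f (b, r, z)"] fin
        by (simp add: case_prod_unfold sum.cartesian_product')
    qed
    show ?thesis unfolding * by simp
  qed
  also have "\<dots> = 2 ^ n * (\<Sum>r\<in>?S. \<Sum>g\<in>dtrees ?S r. mean_prim (twt ?S r g) 0 *
     (\<Prod>k\<in>?S. \<Sum>l\<in>UNIV. D (mlist (image_mset (snd \<circ> g) (mset_set (kids ?S r g k)))) (if k = r then j else snd (g k)) l * p $ l))"
  proof -
    have "card (?S \<rightarrow>\<^sub>E {1, 2::nat}) = 2 ^ n" by (subst card_PiE) (auto simp: numeral_2_eq_2)
    then show ?thesis
      by (simp add: sum_distrib_left[symmetric] prod_sum_PiE)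
  qed
  also have "\<dots> = (\<Sum>r\<in>?S. \<Sum>g\<in>dtrees ?S r. mean_prim (twt ?S r g) 0 * tsym dv ?S r g {#} j)"
    unfolding sum_distrib_left[of "2 ^ n"]
  proof (intro sum.cong refl)
    fix r and g :: "'d decoration"
    let ?f = "\<lambda>k. (\<Sum>l\<in>UNIV. D (mlist (image_mset (snd \<circ> g) (mset_set (kids ?S r g k)))) (if k = r then j else snd (g k)) l * p $ l)"
    have "(\<Prod>k\<in>?S. 2 * ?f k) = 2 ^ n * (\<Prod>k\<in>?S. ?f k)" by (simp add: prod.distrib)
    then show "2 ^ n * (mean_prim (twt ?S r g) 0 * (\<Prod>k\<in>?S. ?f k)) = mean_prim (twt ?S r g) 0 * tsym dv ?S r g {#} j"
      by (simp add: tsym_def dv_def)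
  qed
  also have "\<dots> = (\<Sum>r\<in>?S. mean_prim (theta dv ?S r {#} j) 0)"
    unfolding theta_def
    by (intro sum.cong refl, subst mean_prim_sum) (auto intro: finite_dtrees twt_cont)
  also have "\<dots> = (\<Sum>r\<in>?S. mean_prim (th dv n {#} j) 0)"
  proof (rule sum.cong[OF refl])
    fix r assume r: "r \<in> ?S"
    show "mean_prim (theta dv ?S r {#} j) 0 = mean_prim (th dv n {#} j) 0"
      using r theta_eq_th[of ?S r _ dv] by (intro mean_prim_cong) auto
  qed
  finally show ?thesis unfolding dv_def by simp
qed

section \<open>Local bounds of derivatives\<close>

lemma smooth_on_iter_partial_derivative:
  assumes "open U" "smooth_on U f" "x \<in> U"
  shows "(iter_partial is f has_derivative (\<lambda>h. \<Sum>j\<in>UNIV. h $ j * iter_partial (j # is) f x)) (at x)"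
proof -
  have "iter_partial is f differentiable (at x)"
    using assms by (metis smooth_on_def differentiable_on_def at_within_open)
  then obtain D where D: "(iter_partial is f has_derivative D) (at x)" by (auto simp: differentiable_def)
  have lin: "linear D" using D by (rule has_derivative_linear)
  have pj: "partial j (iter_partial is f) x = D (axis j 1)" for j
  proof -
    have "((\<lambda>t. iter_partial is f (x + t *\<^sub>R axis j 1)) has_derivative (\<lambda>t. D (t *\<^sub>R axis j 1))) (at 0)"
      by (rule has_derivative_compose[of "\<lambda>t. x + t *\<^sub>R axis j 1" "\<lambda>t. t *\<^sub>R axis j 1" 0 UNIV])
        (auto intro!: derivative_eq_intros D)
    then have "((\<lambda>t. iter_partial is f (x + t *\<^sub>R axis j 1)) has_field_derivative D (axis j 1)) (at 0)"
      by (rule has_derivative_imp_has_field_derivative) (simp add: linear_cmul[OF lin])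
    then show ?thesis unfolding partial_def by (rule DERIV_imp_deriv)
  qed
  have Dh: "D h = (\<Sum>j\<in>UNIV. h $ j * D (axis j 1))" for h
  proof -
    have "h = (\<Sum>j\<in>UNIV. h $ j *\<^sub>R axis j 1)"
      by (rule basis_expansion[of h, unfolded scalar_mult_eq_scaleR, symmetric])
    then have "D h = D (\<Sum>j\<in>UNIV. h $ j *\<^sub>R axis j 1)" by (rule arg_cong[where f = D])
    also have "\<dots> = (\<Sum>j\<in>UNIV. D (h $ j *\<^sub>R axis j 1))" by (rule linear_sum[OF lin])
    also have "\<dots> = (\<Sum>j\<in>UNIV. h $ j * D (axis j 1))" by (simp only: linear_cmul[OF lin] real_scaleR_def)
    finally show ?thesis .
  qed
  have "D = (\<lambda>h. \<Sum>j\<in>UNIV. h $ j * iter_partial (j # is) f x)"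
  proof
    fix h show "D h = (\<Sum>j\<in>UNIV. h $ j * iter_partial (j # is) f x)"
      unfolding iter_partial.simps pj by (rule Dh)
  qed
  then show ?thesis using D by (simp only:)
qed

lemma smooth_on_curve_derivative:
  assumes "open U" "smooth_on U f" "\<gamma> t \<in> U" "(\<gamma> has_vector_derivative v) (at t within S)"
  shows "((\<lambda>t. iter_partial is f (\<gamma> t)) has_real_derivative (\<Sum>j\<in>UNIV. v $ j * iter_partial (j # is) f (\<gamma> t))) (at t within S)"
proof -
  have 1: "(iter_partial is f has_derivative (\<lambda>h. \<Sum>j\<in>UNIV. h $ j * iter_partial (j # is) f (\<gamma> t))) (at (\<gamma> t) within \<gamma> ` S)"
    using smooth_on_iter_partial_derivative[OF assms(1-3)] by (rule has_derivative_at_withinI)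
  have "((\<lambda>t. iter_partial is f (\<gamma> t)) has_derivative (\<lambda>s. \<Sum>j\<in>UNIV. (s *\<^sub>R v) $ j * iter_partial (j # is) f (\<gamma> t))) (at t within S)"
    using diff_chain_within[OF assms(4)[unfolded has_vector_derivative_def] 1] by (simp add: o_def)
  then show ?thesis
    by (rule has_derivative_imp_has_field_derivative) (simp add: sum_distrib_left mult_ac)
qed

lemma smooth_on_line_derivative:
  assumes "open U" "smooth_on U f" "y + t *\<^sub>R v \<in> U"
  shows "((\<lambda>t. iter_partial is f (y + t *\<^sub>R v)) has_real_derivative (\<Sum>j\<in>UNIV. v $ j * iter_partial (j # is) f (y + t *\<^sub>R v))) (at t)"
  by (rule smooth_on_curve_derivative[OF assms(1,2)]) (auto intro!: derivative_eq_intros assms(3))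

lemma smooth_on_axis_derivative:
  assumes "open U" "smooth_on U f" "y + t *\<^sub>R axis i 1 \<in> U"
  shows "((\<lambda>t. iter_partial is f (y + t *\<^sub>R axis i 1)) has_real_derivative iter_partial (i # is) f (y + t *\<^sub>R axis i 1)) (at t)"
proof -
  have "(\<Sum>j\<in>UNIV. axis i (1::real) $ j * iter_partial (j # is) f (y + t *\<^sub>R axis i 1)) = iter_partial (i # is) f (y + t *\<^sub>R axis i 1)"
    by (subst sum.remove[of _ i]) (auto simp: axis_def intro!: sum.neutral)
  then show ?thesis using smooth_on_line_derivative[OF assms, of "is"] by (simp only:)
qed

lemma iter_partial_cong:
  assumes "open U" "\<And>x. x \<in> U \<Longrightarrow> f x = g x" "x \<in> U"
  shows "iter_partial is f x = iter_partial is g x"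
  using assms(3)
proof (induction "is" arbitrary: x)
  case (Cons i "is")
  have "\<forall>\<^sub>F t in nhds 0. x + t *\<^sub>R axis i 1 \<in> U"
  proof -
    have "((\<lambda>t. x + t *\<^sub>R axis i 1) \<longlongrightarrow> x + 0 *\<^sub>R axis i (1::real)) (nhds 0)"
      by (intro tendsto_intros) (auto simp: filterlim_ident)
    then show ?thesis using Cons.prems assms(1) by (auto simp: tendsto_def)
  qed
  then have "\<forall>\<^sub>F t in nhds 0. iter_partial is f (x + t *\<^sub>R axis i 1) = iter_partial is g (x + t *\<^sub>R axis i 1)"
    by (rule eventually_mono) (rule Cons.IH)
  then show ?case by (simp add: partial_def deriv_cong_ev)
qed (simp add: assms(2))

lemma iter_partial_minus:
  assumes "open U" "smooth_on U f" "x \<in> U"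
  shows "iter_partial is (\<lambda>y. - f y) x = - iter_partial is f x"
  using assms(3)
proof (induction "is" arbitrary: x)
  case (Cons i "is")
  have "iter_partial [i] (iter_partial is (\<lambda>y. - f y)) x = iter_partial [i] (\<lambda>x. - iter_partial is f x) x"
    using Cons.IH Cons.prems assms(1) by (intro iter_partial_cong) auto
  then have "iter_partial (i # is) (\<lambda>y. - f y) x = deriv (\<lambda>t. - iter_partial is f (x + t *\<^sub>R axis i 1)) 0"
    by (simp add: partial_def)
  also have "\<dots> = - iter_partial (i # is) f x"
    using smooth_on_axis_derivative[OF assms(1,2), of x 0 i "is"] Cons.prems
    by (intro DERIV_imp_deriv DERIV_minus) auto
  finally show ?case .
qed simp

section \<open>Symmetry of iterated partial derivatives\<close>

lemma second_difference:
  assumes U: "open U" and f: "smooth_on U f" and h: "0 < h"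
    and sub: "\<And>s t. s \<in> {0..h} \<Longrightarrow> t \<in> {0..h} \<Longrightarrow> x + s *\<^sub>R axis i 1 + t *\<^sub>R axis j 1 \<in> U"
  shows "\<exists>s\<in>{0..h}. \<exists>t\<in>{0..h}. iter_partial is f (x + h *\<^sub>R axis i 1 + h *\<^sub>R axis j 1)
     - iter_partial is f (x + h *\<^sub>R axis i 1) - iter_partial is f (x + h *\<^sub>R axis j 1) + iter_partial is f x
     = h * h * iter_partial (j # i # is) f (x + s *\<^sub>R axis i 1 + t *\<^sub>R axis j 1)"
proof -
  let ?F = "iter_partial is f" and ?G = "iter_partial (i # is) f"
  define \<phi> where "\<phi> s = ?F ((x + h *\<^sub>R axis j 1) + s *\<^sub>R axis i 1) - ?F (x + s *\<^sub>R axis i 1)" for s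
  have "\<exists>s>0. s < h \<and> \<phi> h - \<phi> 0 = (h - 0) * (?G ((x + h *\<^sub>R axis j 1) + s *\<^sub>R axis i 1) - ?G (x + s *\<^sub>R axis i 1))"
  proof (rule MVT2[OF h])
    fix s assume s: "0 \<le> s" "s \<le> h"
    have "x + h *\<^sub>R axis j 1 + s *\<^sub>R axis i 1 \<in> U" "x + s *\<^sub>R axis i 1 \<in> U"
      using sub[of s h] sub[of s 0] s h by (auto simp: algebra_simps)
    then show "DERIV \<phi> s :> ?G ((x + h *\<^sub>R axis j 1) + s *\<^sub>R axis i 1) - ?G (x + s *\<^sub>R axis i 1)"
      unfolding \<phi>_def by (intro DERIV_diff smooth_on_axis_derivative[OF U f])
  qed
  then obtain s where s: "0 < s" "s < h" "\<phi> h - \<phi> 0 = h * (?G (x + s *\<^sub>R axis i 1 + h *\<^sub>R axis j 1) - ?G (x + s *\<^sub>R axis i 1))"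
    by (auto simp: algebra_simps)
  have "\<exists>t>0. t < h \<and> ?G (x + s *\<^sub>R axis i 1 + h *\<^sub>R axis j 1) - ?G (x + s *\<^sub>R axis i 1 + 0 *\<^sub>R axis j 1) =
     (h - 0) * iter_partial (j # i # is) f (x + s *\<^sub>R axis i 1 + t *\<^sub>R axis j 1)"
    by (rule MVT2[OF h], rule smooth_on_axis_derivative[OF U f]) (use sub s in auto)
  then obtain t where "0 < t" "t < h" "?G (x + s *\<^sub>R axis i 1 + h *\<^sub>R axis j 1) - ?G (x + s *\<^sub>R axis i 1) =
     h * iter_partial (j # i # is) f (x + s *\<^sub>R axis i 1 + t *\<^sub>R axis j 1)"
    by auto
  then show ?thesis using s by (intro bexI[of _ s] bexI[of _ t]) (auto simp: \<phi>_def algebra_simps)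
qed

text \<open>The second difference over a small square equals its area times either mixed derivative
  at some point of the square; continuity at \<open>x\<close> identifies the two.\<close>

lemma iter_partial_swap:
  assumes U: "open U" and f: "smooth_on U f" and x: "x \<in> U"
  shows "iter_partial (i # j # is) f x = iter_partial (j # i # is) f x"
proof (rule ccontr)
  define A where "A = iter_partial (i # j # is) f"
  define B where "B = iter_partial (j # i # is) f"
  assume "\<not> ?thesis"
  then have e: "0 < \<bar>A x - B x\<bar> / 2" by (simp add: A_def B_def)
  have "isCont A x" "isCont B x"
    unfolding A_def B_def using smooth_on_iter_partial_derivative[OF U f x] has_derivative_continuous by blast+
  from this[unfolded continuous_at_eps_delta, rule_format, OF e]
  obtain d1 d2 where d1: "0 < d1" "\<And>y. dist y x < d1 \<Longrightarrow> dist (A y) (A x) < \<bar>A x - B x\<bar> / 2"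
    and d2: "0 < d2" "\<And>y. dist y x < d2 \<Longrightarrow> dist (B y) (B x) < \<bar>A x - B x\<bar> / 2"
    by (metis dist_commute)
  obtain d3 where d3: "0 < d3" "ball x d3 \<subseteq> U" using U x openE by blast
  define h where "h = Min {d1, d2, d3} / 3"
  have h: "0 < h" "2 * h < d1" "2 * h < d2" "2 * h < d3" using d1 d2 d3 by (auto simp: h_def)
  have near: "dist (x + s *\<^sub>R axis k 1 + t *\<^sub>R axis l 1) x \<le> 2 * h" if "s \<in> {0..h}" "t \<in> {0..h}" for s t k l
  proof -
    have "norm (s *\<^sub>R axis k (1::real) + t *\<^sub>R axis l 1) \<le> \<bar>s\<bar> + \<bar>t\<bar>"
      using norm_triangle_ineq[of "s *\<^sub>R axis k (1::real)" "t *\<^sub>R axis l 1"] by (simp add: norm_axis_1)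
    then show ?thesis using that by (simp add: dist_norm add.assoc)
  qed
  have sub: "x + s *\<^sub>R axis k 1 + t *\<^sub>R axis l 1 \<in> U" if "s \<in> {0..h}" "t \<in> {0..h}" for s t k l
    using near[OF that, of k l] h d3 by (auto simp: dist_commute)
  obtain s t where st: "s \<in> {0..h}" "t \<in> {0..h}" and 1: "iter_partial is f (x + h *\<^sub>R axis i 1 + h *\<^sub>R axis j 1)
     - iter_partial is f (x + h *\<^sub>R axis i 1) - iter_partial is f (x + h *\<^sub>R axis j 1) + iter_partial is f x
     = h * h * B (x + s *\<^sub>R axis i 1 + t *\<^sub>R axis j 1)"
    using second_difference[OF U f h(1), of x i j "is"] sub unfolding B_def by blast
  obtain s' t' where st': "s' \<in> {0..h}" "t' \<in> {0..h}" and 2: "iter_partial is f (x + h *\<^sub>R axis j 1 + h *\<^sub>R axis i 1)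
     - iter_partial is f (x + h *\<^sub>R axis j 1) - iter_partial is f (x + h *\<^sub>R axis i 1) + iter_partial is f x
     = h * h * A (x + s' *\<^sub>R axis j 1 + t' *\<^sub>R axis i 1)"
    using second_difference[OF U f h(1), of x j i "is"] sub unfolding A_def by blast
  have "h * h * B (x + s *\<^sub>R axis i 1 + t *\<^sub>R axis j 1) = h * h * A (x + s' *\<^sub>R axis j 1 + t' *\<^sub>R axis i 1)"
    using 1 2 by (simp add: algebra_simps)
  then have "B (x + s *\<^sub>R axis i 1 + t *\<^sub>R axis j 1) = A (x + s' *\<^sub>R axis j 1 + t' *\<^sub>R axis i 1)" using h by simp
  moreover have "dist (B (x + s *\<^sub>R axis i 1 + t *\<^sub>R axis j 1)) (B x) < \<bar>A x - B x\<bar> / 2"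
    using near[OF st, of i j] h by (intro d2(2)) linarith
  moreover have "dist (A (x + s' *\<^sub>R axis j 1 + t' *\<^sub>R axis i 1)) (A x) < \<bar>A x - B x\<bar> / 2"
    using near[OF st', of j i] h by (intro d1(2)) linarith
  ultimately show False unfolding dist_real_def by (simp add: abs_if split: if_splits)
qed

lemma iter_partial_move:
  assumes U: "open U" and f: "smooth_on U f"
  shows "x \<in> U \<Longrightarrow> iter_partial (xs @ i # ys) f x = iter_partial (i # xs @ ys) f x"
proof (induction xs arbitrary: x)
  case (Cons a xs)
  have "iter_partial ((a # xs) @ i # ys) f x = iter_partial [a] (iter_partial (xs @ i # ys) f) x" by simp
  also have "\<dots> = iter_partial [a] (iter_partial (i # xs @ ys) f) x"
    using Cons by (intro iter_partial_cong[OF U]) auto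
  also have "\<dots> = iter_partial (a # i # xs @ ys) f x" by simp
  also have "\<dots> = iter_partial (i # a # xs @ ys) f x" by (rule iter_partial_swap[OF U f Cons.prems])
  finally show ?case by simp
qed simp

lemma iter_partial_perm:
  assumes U: "open U" and f: "smooth_on U f"
  shows "mset xs = mset ys \<Longrightarrow> x \<in> U \<Longrightarrow> iter_partial xs f x = iter_partial ys f x"
proof (induction xs arbitrary: ys x)
  case (Cons a xs)
  then have "a \<in> set ys" by (metis list.set_intros(1) set_mset_mset)
  then obtain ys1 ys2 where ys: "ys = ys1 @ a # ys2" by (meson split_list)
  have "iter_partial (a # xs) f x = iter_partial [a] (iter_partial xs f) x" by simp
  also have "\<dots> = iter_partial [a] (iter_partial (ys1 @ ys2) f) x"
    using Cons ys by (intro iter_partial_cong[OF U]) auto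
  also have "\<dots> = iter_partial ys f x" using iter_partial_move[OF U f Cons.prems(2), of ys1 a ys2] ys by simp
  finally show ?case .
qed simp

text \<open>Geometric growth without factorials: if it holds at a point, the Taylor series there
  converges everywhere. The bound is kept pointwise because the constant is at first known at single
  points only.\<close>

definition deriv_bnd :: "(real^'d::finite \<Rightarrow> real) set \<Rightarrow> real \<Rightarrow> real^'d \<Rightarrow> bool" where
  "deriv_bnd F K x \<longleftrightarrow> (\<forall>f\<in>F. \<forall>is. \<bar>iter_partial is f x\<bar> \<le> K ^ (length is + 1))"

lemma deriv_bnd_mono: "deriv_bnd F K x \<Longrightarrow> 0 \<le> K \<Longrightarrow> K \<le> L \<Longrightarrow> deriv_bnd F L x"
  unfolding deriv_bnd_def by (meson order_trans power_mono)

fun line_deriv :: "real^'d::finite \<Rightarrow> (real^'d \<Rightarrow> real) \<Rightarrow> nat \<Rightarrow> 'd list \<Rightarrow> real^'d \<Rightarrow> real" where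
  "line_deriv v f 0 is y = iter_partial is f y"
| "line_deriv v f (Suc m) is y = (\<Sum>j\<in>UNIV. v $ j * line_deriv v f m (j # is) y)"

lemma line_deriv_derivative:
  assumes "open U" "smooth_on U f" "a + t *\<^sub>R v \<in> U"
  shows "((\<lambda>t. line_deriv v f m is (a + t *\<^sub>R v)) has_real_derivative line_deriv v f (Suc m) is (a + t *\<^sub>R v)) (at t)"
proof (induction m arbitrary: "is")
  case 0
  then show ?case using smooth_on_line_derivative[OF assms] by simp
next
  case (Suc m)
  have "((\<lambda>t. \<Sum>j\<in>UNIV. v $ j * line_deriv v f m (j # is) (a + t *\<^sub>R v)) has_real_derivative
     (\<Sum>j\<in>UNIV. v $ j * line_deriv v f (Suc m) (j # is) (a + t *\<^sub>R v))) (at t)"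
    by (intro DERIV_sum DERIV_cmult Suc)
  then show ?case by simp
qed

lemma line_deriv_bound:
  assumes "\<And>is. \<bar>iter_partial is f y\<bar> \<le> B * K ^ length is"
  shows "\<bar>line_deriv v f m is y\<bar> \<le> (\<Sum>j\<in>UNIV. \<bar>v $ j\<bar>) ^ m * (B * K ^ (m + length is))"
proof (induction m arbitrary: "is")
  case 0
  then show ?case using assms by simp
next
  case (Suc m)
  have "\<bar>line_deriv v f (Suc m) is y\<bar> \<le> (\<Sum>j\<in>UNIV. \<bar>v $ j\<bar> * \<bar>line_deriv v f m (j # is) y\<bar>)"
    using sum_abs[of "\<lambda>j. v $ j * line_deriv v f m (j # is) y" UNIV] by (simp add: abs_mult)
  also have "\<dots> \<le> (\<Sum>j\<in>UNIV. \<bar>v $ j\<bar> * ((\<Sum>j\<in>UNIV. \<bar>v $ j\<bar>) ^ m * (B * K ^ (Suc m + length is))))"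
    using Suc.IH[of "_ # is"] by (intro sum_mono mult_left_mono) auto
  also have "\<dots> = (\<Sum>j\<in>UNIV. \<bar>v $ j\<bar>) * ((\<Sum>j\<in>UNIV. \<bar>v $ j\<bar>) ^ m * (B * K ^ (Suc m + length is)))"
    by (rule sum_distrib_right[symmetric])
  finally show ?case by (simp only: power_Suc mult.assoc)
qed

text \<open>An expansion at \<open>c\<close> whose remainder tends to zero, whatever the constants in \<open>far\<close>.\<close>

lemma taylor_transport:
  assumes U: "open U" and f: "smooth_on U f" and M: "0 \<le> M"
    and seg: "\<And>t. t \<in> {0..1} \<Longrightarrow> t \<in> closed_segment c s \<Longrightarrow> a + t *\<^sub>R v \<in> U" and cs: "c \<in> {0..1}" "s \<in> {0..1}"
    and near: "\<And>is. \<bar>iter_partial is f (a + c *\<^sub>R v)\<bar> \<le> M ^ (length is + 1)"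
    and far: "\<And>t is. t \<in> open_segment c s \<Longrightarrow> \<bar>iter_partial is f (a + t *\<^sub>R v)\<bar> \<le> B * K ^ length is"
  shows "\<bar>iter_partial is f (a + s *\<^sub>R v)\<bar> \<le> M ^ (length is + 1) * exp ((\<Sum>j\<in>UNIV. \<bar>v $ j\<bar>) * M)"
proof -
  define w where "w = (\<Sum>j\<in>UNIV. \<bar>v $ j\<bar>)"
  have w: "0 \<le> w" by (simp add: w_def sum_nonneg)
  define C where "C = M ^ (length is + 1) * exp (w * M)"
  have C1: "M ^ (length is + 1) \<le> C"
    using mult_left_mono[of 1 "exp (w * M)" "M ^ (length is + 1)"] w M by (simp add: C_def)
  show ?thesis
  proof (cases "s = c")
    case True
    then show ?thesis using near[of "is"] C1 by (simp add: C_def w_def)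
  next
    case False
    have "\<bar>iter_partial is f (a + s *\<^sub>R v)\<bar> \<le> C + B * K ^ length is * ((w * K) ^ n / fact n)" if n: "0 < n" for n
    proof -
      define lo where "lo = min c s"
      define hi where "hi = max c s"
      have "\<exists>t. (if s < c then s < t \<and> t < c else c < t \<and> t < s) \<and>
        iter_partial is f (a + s *\<^sub>R v) = (\<Sum>m<n. line_deriv v f m is (a + c *\<^sub>R v) / fact m * (s - c) ^ m) +
           line_deriv v f n is (a + t *\<^sub>R v) / fact n * (s - c) ^ n"
      proof (rule Taylor[where a = lo and b = hi and diff = "\<lambda>m t. line_deriv v f m is (a + t *\<^sub>R v)", OF n])
        show "\<forall>m t. m < n \<and> lo \<le> t \<and> t \<le> hi \<longrightarrow>
          DERIV (\<lambda>t. line_deriv v f m is (a + t *\<^sub>R v)) t :> line_deriv v f (Suc m) is (a + t *\<^sub>R v)"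
        proof (intro allI impI)
          fix m t assume "m < n \<and> lo \<le> t \<and> t \<le> hi"
          then have "t \<in> {0..1}" "t \<in> closed_segment c s"
            using cs by (auto simp: lo_def hi_def closed_segment_eq_real_ivl)
          then show "DERIV (\<lambda>t. line_deriv v f m is (a + t *\<^sub>R v)) t :> line_deriv v f (Suc m) is (a + t *\<^sub>R v)"
            by (intro line_deriv_derivative[OF U f] seg)
        qed
      qed (use False in \<open>auto simp: lo_def hi_def\<close>)
      then obtain t where t: "t \<in> open_segment c s" and eq: "iter_partial is f (a + s *\<^sub>R v) =
         (\<Sum>m<n. line_deriv v f m is (a + c *\<^sub>R v) / fact m * (s - c) ^ m) +
           line_deriv v f n is (a + t *\<^sub>R v) / fact n * (s - c) ^ n"
        using False by (auto simp: open_segment_eq_real_ivl split: if_splits)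
      have sc: "\<bar>s - c\<bar> ^ m \<le> 1" for m using cs by (intro power_le_one) auto
      have near': "\<bar>iter_partial is f (a + c *\<^sub>R v)\<bar> \<le> M * M ^ length is" for "is" using near[of "is"] by simp
      have main: "\<bar>line_deriv v f m is (a + c *\<^sub>R v) / fact m * (s - c) ^ m\<bar> \<le> M ^ (length is + 1) * ((w * M) ^ m / fact m)" for m
      proof -
        have "\<bar>line_deriv v f m is (a + c *\<^sub>R v) / fact m * (s - c) ^ m\<bar> = \<bar>line_deriv v f m is (a + c *\<^sub>R v)\<bar> / fact m * \<bar>s - c\<bar> ^ m"
          by (simp add: abs_mult power_abs)
        also have "\<dots> \<le> \<bar>line_deriv v f m is (a + c *\<^sub>R v)\<bar> / fact m * 1"
          by (intro mult_left_mono sc) simp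
        also have "\<dots> \<le> w ^ m * (M * M ^ (m + length is)) / fact m"
          using line_deriv_bound[OF near', of v m "is"] by (simp add: w_def divide_right_mono)
        finally show ?thesis by (simp add: power_add power_mult_distrib mult_ac)
      qed
      have rest: "\<bar>line_deriv v f n is (a + t *\<^sub>R v) / fact n * (s - c) ^ n\<bar> \<le> B * K ^ length is * ((w * K) ^ n / fact n)"
      proof -
        have "\<bar>line_deriv v f n is (a + t *\<^sub>R v) / fact n * (s - c) ^ n\<bar> = \<bar>line_deriv v f n is (a + t *\<^sub>R v)\<bar> / fact n * \<bar>s - c\<bar> ^ n"
          by (simp add: abs_mult power_abs)
        also have "\<dots> \<le> \<bar>line_deriv v f n is (a + t *\<^sub>R v)\<bar> / fact n * 1"
          by (intro mult_left_mono sc) simp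
        also have "\<dots> \<le> w ^ n * (B * K ^ (n + length is)) / fact n"
          using line_deriv_bound[OF far[OF t], of v n "is"] by (simp add: w_def divide_right_mono)
        finally show ?thesis by (simp add: power_add power_mult_distrib mult_ac)
      qed
      have "\<bar>\<Sum>m<n. line_deriv v f m is (a + c *\<^sub>R v) / fact m * (s - c) ^ m\<bar> \<le> (\<Sum>m<n. M ^ (length is + 1) * ((w * M) ^ m / fact m))"
        by (rule order_trans[OF sum_abs sum_mono[OF main]])
      also have "\<dots> = M ^ (length is + 1) * (\<Sum>m<n. (w * M) ^ m /\<^sub>R fact m)"
        by (simp add: sum_distrib_left divide_inverse mult_ac)
      also have "\<dots> \<le> C"
        unfolding C_def exp_def using w M
        by (intro mult_left_mono sum_le_suminf[OF summable_exp_generic]) auto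
      finally show ?thesis using rest unfolding eq by linarith
    qed
    then have ev: "\<forall>\<^sub>F n in sequentially. \<bar>iter_partial is f (a + s *\<^sub>R v)\<bar> \<le> C + B * K ^ length is * ((w * K) ^ n / fact n)"
      using eventually_gt_at_top[of 0] by (rule eventually_mono[rotated])
    have "(\<lambda>n. C + B * K ^ length is * ((w * K) ^ n / fact n)) \<longlonglongrightarrow> C + B * K ^ length is * 0"
      using summable_LIMSEQ_zero[OF summable_exp_generic[of "w * K"]] by (intro tendsto_intros) (simp add: divide_inverse mult.commute)
    then have "\<bar>iter_partial is f (a + s *\<^sub>R v)\<bar> \<le> C + B * K ^ length is * 0"
      by (rule tendsto_lowerbound[OF _ ev]) simp
    then show ?thesis by (simp add: C_def w_def)
  qed
qed

section \<open>Local boundedness of the constants in the derivative bounds\<close>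

context
  fixes U :: "(real^'d::finite) set" and F :: "(real^'d \<Rightarrow> real) set"
  assumes U: "open U" and sm: "\<And>f. f \<in> F \<Longrightarrow> smooth_on U f"
    and bnd: "\<And>x. x \<in> U \<Longrightarrow> \<exists>K>0. deriv_bnd F K x"
begin

definition tame :: "(real^'d) set" where
  "tame = {x. \<exists>r>0. \<exists>K\<ge>1. ball x r \<subseteq> U \<and> (\<forall>y\<in>ball x r. deriv_bnd F K y)}"

lemma open_tame: "open tame"
proof -
  have "ball x r \<subseteq> tame" if "0 < r" "1 \<le> K" "ball x r \<subseteq> U" "\<forall>y\<in>ball x r. deriv_bnd F K y" for x r K
  proof
    fix z assume z: "z \<in> ball x r"
    have "ball z (r - dist x z) \<subseteq> ball x r"
    proof
      fix y assume "y \<in> ball z (r - dist x z)"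
      then show "y \<in> ball x r" using dist_triangle[of x y z] by simp
    qed
    then show "z \<in> tame" unfolding tame_def using z that
      by (intro CollectI exI[of _ "r - dist x z"] conjI exI[of _ K]) auto
  qed
  note sub = this
  have "\<exists>r>0. ball x r \<subseteq> tame" if x: "x \<in> tame" for x
  proof -
    obtain r K where rK: "0 < r" "1 \<le> K" "ball x r \<subseteq> U" "\<forall>y\<in>ball x r. deriv_bnd F K y"
      using x unfolding tame_def by auto
    show ?thesis using sub[OF rK] rK(1) by blast
  qed
  then show ?thesis by (simp add: open_contains_ball)
qed

lemma compact_tame:
  assumes "compact C" "C \<subseteq> tame"
  shows "\<exists>K\<ge>1. \<forall>x\<in>C. deriv_bnd F K x"
proof -
  have "\<forall>x\<in>C. \<exists>r>0. \<exists>K\<ge>1. \<forall>y\<in>ball x r. deriv_bnd F K y" using assms(2) unfolding tame_def by blast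
  then obtain r K where rK: "\<And>x. x \<in> C \<Longrightarrow> 0 < r x" "\<And>x. x \<in> C \<Longrightarrow> 1 \<le> K x" "\<And>x y. x \<in> C \<Longrightarrow> y \<in> ball x (r x) \<Longrightarrow> deriv_bnd F (K x) y"
    by metis
  have "C \<subseteq> (\<Union>x\<in>C. ball x (r x))" using rK(1) by auto
  then obtain D where D: "D \<subseteq> C" "finite D" "C \<subseteq> (\<Union>x\<in>D. ball x (r x))"
    using compactE_image[OF assms(1), of C "\<lambda>x. ball x (r x)"] by auto
  have K0: "0 \<le> K x" if "x \<in> D" for x using rK(2)[of x] D(1) that by force
  define L where "L = 1 + (\<Sum>x\<in>D. K x)"
  have "deriv_bnd F L y" if y: "y \<in> C" for y
  proof -
    obtain x where x: "x \<in> D" "y \<in> ball x (r x)" using D y by auto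
    have "K x \<le> (\<Sum>x\<in>D. K x)" using D(2) x K0 by (intro member_le_sum) auto
    then show ?thesis using rK(2,3)[of x] x D by (intro deriv_bnd_mono[of F "K x" y L]) (auto simp: L_def)
  qed
  moreover have "1 \<le> L" unfolding L_def using sum_nonneg[of D K] K0 by simp
  ultimately show ?thesis by blast
qed

lemma closed_deriv_bnd:
  assumes "closed S" "S \<subseteq> U"
  shows "closed {x \<in> S. deriv_bnd F K x}"
proof -
  have "{x \<in> S. deriv_bnd F K x} = S \<inter> (\<Inter>f\<in>F. \<Inter>is. {x \<in> S. \<bar>iter_partial is f x\<bar> \<le> K ^ (length is + 1)})"
    by (auto simp: deriv_bnd_def)
  moreover have "closed {x \<in> S. \<bar>iter_partial is f x\<bar> \<le> K ^ (length is + 1)}" if f: "f \<in> F" for f "is"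
  proof -
    have "continuous_on S (iter_partial is f)"
    proof (rule continuous_at_imp_continuous_on, rule ballI)
      fix x assume "x \<in> S"
      then show "isCont (iter_partial is f) x"
        using smooth_on_iter_partial_derivative[OF U sm[OF f], of x "is"] assms(2) has_derivative_continuous by blast
    qed
    then have "continuous_on S (\<lambda>x. \<bar>iter_partial is f x\<bar>)" by (intro continuous_intros)
    from continuous_closed_preimage[OF this assms(1), of "{..K ^ (length is + 1)}"]
    have "closed (S \<inter> (\<lambda>x. \<bar>iter_partial is f x\<bar>) -` {..K ^ (length is + 1)})" by simp
    moreover have "S \<inter> (\<lambda>x. \<bar>iter_partial is f x\<bar>) -` {..K ^ (length is + 1)} = {x \<in> S. \<bar>iter_partial is f x\<bar> \<le> K ^ (length is + 1)}"
      by auto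
    ultimately show ?thesis by simp
  qed
  ultimately show ?thesis using assms(1) by (auto intro!: closed_INT closed_Int)
qed

text \<open>The half-open segment from a tame point to a point where the bound holds with constant \<open>k\<close>:
  first the bound at \<open>x\<close> is carried over to the whole segment, then the bound at \<open>a\<close> back to \<open>x\<close>.\<close>

lemma bound_from_segment_end:
  assumes a: "a \<in> U" "deriv_bnd F k a" "1 \<le> k"
    and seg: "\<And>t. t \<in> {0<..1} \<Longrightarrow> a + t *\<^sub>R (x - a) \<in> tame"
  shows "deriv_bnd F (k * exp (k * (\<Sum>j\<in>UNIV. \<bar>(x - a) $ j\<bar>))) x"
proof -
  define v where "v = x - a"
  define w where "w = (\<Sum>j\<in>UNIV. \<bar>v $ j\<bar>)"
  have w0: "0 \<le> w" by (simp add: w_def sum_nonneg)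
  have tU: "tame \<subseteq> U"
  proof
    fix y assume "y \<in> tame"
    then obtain r where "0 < r" "ball y r \<subseteq> U" unfolding tame_def by blast
    then show "y \<in> U" by (meson centre_in_ball subsetD)
  qed
  have segU: "a + t *\<^sub>R v \<in> U" if "t \<in> {0..1}" for t
    using seg[of t] a(1) tU that by (cases "t = 0") (auto simp: v_def)
  have ax: "a + 1 *\<^sub>R v = x" by (simp add: v_def)
  have "x \<in> U" using segU[of 1] ax by simp
  then obtain M where M: "M > 0" "deriv_bnd F M x" using bnd by blast
  have *: "\<bar>iter_partial is f (a + s *\<^sub>R v)\<bar> \<le> M ^ (length is + 1) * exp (w * M)" if s: "s \<in> {0<..1}" and f: "f \<in> F" for s f "is"
  proof -
    have "compact ((\<lambda>t. a + t *\<^sub>R v) ` {s..1})" by (intro compact_continuous_image continuous_intros) auto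
    moreover have "(\<lambda>t. a + t *\<^sub>R v) ` {s..1} \<subseteq> tame" using seg s by (auto simp: v_def)
    ultimately obtain K where K: "1 \<le> K" "\<And>t. t \<in> {s..1} \<Longrightarrow> deriv_bnd F K (a + t *\<^sub>R v)"
      using compact_tame by (metis imageI)
    show ?thesis
      unfolding w_def
    proof (rule taylor_transport[OF U sm[OF f], where c = 1 and B = K and K = K])
      show "\<bar>iter_partial is f (a + 1 *\<^sub>R v)\<bar> \<le> M ^ (length is + 1)" for "is"
        using M(2) f unfolding ax deriv_bnd_def by blast
      fix t :: real and "is" :: "'d list" assume "t \<in> open_segment 1 s"
      then have "t \<in> {s..1}" using s by (auto simp: open_segment_eq_real_ivl split: if_splits)
      then show "\<bar>iter_partial is f (a + t *\<^sub>R v)\<bar> \<le> K * K ^ length is" using K(2) f unfolding deriv_bnd_def by fastforce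
    qed (use M s segU in auto)
  qed
  have "\<bar>iter_partial is f x\<bar> \<le> (k * exp (k * w)) ^ (length is + 1)" if f: "f \<in> F" for f "is"
  proof -
    have "\<bar>iter_partial is f (a + 1 *\<^sub>R v)\<bar> \<le> k ^ (length is + 1) * exp (w * k)"
      unfolding w_def
    proof (rule taylor_transport[OF U sm[OF f], where c = 0 and B = "M * exp (w * M)" and K = M])
      show "\<bar>iter_partial is f (a + 0 *\<^sub>R v)\<bar> \<le> k ^ (length is + 1)" for "is"
        using a(2) f unfolding deriv_bnd_def by simp
      fix t :: real and "is" :: "'d list" assume "t \<in> open_segment 0 1"
      then have "t \<in> {0<..1}" by (auto simp: open_segment_eq_real_ivl)
      from *[OF this f, of "is"] show "\<bar>iter_partial is f (a + t *\<^sub>R v)\<bar> \<le> M * exp (w * M) * M ^ length is" by (simp add: mult_ac)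
    qed (use a segU in auto)
    \<comment> \<open>The exponential is at least 1; raising it to the power
      \<open>length is + 1\<close> restores the form required by \<open>deriv_bnd\<close>.\<close>
    also have "\<dots> \<le> k ^ (length is + 1) * exp (k * w) ^ (length is + 1)"
      using a(3) w0 by (intro mult_left_mono) (simp_all add: mult.commute self_le_power)
    finally show ?thesis unfolding ax by (simp only: power_mult_distrib)
  qed
  then show ?thesis unfolding deriv_bnd_def w_def v_def by blast
qed

text \<open>Baire's theorem on the closure of the nontame points in a small ball: near some nontame
  \<open>a0\<close>, one constant \<open>k\<close> serves all nontame points. A tame point nearby
  inherits a bound from its nearest nontame point through \<open>bound_from_segment_end\<close>, so
  \<open>a0\<close> would be tame after all.\<close>

lemma all_tame: "U \<subseteq> tame"
proof (rule ccontr)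
  assume "\<not> U \<subseteq> tame"
  then obtain p where p: "p \<in> U" "p \<notin> tame" by blast
  obtain r where r: "0 < r" "cball p r \<subseteq> U" using U p(1) open_contains_cball by blast
  define S where "S = closure (ball p r - tame)"
  have "p \<in> ball p r - tame" using p r by simp
  then have "p \<in> S" unfolding S_def by (rule subsetD[OF closure_subset])
  have S: "closed S" unfolding S_def by simp
  have Sne: "S \<noteq> {}" using \<open>p \<in> S\<close> by blast
  have Sc: "S \<subseteq> cball p r" unfolding S_def by (rule closure_minimal) auto
  have SU: "S \<subseteq> U" using Sc r by blast
  have St: "S \<inter> tame = {}"
  proof -
    have "tame \<inter> closure (ball p r - tame) = {}" using open_Int_closure_eq_empty[OF open_tame] by blast
    then show ?thesis by (auto simp: S_def)
  qed
  define E where "E k = {x \<in> S. deriv_bnd F (real (Suc k)) x}" for k :: nat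
  have Ecl: "closed (E k)" for k unfolding E_def by (rule closed_deriv_bnd[OF S SU])
  have Ecov: "\<exists>k. x \<in> E k" if xS: "x \<in> S" for x
  proof -
    have "x \<in> U" using xS SU by blast
    then obtain K where K: "K > 0" "deriv_bnd F K x" using bnd by blast
    obtain k :: nat where "K \<le> real k" using real_arch_simple by blast
    then have "deriv_bnd F (real (Suc k)) x" using K by (intro deriv_bnd_mono[OF K(2)]) auto
    then show ?thesis using xS by (auto simp: E_def)
  qed
  have "\<exists>k. \<not> S \<subseteq> closure (S - E k)"
  proof (rule ccontr)
    assume "\<not> ?thesis"
    then have d: "S \<subseteq> closure (S - E k)" for k by blast
    have "S \<subseteq> closure (\<Inter>(range (\<lambda>k. S - E k)))"
    proof (rule Baire[OF S])
      fix T assume "T \<in> range (\<lambda>k. S - E k)"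
      then obtain k where T: "T = S - E k" by blast
      have "openin (top_of_set S) (S - E k)"
        proof -
        have "S - E k = S \<inter> - E k" by auto
        then show ?thesis using Ecl[of k] by (auto intro: openin_open_Int)
      qed
      then show "openin (top_of_set S) T \<and> S \<subseteq> closure T" using d T by simp
    qed simp
    moreover have "\<Inter>(range (\<lambda>k. S - E k)) = {}" using Ecov by fastforce
    ultimately have "S \<subseteq> closure {}" by (simp only:)
    then show False using Sne by simp
  qed
  then obtain k x where kx: "x \<in> S" "x \<notin> closure (S - E k)" by blast
  then obtain e where e: "0 < e" "\<And>y. y \<in> S - E k \<Longrightarrow> e \<le> dist y x"
    unfolding closure_approachable by (meson not_less)
  obtain a0 where a0: "a0 \<in> ball p r - tame" "dist a0 x < e"
    using kx(1) e(1) unfolding S_def closure_approachable by blast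
  \<comment> \<open>The ball around \<open>a0\<close> stays inside the ball around \<open>p\<close>
    and within distance \<open>e\<close> of \<open>x\<close>, where all points of \<open>S\<close>
    belong to \<open>E k\<close>.\<close>
  define \<rho> where "\<rho> = min (r - dist p a0) (e - dist a0 x)"
  have \<rho>: "0 < \<rho>" using a0 by (auto simp: \<rho>_def)
  have inE: "y \<in> E k" if "y \<in> ball a0 \<rho>" "y \<notin> tame" for y
  proof -
    have "y \<in> ball p r" using that dist_triangle[of p y a0] by (auto simp: \<rho>_def)
    then have "y \<in> S" using that(2) closure_subset by (force simp: S_def)
    moreover have "dist y x < e" using that dist_triangle[of y x a0] by (auto simp: \<rho>_def dist_commute)
    ultimately show ?thesis using e(2)[of y] by fastforce
  qed
  have \<rho>U: "ball a0 \<rho> \<subseteq> U"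
  proof
    fix y assume "y \<in> ball a0 \<rho>"
    then have "y \<in> cball p r" using dist_triangle[of p y a0] by (auto simp: \<rho>_def)
    then show "y \<in> U" using r by blast
  qed
  define \<kappa> where "\<kappa> = real (Suc k)"
  define K where "K = \<kappa> * exp (\<kappa> * (real CARD('d) * \<rho>))"
  have \<kappa>: "1 \<le> \<kappa>" by (simp add: \<kappa>_def)
  have K1: "\<kappa> \<le> K" unfolding K_def using \<kappa> \<rho> by (intro mult_le_cancel_left1[THEN iffD2]) auto
  have "deriv_bnd F K x" if x: "x \<in> ball a0 (\<rho> / 2)" for x
  proof (cases "x \<in> tame")
    case False
    then have "deriv_bnd F \<kappa> x" using inE[of x] x \<rho> by (auto simp: E_def \<kappa>_def)
    then show ?thesis using K1 \<kappa> by (intro deriv_bnd_mono[of F \<kappa> x K]) auto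
  next
    case True
    \<comment> \<open>The radius lies between \<open>\<rho> / 2\<close>, where \<open>x\<close> is,
      and \<open>\<rho>\<close>, where \<open>inE\<close> applies. As \<open>a0\<close> belongs to
      \<open>Q\<close>, the nearest point \<open>a\<close> is closer to \<open>x\<close> than
      \<open>\<rho> / 2\<close>.\<close>
    define Q where "Q = cball a0 (3 * \<rho> / 4) - tame"
    have "closed Q" unfolding Q_def using open_tame by (intro closed_Diff) auto
    moreover have "a0 \<in> Q" using a0 \<rho> by (auto simp: Q_def)
    ultimately obtain a where a: "a \<in> Q" "\<And>y. y \<in> Q \<Longrightarrow> dist x a \<le> dist x y"
      using distance_attains_inf[of Q x] by blast
    have xa: "dist x a < \<rho> / 2" using a(2)[OF \<open>a0 \<in> Q\<close>] x by (simp add: dist_commute)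
    have aE: "a \<in> E k" using a(1) \<rho> by (intro inE) (auto simp: Q_def)
    \<comment> \<open>A nontame point of the segment would lie in \<open>Q\<close>, by convexity of
      the ball, and be nearer to \<open>x\<close> than \<open>a\<close>.\<close>
    have "a + t *\<^sub>R (x - a) \<in> tame" if t: "t \<in> {0<..1}" for t
    proof (rule ccontr)
      assume nt: "a + t *\<^sub>R (x - a) \<notin> tame"
      define y where "y = a + t *\<^sub>R (x - a)"
      have "x - y = (1 - t) *\<^sub>R (x - a)" by (simp add: y_def algebra_simps)
      then have d: "dist x y = (1 - t) * dist x a" using t by (simp add: dist_norm)
      have xna: "dist x a > 0" using True a(1) by (auto simp: Q_def)
      show False
      proof (cases "y \<in> cball a0 (3 * \<rho> / 4)")
        case True
        then have "dist x a \<le> dist x y" using nt by (intro a(2)) (auto simp: Q_def y_def)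
        then show False using d xna t by (simp add: mult_le_cancel_right1)
      next
        case False
        have "a \<in> cball a0 (3 * \<rho> / 4)" "x \<in> cball a0 (3 * \<rho> / 4)" using a(1) x \<rho> by (auto simp: Q_def)
        moreover have "y = (1 - t) *\<^sub>R a + t *\<^sub>R x" by (simp add: y_def algebra_simps)
        ultimately have "y \<in> cball a0 (3 * \<rho> / 4)" using convexD_alt[OF convex_cball, of a a0 "3 * \<rho> / 4" x t] t by auto
        then show False using False by simp
      qed
    qed
    then have "deriv_bnd F (\<kappa> * exp (\<kappa> * (\<Sum>j\<in>UNIV. \<bar>(x - a) $ j\<bar>))) x"
      using aE SU \<kappa> by (intro bound_from_segment_end) (auto simp: E_def \<kappa>_def)
    moreover have "\<kappa> * exp (\<kappa> * (\<Sum>j\<in>UNIV. \<bar>(x - a) $ j\<bar>)) \<le> K"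
    proof -
      have "(\<Sum>j\<in>UNIV. \<bar>(x - a) $ j\<bar>) \<le> (\<Sum>j\<in>(UNIV :: 'd set). \<rho>)"
        using component_le_norm_cart[of "x - a"] xa \<rho> unfolding dist_norm by (intro sum_mono) (smt (verit) field_sum_of_halves)
      then show ?thesis unfolding K_def using \<kappa> by (intro mult_left_mono) auto
    qed
    ultimately show ?thesis using \<kappa> by (intro deriv_bnd_mono[of F _ x K]) auto
  qed
  moreover have "ball a0 (\<rho> / 2) \<subseteq> U" using \<rho>U \<rho> by (auto intro: subset_trans[OF subset_ball])
  moreover have "1 \<le> K" "0 < \<rho> / 2" using K1 \<kappa> \<rho> by simp_all
  ultimately have "a0 \<in> tame" unfolding tame_def by blast
  then show False using a0 by simp
qed

text \<open>One number controls the distance to the complement of \<open>U\<close>, the constant of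
  the derivative bound and the ball on which it holds. The supremum need not be attained; half of it
  lies strictly below an admissible value.\<close>

definition radius :: "real^'d \<Rightarrow> real" where
  "radius x = Sup {\<rho>. 0 < \<rho> \<and> \<rho> \<le> 1 \<and> ball x \<rho> \<subseteq> U \<and> (\<forall>y\<in>ball x \<rho>. deriv_bnd F (1 / \<rho>) y)} / 2"

lemma radius_facts:
  assumes x: "x \<in> U"
  shows "0 < radius x" "radius x \<le> 1" "ball x (radius x) \<subseteq> U"
    "\<And>y. y \<in> ball x (radius x) \<Longrightarrow> deriv_bnd F (1 / radius x) y"
    "\<And>y. y \<in> U \<Longrightarrow> radius x - dist x y \<le> radius y"
proof -
  define A where "A x = {\<rho>. 0 < \<rho> \<and> \<rho> \<le> 1 \<and> ball x \<rho> \<subseteq> U \<and> (\<forall>y\<in>ball x \<rho>. deriv_bnd F (1 / \<rho>) y)}" for x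
  have ne: "A x \<noteq> {}" if "x \<in> U" for x
  proof -
    have "x \<in> tame" using all_tame that by blast
    then obtain r K where r: "0 < r" "1 \<le> K" "ball x r \<subseteq> U" "\<forall>y\<in>ball x r. deriv_bnd F K y"
      unfolding tame_def by auto
    define \<rho> where "\<rho> = min r (1 / K)"
    have "1 / K \<le> 1" "0 < 1 / K" using r(2) by simp_all
    then have "0 < \<rho>" "\<rho> \<le> 1" "\<rho> \<le> r" "\<rho> \<le> 1 / K" using r(1) unfolding \<rho>_def by linarith+
    moreover from this have "K \<le> 1 / \<rho>" using r(2) by (simp add: field_simps)
    moreover have "deriv_bnd F (1 / \<rho>) y" if "y \<in> ball x \<rho>" for y
      using r that \<open>\<rho> \<le> r\<close> \<open>K \<le> 1 / \<rho>\<close> by (intro deriv_bnd_mono[of F K y "1 / \<rho>"]) auto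
    ultimately have "\<rho> \<in> A x" using r(3) by (auto simp: A_def)
    then show ?thesis by blast
  qed
  have bdd: "bdd_above (A x)" for x by (auto simp: A_def intro!: bdd_aboveI[of _ 1])
  have R: "radius x = Sup (A x) / 2" for x by (simp add: radius_def A_def)
  have pos: "0 < Sup (A x)" if xU: "x \<in> U" for x
  proof -
    obtain \<rho> where "\<rho> \<in> A x" using ne[OF xU] by blast
    then show ?thesis using cSup_upper[OF _ bdd, of \<rho> x] by (auto simp: A_def)
  qed
  show R0: "0 < radius x" using pos[OF x] by (simp add: R)
  have "Sup (A x) \<le> 1" using ne[OF x] by (rule cSup_least) (auto simp: A_def)
  then show "radius x \<le> 1" using pos[OF x] by (simp add: R)
  have "radius x < Sup (A x)" using pos[OF x] by (simp add: R)
  then obtain \<rho> where \<rho>: "\<rho> \<in> A x" "radius x < \<rho>" using less_cSup_iff[OF ne[OF x] bdd] by blast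
  then show "ball x (radius x) \<subseteq> U" using \<rho> by (auto simp: A_def)
  show "deriv_bnd F (1 / radius x) y" if "y \<in> ball x (radius x)" for y
  proof -
    have \<rho>0: "0 < \<rho>" "\<forall>y\<in>ball x \<rho>. deriv_bnd F (1 / \<rho>) y" using \<rho>(1) unfolding A_def by blast+
    have "y \<in> ball x \<rho>" using that \<rho>(2) by simp
    then have b: "deriv_bnd F (1 / \<rho>) y" using \<rho>0(2) by blast
    have le: "1 / \<rho> \<le> 1 / radius x" using \<rho>(2) R0 by (simp add: frac_le)
    have "0 \<le> 1 / \<rho>" using \<rho>0(1) by simp
    then show ?thesis by (rule deriv_bnd_mono[OF b _ le])
  qed
  fix y assume y: "y \<in> U"
  \<comment> \<open>A ball that is admissible at \<open>x\<close>, shrunk by the distance of the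
    centers, is admissible at \<open>y\<close>: a smaller radius also relaxes the bound asked
    for.\<close>
  have "\<rho> \<le> Sup (A y) + dist x y" if \<rho>: "\<rho> \<in> A x" for \<rho>
  proof (cases "dist x y < \<rho>")
    case True
    have "ball y (\<rho> - dist x y) \<subseteq> ball x \<rho>"
    proof
      fix z assume "z \<in> ball y (\<rho> - dist x y)"
      then show "z \<in> ball x \<rho>" using dist_triangle[of x z y] by simp
    qed
    moreover have "deriv_bnd F (1 / (\<rho> - dist x y)) z" if "deriv_bnd F (1 / \<rho>) z" for z
    proof (rule deriv_bnd_mono[OF that])
      have "0 < \<rho>" using \<rho> by (simp add: A_def)
      then show "0 \<le> 1 / \<rho>" "1 / \<rho> \<le> 1 / (\<rho> - dist x y)"
        using True by (auto intro: frac_le)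
    qed
    moreover have "\<rho> - dist x y \<le> 1" "0 < \<rho> - dist x y"
    proof -
      have "\<rho> \<le> 1" using \<rho> by (simp add: A_def)
      then show "\<rho> - dist x y \<le> 1" using zero_le_dist[of x y] by linarith
    qed (use True in simp)
    moreover have "ball x \<rho> \<subseteq> U" "\<And>z. z \<in> ball x \<rho> \<Longrightarrow> deriv_bnd F (1 / \<rho>) z" using \<rho> by (simp_all add: A_def)
    ultimately have "\<rho> - dist x y \<in> A y" unfolding A_def by blast
    then show ?thesis using cSup_upper[OF _ bdd, of "\<rho> - dist x y" y] by simp
  next
    case False
    then show ?thesis using pos[OF y] by simp
  qed
  then have "Sup (A x) \<le> Sup (A y) + dist x y" using ne[OF x] by (intro cSup_least) auto
  then show "radius x - dist x y \<le> radius y" using zero_le_dist[of x y] unfolding R by (simp del: zero_le_dist)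
qed

end

section \<open>Curves with prescribed mean\<close>

text \<open>The kernel of \<open>mean_prim\<close> is \<open>s\<close> below \<open>u\<close> and
  \<open>s - 1\<close> above, of modulus at most 1; hence the split of the integral at
  \<open>u\<close>.\<close>

lemma mean_prim_bound:
  assumes g: "continuous_on {0..1} g" and b: "\<And>s. s \<in> {0..1} \<Longrightarrow> \<bar>g s\<bar> \<le> C" and u: "u \<in> {0..1}"
  shows "\<bar>mean_prim g u\<bar> \<le> C"
proof -
  have C: "0 \<le> C" using b[of 0] by simp
  have sg: "continuous_on {0..1} (\<lambda>s. s * g s)" by (intro continuous_intros g)
  have i: "h integrable_on {0..u}" "h integrable_on {u..1}" if "continuous_on {0..1} h" for h :: "real \<Rightarrow> real"
    using u by (auto intro!: integrable_continuous_real continuous_on_subset[OF that])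
  have "integral {0..1} (\<lambda>s. s * g s) = integral {0..u} (\<lambda>s. s * g s) + integral {u..1} (\<lambda>s. s * g s)"
    using u by (intro Henstock_Kurzweil_Integration.integral_combine[symmetric] integrable_continuous_real sg) auto
  then have "mean_prim g u = integral {0..u} (\<lambda>s. s * g s) + integral {u..1} (\<lambda>s. s * g s - g s)"
    using i(2)[OF sg] i(2)[OF g] by (simp add: mean_prim_def Henstock_Kurzweil_Integration.integral_diff)
  moreover have "norm (integral {0..u} (\<lambda>s. s * g s)) \<le> C * (u - 0)"
  proof (intro integral_bound)
    show "continuous_on {0..u} (\<lambda>s. s * g s)" using u by (intro continuous_on_subset[OF sg]) auto
    fix s assume s: "s \<in> {0..u}"
    have "\<bar>s\<bar> * \<bar>g s\<bar> \<le> 1 * C" using s u b[of s] by (intro mult_mono) auto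
    then show "norm (s * g s) \<le> C" by (simp add: abs_mult)
  qed (use u in auto)
  moreover have "norm (integral {u..1} (\<lambda>s. s * g s - g s)) \<le> C * (1 - u)"
  proof (intro integral_bound)
    show "continuous_on {u..1} (\<lambda>s. s * g s - g s)"
      using u by (intro continuous_on_subset[OF continuous_on_diff[OF sg g]]) auto
    fix s assume s: "s \<in> {u..1}"
    have "s * g s - g s = - ((1 - s) * g s)" by (simp add: algebra_simps)
    moreover have "\<bar>(1 - s) * g s\<bar> \<le> 1 * C" using s u b[of s] unfolding abs_mult by (intro mult_mono) auto
    ultimately show "norm (s * g s - g s) \<le> C" by simp
  qed (use u in auto)
  ultimately show ?thesis by (simp add: algebra_simps)
qed

text \<open>Integration by parts with the factor \<open>s\<close>: the boundary value
  \<open>mean_prim g 1\<close> is just the first integral in the definition.\<close>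

lemma integral_mean_prim:
  assumes g: "continuous_on {0..1} g"
  shows "integral {0..1} (mean_prim g) = 0"
proof -
  have sg: "continuous_on {0..1} (\<lambda>s. s * g s)" by (intro continuous_intros g)
  have "((\<lambda>s. mean_prim g s + s * g s) has_integral (1 * mean_prim g 1 - 0 * mean_prim g 0)) {0..1}"
  proof (rule fundamental_theorem_of_calculus)
    fix x :: real assume "x \<in> {0..1}"
    then have "(mean_prim g has_real_derivative g x) (at x within {0..1})"
      using mean_prim_deriv[OF g] by (simp add: has_real_derivative_iff_has_vector_derivative)
    from DERIV_mult[OF DERIV_ident this]
    show "((\<lambda>s. s * mean_prim g s) has_vector_derivative mean_prim g x + x * g x) (at x within {0..1})"
      by (simp add: has_real_derivative_iff_has_vector_derivative[symmetric] mult.commute add.commute)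
  qed simp
  then have "integral {0..1} (\<lambda>s. mean_prim g s + s * g s) = mean_prim g 1" by (simp add: integral_unique)
  moreover have "integral {0..1} (\<lambda>s. mean_prim g s + s * g s) = integral {0..1} (mean_prim g) + integral {0..1} (\<lambda>s. s * g s)"
    by (intro Henstock_Kurzweil_Integration.integral_add integrable_continuous_real mean_prim_cont g sg)
  ultimately show ?thesis by (simp add: mean_prim_def)
qed

lemma mean_prim_diff:
  assumes "continuous_on {0..1} g" "continuous_on {0..1} h" "u \<in> {0..1}"
  shows "mean_prim (\<lambda>s. g s - h s) u = mean_prim g u - mean_prim h u"
proof -
  have "mean_prim (\<lambda>s. \<Sum>b\<in>{True, False}. (if b then g else h) s * (if b then 1 else -1)) u =
     (\<Sum>b\<in>{True, False}. mean_prim (if b then g else h) u * (if b then 1 else -1))"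
    using assms by (intro mean_prim_sum) auto
  then show ?thesis by simp
qed

lemma mean_prim_sums:
  fixes g :: "nat \<Rightarrow> real \<Rightarrow> real"
  assumes g: "\<And>n. continuous_on {0..1} (g n)" and b: "\<And>n s. s \<in> {0..1} \<Longrightarrow> \<bar>g n s\<bar> \<le> M n" and M: "summable M"
    and u: "u \<in> {0..1}"
  shows "continuous_on {0..1} (\<lambda>s. \<Sum>n. g n s)"
    "(\<lambda>n. mean_prim (g n) u) sums mean_prim (\<lambda>s. \<Sum>n. g n s) u"
proof -
  let ?G = "\<lambda>s. \<Sum>n. g n s"
  have ul: "uniform_limit {0..1} (\<lambda>n s. \<Sum>i<n. g i s) ?G sequentially"
    using b by (intro Weierstrass_m_test[OF _ M]) auto
  have pc: "continuous_on {0..1} (\<lambda>s. \<Sum>i<n. g i s)" for n by (intro continuous_on_sum g)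
  show G: "continuous_on {0..1} ?G"
    by (rule uniform_limit_theorem[OF _ ul]) (use pc in auto)
  have "(\<lambda>n. \<Sum>i<n. mean_prim (g i) u) \<longlonglongrightarrow> mean_prim ?G u"
    unfolding LIMSEQ_iff
  proof (intro allI impI)
    fix r :: real assume r: "0 < r"
    have "\<forall>\<^sub>F n in sequentially. \<forall>s\<in>{0..1}. dist (\<Sum>i<n. g i s) (?G s) < r / 2"
      using ul r unfolding uniform_limit_iff by (meson half_gt_zero)
    then obtain N where N: "\<And>n s. N \<le> n \<Longrightarrow> s \<in> {0..1} \<Longrightarrow> dist (\<Sum>i<n. g i s) (?G s) < r / 2"
      unfolding eventually_sequentially by blast
    have "norm ((\<Sum>i<n. mean_prim (g i) u) - mean_prim ?G u) < r" if n: "N \<le> n" for n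
    proof -
      have "(\<Sum>i<n. mean_prim (g i) u) = mean_prim (\<lambda>s. \<Sum>i<n. g i s) u"
        using mean_prim_sum[of "{..<n}" g u "\<lambda>_. 1"] g u by simp
      then have "(\<Sum>i<n. mean_prim (g i) u) - mean_prim ?G u = mean_prim (\<lambda>s. (\<Sum>i<n. g i s) - ?G s) u"
        using mean_prim_diff[OF pc G u] by simp
      moreover have "\<bar>mean_prim (\<lambda>s. (\<Sum>i<n. g i s) - ?G s) u\<bar> \<le> r / 2"
        using N[OF n] by (intro mean_prim_bound u continuous_on_diff pc G) (auto simp: dist_real_def less_imp_le)
      ultimately show ?thesis using r by simp
    qed
    then show "\<exists>no. \<forall>n\<ge>no. norm ((\<Sum>i<n. mean_prim (g i) u) - mean_prim ?G u) < r" by blast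
  qed
  then show "(\<lambda>n. mean_prim (g n) u) sums mean_prim ?G u" by (simp add: sums_def)
qed

lemma branch_family_bound:
  assumes "finite S" "\<forall>k\<in>S - {r}. \<rho> (fst (g k)) < (\<rho> k::nat)" "branch_family S r g F" "k \<in> S - {r}" "u \<in> {0..1}"
  shows "\<bar>F k u\<bar> \<le> 1"
  using assms(4,5)
proof (induction "Max (\<rho> ` S) - \<rho> k" arbitrary: k u rule: less_induct)
  case (less k)
  have c: "\<bar>F c v\<bar> \<le> 1" "continuous_on {0..1} (F c)" if c: "c \<in> kids S r g k" "v \<in> {0..1}" for c v
  proof -
    have cS: "c \<in> S - {r}" using c by (auto simp: kids_def)
    then have "\<rho> k < \<rho> c" using c assms(2) by (auto simp: kids_def)
    moreover have "\<rho> c \<le> Max (\<rho> ` S)" using cS assms(1) by auto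
    ultimately show "\<bar>F c v\<bar> \<le> 1" using cS c(2) by (intro less.hyps) auto
    show "continuous_on {0..1} (F c)" by (rule branch_family_cont[OF assms(1-3) cS])
  qed
  have "F k u = mean_prim (\<lambda>u. \<Prod>c\<in>kids S r g k. F c u) u"
    using assms(3) less.prems unfolding branch_family_def by auto
  also have "\<bar>\<dots>\<bar> \<le> 1"
  proof (rule mean_prim_bound[OF _ _ less.prems(2)])
    show "continuous_on {0..1} (\<lambda>u. \<Prod>c\<in>kids S r g k. F c u)"
      using c(2)[of _ 0] by (intro continuous_on_prod) auto
    show "\<bar>\<Prod>c\<in>kids S r g k. F c s\<bar> \<le> 1" if "s \<in> {0..1}" for s
      unfolding abs_prod using c(1)[OF _ that] by (intro prod_le_1) auto
  qed
  finally show ?case .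
qed

lemma twt_bound:
  assumes "finite S" "g \<in> dtrees S r" "u \<in> {0..1}"
  shows "\<bar>twt S r g u\<bar> \<le> 1"
proof -
  obtain \<rho> where \<rho>: "\<forall>k\<in>S - {r}. \<rho> (fst (g k)) < (\<rho> k::nat)"
    using assms by (auto simp: dtrees_def)
  obtain F where F: "branch_family S r g F"
    using branch_family_exists[OF assms(1) \<rho>] by blast
  show ?thesis unfolding twt_eq[OF assms(1) \<rho> F] abs_prod
    using branch_family_bound[OF assms(1) \<rho> F _ assms(3)] by (intro prod_le_1) (auto simp: kids_def)
qed

lemma sum_card_kids:
  assumes "finite S" "g \<in> dtrees S r"
  shows "(\<Sum>k\<in>S. card (kids S r g k)) = card (S - {r})"
proof -
  have "(\<Sum>k\<in>S. card {c \<in> S - {r}. fst (g c) = k}) = card (S - {r})"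
  proof -
    have "fst ` g ` (S - {r}) \<subseteq> S" using assms(2) by (auto simp: dtrees_def PiE_iff mem_Times_iff)
    then have "(\<lambda>c. fst (g c)) ` (S - {r}) \<subseteq> S" by auto
    from sum.group[OF _ assms(1) this, of "\<lambda>_. 1::nat"] show ?thesis
      unfolding card_eq_sum using assms(1) by simp
  qed
  then show ?thesis by (simp add: kids_def)
qed

lemma card_dtrees: "finite S \<Longrightarrow> r \<in> S \<Longrightarrow>
  card (dtrees S r :: ('d::finite) decoration set) \<le> (card S * CARD('d)) ^ (card S - 1)"
proof -
  assume S: "finite S" "r \<in> S"
  have "card (dtrees S r :: ('d::finite) decoration set) \<le> card ((S - {r}) \<rightarrow>\<^sub>E S \<times> (UNIV :: 'd set))"
    using S by (intro card_mono finite_PiE) (auto simp: dtrees_def)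
  also have "\<dots> = (card S * CARD('d)) ^ (card S - 1)"
    using S by (subst card_PiE) (auto simp: card_cartesian_product)
  finally show ?thesis .
qed

text \<open>With d = \<open>CARD('d)\<close>, there are at most ((n + 1) d)^n trees, each of weight
  at most 1. The exponent of \<open>\<kappa>\<close> counts the vertices, the edges and the outside
  derivatives; \<open>power_self_le_fact\<close> turns the number of trees over n! into a geometric
  factor.\<close>

lemma th_bound:
  fixes dv :: "'d::finite multiset \<Rightarrow> 'd \<Rightarrow> real"
  assumes dv: "\<And>M i. \<bar>dv M i\<bar> \<le> P * \<kappa> ^ (size M + 1)" and P: "0 \<le> P" and \<kappa>: "0 \<le> \<kappa>" and u: "u \<in> {0..1}"
  shows "\<bar>th dv (Suc n) M i u\<bar> / fact n \<le> 3 * P * \<kappa> ^ (size M + 1) * (3 * real CARD('d) * P * \<kappa>\<^sup>2) ^ n"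
proof -
  let ?S = "{1..Suc n}"
  have sym: "\<bar>tsym dv ?S 1 g M i\<bar> \<le> P ^ Suc n * \<kappa> ^ (2 * n + 1 + size M)" if g: "g \<in> dtrees ?S 1" for g
  proof -
    have fk: "finite (kids ?S 1 g k)" for k by (rule finite_kids) simp
    have "\<bar>tsym dv ?S 1 g M i\<bar> \<le> (\<Prod>k\<in>?S. P * \<kappa> ^ (card (kids ?S 1 g k) + (if k = 1 then size M else 0) + 1))"
      unfolding tsym_def abs_prod
    proof (rule prod_mono, intro conjI)
      fix k
      show "\<bar>dv (image_mset (snd \<circ> g) (mset_set (kids ?S 1 g k)) + (if k = 1 then M else {#})) (if k = 1 then i else snd (g k))\<bar>
        \<le> P * \<kappa> ^ (card (kids ?S 1 g k) + (if k = 1 then size M else 0) + 1)"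
        by (rule order_trans[OF dv]) (simp add: fk)
    qed simp
    also have "\<dots> = P ^ card ?S * \<kappa> ^ (\<Sum>k\<in>?S. card (kids ?S 1 g k) + (if k = 1 then size M else 0) + 1)"
      by (simp only: prod.distrib prod_constant power_sum[symmetric])
    also have "(\<Sum>k\<in>?S. card (kids ?S 1 g k) + (if k = 1 then size M else 0) + 1) = 2 * n + 1 + size M"
    proof -
      have "(\<Sum>k\<in>?S. card (kids ?S 1 g k)) = n" using sum_card_kids[OF _ g] by simp
      then show ?thesis by (simp only: sum.distrib) (simp add: sum.delta)
    qed
    finally show ?thesis by simp
  qed
  have "\<bar>th dv (Suc n) M i u\<bar> \<le> (\<Sum>g\<in>(dtrees ?S 1 :: 'd decoration set). P ^ Suc n * \<kappa> ^ (2 * n + 1 + size M))"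
    unfolding th_def theta_def
  proof (rule order_trans[OF sum_abs sum_mono])
    fix g :: "'d decoration" assume g: "g \<in> dtrees ?S 1"
    have "\<bar>twt ?S 1 g u\<bar> * \<bar>tsym dv ?S 1 g M i\<bar> \<le> 1 * (P ^ Suc n * \<kappa> ^ (2 * n + 1 + size M))"
      using twt_bound[OF _ g u] sym[OF g] by (intro mult_mono) auto
    then show "\<bar>twt ?S 1 g u * tsym dv ?S 1 g M i\<bar> \<le> P ^ Suc n * \<kappa> ^ (2 * n + 1 + size M)"
      by (simp add: abs_mult)
  qed
  also have "\<dots> = real (card (dtrees ?S 1 :: 'd decoration set)) * (P ^ Suc n * \<kappa> ^ (2 * n + 1 + size M))"
    by simp
  also have "\<dots> \<le> (real (Suc n) * real CARD('d)) ^ n * (P ^ Suc n * \<kappa> ^ (2 * n + 1 + size M))"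
  proof (intro mult_right_mono)
    have "card (dtrees ?S 1 :: 'd decoration set) \<le> (Suc n * CARD('d)) ^ n"
      using card_dtrees[of ?S 1, where 'd = 'd] by simp
    then show "real (card (dtrees ?S 1 :: 'd decoration set)) \<le> (real (Suc n) * real CARD('d)) ^ n"
      by (metis of_nat_le_iff of_nat_mult of_nat_power)
  qed (use P \<kappa> in simp)
  finally have "\<bar>th dv (Suc n) M i u\<bar> / fact n \<le> (real (Suc n) * real CARD('d)) ^ n * (P ^ Suc n * \<kappa> ^ (2 * n + 1 + size M)) / fact n"
    by (rule divide_right_mono) simp
  also have "\<dots> = real (Suc n) ^ n / fact n * (real CARD('d) ^ n * (P ^ Suc n * \<kappa> ^ (2 * n + 1 + size M)))"
    by (simp add: power_mult_distrib)
  also have "\<dots> \<le> 3 ^ Suc n * (real CARD('d) ^ n * (P ^ Suc n * \<kappa> ^ (2 * n + 1 + size M)))"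
  proof (rule mult_right_mono)
    have "real (Suc n) ^ n / fact n = real (Suc n) ^ Suc n / fact (Suc n)" by (simp add: divide_simps)
    also have "\<dots> \<le> 3 ^ Suc n"
      using power_self_le_fact[of "Suc n"] by (simp add: divide_le_eq del: power_Suc fact_Suc)
    finally show "real (Suc n) ^ n / fact n \<le> 3 ^ Suc n" .
  qed (use P \<kappa> in simp)
  also have "\<dots> = 3 * P * \<kappa> ^ (size M + 1) * (3 * real CARD('d) * P * \<kappa>\<^sup>2) ^ n"
    by (simp add: power_mult_distrib power_add power_mult[symmetric] mult_ac)
  finally show ?thesis .
qed

text \<open>The induction step for \<open>gser_eq_vfield\<close>: every integration supplies the
  next factorial.\<close>

lemma integrate_power_bound:
  fixes H :: "real \<Rightarrow> real"
  assumes H: "H 0 = 0" and d: "\<And>s. s \<in> {0..1} \<Longrightarrow> (H has_real_derivative H' s) (at s)"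
    and b: "\<And>s. s \<in> {0..1} \<Longrightarrow> \<bar>H' s\<bar> \<le> C * (s ^ m / fact m)" and s: "s \<in> {0..1}"
  shows "\<bar>H s\<bar> \<le> C * (s ^ Suc m / fact (Suc m))"
proof -
  have D: "((\<lambda>s. C * (s ^ Suc m / fact (Suc m))) has_real_derivative C * (s ^ m / fact m)) (at s)" for s
  proof -
    have "((\<lambda>s. C * (s ^ Suc m / fact (Suc m))) has_real_derivative C * (real (Suc m) * s ^ m / fact (Suc m))) (at s)"
      by (auto intro!: derivative_eq_intros simp del: power_Suc fact_Suc)
    moreover have "real (Suc m) * s ^ m / fact (Suc m) = s ^ m / fact m" by (simp add: divide_simps)
    ultimately show ?thesis by simp
  qed
  have "C * (0 ^ Suc m / fact (Suc m)) - H 0 \<le> C * (s ^ Suc m / fact (Suc m)) - H s"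
  proof (rule DERIV_nonneg_imp_nondecreasing[where f = "\<lambda>s. C * (s ^ Suc m / fact (Suc m)) - H s" and a = 0 and b = s])
    fix x assume "0 \<le> x" "x \<le> s"
    then have x: "x \<in> {0..1}" using s by simp
    show "\<exists>y. ((\<lambda>s. C * (s ^ Suc m / fact (Suc m)) - H s) has_real_derivative y) (at x) \<and> 0 \<le> y"
      using DERIV_diff[OF D d[OF x]] b[OF x] by (intro exI[of _ "C * (x ^ m / fact m) - H' x"]) linarith
  qed (use s in simp)
  moreover have "C * (0 ^ Suc m / fact (Suc m)) + H 0 \<le> C * (s ^ Suc m / fact (Suc m)) + H s"
  proof (rule DERIV_nonneg_imp_nondecreasing[where f = "\<lambda>s. C * (s ^ Suc m / fact (Suc m)) + H s" and a = 0 and b = s])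
    fix x assume "0 \<le> x" "x \<le> s"
    then have x: "x \<in> {0..1}" using s by simp
    show "\<exists>y. ((\<lambda>s. C * (s ^ Suc m / fact (Suc m)) + H s) has_real_derivative y) (at x) \<and> 0 \<le> y"
      using DERIV_add[OF D d[OF x]] b[OF x] by (intro exI[of _ "C * (x ^ m / fact m) + H' x"]) linarith
  qed (use s in simp)
  ultimately show ?thesis using H by simp
qed

lemma has_vector_derivative_vec_lambda:
  fixes f :: "'d::finite \<Rightarrow> real \<Rightarrow> real"
  assumes "\<And>j. (f j has_vector_derivative f' j) (at u within S)"
  shows "((\<lambda>v. \<chi> j. f j v) has_vector_derivative (\<chi> j. f' j)) (at u within S)"
  unfolding has_vector_derivative_def
  by (rule has_derivative_componentwise_within[THEN iffD2])
    (use assms in \<open>auto simp: Basis_vec_def inner_axis has_vector_derivative_def\<close>)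

definition comps :: "(real^'d::finite \<Rightarrow> real^'d^'d) \<Rightarrow> (real^'d \<Rightarrow> real) set" where
  "comps \<alpha> = {(\<lambda>y. \<alpha> y $ i $ j) |i j. True}"

text \<open>Derivatives of the field twice \<alpha> times \<open>p\<close> that moves the curve; the
  parameter \<epsilon> multiplies it separately.\<close>

definition vfield :: "(real^'d::finite \<Rightarrow> real^'d^'d) \<Rightarrow> real^'d \<Rightarrow> 'd \<Rightarrow> 'd list \<Rightarrow> real^'d \<Rightarrow> real" where
  "vfield \<alpha> p i is y = 2 * (\<Sum>l\<in>UNIV. iter_partial is (\<lambda>y. \<alpha> y $ i $ l) y * p $ l)"

definition tree_coeff :: "(real^'d::finite \<Rightarrow> real^'d^'d) \<Rightarrow> real^'d \<Rightarrow> real^'d \<Rightarrow> 'd multiset \<Rightarrow> 'd \<Rightarrow> real" where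
  "tree_coeff \<alpha> p q M i = vfield \<alpha> p i (mlist M) q"

lemma sum_abs_le_norm: "(\<Sum>l\<in>UNIV. \<bar>(p::real^'d::finite) $ l\<bar>) \<le> real CARD('d) * norm p"
proof -
  have "(\<Sum>l\<in>UNIV. \<bar>p $ l\<bar>) \<le> (\<Sum>l\<in>(UNIV :: 'd set). norm p)"
    by (intro sum_mono component_le_norm_cart)
  then show ?thesis by simp
qed

lemma vfield_bound:
  fixes p :: "real^'d::finite"
  assumes "deriv_bnd (comps \<alpha>) \<kappa> y"
  shows "\<bar>vfield \<alpha> p i is y\<bar> \<le> 2 * real CARD('d) * norm p * \<kappa> ^ (length is + 1)"
proof -
  have b: "\<bar>iter_partial is (\<lambda>y. \<alpha> y $ i $ l) y\<bar> \<le> \<kappa> ^ (length is + 1)" for l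
    using assms by (auto simp: deriv_bnd_def comps_def)
  have "\<bar>\<Sum>l\<in>UNIV. iter_partial is (\<lambda>y. \<alpha> y $ i $ l) y * p $ l\<bar> \<le> (\<Sum>l\<in>UNIV. \<kappa> ^ (length is + 1) * \<bar>p $ l\<bar>)"
    using b by (intro order_trans[OF sum_abs] sum_mono) (auto simp: abs_mult intro!: mult_right_mono)
  also have "\<dots> = \<kappa> ^ (length is + 1) * (\<Sum>l\<in>UNIV. \<bar>p $ l\<bar>)" by (rule sum_distrib_left[symmetric])
  also have "\<dots> \<le> \<kappa> ^ (length is + 1) * (real CARD('d) * norm p)"
    using order_trans[OF abs_ge_zero b] by (intro mult_left_mono sum_abs_le_norm) auto
  finally show ?thesis by (simp add: vfield_def abs_mult mult_ac)
qed

section \<open>The curve as a power series in \<epsilon>\<close>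

context
  fixes U :: "(real^'d::finite) set" and \<alpha> :: "real^'d \<Rightarrow> real^'d^'d" and p q :: "real^'d" and \<rho> \<epsilon> \<kappa> PP :: real
  assumes \<kappa>_def: "\<kappa> = 1 / \<rho>" and PP_def: "PP = 2 * real CARD('d) * norm p"
    and U: "open U" and sm: "\<And>i j. smooth_on U (\<lambda>y. \<alpha> y $ i $ j)"
    and \<rho>: "0 < \<rho>" "\<rho> \<le> 1" "ball q \<rho> \<subseteq> U"
    and bnd: "\<And>y. y \<in> ball q \<rho> \<Longrightarrow> deriv_bnd (comps \<alpha>) (1 / \<rho>) y"
    and p: "24 * real CARD('d) ^ 2 * norm p \<le> \<rho>\<^sup>2" and \<epsilon>: "\<bar>\<epsilon>\<bar> \<le> 1"
begin

abbreviation "dv \<equiv> tree_coeff \<alpha> p q"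

lemma \<kappa>: "0 \<le> \<kappa>" "0 \<le> PP" and qU: "q \<in> U" and d1: "1 \<le> real CARD('d)"
  using \<rho> by (auto simp: Suc_leI \<kappa>_def PP_def)

lemma vfield_perm: "mset xs = mset ys \<Longrightarrow> y \<in> U \<Longrightarrow> vfield \<alpha> p i xs y = vfield \<alpha> p i ys y"
proof -
  assume "mset xs = mset ys" "y \<in> U"
  then have "iter_partial xs (\<lambda>y. \<alpha> y $ i $ l) y = iter_partial ys (\<lambda>y. \<alpha> y $ i $ l) y" for l
    by (rule iter_partial_perm[OF U sm])
  then show ?thesis by (simp only: vfield_def)
qed

lemma dv_bound: "\<bar>dv M i\<bar> \<le> PP * \<kappa> ^ (size M + 1)"
proof -
  have "length (mlist M) = size M" by (metis mset_mlist size_mset)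
  moreover have "deriv_bnd (comps \<alpha>) \<kappa> q" using \<rho> unfolding \<kappa>_def by (intro bnd) simp
  ultimately show ?thesis unfolding tree_coeff_def PP_def using vfield_bound by metis
qed

text \<open>The constant 24 in the assumption on \<open>p\<close> is chosen for this ratio. With
  coefficients decaying like (1/4)^n the series in \<open>t\<close> still converge at 2, which
  allows termwise differentiation for \<open>t\<close> between -1 and 1.\<close>

lemma small: "3 * real CARD('d) * PP * \<kappa>\<^sup>2 \<le> 1 / 4"
proof -
  have "3 * real CARD('d) * PP * \<kappa>\<^sup>2 = (24 * real CARD('d) ^ 2 * norm p) / (4 * \<rho>\<^sup>2)"
    by (simp add: power2_eq_square \<kappa>_def PP_def)
  also have "\<dots> \<le> \<rho>\<^sup>2 / (4 * \<rho>\<^sup>2)" using p by (rule divide_right_mono) simp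
  finally show ?thesis using \<rho>(1) by simp
qed

lemma coeff_bound:
  assumes "u \<in> {0..1}"
  shows "\<bar>th dv (Suc n) M i u / fact n\<bar> \<le> 3 * PP * \<kappa> ^ (size M + 1) * (1 / 4) ^ n"
proof -
  have "\<bar>th dv (Suc n) M i u\<bar> / fact n \<le> 3 * PP * \<kappa> ^ (size M + 1) * (3 * real CARD('d) * PP * \<kappa>\<^sup>2) ^ n"
    by (rule th_bound[OF dv_bound \<kappa>(2,1) assms])
  also have "\<dots> \<le> 3 * PP * \<kappa> ^ (size M + 1) * (1 / 4) ^ n"
    using \<kappa> small by (intro mult_left_mono power_mono mult_nonneg_nonneg) auto
  finally show ?thesis by simp
qed

lemma mp_coeff_bound:
  assumes "u \<in> {0..1}"
  shows "\<bar>mean_prim (th dv (Suc n) {#} j) u / fact n\<bar> \<le> 3 * PP * \<kappa> * (1 / 4) ^ n"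
proof -
  have "\<bar>mean_prim (th dv (Suc n) {#} j) u\<bar> \<le> (3 * PP * \<kappa> * (1 / 4) ^ n) * fact n"
  proof (rule mean_prim_bound[OF th_cont _ assms])
    show "\<bar>th dv (Suc n) {#} j s\<bar> \<le> (3 * PP * \<kappa> * (1 / 4) ^ n) * fact n" if "s \<in> {0..1}" for s
      using coeff_bound[OF that, of n "{#}" j] by (simp add: divide_le_eq)
  qed
  then show ?thesis by (simp add: divide_le_eq)
qed

text \<open>The candidate for the derivative of the field by the indices in \<open>M\<close>, taken
  along the curve; \<open>gser_eq_vfield\<close> confirms it.\<close>

definition gser :: "'d multiset \<Rightarrow> 'd \<Rightarrow> real \<Rightarrow> real \<Rightarrow> real" where
  "gser M i u t = (\<Sum>n. th dv (Suc n) M i u / fact n * t ^ n)"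

text \<open>The coefficients, in powers of \<open>t\<close> in place of \<epsilon>, of component
  \<open>j\<close> of the curve at time \<open>u\<close>.\<close>

definition xcoeff :: "'d \<Rightarrow> real \<Rightarrow> nat \<Rightarrow> real" where
  "xcoeff j u n = (case n of 0 \<Rightarrow> q $ j | Suc m \<Rightarrow> mean_prim (th dv (Suc m) {#} j) u / fact m)"

definition xser :: "'d \<Rightarrow> real \<Rightarrow> real \<Rightarrow> real" where
  "xser j u t = (\<Sum>n. xcoeff j u n * t ^ n)"

lemma summable_geo: "summable (\<lambda>n. C * (1 / 4) ^ n * (2::real) ^ n)"
proof -
  have "(\<lambda>n. C * (1 / 4) ^ n * (2::real) ^ n) = (\<lambda>n. C * (1 / 2) ^ n)"
    by (simp add: mult.assoc power_mult_distrib[symmetric])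
  then show ?thesis by (simp add: summable_mult)
qed

lemma gser_summable: "u \<in> {0..1} \<Longrightarrow> summable (\<lambda>n. th dv (Suc n) M i u / fact n * 2 ^ n)"
proof (rule summable_comparison_test'[OF summable_geo[of "3 * PP * \<kappa> ^ (size M + 1)"], of 0])
  fix n assume "u \<in> {0..1}"
  then have "\<bar>th dv (Suc n) M i u / fact n\<bar> * 2 ^ n \<le> 3 * PP * \<kappa> ^ (size M + 1) * (1 / 4) ^ n * 2 ^ n"
    by (intro mult_right_mono coeff_bound) simp_all
  then show "norm (th dv (Suc n) M i u / fact n * 2 ^ n) \<le> 3 * PP * \<kappa> ^ (size M + 1) * (1 / 4) ^ n * 2 ^ n"
    by (simp add: abs_mult)
qed

lemma xcoeff_bound: "u \<in> {0..1} \<Longrightarrow> \<bar>xcoeff j u n\<bar> \<le> (\<bar>q $ j\<bar> + 12 * PP * \<kappa>) * (1 / 4) ^ n"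
proof (cases n)
  case 0
  then show ?thesis using \<kappa> by (simp add: xcoeff_def)
next
  case (Suc m)
  assume u: "u \<in> {0..1}"
  have "\<bar>xcoeff j u n\<bar> \<le> 3 * PP * \<kappa> * (1 / 4) ^ m" using mp_coeff_bound[OF u, of m j] Suc by (simp add: xcoeff_def)
  also have "\<dots> = 12 * PP * \<kappa> * (1 / 4) ^ n" by (simp add: Suc)
  also have "\<dots> \<le> (\<bar>q $ j\<bar> + 12 * PP * \<kappa>) * (1 / 4) ^ n" by (intro mult_right_mono) auto
  finally show ?thesis .
qed

lemma xser_summable: "u \<in> {0..1} \<Longrightarrow> summable (\<lambda>n. xcoeff j u n * 2 ^ n)"
proof (rule summable_comparison_test'[OF summable_geo[of "\<bar>q $ j\<bar> + 12 * PP * \<kappa>"], of 0])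
  fix n assume "u \<in> {0..1}"
  then have "\<bar>xcoeff j u n\<bar> * 2 ^ n \<le> (\<bar>q $ j\<bar> + 12 * PP * \<kappa>) * (1 / 4) ^ n * 2 ^ n"
    by (intro mult_right_mono xcoeff_bound) simp_all
  then show "norm (xcoeff j u n * 2 ^ n) \<le> (\<bar>q $ j\<bar> + 12 * PP * \<kappa>) * (1 / 4) ^ n * 2 ^ n"
    by (simp add: abs_mult)
qed

lemma gser_deriv:
  assumes u: "u \<in> {0..1}" and t: "\<bar>t\<bar> \<le> 1"
  shows "(gser M i u has_real_derivative (\<Sum>n. diffs (\<lambda>n. th dv (Suc n) M i u / fact n) n * t ^ n)) (at t)"
  unfolding gser_def using termdiffs_strong[OF gser_summable[OF u], of t] t by simp

lemma xser_deriv: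
  assumes u: "u \<in> {0..1}" and t: "\<bar>t\<bar> \<le> 1"
  shows "(xser j u has_real_derivative (\<Sum>n. diffs (xcoeff j u) n * t ^ n)) (at t)"
  unfolding xser_def using termdiffs_strong[OF xser_summable[OF u], of t] t by simp

lemma norm_summable:
  assumes "summable (\<lambda>n. c n * (2::real) ^ n)" "\<bar>t\<bar> \<le> 1"
  shows "summable (\<lambda>n. norm (c n * t ^ n))"
  using powser_insidea[OF assms(1), of t] assms(2) by simp

lemma diffs_summable:
  assumes "summable (\<lambda>n. c n * (2::real) ^ n)"
  shows "summable (\<lambda>n. diffs c n * (3 / 2) ^ n)"
  by (rule termdiff_converges[of _ 2]) (auto intro: powser_inside[OF assms])

lemma xdiffs_bound:
  assumes u: "u \<in> {0..1}"
  shows "\<exists>E\<ge>0. \<forall>t. \<bar>t\<bar> \<le> 1 \<longrightarrow> (\<forall>j. \<bar>\<Sum>n. diffs (xcoeff j u) n * t ^ n\<bar> \<le> E)"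
proof -
  have s: "summable (\<lambda>n. norm (diffs (xcoeff j u) n * t ^ n))" if "\<bar>t\<bar> \<le> 1" for j t
    using powser_insidea[OF diffs_summable[OF xser_summable[OF u]], of t j] that by simp
  define E where "E = (\<Sum>j\<in>UNIV. \<Sum>n. norm (diffs (xcoeff j u) n))"
  have s1: "summable (\<lambda>n. norm (diffs (xcoeff j u) n))" for j using s[of 1 j] by simp
  have "\<bar>\<Sum>n. diffs (xcoeff j u) n * t ^ n\<bar> \<le> E" if t: "\<bar>t\<bar> \<le> 1" for t j
  proof -
    have "\<bar>\<Sum>n. diffs (xcoeff j u) n * t ^ n\<bar> \<le> (\<Sum>n. norm (diffs (xcoeff j u) n * t ^ n))"
      using summable_norm[OF s[OF t]] by simp
    also have "\<dots> \<le> (\<Sum>n. norm (diffs (xcoeff j u) n))"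
      using t by (intro suminf_le s[OF t] s1) (auto simp: abs_mult power_abs intro!: mult_left_le power_le_one)
    also have "\<dots> \<le> E" unfolding E_def by (rule member_le_sum) (use s1 in \<open>auto intro!: suminf_nonneg\<close>)
    finally show ?thesis .
  qed
  moreover have "0 \<le> E" unfolding E_def by (intro sum_nonneg suminf_nonneg s1) auto
  ultimately show ?thesis by blast
qed

text \<open>The chain rule at the level of coefficients: after division by factorials,
  \<open>th_rec\<close> is the Cauchy product of the series of \<open>gser\<close> and of the
  derivative of \<open>xser\<close> in \<open>t\<close>.\<close>

lemma gser_ode:
  assumes u: "u \<in> {0..1}" and t: "\<bar>t\<bar> \<le> 1"
  shows "(\<Sum>n. diffs (\<lambda>n. th dv (Suc n) M i u / fact n) n * t ^ n) =
    (\<Sum>j\<in>UNIV. gser (M + {#j#}) i u t * (\<Sum>n. diffs (xcoeff j u) n * t ^ n))"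
proof -
  define a where "a j n = th dv (Suc n) (M + {#j#}) i u / fact n * t ^ n" for j n
  define b where "b j n = diffs (xcoeff j u) n * t ^ n" for j n
  have sa: "summable (\<lambda>n. norm (a j n))" for j
    unfolding a_def by (rule norm_summable[OF gser_summable[OF u] t])
  have sb: "summable (\<lambda>n. norm (b j n))" for j
    unfolding b_def using powser_insidea[OF diffs_summable[OF xser_summable[OF u]], of t j] t by simp
  have cp: "(\<lambda>n. \<Sum>k\<le>n. b j k * a j (n - k)) sums ((\<Sum>n. b j n) * (\<Sum>n. a j n))" for j
    by (rule Cauchy_product_sums[OF sb sa])
  have "diffs (\<lambda>n. th dv (Suc n) M i u / fact n) n * t ^ n = (\<Sum>j\<in>UNIV. \<Sum>k\<le>n. b j k * a j (n - k))" for n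
  proof -
    have "diffs (\<lambda>n. th dv (Suc n) M i u / fact n) n * t ^ n = th dv (Suc (Suc n)) M i u / fact n * t ^ n"
      by (simp add: diffs_def divide_simps)
    also have "\<dots> = (\<Sum>k\<le>n. \<Sum>j\<in>UNIV. b j k * a j (n - k))"
      unfolding th_rec[OF u] sum_divide_distrib sum_distrib_right
    proof (rule sum.cong[OF refl])
      fix k assume k: "k \<in> {..n}"
      have bin: "of_nat (n choose k) / fact n = 1 / (fact k * fact (n - k) :: real)"
        using k binomial_fact[of k n, where 'a = real] by (simp add: field_simps)
      have "Suc n - k = Suc (n - k)" using k by (simp add: Suc_diff_le)
      note e = this
      have tk: "t ^ n = t ^ k * t ^ (n - k)" using k by (simp add: power_add[symmetric])
      have bx: "of_nat (n choose k) * X / fact n * t ^ n = X * (1 / (fact k * fact (n - k))) * (t ^ k * t ^ (n - k))" for X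
        unfolding bin[symmetric] tk by simp
      show "of_nat (n choose k) * (\<Sum>j\<in>UNIV. th dv (Suc n - k) (M + {#j#}) i u * (of_nat (Suc k) * mean_prim (th dv (Suc k) {#} j) u)) / fact n * t ^ n
         = (\<Sum>j\<in>UNIV. b j k * a j (n - k))"
        unfolding e bx sum_distrib_right by (simp add: a_def b_def diffs_def xcoeff_def mult_ac)
    qed
    also have "\<dots> = (\<Sum>j\<in>UNIV. \<Sum>k\<le>n. b j k * a j (n - k))" by (rule sum.swap)
    finally show ?thesis .
  qed
  then have "(\<lambda>n. diffs (\<lambda>n. th dv (Suc n) M i u / fact n) n * t ^ n) sums (\<Sum>j\<in>UNIV. (\<Sum>n. b j n) * (\<Sum>n. a j n))"
    using sums_sum[of UNIV "\<lambda>j n. \<Sum>k\<le>n. b j k * a j (n - k)", OF cp] by simp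
  then show ?thesis by (simp add: sums_iff gser_def a_def b_def mult.commute)
qed

lemma xser_near:
  assumes u: "u \<in> {0..1}" and t: "\<bar>t\<bar> \<le> 1"
  shows "\<bar>xser j u t - q $ j\<bar> \<le> \<rho> / (2 * real CARD('d))"
proof -
  have s: "summable (\<lambda>n. norm (xcoeff j u n * t ^ n))" by (rule norm_summable[OF xser_summable[OF u] t])
  have "xser j u t = (\<Sum>n. xcoeff j u (Suc n) * t ^ Suc n) + q $ j"
    unfolding xser_def using suminf_split_head[OF summable_norm_cancel[OF s]] by (simp add: xcoeff_def)
  then have "\<bar>xser j u t - q $ j\<bar> = \<bar>\<Sum>n. xcoeff j u (Suc n) * t ^ Suc n\<bar>" by simp
  also have s2: "summable (\<lambda>n. norm (xcoeff j u (Suc n) * t ^ Suc n))"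
    using s by (rule summable_Suc_iff[THEN iffD2])
  then have "\<bar>\<Sum>n. xcoeff j u (Suc n) * t ^ Suc n\<bar> \<le> (\<Sum>n. norm (xcoeff j u (Suc n) * t ^ Suc n))"
    using summable_norm[OF s2] by simp
  also have "\<dots> \<le> (\<Sum>n. 3 * PP * \<kappa> * (1 / 4) ^ n)"
  proof (rule suminf_le[OF _ s2])
    show "summable (\<lambda>n. 3 * PP * \<kappa> * (1 / 4) ^ n)" by (intro summable_mult summable_geometric) simp
    show "norm (xcoeff j u (Suc n) * t ^ Suc n) \<le> 3 * PP * \<kappa> * (1 / 4) ^ n" for n
    proof -
      have "norm (xcoeff j u (Suc n) * t ^ Suc n) \<le> (3 * PP * \<kappa> * (1 / 4) ^ n) * 1"
        unfolding norm_mult using mp_coeff_bound[OF u, of n j] t \<kappa>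
        by (intro mult_mono) (auto simp: xcoeff_def power_abs simp del: power_Suc intro!: power_le_one)
      then show ?thesis by simp
    qed
  qed
  also have "\<dots> = 3 * PP * \<kappa> * (\<Sum>n. (1 / 4) ^ n)" by (rule suminf_mult) (simp add: summable_geometric)
  also have "(\<Sum>n. (1 / 4::real) ^ n) = 4 / 3" by (subst suminf_geometric) auto
  also have "3 * PP * \<kappa> * (4 / 3) = (24 * real CARD('d) ^ 2 * norm p) / (3 * real CARD('d) * \<rho>)"
    using d1 by (simp add: power2_eq_square \<kappa>_def PP_def)
  also have "\<dots> \<le> \<rho>\<^sup>2 / (3 * real CARD('d) * \<rho>)" using p \<rho> by (intro divide_right_mono) auto
  also have "\<dots> \<le> \<rho> / (2 * real CARD('d))" using d1 \<rho> by (simp add: power2_eq_square divide_simps)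
  finally show ?thesis .
qed

definition xvec :: "real \<Rightarrow> real \<Rightarrow> real^'d" where
  "xvec u t = (\<chi> j. xser j u t)"

lemma xvec_near:
  assumes "u \<in> {0..1}" "\<bar>t\<bar> \<le> 1"
  shows "dist q (xvec u t) \<le> \<rho> / 2"
proof -
  have "dist q (xvec u t) \<le> (\<Sum>j\<in>UNIV. \<bar>(xvec u t - q) $ j\<bar>)"
    using norm_le_l1_cart[of "xvec u t - q"] by (simp add: dist_norm norm_minus_commute)
  also have "\<dots> \<le> (\<Sum>j\<in>(UNIV :: 'd set). \<rho> / (2 * real CARD('d)))"
    using xser_near[OF assms] by (intro sum_mono) (simp add: xvec_def)
  finally show ?thesis by simp
qed

lemma xvec_ball: "u \<in> {0..1} \<Longrightarrow> \<bar>t\<bar> \<le> 1 \<Longrightarrow> xvec u t \<in> ball q \<rho>"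
  using xvec_near[of u t] \<rho> by simp

lemma gser_bound:
  assumes u: "u \<in> {0..1}" and t: "\<bar>t\<bar> \<le> 1"
  shows "\<bar>gser M i u t\<bar> \<le> 4 * PP * \<kappa> ^ (size M + 1)"
proof -
  have s: "summable (\<lambda>n. norm (th dv (Suc n) M i u / fact n * t ^ n))" by (rule norm_summable[OF gser_summable[OF u] t])
  have "\<bar>gser M i u t\<bar> \<le> (\<Sum>n. norm (th dv (Suc n) M i u / fact n * t ^ n))"
    unfolding gser_def using summable_norm[OF s] by simp
  also have "\<dots> \<le> (\<Sum>n. 3 * PP * \<kappa> ^ (size M + 1) * (1 / 4) ^ n)"
  proof (rule suminf_le[OF _ s])
    show "summable (\<lambda>n. 3 * PP * \<kappa> ^ (size M + 1) * (1 / 4) ^ n)" by (intro summable_mult summable_geometric) simp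
    show "norm (th dv (Suc n) M i u / fact n * t ^ n) \<le> 3 * PP * \<kappa> ^ (size M + 1) * (1 / 4) ^ n" for n
    proof -
      have "\<bar>th dv (Suc n) M i u / fact n\<bar> * \<bar>t ^ n\<bar> \<le> (3 * PP * \<kappa> ^ (size M + 1) * (1 / 4) ^ n) * 1"
        using coeff_bound[OF u, of n M i] t \<kappa> by (intro mult_mono) (auto simp: power_abs intro!: power_le_one)
      then show ?thesis by (simp add: abs_mult)
    qed
  qed
  also have "\<dots> = 3 * PP * \<kappa> ^ (size M + 1) * (\<Sum>n. (1 / 4) ^ n)" by (rule suminf_mult) (simp add: summable_geometric)
  also have "(\<Sum>n. (1 / 4::real) ^ n) = 4 / 3" by (subst suminf_geometric) auto
  finally show ?thesis by simp
qed

text \<open>Both sides solve the same infinite linear system in \<open>t\<close>, indexed by \<open>M\<close>, and their difference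
  grows at most geometrically in the size of \<open>M\<close>; iterating the system shows that it vanishes.\<close>

lemma gser_eq_vfield:
  assumes u: "u \<in> {0..1}"
  shows "gser M i u \<epsilon> = vfield \<alpha> p i (mlist M) (xvec u \<epsilon>)"
proof -
  obtain E where E: "0 \<le> E" "\<And>t j. \<bar>t\<bar> \<le> 1 \<Longrightarrow> \<bar>\<Sum>n. diffs (xcoeff j u) n * t ^ n\<bar> \<le> E"
    using xdiffs_bound[OF u] by blast
  define h where "h M i s = gser M i u (\<epsilon> * s) - vfield \<alpha> p i (mlist M) (xvec u (\<epsilon> * s))" for M i s
  define dx where "dx j s = (\<Sum>n. diffs (xcoeff j u) n * (\<epsilon> * s) ^ n)" for j s
  have es: "\<bar>\<epsilon> * s\<bar> \<le> 1" if "s \<in> {0..1}" for s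
    using that \<epsilon> unfolding abs_mult by (intro mult_le_one) auto
  have len: "length (mlist M) = size M" for M :: "'d multiset" by (metis mset_mlist size_mset)
  have hd: "(h M i has_real_derivative \<epsilon> * (\<Sum>j\<in>UNIV. h (M + {#j#}) i s * dx j s)) (at s)" if s: "s \<in> {0..1}" for M i s
  proof -
    have lin: "((\<lambda>s. \<epsilon> * s) has_real_derivative \<epsilon>) (at s)" by (auto intro!: derivative_eq_intros)
    have 1: "((\<lambda>s. gser M i u (\<epsilon> * s)) has_real_derivative (\<Sum>j\<in>UNIV. gser (M + {#j#}) i u (\<epsilon> * s) * dx j s) * \<epsilon>) (at s)"
      using DERIV_chain2[OF gser_deriv[OF u es[OF s], of M i] lin] by (simp only: gser_ode[OF u es[OF s]] dx_def)
    have 2: "((\<lambda>s. xvec u (\<epsilon> * s)) has_vector_derivative (\<chi> j. dx j s * \<epsilon>)) (at s)"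
      unfolding xvec_def
      by (rule has_vector_derivative_vec_lambda)
        (use DERIV_chain2[OF xser_deriv[OF u es[OF s]] lin] in \<open>simp add: dx_def has_real_derivative_iff_has_vector_derivative\<close>)
    have xU: "xvec u (\<epsilon> * s) \<in> U" using xvec_ball[OF u es[OF s]] \<rho> by blast
    have 3: "((\<lambda>s. vfield \<alpha> p i (mlist M) (xvec u (\<epsilon> * s))) has_real_derivative
      2 * (\<Sum>l\<in>UNIV. (\<Sum>j\<in>UNIV. (\<chi> j. dx j s * \<epsilon>) $ j * iter_partial (j # mlist M) (\<lambda>y. \<alpha> y $ i $ l) (xvec u (\<epsilon> * s))) * p $ l)) (at s)"
      unfolding vfield_def
      by (intro DERIV_cmult DERIV_sum DERIV_cmult_right smooth_on_curve_derivative[OF U sm xU 2])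
    have "2 * (\<Sum>l\<in>UNIV. (\<Sum>j\<in>UNIV. (\<chi> j. dx j s * \<epsilon>) $ j * iter_partial (j # mlist M) (\<lambda>y. \<alpha> y $ i $ l) (xvec u (\<epsilon> * s))) * p $ l)
       = (\<Sum>j\<in>UNIV. vfield \<alpha> p i (j # mlist M) (xvec u (\<epsilon> * s)) * dx j s) * \<epsilon>"
    proof -
      have "(\<Sum>l\<in>UNIV. (\<Sum>j\<in>UNIV. (\<chi> j. dx j s * \<epsilon>) $ j * iter_partial (j # mlist M) (\<lambda>y. \<alpha> y $ i $ l) (xvec u (\<epsilon> * s))) * p $ l) =
        (\<Sum>j\<in>UNIV. \<Sum>l\<in>UNIV. dx j s * \<epsilon> * iter_partial (j # mlist M) (\<lambda>y. \<alpha> y $ i $ l) (xvec u (\<epsilon> * s)) * p $ l)"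
        unfolding sum_distrib_right by (subst sum.swap) simp
      then have "2 * (\<Sum>l\<in>UNIV. (\<Sum>j\<in>UNIV. (\<chi> j. dx j s * \<epsilon>) $ j * iter_partial (j # mlist M) (\<lambda>y. \<alpha> y $ i $ l) (xvec u (\<epsilon> * s))) * p $ l) =
        (\<Sum>j\<in>UNIV. 2 * (\<Sum>l\<in>UNIV. dx j s * \<epsilon> * iter_partial (j # mlist M) (\<lambda>y. \<alpha> y $ i $ l) (xvec u (\<epsilon> * s)) * p $ l))"
        by (simp only: sum_distrib_left[of 2])
      also have "\<dots> = (\<Sum>j\<in>UNIV. vfield \<alpha> p i (j # mlist M) (xvec u (\<epsilon> * s)) * dx j s * \<epsilon>)"
        unfolding vfield_def sum_distrib_left sum_distrib_right by (intro sum.cong refl) (simp only: mult_ac)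
      finally show ?thesis by (simp only: sum_distrib_right)
    qed
    moreover have "vfield \<alpha> p i (j # mlist M) (xvec u (\<epsilon> * s)) = vfield \<alpha> p i (mlist (M + {#j#})) (xvec u (\<epsilon> * s))" for j
      by (rule vfield_perm[OF _ xU]) (simp add: mset_mlist)
    ultimately have 4: "((\<lambda>s. vfield \<alpha> p i (mlist M) (xvec u (\<epsilon> * s))) has_real_derivative
      (\<Sum>j\<in>UNIV. vfield \<alpha> p i (mlist (M + {#j#})) (xvec u (\<epsilon> * s)) * dx j s) * \<epsilon>) (at s)"
      using 3 by (simp only:)
    show ?thesis unfolding h_def[abs_def]
    proof (rule DERIV_cong[OF DERIV_diff[OF 1 4]])
      show "(\<Sum>j\<in>UNIV. gser (M + {#j#}) i u (\<epsilon> * s) * dx j s) * \<epsilon> - (\<Sum>j\<in>UNIV. vfield \<alpha> p i (mlist (M + {#j#})) (xvec u (\<epsilon> * s)) * dx j s) * \<epsilon> =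
        \<epsilon> * (\<Sum>j\<in>UNIV. (gser (M + {#j#}) i u (\<epsilon> * s) - vfield \<alpha> p i (mlist (M + {#j#})) (xvec u (\<epsilon> * s))) * dx j s)"
        unfolding left_diff_distrib sum_subtractf right_diff_distrib by (simp only: mult.commute)
    qed
  qed
  have h0: "h M i 0 = 0" for M i
  proof -
    have "xvec u 0 = q" by (simp add: xvec_def xser_def xcoeff_def vec_eq_iff powser_zero)
    moreover have "gser M i u 0 = dv M i"
      unfolding gser_def using powser_zero[of "\<lambda>n. th dv (Suc n) M i u / fact n"] by (simp only: th_1 fact_0 div_by_1)
    ultimately show ?thesis by (simp add: h_def tree_coeff_def)
  qed
  \<comment> \<open>One passage from \<open>M\<close> to the multisets with one more index costs a
    factor \<open>\<kappa>\<close> for the extra derivative, the number of indices and the bound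
    \<open>E\<close> for the derivative of \<open>xser\<close>.\<close>
  define W where "W = \<kappa> * real CARD('d) * E"
  have hb: "\<bar>h M i s\<bar> \<le> 5 * PP * \<kappa> ^ (size M + 1) * W ^ m * (s ^ m / fact m)" if "s \<in> {0..1}" for m M i s
    using that
  proof (induction m arbitrary: M i s)
    case 0
    have "\<bar>vfield \<alpha> p i (mlist M) (xvec u (\<epsilon> * s))\<bar> \<le> PP * \<kappa> ^ (size M + 1)"
      using vfield_bound[OF bnd[OF xvec_ball[OF u es[OF 0]]], of p i "mlist M"] by (simp add: len \<kappa>_def PP_def)
    moreover have "\<bar>gser M i u (\<epsilon> * s)\<bar> \<le> 4 * PP * \<kappa> ^ (size M + 1)" by (rule gser_bound[OF u es[OF 0]])
    ultimately show ?case unfolding h_def by simp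
  next
    case (Suc m)
    have "\<bar>h M i s\<bar> \<le> (5 * PP * \<kappa> ^ (size M + 1) * W ^ Suc m) * (s ^ Suc m / fact (Suc m))"
    proof (rule integrate_power_bound[OF h0 hd _ Suc.prems])
      fix s :: real assume s: "s \<in> {0..1}"
      have "\<bar>\<epsilon> * (\<Sum>j\<in>UNIV. h (M + {#j#}) i s * dx j s)\<bar> \<le> 1 * \<bar>\<Sum>j\<in>UNIV. h (M + {#j#}) i s * dx j s\<bar>"
        unfolding abs_mult using \<epsilon> by (intro mult_right_mono) auto
      also have "\<dots> \<le> (\<Sum>j\<in>(UNIV :: 'd set). (5 * PP * \<kappa> ^ (size M + 2) * W ^ m * (s ^ m / fact m)) * E)"
        unfolding mult_1
      proof (rule order_trans[OF sum_abs sum_mono])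
        fix j :: 'd
        have "\<bar>h (M + {#j#}) i s\<bar> * \<bar>dx j s\<bar> \<le> (5 * PP * \<kappa> ^ (size M + 2) * W ^ m * (s ^ m / fact m)) * E"
          using Suc.IH[OF s, of "M + {#j#}" i] E(2)[OF es[OF s], of j]
          by (intro mult_mono) (auto simp: dx_def)
        then show "\<bar>h (M + {#j#}) i s * dx j s\<bar> \<le> (5 * PP * \<kappa> ^ (size M + 2) * W ^ m * (s ^ m / fact m)) * E"
          by (simp add: abs_mult)
      qed
      also have "\<dots> = (5 * PP * \<kappa> ^ (size M + 1) * W ^ Suc m) * (s ^ m / fact m)"
        by (simp add: W_def)
      finally show "\<bar>\<epsilon> * (\<Sum>j\<in>UNIV. h (M + {#j#}) i s * dx j s)\<bar> \<le> (5 * PP * \<kappa> ^ (size M + 1) * W ^ Suc m) * (s ^ m / fact m)" .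
    qed
    then show ?case .
  qed
  have "(\<lambda>m. 5 * PP * \<kappa> ^ (size M + 1) * (W ^ m /\<^sub>R fact m)) \<longlonglongrightarrow> 5 * PP * \<kappa> ^ (size M + 1) * 0"
    by (intro tendsto_intros summable_LIMSEQ_zero summable_exp_generic)
  moreover have "\<bar>h M i 1\<bar> \<le> 5 * PP * \<kappa> ^ (size M + 1) * (W ^ m /\<^sub>R fact m)" for m
    using hb[of 1 M i m] by (simp add: divide_inverse mult_ac)
  ultimately have "\<bar>h M i 1\<bar> \<le> 5 * PP * \<kappa> ^ (size M + 1) * 0"
    by (intro tendsto_lowerbound[of _ _ sequentially]) auto
  then show ?thesis by (simp add: h_def)
qed

text \<open>Once the tree sums \<open>G\<close> at the root are recognized as the field along
  \<open>X\<close>, the series reads \<open>X = q\<close> plus \<epsilon> times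
  \<open>mean_prim G\<close>, which contains both the differential equation and the mean. The last
  conjunct is this identity at time 0, in the form in which the trees deliver it.\<close>

lemma curve_exists:
  "\<exists>X. (\<forall>u\<in>{0..1}. (X has_vector_derivative (2 * \<epsilon>) *\<^sub>R (\<alpha> (X u) *v p)) (at u within {0..1}) \<and> dist q (X u) \<le> \<rho> / 2) \<and>
     integral {0..1} X = q \<and>
     (\<forall>j. (\<lambda>n. \<epsilon> ^ Suc n * (mean_prim (th dv (Suc n) {#} j) 0 / fact n)) sums (X 0 $ j - q $ j))"
proof -
  define X where "X u = xvec u \<epsilon>" for u
  define G where "G j s = (\<Sum>n. th dv (Suc n) {#} j s / fact n * \<epsilon> ^ n)" for j s
  have Gv: "G j s = vfield \<alpha> p j [] (X s)" if "s \<in> {0..1}" for j s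
  proof -
    have "mlist ({#} :: 'd multiset) = []" using mset_mlist[of "{#} :: 'd multiset"] by simp
    then show ?thesis using gser_eq_vfield[OF that, of "{#}" j] by (simp add: G_def gser_def X_def)
  qed
  have cs: "continuous_on {0..1} (\<lambda>s. th dv (Suc n) {#} j s / fact n * \<epsilon> ^ n)" for n j
    by (intro continuous_intros th_cont) auto
  have bd: "\<bar>th dv (Suc n) {#} j s / fact n * \<epsilon> ^ n\<bar> \<le> 3 * PP * \<kappa> * (1 / 4) ^ n" if "s \<in> {0..1}" for n j s
  proof -
    have "\<bar>th dv (Suc n) {#} j s / fact n\<bar> * \<bar>\<epsilon> ^ n\<bar> \<le> (3 * PP * \<kappa> * (1 / 4) ^ n) * 1"
      using coeff_bound[OF that, of n "{#}" j] \<epsilon> \<kappa> by (intro mult_mono) (auto simp: power_abs intro!: power_le_one)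
    then show ?thesis by (simp add: abs_mult)
  qed
  have sg: "summable (\<lambda>n. 3 * PP * \<kappa> * (1 / 4) ^ n)" by (intro summable_mult summable_geometric) simp
  have Gc: "continuous_on {0..1} (G j)" for j
    unfolding G_def by (rule mean_prim_sums(1)[OF cs bd sg, of 0]) auto
  have mps: "(\<lambda>n. mean_prim (th dv (Suc n) {#} j) u / fact n * \<epsilon> ^ n) sums mean_prim (G j) u" if u: "u \<in> {0..1}" for j u
  proof -
    have "mean_prim (\<lambda>s. th dv (Suc n) {#} j s / fact n * \<epsilon> ^ n) u = mean_prim (th dv (Suc n) {#} j) u / fact n * \<epsilon> ^ n" for n
      using mean_prim_sum[of "{()}" "\<lambda>_. th dv (Suc n) {#} j" u "\<lambda>_. \<epsilon> ^ n / fact n"] u by (simp add: th_cont)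
    then show ?thesis using mean_prim_sums(2)[OF cs[where j = j] bd[where j = j] sg u] unfolding G_def[abs_def] by (simp only:)
  qed
  have Xs: "(\<lambda>n. \<epsilon> ^ Suc n * (mean_prim (th dv (Suc n) {#} j) u / fact n)) sums (X u $ j - q $ j)"
    and Xj: "X u $ j = q $ j + \<epsilon> * mean_prim (G j) u" if u: "u \<in> {0..1}" for u j
  proof -
    have s: "(\<lambda>n. \<epsilon> ^ Suc n * (mean_prim (th dv (Suc n) {#} j) u / fact n)) sums (\<epsilon> * mean_prim (G j) u)"
      using sums_mult[OF mps[OF u, of j], of \<epsilon>] by (simp add: mult_ac)
    have "X u $ j = (\<Sum>n. xcoeff j u n * \<epsilon> ^ n)" by (simp add: X_def xvec_def xser_def)
    also have "\<dots> = (\<Sum>n. xcoeff j u (Suc n) * \<epsilon> ^ Suc n) + q $ j"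
      using suminf_split_head[OF summable_norm_cancel[OF norm_summable[OF xser_summable[OF u] \<epsilon>]], of j] by (simp add: xcoeff_def)
    also have "(\<Sum>n. xcoeff j u (Suc n) * \<epsilon> ^ Suc n) = \<epsilon> * mean_prim (G j) u"
      using s by (simp add: sums_iff xcoeff_def mult_ac)
    finally show x: "X u $ j = q $ j + \<epsilon> * mean_prim (G j) u" by simp
    show "(\<lambda>n. \<epsilon> ^ Suc n * (mean_prim (th dv (Suc n) {#} j) u / fact n)) sums (X u $ j - q $ j)"
      using s x by simp
  qed
  have comp: "((\<lambda>v. X v $ j) has_vector_derivative \<epsilon> * G j u) (at u within {0..1})" if u: "u \<in> {0..1}" for u j
  proof (rule has_vector_derivative_transform[OF u Xj])
    have "(mean_prim (G j) has_vector_derivative G j u) (at u within {0..1})" by (rule mean_prim_deriv[OF Gc u])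
    then show "((\<lambda>u. q $ j + \<epsilon> * mean_prim (G j) u) has_vector_derivative \<epsilon> * G j u) (at u within {0..1})"
      by (auto intro!: derivative_eq_intros simp: has_real_derivative_iff_has_vector_derivative[symmetric])
  qed
  have der: "(X has_vector_derivative (2 * \<epsilon>) *\<^sub>R (\<alpha> (X u) *v p)) (at u within {0..1})" if u: "u \<in> {0..1}" for u
  proof -
    have "((\<lambda>v. \<chi> j. X v $ j) has_vector_derivative (\<chi> j. \<epsilon> * G j u)) (at u within {0..1})"
      by (rule has_vector_derivative_vec_lambda[OF comp[OF u]])
    moreover have "(\<chi> j. \<epsilon> * G j u) = (2 * \<epsilon>) *\<^sub>R (\<alpha> (X u) *v p)"
      using Gv[OF u] by (simp add: vec_eq_iff vfield_def matrix_vector_mult_def)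
    ultimately show ?thesis by simp
  qed
  have Xc: "continuous_on {0..1} X" using der by (meson continuous_on_vector_derivative)
  have "integral {0..1} X $ j = q $ j" for j
  proof -
    have "integral {0..1} X $ j = integral {0..1} (\<lambda>u. X u $ j)"
      using integral_component_eq_cart[OF integrable_continuous_real[OF Xc]] by simp
    also have "\<dots> = integral {0..1} (\<lambda>u. q $ j + \<epsilon> * mean_prim (G j) u)"
      using Xj by (intro integral_cong) auto
    also have "\<dots> = q $ j + \<epsilon> * integral {0..1} (mean_prim (G j))"
      using mean_prim_cont[OF Gc] by (subst Henstock_Kurzweil_Integration.integral_add)
        (auto intro!: integrable_continuous_real continuous_intros)
    finally show ?thesis by (simp add: integral_mean_prim[OF Gc])
  qed
  then have "integral {0..1} X = q" by (simp add: vec_eq_iff)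
  moreover have "dist q (X u) \<le> \<rho> / 2" if "u \<in> {0..1}" for u unfolding X_def by (rule xvec_near[OF that \<epsilon>])
  ultimately show ?thesis using der Xs[of 0] by (intro exI[of _ X]) auto
qed

end

section \<open>The gradient of the generating function\<close>

lemma ksymbol_swap:
  "ksymbol n (swap_graph n \<Gamma>) \<alpha> p1 p2 x = ksymbol n \<Gamma> \<alpha> p2 p1 x"
proof -
  have f: "filter (\<lambda>e. swap_graph n \<Gamma> e = Aerial k) (kedge_list n) = edge_list_to n \<Gamma> k" for k
    by (intro filter_cong refl) (simp add: set_kedge_list swap_graph_edge)
  have "{e \<in> kedges n. swap_graph n \<Gamma> e = Ground1} = (edges_to n \<Gamma> Ground2)"
    "{e \<in> kedges n. swap_graph n \<Gamma> e = Ground2} = (edges_to n \<Gamma> Ground1)"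
    by (auto simp: swap_graph_edge)
  then show ?thesis unfolding ksymbol_def f by (simp add: mult_ac)
qed

lemma genfun_term_swap: "genfun_term \<epsilon> \<alpha> n p1 p2 x = genfun_term (- \<epsilon>) \<alpha> n p2 p1 x"
proof -
  have sw: "swap_graph n (swap_graph n \<Gamma>) = \<Gamma>" if "\<Gamma> \<in> ktrees n" for \<Gamma>
    using that by (intro swap_graph_swap) (simp add: ktrees_def)
  have "(\<Sum>\<Gamma>\<in>ktrees n. weight n \<Gamma> * ksymbol n \<Gamma> \<alpha> p1 p2 x) =
     (\<Sum>\<Gamma>\<in>ktrees n. weight n (swap_graph n \<Gamma>) * ksymbol n (swap_graph n \<Gamma>) \<alpha> p1 p2 x)"
    by (rule sum.reindex_bij_witness[of _ "swap_graph n" "swap_graph n"])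
      (auto simp: swap_graph_ktrees sw)
  also have "\<dots> = (\<Sum>\<Gamma>\<in>ktrees n. (-1) ^ n * (weight n \<Gamma> * ksymbol n \<Gamma> \<alpha> p2 p1 x))"
  proof (intro sum.cong refl)
    fix \<Gamma> assume G: "\<Gamma> \<in> ktrees n"
    obtain \<rho> where \<rho>: "graph_rank n \<Gamma> \<rho>" using ktree_rank'[OF G] by blast
    have "\<Gamma> \<in> kgraphs n" using G by (simp add: ktrees_def)
    then show "weight n (swap_graph n \<Gamma>) * ksymbol n (swap_graph n \<Gamma>) \<alpha> p1 p2 x = (-1) ^ n * (weight n \<Gamma> * ksymbol n \<Gamma> \<alpha> p2 p1 x)"
      by (simp add: weight_swap[OF _ \<rho>] ksymbol_swap)
  qed
  also have "\<dots> = (-1) ^ n * (\<Sum>\<Gamma>\<in>ktrees n. weight n \<Gamma> * ksymbol n \<Gamma> \<alpha> p2 p1 x)" by (rule sum_distrib_left[symmetric])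
  finally show ?thesis by (simp add: genfun_term_def power_minus[of \<epsilon>])
qed

lemma genfun_swap: "genfun \<epsilon> \<alpha> p1 p2 x = genfun (- \<epsilon>) \<alpha> p2 p1 x"
  unfolding genfun_def genfun_term_swap[of \<epsilon>] by (simp add: add.commute)

lemma target_eq_source: "target_map \<epsilon> \<alpha> p q = source_map (- \<epsilon>) \<alpha> p q"
  unfolding target_map_def source_map_def genfun_swap[of \<epsilon>] ..

lemma gradient_eq: "GDERIV f x :> D \<Longrightarrow> gradient f x = D"
  unfolding gradient_def
proof (rule the_equality)
  fix D' assume "GDERIV f x :> D" "GDERIV f x :> D'"
  then have "(\<lambda>h. h \<bullet> D) = (\<lambda>h. h \<bullet> D')" unfolding gderiv_def by (rule has_derivative_unique)
  then have "h \<bullet> D = h \<bullet> D'" for h by (rule fun_cong)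
  then show "D' = D" by (metis vector_eq_ldot)
qed

lemma GDERIV_local_quadratic:
  fixes f :: "real^'d::finite \<Rightarrow> real"
  assumes r: "0 < r" and b: "\<And>y. dist x y < r \<Longrightarrow> \<bar>f y - f x - D \<bullet> (y - x)\<bar> \<le> K * (norm (y - x))\<^sup>2"
  shows "GDERIV f x :> D"
  unfolding gderiv_def
proof (rule has_derivativeI_sandwich[where e = r and H = "\<lambda>y. K * norm (y - x)"])
  show "bounded_linear (\<lambda>h. h \<bullet> D)" by (rule bounded_linear_inner_left)
  fix y :: "real^'d" assume y: "y \<noteq> x" "dist y x < r"
  have "\<bar>f y - f x - D \<bullet> (y - x)\<bar> / norm (y - x) \<le> K * (norm (y - x))\<^sup>2 / norm (y - x)"
    using b[of y] y by (intro divide_right_mono) (auto simp: dist_commute)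
  then show "norm (f y - f x - (y - x) \<bullet> D) / norm (y - x) \<le> K * norm (y - x)"
    using y by (simp add: power2_eq_square inner_commute)
next
  have "((\<lambda>y. K * norm (y - x)) \<longlongrightarrow> K * norm (x - x)) (at x)" by (intro tendsto_intros)
  then show "((\<lambda>y. K * norm (y - x)) \<longlongrightarrow> 0) (at x)" by simp
qed (use r in auto)

text \<open>Of the 2n edges fewer than n are aerial, and \<open>Ground1\<close> receives at most n
  of the others.\<close>

lemma ktree_ground_counts:
  assumes "\<Gamma> \<in> ktrees n" "1 \<le> n"
  shows "n + 1 \<le> card (edges_to n \<Gamma> Ground1) + card (edges_to n \<Gamma> Ground2)"
    "1 \<le> card (edges_to n \<Gamma> Ground2)"
    "card (edges_to n \<Gamma> Ground2) = 1 \<longleftrightarrow> \<Gamma> \<in> stree n"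
proof -
  have G: "\<Gamma> \<in> kgraphs n" using assms by (simp add: ktrees_def)
  show 1: "n + 1 \<le> card (edges_to n \<Gamma> Ground1) + card (edges_to n \<Gamma> Ground2)"
    using edge_counts[of n \<Gamma>] ktree_aerial_edges[OF assms] by linarith
  show "1 \<le> card (edges_to n \<Gamma> Ground2)" using 1 ground_card_le(1)[OF G] by linarith
  show "card (edges_to n \<Gamma> Ground2) = 1 \<longleftrightarrow> \<Gamma> \<in> stree n" using assms by (simp add: stree_def)
qed

lemma finite_ktrees: "finite (ktrees n)"
  using finite_kgraphs by (rule finite_subset[rotated]) (auto simp: ktrees_def)

lemma ksymbol_linear:
  fixes p2 :: "real^'d::finite"
  assumes "\<Gamma> \<in> stree n"
  shows "ksymbol n \<Gamma> \<alpha> p1 p2 x = (\<Sum>j\<in>UNIV. p2 $ j * ksymbol n \<Gamma> \<alpha> p1 (axis j 1) x)"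
proof -
  obtain e where e: "(edges_to n \<Gamma> Ground2) = {e}"
    using assms card_1_singletonE unfolding stree_def by (metis (mono_tags, lifting) mem_Collect_eq)
  have "p2 $ i = (\<Sum>j\<in>UNIV. p2 $ j * axis j 1 $ i)" for i
    by (subst sum.remove[of _ i]) (auto simp: axis_def intro!: sum.neutral)
  note ax = this
  have lin: "X * p2 $ i = (\<Sum>j\<in>UNIV. p2 $ j * (X * axis j 1 $ i))" for i X
    by (subst ax) (simp only: sum_distrib_left mult.left_commute)
  have s: "(\<Prod>e\<in>{e}. f e) = f e" for f :: "nat \<times> nat \<Rightarrow> real" by simp
  define c where "c I = (\<Prod>k=1..n. iter_partial (map I (edge_list_to n \<Gamma> k)) (\<lambda>y. \<alpha> y $ I (k, 1) $ I (k, 2)) x)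
        * (\<Prod>e \<in> (edges_to n \<Gamma> Ground1). p1 $ I e)" for I :: "nat \<times> nat \<Rightarrow> 'd"
  have k: "ksymbol n \<Gamma> \<alpha> p1 v x = (\<Sum>I \<in> kedges n \<rightarrow>\<^sub>E UNIV. c I * v $ I e)" for v
    unfolding ksymbol_def e s c_def by (rule refl)
  have "(\<Sum>I \<in> kedges n \<rightarrow>\<^sub>E UNIV. c I * p2 $ I e) = (\<Sum>I \<in> kedges n \<rightarrow>\<^sub>E UNIV. \<Sum>j\<in>UNIV. p2 $ j * (c I * axis j 1 $ I e))"
    by (intro sum.cong refl lin)
  also have "\<dots> = (\<Sum>j\<in>UNIV. \<Sum>I \<in> kedges n \<rightarrow>\<^sub>E UNIV. p2 $ j * (c I * axis j 1 $ I e))" by (rule sum.swap)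
  finally show ?thesis unfolding k by (simp only: sum_distrib_left)
qed

text \<open>The exponent \<open>2 * n\<close> of \<open>\<kappa>\<close> counts the n tensors and at
  most n derivatives, one for each aerial edge.\<close>

lemma ksymbol_bound:
  fixes q :: "real^'d::finite"
  assumes G: "\<Gamma> \<in> ktrees n" and n: "1 \<le> n" and bnd: "deriv_bnd (comps \<alpha>) \<kappa> q" and \<kappa>: "1 \<le> \<kappa>"
  shows "\<bar>ksymbol n \<Gamma> \<alpha> p1 p2 q\<bar> \<le> real CARD('d) ^ (2 * n) * \<kappa> ^ (2 * n) *
    (norm p1 ^ card (edges_to n \<Gamma> Ground1) * norm p2 ^ card (edges_to n \<Gamma> Ground2))"
proof -
  let ?G1 = "(edges_to n \<Gamma> Ground1)" and ?G2 = "(edges_to n \<Gamma> Ground2)"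
  define len where "len k = length (edge_list_to n \<Gamma> k)" for k
  have "len k = card (edges_to n \<Gamma> (Aerial k))" for k
  proof -
    have "len k = card (set (edge_list_to n \<Gamma> k))"
      unfolding len_def by (rule distinct_card[symmetric]) (simp add: set_kedge_list(2))
    then show ?thesis by (simp add: set_kedge_list(1))
  qed
  then have "(\<Sum>k=1..n. len k) = (\<Sum>k=1..n. card (edges_to n \<Gamma> (Aerial k)))" by simp
  also have "\<dots> = card (\<Union>k\<in>{1..n}. (edges_to n \<Gamma> (Aerial k)))"
    using finite_kedges by (intro card_UN_disjoint[symmetric]) auto
  also have "\<dots> \<le> card {e \<in> kedges n. \<exists>j. \<Gamma> e = Aerial j}"
    using finite_kedges by (intro card_mono) auto
  also have "\<dots> \<le> n" using ktree_aerial_edges[OF G n] by simp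
  finally have lensum: "(\<Sum>k=1..n. len k) \<le> n" .
  have t: "\<bar>(\<Prod>k=1..n. iter_partial (map I (edge_list_to n \<Gamma> k)) (\<lambda>y. \<alpha> y $ I (k, 1) $ I (k, 2)) q)
        * (\<Prod>e\<in>?G1. p1 $ I e) * (\<Prod>e\<in>?G2. p2 $ I e)\<bar> \<le> \<kappa> ^ (2 * n) * (norm p1 ^ card ?G1 * norm p2 ^ card ?G2)" for I
  proof -
    have "\<bar>\<Prod>k=1..n. iter_partial (map I (edge_list_to n \<Gamma> k)) (\<lambda>y. \<alpha> y $ I (k, 1) $ I (k, 2)) q\<bar>
       \<le> (\<Prod>k=1..n. \<kappa> ^ (len k + 1))"
      unfolding abs_prod
    proof (rule prod_mono, intro conjI)
      fix k
      have "(\<lambda>y. \<alpha> y $ I (k, 1) $ I (k, 2)) \<in> comps \<alpha>" by (auto simp: comps_def)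
      then show "\<bar>iter_partial (map I (edge_list_to n \<Gamma> k)) (\<lambda>y. \<alpha> y $ I (k, 1) $ I (k, 2)) q\<bar> \<le> \<kappa> ^ (len k + 1)"
        using bnd unfolding deriv_bnd_def len_def by (metis length_map)
    qed simp
    also have "\<dots> = (\<Prod>k=1..n. \<kappa> ^ len k) * (\<Prod>k=1..n. \<kappa>)" by (simp only: power_add power_one_right prod.distrib)
    also have "\<dots> = \<kappa> ^ (\<Sum>k=1..n. len k) * \<kappa> ^ n" by (simp only: power_sum prod_constant card_atLeastAtMost diff_Suc_1)
    also have "\<dots> = \<kappa> ^ ((\<Sum>k=1..n. len k) + n)" by (simp only: power_add)
    also have "\<dots> \<le> \<kappa> ^ (2 * n)" using lensum \<kappa> by (intro power_increasing) auto
    finally have 1: "\<bar>\<Prod>k=1..n. iter_partial (map I (edge_list_to n \<Gamma> k)) (\<lambda>y. \<alpha> y $ I (k, 1) $ I (k, 2)) q\<bar>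
       \<le> \<kappa> ^ (2 * n)" .
    have 2: "\<bar>\<Prod>e\<in>E. v $ I e\<bar> \<le> norm v ^ card E" for E and v :: "real^'d"
    proof -
      have "\<bar>\<Prod>e\<in>E. v $ I e\<bar> \<le> (\<Prod>e\<in>E. norm v)" unfolding abs_prod by (intro prod_mono) (auto simp: component_le_norm_cart)
      then show ?thesis by simp
    qed
    show ?thesis
      unfolding abs_mult mult.assoc by (intro mult_mono 1 2) (use \<kappa> in auto)
  qed
  have "\<bar>ksymbol n \<Gamma> \<alpha> p1 p2 q\<bar> \<le> (\<Sum>I\<in>kedges n \<rightarrow>\<^sub>E (UNIV :: 'd set). \<kappa> ^ (2 * n) * (norm p1 ^ card ?G1 * norm p2 ^ card ?G2))"
    unfolding ksymbol_def by (rule order_trans[OF sum_abs sum_mono[OF t]])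
  also have "\<dots> = real CARD('d) ^ (2 * n) * \<kappa> ^ (2 * n) * (norm p1 ^ card ?G1 * norm p2 ^ card ?G2)"
    by (simp add: card_PiE finite_kedges card_kedges)
  finally show ?thesis .
qed

text \<open>48 is 16 from \<open>card_ktrees\<close> times 3 from \<open>power_self_le_fact\<close>;
  weights and powers of \<epsilon> are bounded by 1.\<close>

lemma tree_sum_bound:
  assumes n: "1 \<le> n" and \<epsilon>: "\<bar>\<epsilon>\<bar> \<le> 1" and T: "T \<subseteq> ktrees n"
    and b: "\<And>\<Gamma>. \<Gamma> \<in> T \<Longrightarrow> \<bar>f \<Gamma>\<bar> \<le> C" and C: "0 \<le> C"
  shows "\<bar>\<epsilon> ^ n / fact n * (\<Sum>\<Gamma>\<in>T. weight n \<Gamma> * f \<Gamma>)\<bar> \<le> 48 ^ n * C"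
proof -
  have "\<bar>\<Sum>\<Gamma>\<in>T. weight n \<Gamma> * f \<Gamma>\<bar> \<le> (\<Sum>\<Gamma>\<in>T. C)"
  proof (rule order_trans[OF sum_abs sum_mono])
    fix \<Gamma> assume G: "\<Gamma> \<in> T"
    obtain \<rho> where \<rho>: "graph_rank n \<Gamma> \<rho>" using ktree_rank' G T by blast
    have "\<bar>weight n \<Gamma>\<bar> * \<bar>f \<Gamma>\<bar> \<le> 1 * C"
      using weight_bound[OF _ \<rho>] G T b by (intro mult_mono) (auto simp: ktrees_def)
    then show "\<bar>weight n \<Gamma> * f \<Gamma>\<bar> \<le> C" by (simp add: abs_mult)
  qed
  also have "\<dots> = real (card T) * C" by simp
  also have "\<dots> \<le> (16 ^ n * real n ^ n) * C"
  proof (rule mult_right_mono[OF _ C])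
    have "card T \<le> 16 ^ n * n ^ n" using card_mono[OF finite_ktrees T] card_ktrees[OF n] by linarith
    then have "real (card T) \<le> real (16 ^ n * n ^ n)" by (simp only: of_nat_le_iff)
    then show "real (card T) \<le> 16 ^ n * real n ^ n" by (simp only: of_nat_mult of_nat_numeral of_nat_power)
  qed
  finally have 1: "\<bar>\<Sum>\<Gamma>\<in>T. weight n \<Gamma> * f \<Gamma>\<bar> \<le> (16 ^ n * real n ^ n) * C" .
  have "\<bar>\<epsilon> ^ n / fact n * (\<Sum>\<Gamma>\<in>T. weight n \<Gamma> * f \<Gamma>)\<bar> \<le> (1 / fact n) * ((16 ^ n * real n ^ n) * C)"
    unfolding abs_mult
  proof (intro mult_mono 1)
    have "\<bar>\<epsilon>\<bar> ^ n \<le> 1" using \<epsilon> by (intro power_le_one) auto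
    then show "\<bar>\<epsilon> ^ n / fact n\<bar> \<le> 1 / fact n" by (simp add: power_abs divide_right_mono)
  qed auto
  also have "\<dots> = 16 ^ n * (real n ^ n / fact n) * C" by simp
  also have "\<dots> \<le> 16 ^ n * 3 ^ n * C"
    using power_self_le_fact[of n] C by (intro mult_right_mono mult_left_mono) (auto simp: divide_le_eq)
  also have "\<dots> = 48 ^ n * C" by (simp add: power_mult_distrib[symmetric])
  finally show ?thesis .
qed

context
  fixes U :: "(real^'d::finite) set" and \<alpha> :: "real^'d \<Rightarrow> real^'d^'d" and q :: "real^'d" and \<rho> \<epsilon> :: real
  assumes U: "open U" and sm: "\<And>i j. smooth_on U (\<lambda>y. \<alpha> y $ i $ j)"
    and anti: "\<And>x i j. x \<in> U \<Longrightarrow> \<alpha> x $ i $ j = - \<alpha> x $ j $ i"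
    and \<rho>: "0 < \<rho>" "\<rho> \<le> 1" "ball q \<rho> \<subseteq> U"
    and bnd: "\<And>y. y \<in> ball q \<rho> \<Longrightarrow> deriv_bnd (comps \<alpha>) (1 / \<rho>) y"
    and \<epsilon>: "\<bar>\<epsilon>\<bar> \<le> 1"
begin

text \<open>Chosen so that the generating function is dominated by a geometric series of ratio
  1/2.\<close>

definition S0 :: real where "S0 = \<rho>\<^sup>2 / (96 * real CARD('d) ^ 2)"

lemma card_pos: "1 \<le> real CARD('d)" by (simp add: Suc_leI)

lemma S0: "0 < S0" "S0 \<le> 1" "48 * real CARD('d) ^ 2 * (1 / \<rho>)\<^sup>2 * S0 = 1 / 2"
proof -
  show "0 < S0" using \<rho> card_pos by (simp add: S0_def)
  have "\<rho>\<^sup>2 \<le> 1" using \<rho> by (simp add: power_le_one)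
  moreover have "1 \<le> real CARD('d) ^ 2" using card_pos by (simp add: one_le_power)
  ultimately show "S0 \<le> 1" unfolding S0_def by (subst divide_le_eq_1_pos) linarith+
  show "48 * real CARD('d) ^ 2 * (1 / \<rho>)\<^sup>2 * S0 = 1 / 2" using \<rho> card_pos by (simp add: S0_def power_divide)
qed

lemma bnd_q: "deriv_bnd (comps \<alpha>) (1 / \<rho>) q" "1 \<le> 1 / \<rho>"
  using bnd[of q] \<rho> by auto

lemma power_collect: "48 ^ n * (real CARD('d) ^ (2 * n) * (1 / \<rho>) ^ (2 * n) * (S0 ^ n * Z)) = (1 / 2) ^ n * Z"
proof -
  have "48 ^ n * (real CARD('d) ^ (2 * n) * (1 / \<rho>) ^ (2 * n) * (S0 ^ n * Z)) = (48 * real CARD('d) ^ 2 * (1 / \<rho>)\<^sup>2 * S0) ^ n * Z"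
    by (simp only: power_mult_distrib power_mult mult.assoc)
  then show ?thesis by (simp only: S0(3))
qed

lemma genfun_term_bound:
  assumes n: "1 \<le> n" and s: "norm p1 + norm p2 \<le> S0"
  shows "\<bar>genfun_term \<epsilon> \<alpha> n p1 p2 q\<bar> \<le> (1 / 2) ^ n"
proof -
  have "\<bar>genfun_term \<epsilon> \<alpha> n p1 p2 q\<bar> \<le> 48 ^ n * (real CARD('d) ^ (2 * n) * (1 / \<rho>) ^ (2 * n) * (S0 ^ n * 1))"
    unfolding genfun_term_def
  proof (rule tree_sum_bound[OF n \<epsilon> subset_refl])
    fix \<Gamma> assume G: "\<Gamma> \<in> ktrees n"
    let ?g1 = "card (edges_to n \<Gamma> Ground1)" and ?g2 = "card (edges_to n \<Gamma> Ground2)"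
    have "norm p1 ^ ?g1 * norm p2 ^ ?g2 \<le> S0 ^ ?g1 * S0 ^ ?g2"
      using s S0(1) norm_ge_zero[of p1] norm_ge_zero[of p2] by (intro mult_mono power_mono) (linarith | simp)+
    also have "\<dots> = S0 ^ (?g1 + ?g2)" by (simp add: power_add)
    also have "\<dots> \<le> S0 ^ n" using ktree_ground_counts(1)[OF G n] S0 by (intro power_decreasing) auto
    finally have "norm p1 ^ ?g1 * norm p2 ^ ?g2 \<le> S0 ^ n * 1" by simp
    then show "\<bar>ksymbol n \<Gamma> \<alpha> p1 p2 q\<bar> \<le> real CARD('d) ^ (2 * n) * (1 / \<rho>) ^ (2 * n) * (S0 ^ n * 1)"
      using \<rho> by (intro order_trans[OF ksymbol_bound[OF G n bnd_q]] mult_left_mono) auto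
  qed (use S0 \<rho> in auto)
  then show ?thesis unfolding power_collect by simp
qed

lemma genfun_summable:
  assumes "norm p1 + norm p2 \<le> S0"
  shows "summable (\<lambda>n. genfun_term \<epsilon> \<alpha> (Suc n) p1 p2 q)"
proof (rule summable_comparison_test'[of "\<lambda>n. (1 / 2::real) ^ Suc n" 0])
  show "summable (\<lambda>n. (1 / 2::real) ^ Suc n)" by (intro summable_Suc_iff[THEN iffD2] summable_geometric) simp
  show "norm (genfun_term \<epsilon> \<alpha> (Suc n) p1 p2 q) \<le> (1 / 2) ^ Suc n" for n
    using genfun_term_bound[of "Suc n", OF _ assms] by simp
qed

text \<open>Trees outside \<open>stree\<close> have at least two edges to \<open>Ground2\<close>, so
  they are quadratic in \<open>p2\<close> and invisible to the gradient at 0. The trees of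
  \<open>stree\<close> are linear in \<open>p2\<close>, with coefficients that sum up to
  \<open>X 0 - q\<close>.\<close>

lemma genfun_source:
  assumes p: "norm p < S0"
  shows "\<exists>X. (\<forall>u\<in>{0..1}. (X has_vector_derivative (2 * \<epsilon>) *\<^sub>R (\<alpha> (X u) *v p)) (at u within {0..1}) \<and> dist q (X u) \<le> \<rho> / 2) \<and>
     integral {0..1} X = q \<and> GDERIV (\<lambda>p2. genfun \<epsilon> \<alpha> p p2 q) 0 :> X 0"
proof -
  have p24: "24 * real CARD('d) ^ 2 * norm p \<le> \<rho>\<^sup>2"
  proof -
    have "96 * real CARD('d) ^ 2 * norm p \<le> 96 * real CARD('d) ^ 2 * S0" using p by (intro mult_left_mono) auto
    also have "\<dots> = \<rho>\<^sup>2" using card_pos by (simp add: S0_def)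
    finally have "96 * (real CARD('d) ^ 2 * norm p) \<le> \<rho>\<^sup>2" by (simp only: mult.assoc)
    moreover have "0 \<le> real CARD('d) ^ 2 * norm p" by (intro mult_nonneg_nonneg) auto
    ultimately have "24 * (real CARD('d) ^ 2 * norm p) \<le> \<rho>\<^sup>2" by linarith
    then show ?thesis by (simp only: mult.assoc)
  qed
  obtain X where X: "\<forall>u\<in>{0..1}. (X has_vector_derivative (2 * \<epsilon>) *\<^sub>R (\<alpha> (X u) *v p)) (at u within {0..1}) \<and> dist q (X u) \<le> \<rho> / 2"
      "integral {0..1} X = q"
    and Xs: "\<forall>j. (\<lambda>n. \<epsilon> ^ Suc n * (mean_prim (th (tree_coeff \<alpha> p q) (Suc n) {#} j) 0 / fact n)) sums (X 0 $ j - q $ j)"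
    using curve_exists[OF refl refl U sm \<rho> bnd p24 \<epsilon>] by blast
  have qU: "q \<in> U" using \<rho> by auto
  define L where "L n j = \<epsilon> ^ n / fact n * (\<Sum>\<Gamma>\<in>stree n. weight n \<Gamma> * ksymbol n \<Gamma> \<alpha> p (axis j 1) q)" for n j
  have L: "L (Suc n) j = \<epsilon> ^ Suc n * (mean_prim (th (tree_coeff \<alpha> p q) (Suc n) {#} j) 0 / fact n)" for n j
  proof -
    have tc: "(\<lambda>M i. 2 * (\<Sum>l\<in>UNIV. iter_partial (mlist M) (\<lambda>y. \<alpha> y $ i $ l) q * p $ l)) = tree_coeff \<alpha> p q"
      by (simp add: tree_coeff_def vfield_def fun_eq_iff)
    have "(\<Sum>\<Gamma>\<in>stree (Suc n). weight (Suc n) \<Gamma> * ksymbol (Suc n) \<Gamma> \<alpha> p (axis j 1) q) =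
      real (Suc n) * mean_prim (th (\<lambda>M i. 2 * (\<Sum>l\<in>UNIV. iter_partial (mlist M) (\<lambda>y. \<alpha> y $ i $ l) q * p $ l)) (Suc n) {#} j) 0"
    proof (rule source_tree_sum)
      show "iter_partial xs (\<lambda>y. \<alpha> y $ i $ j) q = iter_partial ys (\<lambda>y. \<alpha> y $ i $ j) q" if "mset xs = mset ys" for xs ys i j
        by (rule iter_partial_perm[OF U sm that qU])
      show "iter_partial xs (\<lambda>y. \<alpha> y $ i $ j) q = - iter_partial xs (\<lambda>y. \<alpha> y $ j $ i) q" for xs i j
      proof -
        have "iter_partial xs (\<lambda>y. \<alpha> y $ i $ j) q = iter_partial xs (\<lambda>y. - \<alpha> y $ j $ i) q"
          by (rule iter_partial_cong[OF U anti qU])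
        then show ?thesis using iter_partial_minus[OF U sm qU] by simp
      qed
    qed simp
    then show ?thesis unfolding tc by (simp add: L_def divide_simps)
  qed
  define R where "R n p2 = \<epsilon> ^ n / fact n * (\<Sum>\<Gamma>\<in>ktrees n - stree n. weight n \<Gamma> * ksymbol n \<Gamma> \<alpha> p p2 q)" for n p2
  have split: "genfun_term \<epsilon> \<alpha> n p p2 q = (\<Sum>j\<in>UNIV. p2 $ j * L n j) + R n p2" for n p2
  proof -
    have "(\<Sum>\<Gamma>\<in>ktrees n. weight n \<Gamma> * ksymbol n \<Gamma> \<alpha> p p2 q) =
      (\<Sum>\<Gamma>\<in>ktrees n - stree n. weight n \<Gamma> * ksymbol n \<Gamma> \<alpha> p p2 q) + (\<Sum>\<Gamma>\<in>stree n. weight n \<Gamma> * ksymbol n \<Gamma> \<alpha> p p2 q)"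
      by (intro sum.subset_diff finite_ktrees) (auto simp: stree_def)
    also have "(\<Sum>\<Gamma>\<in>stree n. weight n \<Gamma> * ksymbol n \<Gamma> \<alpha> p p2 q) =
       (\<Sum>\<Gamma>\<in>stree n. \<Sum>j\<in>UNIV. p2 $ j * (weight n \<Gamma> * ksymbol n \<Gamma> \<alpha> p (axis j 1) q))"
    proof (intro sum.cong refl)
      fix \<Gamma> assume "\<Gamma> \<in> stree n"
      from ksymbol_linear[OF this, of \<alpha> p p2 q]
      show "weight n \<Gamma> * ksymbol n \<Gamma> \<alpha> p p2 q = (\<Sum>j\<in>UNIV. p2 $ j * (weight n \<Gamma> * ksymbol n \<Gamma> \<alpha> p (axis j 1) q))"
        by (simp only: sum_distrib_left mult.left_commute)
    qed
    also have "\<dots> = (\<Sum>j\<in>UNIV. p2 $ j * (\<Sum>\<Gamma>\<in>stree n. weight n \<Gamma> * ksymbol n \<Gamma> \<alpha> p (axis j 1) q))"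
      unfolding sum_distrib_left by (rule sum.swap)
    finally show ?thesis
      unfolding genfun_term_def R_def L_def by (simp add: distrib_left sum_distrib_left mult_ac)
  qed
  \<comment> \<open>Two factors \<open>norm p2\<close> are split off; at least n - 1 ground edges
    remain, each estimated by \<open>S0\<close>, whence the division by \<open>S0\<close>.\<close>
  have Rb: "\<bar>R n p2\<bar> \<le> (1 / 2) ^ n * ((norm p2)\<^sup>2 / S0)" if n: "1 \<le> n" and s: "norm p + norm p2 \<le> S0" for n p2
  proof -
    have "\<bar>R n p2\<bar> \<le> 48 ^ n * (real CARD('d) ^ (2 * n) * (1 / \<rho>) ^ (2 * n) * (S0 ^ n * ((norm p2)\<^sup>2 / S0)))"
      unfolding R_def
    proof (rule tree_sum_bound[OF n \<epsilon> Diff_subset])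
      fix \<Gamma> assume G: "\<Gamma> \<in> ktrees n - stree n"
      let ?g1 = "card (edges_to n \<Gamma> Ground1)" and ?g2 = "card (edges_to n \<Gamma> Ground2)"
      have GT: "\<Gamma> \<in> ktrees n" using G by simp
      have "?g2 \<noteq> 1" "1 \<le> ?g2" using ktree_ground_counts(2,3)[OF GT n] G by blast+
      then have g2: "2 \<le> ?g2" by linarith
      have pw: "norm p2 ^ ?g2 = (norm p2)\<^sup>2 * norm p2 ^ (?g2 - 2)"
        using power_add[of "norm p2" 2 "?g2 - 2"] unfolding le_add_diff_inverse[OF g2] .
      have "norm p ^ ?g1 * norm p2 ^ ?g2 = (norm p2)\<^sup>2 * (norm p ^ ?g1 * norm p2 ^ (?g2 - 2))"
        unfolding pw by (simp only: mult.left_commute)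
      also have "\<dots> \<le> (norm p2)\<^sup>2 * (S0 ^ ?g1 * S0 ^ (?g2 - 2))"
        using s S0(1) norm_ge_zero[of p] norm_ge_zero[of p2] by (intro mult_left_mono mult_mono power_mono) (linarith | simp)+
      also have "S0 ^ ?g1 * S0 ^ (?g2 - 2) = S0 ^ (?g1 + ?g2 - 2)" using g2 by (simp add: power_add[symmetric])
      finally have 1: "norm p ^ ?g1 * norm p2 ^ ?g2 \<le> (norm p2)\<^sup>2 * S0 ^ (?g1 + ?g2 - 2)" .
      have "S0 ^ (?g1 + ?g2 - 2) \<le> S0 ^ (n - 1)"
        using ktree_ground_counts(1)[OF GT n] S0 by (intro power_decreasing) auto
      also have "S0 ^ (n - 1) = S0 ^ n / S0" using n S0(1) by (simp add: power_diff)
      finally have "(norm p2)\<^sup>2 * S0 ^ (?g1 + ?g2 - 2) \<le> (norm p2)\<^sup>2 * (S0 ^ n / S0)" by (intro mult_left_mono) auto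
      also have "\<dots> = S0 ^ n * ((norm p2)\<^sup>2 / S0)" by simp
      finally have "norm p ^ ?g1 * norm p2 ^ ?g2 \<le> S0 ^ n * ((norm p2)\<^sup>2 / S0)" using 1 by linarith
      then show "\<bar>ksymbol n \<Gamma> \<alpha> p p2 q\<bar> \<le> real CARD('d) ^ (2 * n) * (1 / \<rho>) ^ (2 * n) * (S0 ^ n * ((norm p2)\<^sup>2 / S0))"
        using \<rho> by (intro order_trans[OF ksymbol_bound[OF GT n bnd_q]] mult_left_mono) auto
    qed (use S0 \<rho> in auto)
    then show ?thesis unfolding power_collect .
  qed
  have quad: "\<bar>genfun \<epsilon> \<alpha> p p2 q - p \<bullet> q - X 0 \<bullet> p2\<bar> \<le> (1 / S0) * (norm p2)\<^sup>2" if s: "norm p + norm p2 \<le> S0" for p2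
  proof -
    have Ls: "(\<lambda>n. \<Sum>j\<in>UNIV. p2 $ j * L (Suc n) j) sums (\<Sum>j\<in>UNIV. p2 $ j * (X 0 $ j - q $ j))"
      unfolding L using Xs by (intro sums_sum sums_mult) auto
    have gs: "summable (\<lambda>n. 1 / 2 * (1 / 2) ^ n * ((norm p2)\<^sup>2 / S0))" by (intro summable_mult2 summable_mult summable_geometric) simp
    have Rn: "norm (R (Suc n) p2) \<le> 1 / 2 * (1 / 2) ^ n * ((norm p2)\<^sup>2 / S0)" for n
      using Rb[of "Suc n", OF _ s] by simp
    have Rs: "summable (\<lambda>n. norm (R (Suc n) p2))"
      by (rule summable_comparison_test'[OF gs, of 0]) (use Rn in simp)
    have "(\<Sum>n. genfun_term \<epsilon> \<alpha> (Suc n) p p2 q) = (\<Sum>j\<in>UNIV. p2 $ j * (X 0 $ j - q $ j)) + (\<Sum>n. R (Suc n) p2)"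
      unfolding split using sums_add[OF Ls summable_sums[OF summable_norm_cancel[OF Rs]]] by (simp add: sums_iff)
    moreover have "(\<Sum>j\<in>UNIV. p2 $ j * (X 0 $ j - q $ j)) = p2 \<bullet> (X 0 - q)" by (simp add: inner_vec_def)
    ultimately have "genfun \<epsilon> \<alpha> p p2 q - p \<bullet> q - X 0 \<bullet> p2 = (\<Sum>n. R (Suc n) p2)"
      unfolding genfun_def by (simp add: inner_simps inner_commute)
    also have "\<bar>\<dots>\<bar> \<le> (\<Sum>n. norm (R (Suc n) p2))" using summable_norm[OF Rs] by simp
    also have "\<dots> \<le> (\<Sum>n. 1 / 2 * (1 / 2) ^ n * ((norm p2)\<^sup>2 / S0))"
      by (intro suminf_le Rs gs Rn)
    also have "\<dots> = (\<Sum>n. (1 / 2) ^ n) * (1 / 2 * ((norm p2)\<^sup>2 / S0))"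
    proof -
      have "summable (\<lambda>n. (1 / 2 :: real) ^ n)" by (intro summable_geometric) simp
      from suminf_mult2[OF this, of "1 / 2 * ((norm p2)\<^sup>2 / S0)"] show ?thesis by (simp add: mult_ac)
    qed
    also have "(\<Sum>n. (1 / 2::real) ^ n) = 2" by (subst suminf_geometric) auto
    finally show ?thesis by simp
  qed
  have "GDERIV (\<lambda>p2. genfun \<epsilon> \<alpha> p p2 q) 0 :> X 0"
  proof (rule GDERIV_local_quadratic[where r = "S0 - norm p" and K = "1 / S0"])
    have g0: "genfun \<epsilon> \<alpha> p 0 q = p \<bullet> q" using quad[of 0] p by simp
    show "\<bar>genfun \<epsilon> \<alpha> p y q - genfun \<epsilon> \<alpha> p 0 q - X 0 \<bullet> (y - 0)\<bar> \<le> 1 / S0 * (norm (y - 0))\<^sup>2" if "dist 0 y < S0 - norm p" for y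
      unfolding g0 diff_zero using that by (intro quad) simp
  qed (use p in simp)
  then show ?thesis using X by blast
qed

lemmas genfun_source_curve = genfun_source[unfolded S0_def]
lemmas genfun_summable_near = genfun_summable[unfolded S0_def]

end

section \<open>Poisson and Hamilton flows\<close>

lemma vector_derivative_bound:
  fixes f :: "real \<Rightarrow> 'a::real_normed_vector"
  assumes "\<And>u. u \<in> {a..b} \<Longrightarrow> (f has_vector_derivative f' u) (at u within {a..b})"
    and "\<And>u. u \<in> {a..b} \<Longrightarrow> norm (f' u) \<le> B" and "u \<in> {a..b}" "v \<in> {a..b}"
  shows "norm (f u - f v) \<le> B * \<bar>u - v\<bar>"
proof -
  have "norm (f u - f v) \<le> B * norm (u - v)"
  proof (rule differentiable_bound[of "{a..b}" f "\<lambda>u h. h *\<^sub>R f' u"])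
    show "(f has_derivative (\<lambda>h. h *\<^sub>R f' x)) (at x within {a..b})" if "x \<in> {a..b}" for x
      using assms(1)[OF that] by (simp add: has_vector_derivative_def)
    show "onorm (\<lambda>h. h *\<^sub>R f' x) \<le> B" if "x \<in> {a..b}" for x
      using assms(2)[OF that] by (intro onorm_le) (simp add: mult.commute[of B] mult_left_mono)
  qed (use assms in auto)
  then show ?thesis by simp
qed

lemma mean_distance:
  fixes f :: "real \<Rightarrow> 'a::banach"
  assumes d: "\<And>u. u \<in> {0..1} \<Longrightarrow> (f has_vector_derivative f' u) (at u within {0..1})"
    and B: "\<And>u. u \<in> {0..1} \<Longrightarrow> norm (f' u) \<le> B" and u: "u \<in> {0..1}"
  shows "norm (f u - integral {0..1} f) \<le> B"
proof -
  have c: "continuous_on {0..1} f" by (rule continuous_on_vector_derivative[OF d])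
  have "0 \<le> B" using B[OF u] norm_ge_zero order_trans by blast
  have "integral {0..1} (\<lambda>v. f u - f v) = f u - integral {0..1} f"
    using integrable_continuous_real[OF c] by (subst integral_diff) auto
  moreover have "norm (integral {0..1} (\<lambda>v. f u - f v)) \<le> B * (1 - 0)"
  proof (rule integral_bound)
    show "norm (f u - f v) \<le> B" if "v \<in> {0..1}" for v
    proof -
      have "norm (f u - f v) \<le> B * \<bar>u - v\<bar>" by (rule vector_derivative_bound[OF d B u that])
      also have "\<dots> \<le> B * 1" using u that \<open>0 \<le> B\<close> by (intro mult_left_mono) auto
      finally show ?thesis by simp
    qed
  qed (auto intro!: continuous_intros c)
  ultimately show ?thesis by simp
qed

text \<open>Gronwall by continuation: the linear bound is asked for only to the right of a time up
  to which \<open>w\<close> vanishes, so that its constant may depend on the point reached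
  there.\<close>

lemma vanishing_of_local_bound:
  fixes w :: "real \<Rightarrow> 'a::banach"
  assumes d: "\<And>u. u \<in> {0..1} \<Longrightarrow> (w has_vector_derivative w' u) (at u within {0..1})"
    and w0: "w 0 = 0"
    and loc: "\<And>t. t \<in> {0..<1} \<Longrightarrow> (\<And>s. s \<in> {0..t} \<Longrightarrow> w s = 0) \<Longrightarrow>
        \<exists>\<delta>>0. \<exists>L. \<forall>s\<in>{t..t+\<delta>} \<inter> {0..1}. norm (w' s) \<le> L * norm (w s)"
    and u: "u \<in> {0..1}"
  shows "w u = 0"
proof -
  have c: "continuous_on {0..1} w" by (rule continuous_on_vector_derivative[OF d])
  define Z where "Z = {t\<in>{0..1}. \<forall>s\<in>{0..t}. w s = 0}"
  define T where "T = Sup Z"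
  have Z0: "0 \<in> Z" using w0 by (auto simp: Z_def)
  have bdd: "bdd_above Z" by (rule bdd_aboveI[of _ 1]) (auto simp: Z_def)
  have T01: "0 \<le> T" "T \<le> 1" proof -
    show "0 \<le> T" unfolding T_def by (rule cSup_upper[OF Z0 bdd])
    show "T \<le> 1" unfolding T_def by (rule cSup_least) (use Z0 in blast, simp add: Z_def)
  qed
  have below: "w s = 0" if s: "s \<in> {0..<T}" for s
  proof -
    obtain t where "t \<in> Z" "s < t" using s less_cSupD[of Z s] Z0 by (auto simp: T_def)
    then show ?thesis using s by (auto simp: Z_def)
  qed
  have wT: "w T = 0"
  proof (cases "T = 0")
    case False
    then have "closure {0..<T} = {0..T}" using T01 by (intro closure_atLeastLessThan) simp
    moreover have "closed {x \<in> {0..1}. w x = 0}" using c by (intro continuous_closed_preimage_constant) auto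
    moreover have "{0..<T} \<subseteq> {x \<in> {0..1}. w x = 0}" using below T01 by auto
    ultimately have "{0..T} \<subseteq> {x \<in> {0..1}. w x = 0}" using closure_minimal by metis
    then show ?thesis using T01 by auto
  qed (use w0 in simp)
  have zero: "w s = 0" if "s \<in> {0..T}" for s using below wT that by (cases "s = T") auto
  show ?thesis
  proof (cases "T = 1")
    case True then show ?thesis using zero u by auto
  next
    case False
    then have "T \<in> {0..<1}" using T01 by auto
    from loc[OF this zero] obtain \<delta> L where \<delta>: "\<delta> > 0"
      and L: "\<forall>s\<in>{T..T+\<delta>} \<inter> {0..1}. norm (w' s) \<le> L * norm (w s)" by blast
    \<comment> \<open>So short that the maximum of \<open>norm (w s)\<close> on the interval is at
      most half of itself.\<close>
    define \<eta> where "\<eta> = min \<delta> (min (1 - T) (1 / (2 * (\<bar>L\<bar> + 1))))"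
    have \<eta>: "0 < \<eta>" "\<eta> \<le> \<delta>" "T + \<eta> \<le> 1" and L\<eta>: "\<eta> \<le> 1 / (2 * (\<bar>L\<bar> + 1))"
      using \<delta> T01 False by (auto simp: \<eta>_def)
    have sub: "{T..T+\<eta>} \<subseteq> {0..1}" using \<eta> T01 by auto
    have "continuous_on {T..T+\<eta>} (\<lambda>s. norm (w s))" by (intro continuous_on_norm continuous_on_subset[OF c sub])
    then obtain s where s: "s \<in> {T..T+\<eta>}" "\<And>r. r \<in> {T..T+\<eta>} \<Longrightarrow> norm (w r) \<le> norm (w s)"
      using continuous_attains_sup[of "{T..T+\<eta>}" "\<lambda>s. norm (w s)"] \<eta> by auto
    have "norm (w s - w T) \<le> ((\<bar>L\<bar> + 1) * norm (w s)) * \<bar>s - T\<bar>"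
    proof (rule vector_derivative_bound)
      show "(w has_vector_derivative w' r) (at r within {T..T+\<eta>})" if "r \<in> {T..T+\<eta>}" for r
        using d sub that by (meson has_vector_derivative_within_subset subsetD)
      show "norm (w' r) \<le> (\<bar>L\<bar> + 1) * norm (w s)" if r: "r \<in> {T..T+\<eta>}" for r
      proof -
        have "norm (w' r) \<le> L * norm (w r)" using L r sub \<eta> by auto
        also have "\<dots> \<le> (\<bar>L\<bar> + 1) * norm (w r)" by (intro mult_right_mono) auto
        also have "\<dots> \<le> (\<bar>L\<bar> + 1) * norm (w s)" by (intro mult_left_mono s(2) r) auto
        finally show ?thesis .
      qed
    qed (use s(1) \<eta> in auto)
    also have "\<dots> \<le> ((\<bar>L\<bar> + 1) * norm (w s)) * (1 / (2 * (\<bar>L\<bar> + 1)))"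
      using s(1) L\<eta> by (intro mult_left_mono) auto
    also have "\<dots> = norm (w s) / 2" using abs_ge_zero[of L] by (simp add: field_simps add_nonneg_eq_0_iff)
    finally have "norm (w s) = 0" using wT by simp
    then have "w r = 0" if "r \<in> {T..T+\<eta>}" for r using s(2)[OF that] by simp
    then have "T + \<eta> \<in> Z" using zero \<eta> T01 unfolding Z_def by (auto simp: not_le[symmetric]) (metis atLeastAtMost_iff linear)
    then have "T + \<eta> \<le> T" unfolding T_def by (rule cSup_upper[OF _ bdd])
    then show ?thesis using \<eta> by simp
  qed
qed

text \<open>For a gradient that is only known to exist: the difference quotients in the direction
  \<open>D - a\<close> bound the length of that vector.\<close>

lemma gradient_distance_le:
  fixes f :: "real^'d::finite \<Rightarrow> real"
  assumes g: "GDERIV f x :> D" and r: "0 < r" and L: "0 \<le> L"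
    and b: "\<And>y. dist x y < r \<Longrightarrow> \<bar>f y - f x - a \<bullet> (y - x)\<bar> \<le> L * norm (y - x)"
  shows "norm (D - a) \<le> L"
proof (cases "D = a")
  case False
  define v where "v = D - a"
  have v: "0 < norm v" using False by (simp add: v_def)
  have "((\<lambda>t. x + t *\<^sub>R v) has_derivative (\<lambda>t. t *\<^sub>R v)) (at 0)" by (auto intro!: derivative_eq_intros)
  moreover have "(f has_derivative (\<lambda>h. h \<bullet> D)) (at (x + 0 *\<^sub>R v))" using g by (simp add: gderiv_def)
  ultimately have "((\<lambda>t. f (x + t *\<^sub>R v)) has_derivative (\<lambda>t. (t *\<^sub>R v) \<bullet> D)) (at 0)" by (rule has_derivative_compose)
  then have "((\<lambda>t. f (x + t *\<^sub>R v)) has_real_derivative v \<bullet> D) (at 0)"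
    by (simp add: has_field_derivative_def mult_commute_abs)
  then have "((\<lambda>t. (f (x + t *\<^sub>R v) - f x) / t) \<longlongrightarrow> v \<bullet> D) (at 0)" by (simp add: DERIV_def)
  then have "((\<lambda>t. \<bar>(f (x + t *\<^sub>R v) - f x) / t - a \<bullet> v\<bar>) \<longlongrightarrow> \<bar>v \<bullet> D - a \<bullet> v\<bar>) (at 0)" by (intro tendsto_intros)
  moreover have "\<forall>\<^sub>F t in at 0. \<bar>(f (x + t *\<^sub>R v) - f x) / t - a \<bullet> v\<bar> \<le> L * norm v"
  proof -
    have "\<forall>\<^sub>F t in at 0. dist t 0 < r / norm v" using r v by (intro eventually_at_ball'[unfolded mem_ball] eventually_at[THEN iffD2]) (auto intro!: exI[of _ "r / norm v"])
    moreover have "\<forall>\<^sub>F t in at 0. t \<noteq> (0::real)" by (rule eventually_neq_at_within)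
    ultimately show ?thesis
    proof eventually_elim
      fix t :: real assume t: "dist t 0 < r / norm v" "t \<noteq> 0"
      have "\<bar>t\<bar> * norm v < r" using t v by (simp add: pos_less_divide_eq)
      then have "\<bar>f (x + t *\<^sub>R v) - f x - a \<bullet> (t *\<^sub>R v)\<bar> \<le> L * (\<bar>t\<bar> * norm v)"
        using b[of "x + t *\<^sub>R v"] by (simp add: dist_norm)
      then have "\<bar>f (x + t *\<^sub>R v) - f x - a \<bullet> (t *\<^sub>R v)\<bar> / \<bar>t\<bar> \<le> L * norm v" using t by (simp add: divide_le_eq mult_ac)
      moreover have "\<bar>f (x + t *\<^sub>R v) - f x - a \<bullet> (t *\<^sub>R v)\<bar> / \<bar>t\<bar> = \<bar>(f (x + t *\<^sub>R v) - f x) / t - a \<bullet> v\<bar>"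
        using t by (simp add: abs_divide[symmetric] diff_divide_distrib)
      ultimately show "\<bar>(f (x + t *\<^sub>R v) - f x) / t - a \<bullet> v\<bar> \<le> L * norm v" by simp
    qed
  qed
  ultimately have "\<bar>v \<bullet> D - a \<bullet> v\<bar> \<le> L * norm v" by (intro tendsto_upperbound) auto
  moreover have "v \<bullet> D - a \<bullet> v = norm v * norm v" unfolding power2_eq_square[symmetric] power2_norm_eq_inner by (simp add: v_def inner_simps inner_commute)
  ultimately show ?thesis using v by (simp add: v_def)
qed (use L in simp)

lemma matrix_vector_bound:
  fixes M :: "real^'d^'d"
  assumes "\<And>i j. \<bar>M $ i $ j\<bar> \<le> C"
  shows "norm (M *v v) \<le> real CARD('d) ^ 2 * C * norm v"
proof -
  have "\<bar>(M *v v) $ i\<bar> \<le> real CARD('d) * (C * norm v)" for i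
  proof -
    have "\<bar>(M *v v) $ i\<bar> \<le> (\<Sum>j\<in>UNIV. \<bar>M $ i $ j * v $ j\<bar>)" by (simp add: matrix_vector_mult_def)
    also have "\<dots> \<le> (\<Sum>j\<in>(UNIV :: 'd set). C * norm v)"
      unfolding abs_mult using assms order_trans[OF abs_ge_zero assms] by (intro sum_mono mult_mono component_le_norm_cart) auto
    finally show ?thesis by simp
  qed
  then have "(\<Sum>i\<in>UNIV. \<bar>(M *v v) $ i\<bar>) \<le> (\<Sum>i\<in>(UNIV :: 'd set). real CARD('d) * (C * norm v))" by (intro sum_mono)
  then have "norm (M *v v) \<le> (\<Sum>i\<in>(UNIV :: 'd set). real CARD('d) * (C * norm v))" by (rule order_trans[OF norm_le_l1_cart])
  then show ?thesis by (simp add: power2_eq_square mult_ac)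
qed

section \<open>Local bounds and Lipschitz constants of the tensor\<close>

context
  fixes U :: "(real^'d::finite) set" and \<alpha> :: "real^'d \<Rightarrow> real^'d^'d" and b :: "real^'d" and \<rho> :: real
  assumes U: "open U" and sm: "\<And>i j. smooth_on U (\<lambda>y. \<alpha> y $ i $ j)"
    and \<rho>: "0 < \<rho>" "\<rho> \<le> 1" "ball b \<rho> \<subseteq> U"
    and bnd: "\<And>y. y \<in> ball b \<rho> \<Longrightarrow> deriv_bnd (comps \<alpha>) (1 / \<rho>) y"
begin

lemma comp_bound: "y \<in> ball b \<rho> \<Longrightarrow> \<bar>iter_partial is (\<lambda>y. \<alpha> y $ i $ j) y\<bar> \<le> (1 / \<rho>) ^ (length is + 1)"
  using bnd unfolding deriv_bnd_def comps_def by blast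

lemma field_bound: "y \<in> ball b \<rho> \<Longrightarrow> norm (\<alpha> y *v v) \<le> real CARD('d) ^ 3 / \<rho> * norm v"
proof -
  assume y: "y \<in> ball b \<rho>"
  have "norm (\<alpha> y *v v) \<le> real CARD('d) ^ 2 * (1 / \<rho>) * norm v"
    using comp_bound[OF y, of "[]"] by (intro matrix_vector_bound) simp
  also have "\<dots> \<le> real CARD('d) ^ 3 * (1 / \<rho>) * norm v"
    using \<rho> by (intro mult_right_mono power_increasing) (auto simp: Suc_leI)
  finally show ?thesis by simp
qed

lemma comp_lipschitz:
  assumes y: "y \<in> ball b \<rho>" and z: "z \<in> ball b \<rho>"
  shows "norm (\<alpha> y $ i $ j - \<alpha> z $ i $ j) \<le> real CARD('d) / \<rho>\<^sup>2 * norm (y - z)"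
proof -
  have c: "\<bar>iter_partial [k] (\<lambda>y. \<alpha> y $ i $ j) x\<bar> \<le> (1 / \<rho>)\<^sup>2" if "x \<in> ball b \<rho>" for x k
    using comp_bound[OF that, of "[k]" i j] by (simp add: power2_eq_square)
  define D where "D x h = (\<Sum>k\<in>UNIV. h $ k * iter_partial [k] (\<lambda>y. \<alpha> y $ i $ j) x)" for x h :: "real^'d"
  have 1: "((\<lambda>y. \<alpha> y $ i $ j) has_derivative D x) (at x within ball b \<rho>)" if "x \<in> ball b \<rho>" for x
  proof -
    have "(iter_partial [] (\<lambda>y. \<alpha> y $ i $ j) has_derivative D x) (at x)"
      unfolding D_def using that \<rho>(3) by (intro smooth_on_iter_partial_derivative[OF U sm]) blast
    then show ?thesis unfolding iter_partial.simps by (rule has_derivative_at_withinI)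
  qed
  have 2: "onorm (D x) \<le> real CARD('d) / \<rho>\<^sup>2" if x: "x \<in> ball b \<rho>" for x
  proof (rule onorm_le)
    fix h :: "real^'d"
    have "norm (D x h) \<le> (\<Sum>k\<in>(UNIV :: 'd set). norm h * (1 / \<rho>)\<^sup>2)"
      unfolding real_norm_def D_def
    proof (rule order_trans[OF sum_abs sum_mono])
      show "\<bar>h $ k * iter_partial [k] (\<lambda>y. \<alpha> y $ i $ j) x\<bar> \<le> norm h * (1 / \<rho>)\<^sup>2" for k
        unfolding abs_mult by (rule mult_mono[OF component_le_norm_cart c[OF x] norm_ge_zero abs_ge_zero])
    qed
    then show "norm (D x h) \<le> real CARD('d) / \<rho>\<^sup>2 * norm h" by (simp add: power_divide mult_ac)
  qed
  show ?thesis by (rule differentiable_bound[OF convex_ball 1 2 y z])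
qed

lemma field_lipschitz:
  assumes "y \<in> ball b \<rho>" "z \<in> ball b \<rho>"
  shows "norm (\<alpha> y *v v - \<alpha> z *v v) \<le> real CARD('d) ^ 3 / \<rho>\<^sup>2 * norm (y - z) * norm v"
proof -
  have "norm ((\<alpha> y - \<alpha> z) *v v) \<le> real CARD('d) ^ 2 * (real CARD('d) / \<rho>\<^sup>2 * norm (y - z)) * norm v"
    using comp_lipschitz[OF assms] by (intro matrix_vector_bound) simp
  also have "\<dots> = real CARD('d) ^ 3 / \<rho>\<^sup>2 * norm (y - z) * norm v" by (simp add: power3_eq_cube power2_eq_square)
  finally show ?thesis by (simp only: matrix_vector_mult_diff_rdistrib)
qed

lemma field_continuous: "continuous_on (ball b \<rho>) (\<lambda>y. \<alpha> y *v v)"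
proof (rule lipschitz_on_continuous_on[OF lipschitz_onI])
  show "dist (\<alpha> y *v v) (\<alpha> z *v v) \<le> (real CARD('d) ^ 3 / \<rho>\<^sup>2 * norm v) * dist y z" if "y \<in> ball b \<rho>" "z \<in> ball b \<rho>" for y z
    using field_lipschitz[OF that, of v] by (simp add: dist_norm mult_ac)
qed simp

end

definition mean_curve :: "(real^'d::finite \<Rightarrow> real^'d^'d) \<Rightarrow> real \<Rightarrow> real^'d \<Rightarrow> real^'d \<Rightarrow> (real \<Rightarrow> real^'d) \<Rightarrow> bool" where
  "mean_curve \<alpha> e p q X \<longleftrightarrow> integral {0..1} X = q \<and>
     (\<forall>u\<in>{0..1}. (X has_vector_derivative (2 * e) *\<^sub>R (\<alpha> (X u) *v p)) (at u within {0..1}))"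

lemma partial_GDERIV:
  fixes f :: "real^'d::finite \<Rightarrow> real"
  assumes "GDERIV f x :> D" shows "partial j f x = D $ j"
proof -
  have "((\<lambda>t. x + t *\<^sub>R axis j 1) has_derivative (\<lambda>t. t *\<^sub>R axis j (1::real))) (at 0)" by (auto intro!: derivative_eq_intros)
  moreover have "(f has_derivative (\<lambda>h. h \<bullet> D)) (at (x + 0 *\<^sub>R axis j 1))" using assms by (simp add: gderiv_def)
  ultimately have "((\<lambda>t. f (x + t *\<^sub>R axis j 1)) has_derivative (\<lambda>t. (t *\<^sub>R axis j 1) \<bullet> D)) (at 0)" by (rule has_derivative_compose)
  then have "((\<lambda>t. f (x + t *\<^sub>R axis j 1)) has_real_derivative D $ j) (at 0)"
    by (simp add: has_field_derivative_def inner_axis' mult_commute_abs)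
  then show ?thesis unfolding partial_def by (rule DERIV_imp_deriv)
qed

lemma open_positive:
  fixes f :: "'a::topological_space \<Rightarrow> real"
  assumes "continuous_on S f" "open S" shows "open {z \<in> S. 0 < f z}"
proof -
  have "open (S \<inter> f -` {0<..})" using assms by (intro continuous_open_preimage) auto
  moreover have "S \<inter> f -` {0<..} = {z \<in> S. 0 < f z}" by auto
  ultimately show ?thesis by simp
qed

lemma mean_curve_continuous: "mean_curve \<alpha> e p q X \<Longrightarrow> continuous_on {0..1} X"
  unfolding mean_curve_def by (rule continuous_on_vector_derivative[of _ X]) blast

lemma mean_curve_reverse:
  assumes "mean_curve \<alpha> e p q X"
  shows "mean_curve \<alpha> (- e) p q (\<lambda>u. X (1 - u))"
  unfolding mean_curve_def
proof (intro conjI ballI)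
  have "(X has_integral q) {0..1}"
    using assms integrable_integral[OF integrable_continuous_real[OF mean_curve_continuous[OF assms]]]
    by (simp add: mean_curve_def)
  from has_integral_affinity[OF this[folded cbox_interval], of "-1" 1]
  have "((\<lambda>u. X (1 - u)) has_integral q) ((\<lambda>x. 1 - x) ` {0..1})" by (simp add: algebra_simps cbox_interval)
  then show "integral {0..1} (\<lambda>u. X (1 - u)) = q" by (simp add: integral_unique image_diff_atLeastAtMost)
next
  fix u :: real assume u: "u \<in> {0..1}"
  have "(X has_vector_derivative (2 * e) *\<^sub>R (\<alpha> (X (1 - u)) *v p)) (at (1 - u) within (\<lambda>u. 1 - u) ` {0..1})"
    using assms u by (auto simp: mean_curve_def image_diff_atLeastAtMost)
  moreover have "((\<lambda>u. 1 - u) has_vector_derivative -1) (at u within {0..1})" by (auto intro!: derivative_eq_intros)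
  ultimately have "((X \<circ> (\<lambda>u. 1 - u)) has_vector_derivative -1 *\<^sub>R ((2 * e) *\<^sub>R (\<alpha> (X (1 - u)) *v p))) (at u within {0..1})"
    by (intro vector_diff_chain_within)
  then show "((\<lambda>u. X (1 - u)) has_vector_derivative (2 * - e) *\<^sub>R (\<alpha> (X (1 - u)) *v p)) (at u within {0..1})"
    by (simp add: o_def)
qed

section \<open>Curves near the zero section: uniqueness, dependence on the data, moments\<close>

context
  fixes U :: "(real^'d::finite) set" and \<alpha> :: "real^'d \<Rightarrow> real^'d^'d" and R :: "real^'d \<Rightarrow> real" and A :: real
  assumes A_def: "A = real CARD('d) ^ 3" and U: "open U" and sm: "\<And>i j. smooth_on U (\<lambda>y. \<alpha> y $ i $ j)"
    and anti: "\<And>x i j. x \<in> U \<Longrightarrow> \<alpha> x $ i $ j = - \<alpha> x $ j $ i"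
    and Rpos: "\<And>x. x \<in> U \<Longrightarrow> 0 < R x" and R1: "\<And>x. x \<in> U \<Longrightarrow> R x \<le> 1"
    and Rball: "\<And>x. x \<in> U \<Longrightarrow> ball x (R x) \<subseteq> U"
    and Rbnd: "\<And>x y. x \<in> U \<Longrightarrow> y \<in> ball x (R x) \<Longrightarrow> deriv_bnd (comps \<alpha>) (1 / R x) y"
    and Rlip: "\<And>x y. x \<in> U \<Longrightarrow> y \<in> U \<Longrightarrow> R x - dist x y \<le> R y"
begin

lemma A1: "1 \<le> A" by (simp add: A_def Suc_leI)

text \<open>As \<open>A\<close> dominates the square of the dimension, this is enough for
  \<open>genfun_source_curve\<close>. It also limits the speed of the curve to
  \<open>R q / 48\<close>, so that the curve hardly moves on the scale of
  \<open>R q\<close>.\<close>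

definition small :: "real^'d \<Rightarrow> real^'d \<Rightarrow> bool" where
  "small p q \<longleftrightarrow> q \<in> U \<and> 96 * A * norm p < (R q)\<^sup>2"

lemma field_bound_at: "b \<in> U \<Longrightarrow> y \<in> ball b (R b) \<Longrightarrow> norm (\<alpha> y *v v) \<le> A / R b * norm v"
  unfolding A_def by (rule field_bound[OF U sm Rpos R1 Rball Rbnd])

lemma field_lip_at: "b \<in> U \<Longrightarrow> y \<in> ball b (R b) \<Longrightarrow> z \<in> ball b (R b) \<Longrightarrow>
    norm (\<alpha> y *v v - \<alpha> z *v v) \<le> A / (R b)\<^sup>2 * norm (y - z) * norm v"
  unfolding A_def by (rule field_lipschitz[OF U sm Rpos R1 Rball Rbnd])

lemma field_cont_at: "b \<in> U \<Longrightarrow> continuous_on (ball b (R b)) (\<lambda>y. \<alpha> y *v v)"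
  by (rule field_continuous[OF U sm Rpos R1 Rball Rbnd])

text \<open>Choosing the curve together with the gradient identifies its starting point with the
  source map; \<open>crv_unique\<close> pins down the curve itself.\<close>

definition crv :: "real \<Rightarrow> real^'d \<Rightarrow> real^'d \<Rightarrow> real \<Rightarrow> real^'d" where
  "crv e p q = (SOME X. mean_curve \<alpha> e p q X \<and> (\<forall>u\<in>{0..1}. dist q (X u) \<le> R q / 2) \<and>
     GDERIV (\<lambda>p2. genfun e \<alpha> p p2 q) 0 :> X 0)"

lemma crv:
  assumes "small p q" "\<bar>e\<bar> \<le> 1"
  shows "mean_curve \<alpha> e p q (crv e p q)" "\<And>u. u \<in> {0..1} \<Longrightarrow> dist q (crv e p q u) \<le> R q / 2"
    "GDERIV (\<lambda>p2. genfun e \<alpha> p p2 q) 0 :> crv e p q 0"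
proof -
  have q: "q \<in> U" using assms by (simp add: small_def)
  have D: "1 \<le> real CARD('d)" by (simp add: Suc_leI)
  have "96 * real CARD('d) ^ 2 * norm p \<le> 96 * A * norm p"
    unfolding A_def using D by (intro mult_right_mono mult_left_mono power_increasing) auto
  also have "\<dots> < (R q)\<^sup>2" using assms by (simp add: small_def)
  finally have "norm p < (R q)\<^sup>2 / (96 * real CARD('d) ^ 2)" using D by (simp add: pos_less_divide_eq mult_ac)
  then have "\<exists>X. mean_curve \<alpha> e p q X \<and> (\<forall>u\<in>{0..1}. dist q (X u) \<le> R q / 2) \<and>
     GDERIV (\<lambda>p2. genfun e \<alpha> p p2 q) 0 :> X 0"
    using genfun_source_curve[OF U sm anti Rpos[OF q] R1[OF q] Rball[OF q] Rbnd[OF q] assms(2), of p]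
    unfolding mean_curve_def by (simp only: conj_assoc ball_conj_distrib) blast
  from someI_ex[OF this] show "mean_curve \<alpha> e p q (crv e p q)" "\<And>u. u \<in> {0..1} \<Longrightarrow> dist q (crv e p q u) \<le> R q / 2"
    "GDERIV (\<lambda>p2. genfun e \<alpha> p p2 q) 0 :> crv e p q 0" unfolding crv_def[symmetric] by blast+
qed

lemma small_ratio:
  assumes "small p q" shows "A / R q * norm p \<le> R q / 96"
proof -
  have "0 < R q" "96 * A * norm p < (R q)\<^sup>2" using assms Rpos by (auto simp: small_def)
  then show ?thesis by (simp add: divide_simps power2_eq_square mult_ac)
qed

lemma mean_curve_speed:
  assumes s: "small p q" and e: "\<bar>e\<bar> \<le> 1" and X: "mean_curve \<alpha> e p q X"
    and B: "\<And>u. u \<in> {0..1} \<Longrightarrow> X u \<in> ball q (R q)" and u: "u \<in> {0..1}"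
  shows "norm ((2 * e) *\<^sub>R (\<alpha> (X u) *v p)) \<le> R q / 48"
proof -
  have q: "q \<in> U" using s by (simp add: small_def)
  have "norm ((2 * e) *\<^sub>R (\<alpha> (X u) *v p)) \<le> 2 * (A / R q * norm p)"
    using field_bound_at[OF q, of "X u" p] B[OF u] e mult_mono[of "2 * \<bar>e\<bar>" 2 "norm (\<alpha> (X u) *v p)" "A / R q * norm p"]
    by (simp add: abs_mult)
  then show ?thesis using small_ratio[OF s] by linarith
qed

lemma mean_curve_near:
  assumes s: "small p q" and e: "\<bar>e\<bar> \<le> 1" and X: "mean_curve \<alpha> e p q X"
    and B: "\<And>u. u \<in> {0..1} \<Longrightarrow> X u \<in> ball q (R q)" and u: "u \<in> {0..1}" "v \<in> {0..1}"
  shows "dist q (X u) \<le> R q / 48" "dist (X u) (X v) \<le> R q / 48"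
proof -
  note X' = X[unfolded mean_curve_def]
  note sp = mean_curve_speed[OF s e X B]
  have "norm (X u - integral {0..1} X) \<le> R q / 48"
    by (rule mean_distance[OF _ sp u(1)]) (use X' in auto)
  then show "dist q (X u) \<le> R q / 48" using X' by (simp add: dist_norm norm_minus_commute)
  have q: "q \<in> U" using s by (simp add: small_def)
  have "norm (X u - X v) \<le> R q / 48 * \<bar>u - v\<bar>"
    by (rule vector_derivative_bound[OF _ sp u]) (use X' in auto)
  also have "\<dots> \<le> R q / 48 * 1" using u Rpos[OF q] by (intro mult_left_mono) auto
  finally show "dist (X u) (X v) \<le> R q / 48" by (simp add: dist_norm)
qed

lemma crv_ball: "small p q \<Longrightarrow> \<bar>e\<bar> \<le> 1 \<Longrightarrow> u \<in> {0..1} \<Longrightarrow> crv e p q u \<in> ball q (R q)"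
  using crv(2)[of p q e u] Rpos[of q] by (auto simp: small_def)

lemma crv_near:
  assumes "small p q" "\<bar>e\<bar> \<le> 1" "u \<in> {0..1}" "v \<in> {0..1}"
  shows "dist q (crv e p q u) \<le> R q / 48" "dist (crv e p q u) (crv e p q v) \<le> R q / 48"
  using mean_curve_near[OF assms(1,2) crv(1) crv_ball assms(3,4)] assms(1,2) by auto

text \<open>If m is the largest distance of the curves, the velocity of their difference is at most
  m / 24 plus the effect of \<open>p - p'\<close>. A curve strays from its mean by no more than its
  maximal speed, so m is absorbed on the left. Uniqueness and Lipschitz dependence both come from
  this estimate.\<close>

lemma mean_curve_dist:
  assumes b: "b \<in> U" and e: "\<bar>e\<bar> \<le> 1"
    and X: "mean_curve \<alpha> e p q X" and XB: "\<And>u. u \<in> {0..1} \<Longrightarrow> X u \<in> ball b (R b)"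
    and Y: "mean_curve \<alpha> e p' q' Y" and YB: "\<And>u. u \<in> {0..1} \<Longrightarrow> Y u \<in> ball b (R b)"
    and p: "96 * A * norm p \<le> 2 * (R b)\<^sup>2" and u: "u \<in> {0..1}"
  shows "norm (X u - Y u) \<le> 2 * norm (q - q') + 4 * A / R b * norm (p - p')"
proof -
  note X' = X[unfolded mean_curve_def] and Y' = Y[unfolded mean_curve_def]
  have \<rho>: "0 < R b" by (rule Rpos[OF b])
  have c: "continuous_on {0..1} X" "continuous_on {0..1} Y" using X Y by (auto intro: mean_curve_continuous)
  have "continuous_on {0..1} (\<lambda>u. norm (X u - Y u))" by (intro continuous_intros c)
  then obtain s where s: "s \<in> {0..1}" "\<And>v. v \<in> {0..1} \<Longrightarrow> norm (X v - Y v) \<le> norm (X s - Y s)"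
    using continuous_attains_sup[of "{0..1::real}" "\<lambda>u. norm (X u - Y u)"] by auto
  define m where "m = norm (X s - Y s)"
  define d where "d u = (2 * e) *\<^sub>R (\<alpha> (X u) *v p) - (2 * e) *\<^sub>R (\<alpha> (Y u) *v p')" for u
  have d: "((\<lambda>u. X u - Y u) has_vector_derivative d u) (at u within {0..1})" if "u \<in> {0..1}" for u
    unfolding d_def using X' Y' that by (intro has_vector_derivative_diff) auto
  have db: "norm (d u) \<le> m / 24 + 2 * A / R b * norm (p - p')" if u: "u \<in> {0..1}" for u
  proof -
    have "d u = (2 * e) *\<^sub>R ((\<alpha> (X u) *v p - \<alpha> (Y u) *v p) + \<alpha> (Y u) *v (p - p'))"
      by (simp add: d_def scaleR_diff_right scaleR_add_right matrix_vector_mult_diff_distrib)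
    then have "norm (d u) = 2 * \<bar>e\<bar> * norm ((\<alpha> (X u) *v p - \<alpha> (Y u) *v p) + \<alpha> (Y u) *v (p - p'))"
      by (simp add: abs_mult)
    also have "\<dots> \<le> 2 * 1 * (norm (\<alpha> (X u) *v p - \<alpha> (Y u) *v p) + norm (\<alpha> (Y u) *v (p - p')))"
      using e by (intro mult_mono norm_triangle_ineq) auto
    also have "\<dots> \<le> 2 * 1 * (A / (R b)\<^sup>2 * norm (X u - Y u) * norm p + A / R b * norm (p - p'))"
      by (intro mult_left_mono add_mono field_lip_at[OF b] field_bound_at[OF b] XB YB u) auto
    also have "\<dots> \<le> 2 * 1 * (A / (R b)\<^sup>2 * m * norm p + A / R b * norm (p - p'))"
      using s(2)[OF u] \<rho> A1 unfolding m_def by (intro mult_left_mono add_right_mono mult_right_mono) auto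
    also have "A / (R b)\<^sup>2 * m * norm p = (96 * A * norm p) * (m / (96 * (R b)\<^sup>2))" by simp
    also have "\<dots> \<le> (2 * (R b)\<^sup>2) * (m / (96 * (R b)\<^sup>2))" by (intro mult_right_mono p) (simp add: m_def)
    also have "\<dots> = m / 48" using \<rho> by simp
    finally show ?thesis by simp
  qed
  have "integral {0..1} (\<lambda>u. X u - Y u) = q - q'"
    using X' Y' c by (simp add: integral_diff integrable_continuous_real)
  then have "norm ((X s - Y s) - (q - q')) \<le> m / 24 + 2 * A / R b * norm (p - p')"
    using mean_distance[OF d db s(1)] by simp
  then have "m \<le> norm (q - q') + (m / 24 + 2 * A / R b * norm (p - p'))"
    unfolding m_def using norm_triangle_ineq2[of "X s - Y s" "q - q'"] by linarith
  moreover have "0 \<le> m" "0 \<le> norm (q - q')" by (simp_all add: m_def)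
  ultimately have "m \<le> 2 * norm (q - q') + 2 * (2 * A / R b * norm (p - p'))" by linarith
  then show ?thesis using s(2)[OF u] by (simp add: m_def)
qed

lemma crv_unique:
  assumes s: "small p q" and e: "\<bar>e\<bar> \<le> 1" and X: "mean_curve \<alpha> e p q X"
    and B: "\<And>u. u \<in> {0..1} \<Longrightarrow> X u \<in> ball q (R q)" and u: "u \<in> {0..1}"
  shows "X u = crv e p q u"
proof -
  have q: "q \<in> U" using s by (simp add: small_def)
  have p: "96 * A * norm p \<le> 2 * (R q)\<^sup>2" using s zero_le_power2[of "R q"] unfolding small_def by linarith
  have "norm (X u - crv e p q u) \<le> 2 * norm (q - q) + 4 * A / R q * norm (p - p)"
    by (rule mean_curve_dist[OF q e X B crv(1)[OF s e] crv_ball[OF s e] p u])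
  then show ?thesis by simp
qed

lemma crv_reverse: "small p q \<Longrightarrow> \<bar>e\<bar> \<le> 1 \<Longrightarrow> crv (- e) p q 0 = crv e p q 1"
  using crv_unique[of p q "- e" "\<lambda>u. crv e p q (1 - u)" 0] mean_curve_reverse[OF crv(1)] crv_ball by simp

lemma source_crv:
  assumes "small p q" "\<bar>e\<bar> \<le> 1"
  shows "source_map e \<alpha> p q = crv e p q 0" "has_gradient_at (\<lambda>p2. genfun e \<alpha> p p2 q) 0"
  unfolding source_map_def has_gradient_at_def using crv(3)[OF assms] gradient_eq by blast+

lemma target_crv:
  assumes "small p q" "\<bar>e\<bar> \<le> 1"
  shows "target_map e \<alpha> p q = crv e p q 1" "has_gradient_at (\<lambda>p1. genfun e \<alpha> p1 p q) 0"
proof -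
  have e: "\<bar>- e\<bar> \<le> 1" using assms by simp
  show "target_map e \<alpha> p q = crv e p q 1"
    unfolding target_eq_source source_crv(1)[OF assms(1) e] by (rule crv_reverse[OF assms])
  show "has_gradient_at (\<lambda>p1. genfun e \<alpha> p1 p q) 0"
    using source_crv(2)[OF assms(1) e] genfun_swap[of e \<alpha>] by simp
qed

lemma R_dist:
  assumes "x \<in> U" "y \<in> U" shows "\<bar>R x - R y\<bar> \<le> dist x y"
  using Rlip[OF assms] Rlip[OF assms(2,1)] by (simp add: dist_commute)

text \<open>The square of 5/4 is below 2, the slack allowed in \<open>mean_curve_dist\<close>; it
  permits the comparison of curves with different means inside one ball.\<close>

lemma small_center:
  assumes b: "b \<in> U" and s: "small p q" and d: "dist b q \<le> R b / 4"
  shows "96 * A * norm p \<le> 2 * (R b)\<^sup>2"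
proof -
  have "R q \<le> 5 / 4 * R b" using R_dist[of b q] b s d by (auto simp: small_def)
  then have "(R q)\<^sup>2 \<le> (5 / 4 * R b)\<^sup>2" using Rpos s by (intro power_mono) (auto simp: small_def intro: less_imp_le)
  also have "\<dots> \<le> 2 * (R b)\<^sup>2" by (simp add: power_mult_distrib power_divide)
  finally show ?thesis using s by (simp add: small_def)
qed

lemma crv_center_ball:
  assumes b: "b \<in> U" and s: "small p q" and d: "dist b q \<le> R b / 4" and e: "\<bar>e\<bar> \<le> 1" and u: "u \<in> {0..1}"
  shows "crv e p q u \<in> ball b (R b)"
proof -
  have "R q \<le> 5 / 4 * R b" using R_dist[of b q] b s d by (auto simp: small_def)
  moreover have "dist q (crv e p q u) \<le> R q / 48" by (rule crv_near(1)[OF s e u u])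
  ultimately have "dist b q + dist q (crv e p q u) < R b" using d Rpos[OF b] by linarith
  then show ?thesis using dist_triangle[of b "crv e p q u" q] by simp
qed

lemma crv_lipschitz:
  assumes b: "b \<in> U" and e: "\<bar>e\<bar> \<le> 1" and s: "small p q" "dist b q \<le> R b / 4" and s': "small p' q'" "dist b q' \<le> R b / 4"
    and u: "u \<in> {0..1}"
  shows "norm (crv e p q u - crv e p' q' u) \<le> 2 * norm (q - q') + 4 * A / R b * norm (p - p')"
  by (rule mean_curve_dist[OF b e crv(1)[OF s(1) e] crv_center_ball[OF b s e] crv(1)[OF s'(1) e] crv_center_ball[OF b s' e]
      small_center[OF b s] u])

lemma crv_ode:
  assumes "small p q" "\<bar>e\<bar> \<le> 1"
  shows "u \<in> {0..1} \<Longrightarrow> (crv e p q has_vector_derivative (2 * e) *\<^sub>R (\<alpha> (crv e p q u) *v p)) (at u within {0..1})"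
    "integral {0..1} (crv e p q) = q" "continuous_on {0..1} (crv e p q)"
  using crv(1)[OF assms] mean_curve_continuous[OF crv(1)[OF assms]] unfolding mean_curve_def by blast+

lemma antisymmetric_inner:
  assumes "x \<in> U" shows "v \<bullet> (\<alpha> x *v w) = - (w \<bullet> (\<alpha> x *v v))"
proof -
  have "v \<bullet> (\<alpha> x *v w) = (\<Sum>i\<in>UNIV. \<Sum>j\<in>UNIV. v $ i * (\<alpha> x $ i $ j * w $ j))"
    by (simp add: inner_vec_def matrix_vector_mult_def sum_distrib_left)
  also have "\<dots> = (\<Sum>j\<in>UNIV. \<Sum>i\<in>UNIV. - (w $ j * (\<alpha> x $ j $ i * v $ i)))"
    using anti[OF assms] by (subst sum.swap) (intro sum.cong refl, metis mult.commute mult.left_commute mult_minus_left mult_minus_right)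
  also have "\<dots> = - (w \<bullet> (\<alpha> x *v v))"
    by (simp add: inner_vec_def matrix_vector_mult_def sum_distrib_left sum_negf)
  finally show ?thesis .
qed

text \<open>Integrating the velocity of the curve against \<open>u\<close> by parts gives its end
  point minus its mean; this is how the target map is expressed by \<open>moment\<close>, see
  \<open>target_moment\<close>.\<close>

definition moment :: "real \<Rightarrow> real^'d \<Rightarrow> real^'d \<Rightarrow> real^'d \<Rightarrow> real^'d" where
  "moment e a p q = integral {0..1} (\<lambda>u. u *\<^sub>R (\<alpha> (crv e p q u) *v a))"

lemma moment_continuous:
  assumes s: "small p q" and e: "\<bar>e\<bar> \<le> 1"
  shows "continuous_on {0..1} (\<lambda>u. u *\<^sub>R (\<alpha> (crv e p q u) *v a))"
proof -
  have q: "q \<in> U" using s by (simp add: small_def)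
  have "crv e p q ` {0..1} \<subseteq> ball q (R q)" using crv_ball[OF s e] by blast
  then have "continuous_on {0..1} (\<lambda>u. \<alpha> (crv e p q u) *v a)"
    by (rule continuous_on_compose2[OF field_cont_at[OF q] crv_ode(3)[OF s e]])
  then show ?thesis by (intro continuous_intros)
qed

lemma moment_has_integral:
  assumes s: "small p q" and e: "\<bar>e\<bar> \<le> 1"
  shows "((\<lambda>u. u *\<^sub>R (\<alpha> (crv e p q u) *v a)) has_integral moment e a p q) {0..1}"
  unfolding moment_def by (intro integrable_integral integrable_continuous_real moment_continuous assms)

lemma crv_U: "small p q \<Longrightarrow> \<bar>e\<bar> \<le> 1 \<Longrightarrow> u \<in> {0..1} \<Longrightarrow> crv e p q u \<in> U"
  using crv_ball[of p q e u] Rball[of q] unfolding small_def by blast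

lemma target_moment:
  assumes s: "small p q" and e: "\<bar>e\<bar> \<le> 1"
  shows "crv e p q 1 = q + (2 * e) *\<^sub>R moment e p p q"
proof -
  let ?X = "crv e p q"
  have "((\<lambda>u. u *\<^sub>R ?X u) has_vector_derivative u *\<^sub>R ((2 * e) *\<^sub>R (\<alpha> (?X u) *v p)) + 1 *\<^sub>R ?X u) (at u within {0..1})"
    if "u \<in> {0..1}" for u
    by (rule has_vector_derivative_scaleR[OF DERIV_ident crv_ode(1)[OF s e that]])
  then have "((\<lambda>u. u *\<^sub>R ((2 * e) *\<^sub>R (\<alpha> (?X u) *v p)) + 1 *\<^sub>R ?X u) has_integral (1 *\<^sub>R ?X 1 - 0 *\<^sub>R ?X 0)) {0..1}"
    by (intro fundamental_theorem_of_calculus) auto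
  moreover have "((\<lambda>u. (2 * e) *\<^sub>R (u *\<^sub>R (\<alpha> (?X u) *v p)) + ?X u) has_integral ((2 * e) *\<^sub>R moment e p p q + q)) {0..1}"
    using integrable_integral[OF integrable_continuous_real[OF crv_ode(3)[OF s e]]] crv_ode(2)[OF s e]
    by (intro has_integral_add has_integral_cmul moment_has_integral s e) simp
  ultimately have "?X 1 = (2 * e) *\<^sub>R moment e p p q + q"
    by (simp add: mult.commute has_integral_unique)
  then show ?thesis by simp
qed

lemma moment_inner:
  assumes s: "small p q" and e: "\<bar>e\<bar> \<le> 1"
  shows "v \<bullet> moment e w p q = - (w \<bullet> moment e v p q)"
proof -
  have i: "((\<lambda>u. v \<bullet> (u *\<^sub>R (\<alpha> (crv e p q u) *v w))) has_integral v \<bullet> moment e w p q) {0..1}" for v w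
    using has_integral_linear[OF moment_has_integral[OF s e, of w] bounded_linear_inner_right[of v]] by (simp add: o_def)
  have "((\<lambda>u. - (w \<bullet> (u *\<^sub>R (\<alpha> (crv e p q u) *v v)))) has_integral v \<bullet> moment e w p q) {0..1}"
  proof (rule has_integral_eq[OF _ i])
    show "v \<bullet> (u *\<^sub>R (\<alpha> (crv e p q u) *v w)) = - (w \<bullet> (u *\<^sub>R (\<alpha> (crv e p q u) *v v)))" if "u \<in> {0..1}" for u
      using antisymmetric_inner[OF crv_U[OF s e that], of v w] by simp
  qed
  then show ?thesis using has_integral_neg[OF i[of w v]] has_integral_unique by blast
qed

text \<open>By antisymmetry \<open>a\<close> is orthogonal to its own moment, so any multiple of it
  may be added. With this term the formula is centered at the momentum that the flow will have at
  time \<tau>.\<close>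

lemma target_inner:
  assumes "small p q" "\<bar>e\<bar> \<le> 1"
  shows "a \<bullet> crv e p q 1 = a \<bullet> q - 2 * e * ((p - \<tau> *\<^sub>R a) \<bullet> moment e a p q)"
proof -
  have "a \<bullet> moment e a p q = 0" using moment_inner[OF assms, of a a] by simp
  then show ?thesis unfolding target_moment[OF assms]
    using moment_inner[OF assms, of a p] by (simp add: inner_simps)
qed

lemma moment_lipschitz:
  assumes b: "b \<in> U" and e: "\<bar>e\<bar> \<le> 1" and s: "small p q" "dist b q \<le> R b / 4" and s': "small p' q'" "dist b q' \<le> R b / 4"
  shows "norm (moment e a p q - moment e a p' q') \<le>
    A / (R b)\<^sup>2 * norm a * (2 * norm (q - q') + 4 * A / R b * norm (p - p'))"
proof -
  let ?X = "crv e p q" and ?Y = "crv e p' q'" and ?L = "2 * norm (q - q') + 4 * A / R b * norm (p - p')"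
  have "norm (integral {0..1} (\<lambda>u. u *\<^sub>R (\<alpha> (?X u) *v a) - u *\<^sub>R (\<alpha> (?Y u) *v a))) \<le> A / (R b)\<^sup>2 * norm a * ?L * (1 - 0)"
  proof (rule integral_bound)
    fix u :: real assume u: "u \<in> {0..1}"
    have "norm (u *\<^sub>R (\<alpha> (?X u) *v a) - u *\<^sub>R (\<alpha> (?Y u) *v a)) = \<bar>u\<bar> * norm (\<alpha> (?X u) *v a - \<alpha> (?Y u) *v a)"
      by (simp only: scaleR_diff_right[symmetric] norm_scaleR)
    also have "\<dots> \<le> 1 * (A / (R b)\<^sup>2 * norm (?X u - ?Y u) * norm a)"
      using u by (intro mult_mono field_lip_at b crv_center_ball[OF b s e u] crv_center_ball[OF b s' e u]) auto
    also have "\<dots> \<le> 1 * (A / (R b)\<^sup>2 * ?L * norm a)"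
      using A1 by (intro mult_left_mono mult_right_mono crv_lipschitz[OF b e s s' u]) auto
    finally show "norm (u *\<^sub>R (\<alpha> (?X u) *v a) - u *\<^sub>R (\<alpha> (?Y u) *v a)) \<le> A / (R b)\<^sup>2 * norm a * ?L"
      by (simp only: mult_1 mult.assoc mult.commute[of "norm a"])
  qed (auto intro!: continuous_on_diff moment_continuous s s' e)
  moreover have "integral {0..1} (\<lambda>u. u *\<^sub>R (\<alpha> (?X u) *v a) - u *\<^sub>R (\<alpha> (?Y u) *v a)) = moment e a p q - moment e a p' q'"
    unfolding moment_def
    by (intro integral_diff integrable_continuous_real moment_continuous s s' e)
  ultimately show ?thesis by simp
qed

lemma R_continuous: "continuous_on U R"
proof (rule lipschitz_on_continuous_on[OF lipschitz_onI])
  show "dist (R x) (R y) \<le> 1 * dist x y" if "x \<in> U" "y \<in> U" for x y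
    using R_dist[OF that] by (simp add: dist_real_def)
qed simp

lemma open_small: "open {(p, q). small p q}"
proof -
  have "continuous_on (UNIV \<times> U) (\<lambda>z::(real^'d) \<times> (real^'d). (R (snd z))\<^sup>2 - 96 * A * norm (fst z))"
    by (intro continuous_intros continuous_on_compose2[OF R_continuous]) auto
  from open_positive[OF this open_Times[OF open_UNIV U]] show ?thesis
    by (rule back_subst[where P = "open"]) (auto simp: small_def)
qed

lemma crv_continuous:
  assumes e: "\<bar>e\<bar> \<le> 1" and u: "u \<in> {0..1}"
  shows "continuous_on {(p, q). small p q} (\<lambda>z. crv e (fst z) (snd z) u)"
  unfolding continuous_on_def
proof (intro ballI)
  fix z0 :: "(real^'d) \<times> (real^'d)" assume z0: "z0 \<in> {(p, q). small p q}"
  let ?F = "at z0 within {(p, q). small p q}"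
  have s: "small (fst z0) (snd z0)" using z0 by auto
  then have q: "snd z0 \<in> U" by (simp add: small_def)
  note r = Rpos[OF q]
  define g where "g z = 2 * norm (snd z - snd z0) + 4 * A / R (snd z0) * norm (fst z - fst z0)" for z
  have "(g \<longlongrightarrow> 2 * norm (snd z0 - snd z0) + 4 * A / R (snd z0) * norm (fst z0 - fst z0)) ?F"
    unfolding g_def by (intro tendsto_intros)
  then have g: "(g \<longlongrightarrow> 0) ?F" by simp
  have "((\<lambda>z. dist (snd z0) (snd z)) \<longlongrightarrow> dist (snd z0) (snd z0)) ?F" by (intro tendsto_intros)
  then have "\<forall>\<^sub>F z in ?F. dist (snd z0) (snd z) < R (snd z0) / 4" using r by (intro order_tendstoD) auto
  moreover have "\<forall>\<^sub>F z in ?F. z \<in> {(p, q). small p q}" by (auto simp: eventually_at_filter)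
  ultimately have "\<forall>\<^sub>F z in ?F. norm (crv e (fst z) (snd z) u - crv e (fst z0) (snd z0) u) \<le> g z"
  proof eventually_elim
    case (elim z)
    then show ?case unfolding g_def
      using r by (intro crv_lipschitz[OF q e _ _ s _ u]) auto
  qed
  then have "((\<lambda>z. crv e (fst z) (snd z) u - crv e (fst z0) (snd z0) u) \<longlongrightarrow> 0) ?F"
    by (rule Lim_null_comparison[OF _ g])
  then show "((\<lambda>z. crv e (fst z) (snd z) u) \<longlongrightarrow> crv e (fst z0) (snd z0) u) ?F" by (rule LIM_zero_cancel)
qed

text \<open>The second condition concerns the starting point of the curve, which is constant along
  the Hamiltonian flow while \<open>q\<close> moves; this makes the set invariant. The factor 2
  compared with \<open>small\<close> pays for passing from the starting point to the mean of an
  initial part of the curve.\<close>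

definition good :: "real \<Rightarrow> ((real^'d) \<times> (real^'d)) set" where
  "good e = {(p, q). small p q \<and> 192 * A * norm p < (R (crv e p q 0))\<^sup>2}"

lemma open_good:
  assumes e: "\<bar>e\<bar> \<le> 1" shows "open (good e)"
proof -
  have "continuous_on {(p, q). small p q} (\<lambda>z. (R (crv e (fst z) (snd z) 0))\<^sup>2 - 192 * A * norm (fst z))"
    using e by (intro continuous_intros continuous_on_compose2[OF R_continuous] crv_continuous) (auto intro: crv_U)
  from open_positive[OF this open_small] show ?thesis
    by (rule back_subst[where P = "open"]) (auto simp: good_def)
qed

lemma small_0: "q \<in> U \<Longrightarrow> small 0 q" using Rpos[of q] by (simp add: small_def)

lemma good_0: "\<bar>e\<bar> \<le> 1 \<Longrightarrow> q \<in> U \<Longrightarrow> (0, q) \<in> good e"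
  using small_0 Rpos[OF crv_U[OF small_0, of q e 0]] by (simp add: good_def)

text \<open>The domain of the generating function is cut down so that \<open>G_S\<close> becomes
  exactly \<open>good e\<close>; the bound on the sum of the norms ensures convergence.\<close>

definition neighborhood :: "real \<Rightarrow> ((real^'d) \<times> (real^'d) \<times> (real^'d)) set" where
  "neighborhood e = {(p1, p2, x). x \<in> U \<and> 96 * A * (norm p1 + norm p2) < (R x)\<^sup>2 \<and> (p1, x) \<in> good e \<and> (p2, x) \<in> good e}"

lemma neighborhood_domain:
  assumes e: "\<bar>e\<bar> \<le> 1" shows "genfun_domain e \<alpha> U (neighborhood e)"
  unfolding genfun_domain_def
proof (intro conjI)
  let ?S = "UNIV \<times> UNIV \<times> U :: ((real^'d) \<times> (real^'d) \<times> (real^'d)) set"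
  have "continuous_on ?S (\<lambda>z. (R (snd (snd z)))\<^sup>2 - 96 * A * (norm (fst z) + norm (fst (snd z))))"
    by (intro continuous_intros continuous_on_compose2[OF R_continuous]) auto
  then have 1: "open {z \<in> ?S. 0 < (R (snd (snd z)))\<^sup>2 - 96 * A * (norm (fst z) + norm (fst (snd z)))}"
    by (rule open_positive) (intro open_Times open_UNIV U)
  have 2: "open ((\<lambda>z::(real^'d) \<times> (real^'d) \<times> (real^'d). (fst z, snd (snd z))) -` good e)" "open ((\<lambda>z::(real^'d) \<times> (real^'d) \<times> (real^'d). (fst (snd z), snd (snd z))) -` good e)"
    by (intro open_vimage open_good e continuous_intros)+
  have "neighborhood e = {z \<in> ?S. 0 < (R (snd (snd z)))\<^sup>2 - 96 * A * (norm (fst z) + norm (fst (snd z)))}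
     \<inter> ((\<lambda>z. (fst z, snd (snd z))) -` good e) \<inter> ((\<lambda>z. (fst (snd z), snd (snd z))) -` good e)"
    by (auto simp: neighborhood_def)
  then show "open (neighborhood e)" using 1 2 by (simp only: open_Int)
  show "{0} \<times> {0} \<times> U \<subseteq> neighborhood e" using good_0[OF e] Rpos by (force simp: neighborhood_def)
  show "neighborhood e \<subseteq> ?S" by (auto simp: neighborhood_def)
  show "\<forall>(p1, p2, x)\<in>neighborhood e. summable (\<lambda>n. genfun_term e \<alpha> (Suc n) p1 p2 x)"
  proof (clarify)
    fix p1 p2 x assume "(p1, p2, x) \<in> neighborhood e"
    then have x: "x \<in> U" and n: "96 * A * (norm p1 + norm p2) < (R x)\<^sup>2" by (auto simp: neighborhood_def)
    have D: "1 \<le> real CARD('d)" by (simp add: Suc_leI)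
    have "96 * real CARD('d) ^ 2 * (norm p1 + norm p2) \<le> 96 * A * (norm p1 + norm p2)"
      unfolding A_def using D by (intro mult_right_mono mult_left_mono power_increasing) auto
    then have "96 * real CARD('d) ^ 2 * (norm p1 + norm p2) \<le> (R x)\<^sup>2" using n by linarith
    then have "norm p1 + norm p2 \<le> (R x)\<^sup>2 / (96 * real CARD('d) ^ 2)" using D by (simp add: pos_le_divide_eq mult_ac)
    then show "summable (\<lambda>n. genfun_term e \<alpha> (Suc n) p1 p2 x)"
      using genfun_summable_near[OF U sm anti Rpos[OF x] R1[OF x] Rball[OF x] Rbnd[OF x] e] by blast
  qed
qed

lemma G_S_good:
  assumes e: "\<bar>e\<bar> \<le> 1" shows "G_S e \<alpha> U (neighborhood e) = good e"
proof -
  have "(p, 0, q) \<in> neighborhood e \<longleftrightarrow> (p, q) \<in> good e" "(0, p, q) \<in> neighborhood e \<longleftrightarrow> (p, q) \<in> good e" for p q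
    using good_0[OF e] by (auto simp: neighborhood_def good_def small_def)
  then show ?thesis
    using source_crv[OF _ e] target_crv[OF _ e] crv_U[OF _ e, of _ _ 0] crv_U[OF _ e, of _ _ 1]
    unfolding G_S_def by (auto simp: good_def)
qed

section \<open>The tensor \<open>B\<close> and the Poisson equation\<close>

lemma crv_zero: "\<bar>e\<bar> \<le> 1 \<Longrightarrow> x \<in> U \<Longrightarrow> u \<in> {0..1} \<Longrightarrow> crv e 0 x u = x"
  using crv_unique[OF small_0, of x e "\<lambda>_. x" u] Rpos[of x] by (simp add: mean_curve_def)

lemma crv_expansion:
  assumes s: "small p x" and e: "\<bar>e\<bar> \<le> 1"
  shows "norm (crv e p x 0 - x + e *\<^sub>R (\<alpha> x *v p)) \<le> 8 * A\<^sup>2 / R x ^ 3 * (norm p)\<^sup>2"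
proof -
  let ?X = "crv e p x"
  have x: "x \<in> U" using s by (simp add: small_def)
  have r: "0 < R x" by (rule Rpos[OF x])
  define Y where "Y u = ?X u - (2 * e * u) *\<^sub>R (\<alpha> x *v p)" for u
  define d where "d u = (2 * e) *\<^sub>R (\<alpha> (?X u) *v p) - (2 * e) *\<^sub>R (\<alpha> x *v p)" for u
  have dY: "(Y has_vector_derivative d u) (at u within {0..1})" if "u \<in> {0..1}" for u
    unfolding Y_def d_def
    by (rule has_vector_derivative_diff[OF crv_ode(1)[OF s e that]]) (auto intro!: derivative_eq_intros)
  have "norm (d u) \<le> 8 * A\<^sup>2 / R x ^ 3 * (norm p)\<^sup>2" if u: "u \<in> {0..1}" for u
  proof -
    have "norm (?X u - x) \<le> 4 * A / R x * norm p"
      using crv_lipschitz[OF x e s _ small_0[OF x] _ u] r crv_zero[OF e x u] by simp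
    then have "A / (R x)\<^sup>2 * norm (?X u - x) * norm p \<le> A / (R x)\<^sup>2 * (4 * A / R x * norm p) * norm p"
      using A1 by (intro mult_left_mono mult_right_mono) auto
    then have 1: "norm (\<alpha> (?X u) *v p - \<alpha> x *v p) \<le> A / (R x)\<^sup>2 * (4 * A / R x * norm p) * norm p"
      using field_lip_at[OF x crv_ball[OF s e u], of x p] r by simp
    have "norm (d u) = 2 * \<bar>e\<bar> * norm (\<alpha> (?X u) *v p - \<alpha> x *v p)"
      by (simp add: d_def scaleR_diff_right[symmetric] abs_mult del: scaleR_diff_right)
    also have "\<dots> \<le> 2 * 1 * (A / (R x)\<^sup>2 * (4 * A / R x * norm p) * norm p)" using e 1 by (intro mult_mono) auto
    also have "\<dots> = 8 * A\<^sup>2 / R x ^ 3 * (norm p)\<^sup>2" by (simp add: power2_eq_square power3_eq_cube)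
    finally show ?thesis .
  qed
  from mean_distance[OF dY this, of 0]
  have "norm (Y 0 - integral {0..1} Y) \<le> 8 * A\<^sup>2 / R x ^ 3 * (norm p)\<^sup>2" by simp
  moreover have "(Y has_integral (x - e *\<^sub>R (\<alpha> x *v p))) {0..1}"
    unfolding Y_def
  proof (rule has_integral_diff)
    show "(?X has_integral x) {0..1}"
      using integrable_integral[OF integrable_continuous_real[OF crv_ode(3)[OF s e]]] crv_ode(2)[OF s e] by simp
    have "((\<lambda>u. (2 * e * u) *\<^sub>R (\<alpha> x *v p)) has_integral ((e * 1\<^sup>2) *\<^sub>R (\<alpha> x *v p) - (e * 0\<^sup>2) *\<^sub>R (\<alpha> x *v p))) {0..1}"
      by (rule fundamental_theorem_of_calculus) (auto intro!: derivative_eq_intros)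
    then show "((\<lambda>u. (2 * e * u) *\<^sub>R (\<alpha> x *v p)) has_integral e *\<^sub>R (\<alpha> x *v p)) {0..1}" by simp
  qed
  ultimately have "norm (crv e p x 0 - (x - e *\<^sub>R (\<alpha> x *v p))) \<le> 8 * A\<^sup>2 / R x ^ 3 * (norm p)\<^sup>2"
    unfolding integral_unique[OF \<open>(Y has_integral _) _\<close>] by (simp add: Y_def)
  then show ?thesis by (simp only: diff_diff_eq2 add.commute add_diff_eq diff_add_eq)
qed

text \<open>The inner derivative is component \<open>j\<close> of the starting point, whose linear
  part in \<open>p\<close> is row \<open>j\<close> of \<alpha> times \<open>- e\<close>;
  antisymmetry turns the row into a column and removes the sign.\<close>

lemma B_field_eq:
  assumes e: "\<bar>e\<bar> \<le> 1" and x: "x \<in> U"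
  shows "B_field e \<alpha> x = (2 * e) *\<^sub>R \<alpha> x"
proof -
  have "partial i (\<lambda>p1. partial j (\<lambda>p2. genfun e \<alpha> p1 p2 x) 0) 0 = e * \<alpha> x $ i $ j" for i j
  proof -
    have F: "partial j (\<lambda>p2. genfun e \<alpha> p p2 x) 0 = crv e p x 0 $ j" if "small p x" for p
      by (rule partial_GDERIV[OF crv(3)[OF that e]])
    have "GDERIV (\<lambda>p1. partial j (\<lambda>p2. genfun e \<alpha> p1 p2 x) 0) 0 :> - e *\<^sub>R (\<alpha> x $ j)"
    proof (rule GDERIV_local_quadratic)
      show "0 < (R x)\<^sup>2 / (96 * A)" using Rpos[OF x] A1 by simp
      fix p :: "real^'d" assume "dist 0 p < (R x)\<^sup>2 / (96 * A)"
      then have s: "small p x" using x A1 by (simp add: small_def pos_less_divide_eq mult_ac)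
      have "\<bar>(crv e p x 0 - x + e *\<^sub>R (\<alpha> x *v p)) $ j\<bar> \<le> 8 * A\<^sup>2 / R x ^ 3 * (norm p)\<^sup>2"
        by (rule order_trans[OF component_le_norm_cart crv_expansion[OF s e]])
      moreover have "(\<alpha> x *v p) $ j = \<alpha> x $ j \<bullet> p" by (simp add: matrix_vector_mult_def inner_vec_def)
      ultimately show "\<bar>partial j (\<lambda>p2. genfun e \<alpha> p p2 x) 0 - partial j (\<lambda>p2. genfun e \<alpha> 0 p2 x) 0 - (- e *\<^sub>R \<alpha> x $ j) \<bullet> (p - 0)\<bar>
         \<le> 8 * A\<^sup>2 / R x ^ 3 * (norm (p - 0))\<^sup>2"
        using F[OF s] F[OF small_0[OF x]] crv_zero[OF e x, of 0] by simp
    qed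
    from partial_GDERIV[OF this, of i] show ?thesis using anti[OF x, of i j] by simp
  qed
  then show ?thesis by (simp add: B_field_def vec_eq_iff)
qed

lemma poisson_solution_iff:
  assumes e: "\<bar>e\<bar> \<le> 1"
  shows "poisson_solution U (B_field e \<alpha>) p x0 x \<longleftrightarrow> x 0 = x0 \<and>
    (\<forall>\<tau>\<in>{0..1}. x \<tau> \<in> U \<and> (x has_vector_derivative (2 * e) *\<^sub>R (\<alpha> (x \<tau>) *v p)) (at \<tau> within {0..1}))"
  unfolding poisson_solution_def by (auto simp: B_field_eq[OF e] scaleR_matrix_vector_assoc)

lemma stays_near:
  fixes f :: "real \<Rightarrow> real^'d"
  assumes "continuous_on {0..1} f" "t \<in> {0..1}" "0 < r"
  shows "\<exists>\<delta>>0. \<forall>s\<in>{t..t+\<delta>} \<inter> {0..1}. dist (f t) (f s) < r"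
proof -
  obtain d where d: "0 < d" "\<And>s. s \<in> {0..1} \<Longrightarrow> dist s t < d \<Longrightarrow> dist (f s) (f t) < r"
    using assms unfolding continuous_on_iff by blast
  have "dist (f t) (f s) < r" if "s \<in> {t..t+d/2} \<inter> {0..1}" for s
    using d(2)[of s] d(1) that by (simp add: dist_real_def dist_commute)
  then show ?thesis using d(1) by (intro exI[of _ "d / 2"]) auto
qed

lemma poisson_unique:
  assumes e: "\<bar>e\<bar> \<le> 1"
    and x: "poisson_solution U (B_field e \<alpha>) p x0 x" and y: "poisson_solution U (B_field e \<alpha>) p x0 y"
    and u: "u \<in> {0..1}"
  shows "x u = y u"
proof -
  note x' = x[unfolded poisson_solution_iff[OF e]] and y' = y[unfolded poisson_solution_iff[OF e]]
  have cx: "continuous_on {0..1} x" and cy: "continuous_on {0..1} y"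
    using x' y' by (auto intro!: continuous_on_vector_derivative)
  define d where "d s = (2 * e) *\<^sub>R (\<alpha> (x s) *v p) - (2 * e) *\<^sub>R (\<alpha> (y s) *v p)" for s
  have "x u - y u = 0"
  proof (rule vanishing_of_local_bound[where w = "\<lambda>s. x s - y s" and w' = d])
    show "((\<lambda>s. x s - y s) has_vector_derivative d s) (at s within {0..1})" if "s \<in> {0..1}" for s
      unfolding d_def using x' y' that by (intro has_vector_derivative_diff) auto
    show "x 0 - y 0 = 0" using x' y' by simp
    fix t :: real assume t: "t \<in> {0..<1}" and z: "\<And>s. s \<in> {0..t} \<Longrightarrow> x s - y s = 0"
    have t01: "t \<in> {0..1}" using t by simp
    have b: "x t \<in> U" "y t = x t" using x' t01 z[of t] t by (blast, simp)
    note r = Rpos[OF b(1)]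
    obtain \<delta>1 where \<delta>1: "\<delta>1 > 0" "\<forall>s\<in>{t..t+\<delta>1} \<inter> {0..1}. dist (x t) (x s) < R (x t)"
      using stays_near[OF cx t01 r] by blast
    obtain \<delta>2 where \<delta>2: "\<delta>2 > 0" "\<forall>s\<in>{t..t+\<delta>2} \<inter> {0..1}. dist (x t) (y s) < R (x t)"
      using stays_near[OF cy t01 r] unfolding b(2) by blast
    have "norm (d s) \<le> (2 * (A / (R (x t))\<^sup>2 * norm p)) * norm (x s - y s)" if "s \<in> {t..t+min \<delta>1 \<delta>2} \<inter> {0..1}" for s
    proof -
      have "x s \<in> ball (x t) (R (x t))" "y s \<in> ball (x t) (R (x t))" using \<delta>1 \<delta>2 that by auto
      from field_lip_at[OF b(1) this, of p]
      have 1: "norm (\<alpha> (x s) *v p - \<alpha> (y s) *v p) \<le> A / (R (x t))\<^sup>2 * norm (x s - y s) * norm p" .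
      have "norm (d s) = 2 * \<bar>e\<bar> * norm (\<alpha> (x s) *v p - \<alpha> (y s) *v p)"
        by (simp add: d_def scaleR_diff_right[symmetric] abs_mult del: scaleR_diff_right)
      also have "\<dots> \<le> 2 * 1 * (A / (R (x t))\<^sup>2 * norm (x s - y s) * norm p)" using e 1 by (intro mult_mono) auto
      finally show ?thesis by (simp add: mult_ac)
    qed
    then show "\<exists>\<delta>>0. \<exists>L. \<forall>s\<in>{t..t+\<delta>} \<inter> {0..1}. norm (d s) \<le> L * norm (x s - y s)"
      using \<delta>1(1) \<delta>2(1) by (metis min_less_iff_conj)
  qed (rule u)
  then show ?thesis by simp
qed

lemma crv_poisson:
  assumes "small p q" "\<bar>e\<bar> \<le> 1"
  shows "poisson_solution U (B_field e \<alpha>) p (crv e p q 0) (crv e p q)"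
  unfolding poisson_solution_iff[OF assms(2)] using crv_U[OF assms] crv_ode(1)[OF assms] by blast

section \<open>The Hamiltonian flow\<close>

text \<open>Rescaling time in a curve for \<open>(p, q)\<close> gives the curve for \<open>(\<tau> p, barycenter \<tau>)\<close>,
  with the same starting point.\<close>

definition barycenter :: "real \<Rightarrow> real^'d \<Rightarrow> real^'d \<Rightarrow> real \<Rightarrow> real^'d" where
  "barycenter e p q \<tau> = integral {0..1} (\<lambda>u. crv e p q (\<tau> * u))"

lemma crv_rescaled:
  assumes g: "(p, q) \<in> good e" and e: "\<bar>e\<bar> \<le> 1" and \<tau>: "\<tau> \<in> {0..1}"
  shows "(\<tau> *\<^sub>R p, barycenter e p q \<tau>) \<in> good e"
    "\<And>u. u \<in> {0..1} \<Longrightarrow> crv e (\<tau> *\<^sub>R p) (barycenter e p q \<tau>) u = crv e p q (\<tau> * u)"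
proof -
  let ?X = "crv e p q" and ?b = "barycenter e p q \<tau>"
  let ?Y = "\<lambda>u. ?X (\<tau> * u)"
  have s: "small p q" and n: "192 * A * norm p < (R (?X 0))\<^sup>2" using g by (auto simp: good_def)
  have \<tau>u: "\<tau> * u \<in> {0..1}" if "u \<in> {0..1}" for u using \<tau> that by (auto simp: mult_le_one)
  have q: "q \<in> U" using s by (simp add: small_def)
  have x0: "?X 0 \<in> U" by (rule crv_U[OF s e]) simp
  \<comment> \<open>The curve stays within \<open>R q / 48\<close> of \<open>q\<close> and
    \<open>R\<close> is 1-Lipschitz, so replacing \<open>q\<close> by the starting point costs a
    factor 48/47.\<close>
  have Rq: "R q \<le> 48 / 47 * R (?X 0)"
    using R_dist[OF q x0] crv_near(1)[OF s e, of 0 0] by simp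
  have near: "norm (?X 0 - ?X v) \<le> R (?X 0) / 47" if "v \<in> {0..1}" for v
    using crv_near(2)[OF s e _ that, of 0] Rq by (simp add: dist_norm)
  have cY: "continuous_on {0..1} ?Y"
    by (intro continuous_on_compose2[OF crv_ode(3)[OF s e]] continuous_intros) (use \<tau>u in blast)
  have Y: "mean_curve \<alpha> e (\<tau> *\<^sub>R p) ?b ?Y"
    unfolding mean_curve_def
  proof (intro conjI ballI)
    show "integral {0..1} ?Y = ?b" by (simp add: barycenter_def)
    fix u :: real assume u: "u \<in> {0..1}"
    have "(\<lambda>u. \<tau> * u) ` {0..1} \<subseteq> {0..1}" using \<tau>u by blast
    with crv_ode(1)[OF s e \<tau>u[OF u]]
    have "(?X has_vector_derivative (2 * e) *\<^sub>R (\<alpha> (?Y u) *v p)) (at (\<tau> * u) within (\<lambda>u. \<tau> * u) ` {0..1})"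
      by (rule has_vector_derivative_within_subset)
    moreover have "((\<lambda>u. \<tau> * u) has_vector_derivative \<tau>) (at u within {0..1})" by (auto intro!: derivative_eq_intros)
    ultimately have "((?X \<circ> (\<lambda>u. \<tau> * u)) has_vector_derivative \<tau> *\<^sub>R ((2 * e) *\<^sub>R (\<alpha> (?Y u) *v p))) (at u within {0..1})"
      by (intro vector_diff_chain_within)
    then show "(?Y has_vector_derivative (2 * e) *\<^sub>R (\<alpha> (?Y u) *v (\<tau> *\<^sub>R p))) (at u within {0..1})"
      by (simp add: o_def matrix_vector_mult_scaleR mult.commute)
  qed
  have "norm (integral {0..1} (\<lambda>u. ?X 0 - ?Y u)) \<le> R (?X 0) / 47 * (1 - 0)"
    by (rule integral_bound) (simp, intro continuous_intros cY, rule near[OF \<tau>u])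
  moreover have "integral {0..1} (\<lambda>u. ?X 0 - ?Y u) = ?X 0 - ?b"
    unfolding barycenter_def using integrable_continuous_real[OF cY] by (subst integral_diff) auto
  ultimately have db: "dist (?X 0) ?b \<le> R (?X 0) / 47" by (simp add: dist_norm)
  have r0: "0 < R (?X 0)" by (rule Rpos[OF x0])
  have bU: "?b \<in> U" using Rball[OF x0] db r0 by auto
  \<comment> \<open>In the same way, the mean of the rescaled curve costs a factor 46/47. The square
    of 47/46 is below 2, within the margin that 192 in \<open>good\<close> leaves over 96 in
    \<open>small\<close>.\<close>
  have Rb: "46 / 47 * R (?X 0) \<le> R ?b" using R_dist[OF x0 bU] db by simp
  have "norm (\<tau> *\<^sub>R p) \<le> norm p" using \<tau> by (simp add: mult_left_le_one_le)
  then have n1: "192 * A * norm (\<tau> *\<^sub>R p) \<le> 192 * A * norm p" using A1 by (intro mult_left_mono) auto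
  have "(46 / 47 * R (?X 0))\<^sup>2 \<le> (R ?b)\<^sup>2" using r0 Rb by (intro power_mono) auto
  then have "2116 * (R (?X 0))\<^sup>2 \<le> 2209 * (R ?b)\<^sup>2" by (simp add: power_mult_distrib power_divide)
  then have "(R (?X 0))\<^sup>2 \<le> 2 * (R ?b)\<^sup>2" using zero_le_power2[of "R ?b"] by linarith
  then have sb: "small (\<tau> *\<^sub>R p) ?b" using n n1 bU by (simp add: small_def)
  have YB: "?Y u \<in> ball ?b (R ?b)" if "u \<in> {0..1}" for u
  proof -
    have "dist (?X 0) (?Y u) \<le> R (?X 0) / 47" using near[OF \<tau>u[OF that]] by (simp add: dist_norm)
    then have "dist ?b (?Y u) \<le> 2 / 47 * R (?X 0)" using db dist_triangle[of ?b "?Y u" "?X 0"] by (simp add: dist_commute)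
    then show ?thesis using Rb r0 by simp
  qed
  show eq: "crv e (\<tau> *\<^sub>R p) ?b u = ?Y u" if "u \<in> {0..1}" for u
    by (rule crv_unique[OF sb e Y YB that, symmetric])
  \<comment> \<open>The rescaled curve has the same starting point, so the second condition of
    \<open>good\<close> carries over.\<close>
  show "(\<tau> *\<^sub>R p, ?b) \<in> good e" unfolding good_def using sb eq[of 0] n n1 by simp
qed

lemma small_nearby:
  assumes "small p q"
  shows "\<exists>r>0. \<forall>p' q'. dist p p' < r \<longrightarrow> dist q q' < r \<longrightarrow> small p' q'"
proof -
  have "(p, q) \<in> {(p, q). small p q}" using assms by simp
  then obtain S T where "open S" "open T" "(p, q) \<in> S \<times> T" "S \<times> T \<subseteq> {(p, q). small p q}"
    using open_prod_elim[OF open_small] by blast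
  then have ST: "open S" "open T" "p \<in> S" "q \<in> T" "S \<times> T \<subseteq> {(p, q). small p q}" by auto
  obtain r1 where r1: "0 < r1" "ball p r1 \<subseteq> S" using ST open_contains_ball by blast
  obtain r2 where r2: "0 < r2" "ball q r2 \<subseteq> T" using ST open_contains_ball by blast
  have "small p' q'" if "dist p p' < min r1 r2" "dist q q' < min r1 r2" for p' q'
  proof -
    have "p' \<in> S" "q' \<in> T" using that r1(2) r2(2) by (auto simp: subset_eq)
    then show ?thesis using ST(5) by blast
  qed
  then show ?thesis using r1 r2 by (intro exI[of _ "min r1 r2"]) auto
qed

text \<open>With momentum \<open>\<tau> *\<^sub>R a\<close> the moment term of
  \<open>target_inner\<close> is zero for every nearby \<open>q\<close>, and a linear function of
  \<open>q\<close> remains.\<close>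

lemma target_gradient_q:
  assumes s: "small (\<tau> *\<^sub>R a) q" and e: "\<bar>e\<bar> \<le> 1"
  shows "GDERIV (\<lambda>q. a \<bullet> target_map e \<alpha> (\<tau> *\<^sub>R a) q) q :> a"
proof -
  obtain r where r: "0 < r" "\<And>p' q'. dist (\<tau> *\<^sub>R a) p' < r \<Longrightarrow> dist q q' < r \<Longrightarrow> small p' q'"
    using small_nearby[OF s] by blast
  have f: "a \<bullet> target_map e \<alpha> (\<tau> *\<^sub>R a) y = a \<bullet> y" if "dist q y < r" for y
    using target_crv(1)[OF r(2) e] target_inner[OF r(2) e, of "\<tau> *\<^sub>R a" y a \<tau>] that r(1) by simp
  show ?thesis
    by (rule GDERIV_local_quadratic[OF r(1), where K = 0]) (use f f[of q] r(1) in \<open>simp add: inner_diff_right\<close>)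
qed

text \<open>In \<open>target_inner\<close> the moment is multiplied by the deviation from
  \<open>\<tau> *\<^sub>R a\<close>. At deviation zero its value is therefore all that enters the
  gradient, and Lipschitz dependence of the moment on \<open>p\<close> makes the error
  quadratic.\<close>

lemma target_gradient_p:
  assumes s: "small (\<tau> *\<^sub>R a) q" and e: "\<bar>e\<bar> \<le> 1"
  shows "GDERIV (\<lambda>p. a \<bullet> target_map e \<alpha> p q) (\<tau> *\<^sub>R a) :> - (2 * e) *\<^sub>R moment e a (\<tau> *\<^sub>R a) q"
proof -
  obtain r where r: "0 < r" "\<And>p' q'. dist (\<tau> *\<^sub>R a) p' < r \<Longrightarrow> dist q q' < r \<Longrightarrow> small p' q'"
    using small_nearby[OF s] by blast
  have q: "q \<in> U" using s by (simp add: small_def)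
  have f: "a \<bullet> target_map e \<alpha> p q = a \<bullet> q - 2 * e * ((p - \<tau> *\<^sub>R a) \<bullet> moment e a p q)" if "small p q" for p
    unfolding target_crv(1)[OF that e] by (rule target_inner[OF that e])
  show ?thesis
  proof (rule GDERIV_local_quadratic[OF r(1)])
    fix y assume "dist (\<tau> *\<^sub>R a) y < r"
    then have y: "small y q" using r by simp
    let ?m = "moment e a y q - moment e a (\<tau> *\<^sub>R a) q"
    have m: "norm ?m \<le> A / (R q)\<^sup>2 * norm a * (4 * A / R q * norm (y - \<tau> *\<^sub>R a))"
      using moment_lipschitz[OF q e y _ s] Rpos[OF q] by simp
    have "a \<bullet> target_map e \<alpha> y q - a \<bullet> target_map e \<alpha> (\<tau> *\<^sub>R a) q - (- (2 * e) *\<^sub>R moment e a (\<tau> *\<^sub>R a) q) \<bullet> (y - \<tau> *\<^sub>R a)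
      = - (2 * e) * ((y - \<tau> *\<^sub>R a) \<bullet> ?m)"
      unfolding f[OF y] f[OF s] inner_diff_right[of _ "moment e a y q"] inner_scaleR_left inner_commute[of "moment e a (\<tau> *\<^sub>R a) q"]
      by (simp add: algebra_simps)
    then have "\<bar>a \<bullet> target_map e \<alpha> y q - a \<bullet> target_map e \<alpha> (\<tau> *\<^sub>R a) q - (- (2 * e) *\<^sub>R moment e a (\<tau> *\<^sub>R a) q) \<bullet> (y - \<tau> *\<^sub>R a)\<bar>
      = 2 * \<bar>e\<bar> * \<bar>(y - \<tau> *\<^sub>R a) \<bullet> ?m\<bar>" by (simp only: abs_mult abs_minus_cancel abs_numeral)
    also have "\<dots> \<le> 2 * 1 * (norm (y - \<tau> *\<^sub>R a) * (A / (R q)\<^sup>2 * norm a * (4 * A / R q * norm (y - \<tau> *\<^sub>R a))))"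
      using e m by (intro mult_mono order_trans[OF Cauchy_Schwarz_ineq2]) auto
    also have "\<dots> = (8 * A\<^sup>2 / R q ^ 3 * norm a) * (norm (y - \<tau> *\<^sub>R a))\<^sup>2" by (simp add: power2_eq_square power3_eq_cube)
    finally show "\<bar>a \<bullet> target_map e \<alpha> y q - a \<bullet> target_map e \<alpha> (\<tau> *\<^sub>R a) q - (- (2 * e) *\<^sub>R moment e a (\<tau> *\<^sub>R a) q) \<bullet> (y - \<tau> *\<^sub>R a)\<bar>
      \<le> (8 * A\<^sup>2 / R q ^ 3 * norm a) * (norm (y - \<tau> *\<^sub>R a))\<^sup>2" .
  qed
qed

text \<open>For an arbitrary solution of the Hamilton system the momentum is not known beforehand.
  Away from \<open>\<tau> *\<^sub>R a\<close> the gradient differs from \<open>a\<close> by at most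
  a multiple of the deviation, which is the estimate that excludes any deviation.\<close>

lemma target_gradient_distance:
  assumes b: "b \<in> U" and s: "small p q" and d: "dist b q < R b / 4" and e: "\<bar>e\<bar> \<le> 1"
    and D: "GDERIV (\<lambda>q. a \<bullet> target_map e \<alpha> p q) q :> D"
  shows "norm (D - a) \<le> (4 * A / (R b)\<^sup>2 * norm a) * norm (p - \<tau> *\<^sub>R a)"
proof -
  obtain r where r: "0 < r" "\<And>p' q'. dist p p' < r \<Longrightarrow> dist q q' < r \<Longrightarrow> small p' q'"
    using small_nearby[OF s] by blast
  have f: "a \<bullet> target_map e \<alpha> p q = a \<bullet> q - 2 * e * ((p - \<tau> *\<^sub>R a) \<bullet> moment e a p q)" if "small p q" for q
    unfolding target_crv(1)[OF that e] by (rule target_inner[OF that e])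
  show ?thesis
  proof (rule gradient_distance_le[OF D])
    show "0 < min r (R b / 4 - dist b q)" using r d by simp
    show "0 \<le> 4 * A / (R b)\<^sup>2 * norm a * norm (p - \<tau> *\<^sub>R a)" using A1 by (intro mult_nonneg_nonneg divide_nonneg_nonneg) auto
    fix y assume y: "dist q y < min r (R b / 4 - dist b q)"
    then have sy: "small p y" using r by simp
    have dy: "dist b y \<le> R b / 4" using y dist_triangle[of b y q] by simp
    let ?m = "moment e a p y - moment e a p q"
    have m: "norm ?m \<le> A / (R b)\<^sup>2 * norm a * (2 * norm (y - q))"
      using moment_lipschitz[OF b e sy dy s less_imp_le[OF d]] by simp
    have "a \<bullet> target_map e \<alpha> p y - a \<bullet> target_map e \<alpha> p q - a \<bullet> (y - q) = - (2 * e) * ((p - \<tau> *\<^sub>R a) \<bullet> ?m)"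
      unfolding f[OF s] f[OF sy] inner_diff_right by (simp add: algebra_simps)
    then have "\<bar>a \<bullet> target_map e \<alpha> p y - a \<bullet> target_map e \<alpha> p q - a \<bullet> (y - q)\<bar> = 2 * \<bar>e\<bar> * \<bar>(p - \<tau> *\<^sub>R a) \<bullet> ?m\<bar>"
      by (simp only: abs_mult abs_minus_cancel abs_numeral)
    also have "\<dots> \<le> 2 * 1 * (norm (p - \<tau> *\<^sub>R a) * (A / (R b)\<^sup>2 * norm a * (2 * norm (y - q))))"
      using e m by (intro mult_mono order_trans[OF Cauchy_Schwarz_ineq2]) auto
    also have "\<dots> = 4 * A / (R b)\<^sup>2 * norm a * norm (p - \<tau> *\<^sub>R a) * norm (y - q)" by simp
    finally show "\<bar>a \<bullet> target_map e \<alpha> p y - a \<bullet> target_map e \<alpha> p q - a \<bullet> (y - q)\<bar>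
      \<le> 4 * A / (R b)\<^sup>2 * norm a * norm (p - \<tau> *\<^sub>R a) * norm (y - q)" .
  qed
qed

text \<open>Differentiation under the integral produces the moment of the rescaled curve, which by
  \<open>crv_rescaled\<close> is the curve belonging to the current point of the flow.\<close>

lemma barycenter_derivative:
  assumes g: "(p, q) \<in> good e" and e: "\<bar>e\<bar> \<le> 1" and \<tau>: "\<tau> \<in> {0..1}"
  shows "(barycenter e p q has_vector_derivative (2 * e) *\<^sub>R moment e p (\<tau> *\<^sub>R p) (barycenter e p q \<tau>)) (at \<tau> within {0..1})"
proof -
  let ?X = "crv e p q"
  have s: "small p q" using g by (auto simp: good_def)
  have q: "q \<in> U" using s by (simp add: small_def)
  have m: "t * u \<in> {0..1}" if "t \<in> {0..1}" "u \<in> {0..1}" for t u :: real using that by (auto simp: mult_le_one)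
  have "((\<lambda>t. integral (cbox 0 1) (\<lambda>u. ?X (t * u))) has_vector_derivative
      integral (cbox 0 1) (\<lambda>u. u *\<^sub>R ((2 * e) *\<^sub>R (\<alpha> (?X (\<tau> * u)) *v p)))) (at \<tau> within {0..1})"
  proof (rule leibniz_rule_vector_derivative[where U = "{0..1}" and fx = "\<lambda>t u. u *\<^sub>R ((2 * e) *\<^sub>R (\<alpha> (?X (t * u)) *v p))"])
    fix t u :: real assume t: "t \<in> {0..1}" and "u \<in> cbox 0 1"
    then have u: "u \<in> {0..1}" by simp
    have "(\<lambda>t. t * u) ` {0..1} \<subseteq> {0..1}" using m u by blast
    with crv_ode(1)[OF s e m[OF t u]]
    have "(?X has_vector_derivative (2 * e) *\<^sub>R (\<alpha> (?X (t * u)) *v p)) (at (t * u) within (\<lambda>t. t * u) ` {0..1})"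
      by (rule has_vector_derivative_within_subset)
    moreover have "((\<lambda>t. t * u) has_vector_derivative u) (at t within {0..1})" by (auto intro!: derivative_eq_intros)
    ultimately have "((?X \<circ> (\<lambda>t. t * u)) has_vector_derivative u *\<^sub>R ((2 * e) *\<^sub>R (\<alpha> (?X (t * u)) *v p))) (at t within {0..1})"
      by (intro vector_diff_chain_within)
    then show "((\<lambda>t. ?X (t * u)) has_vector_derivative u *\<^sub>R ((2 * e) *\<^sub>R (\<alpha> (?X (t * u)) *v p))) (at t within {0..1})"
      by (simp only: o_def)
  next
    fix t :: real assume t: "t \<in> {0..1}"
    have "continuous_on {0..1} (\<lambda>u. ?X (t * u))"
      by (intro continuous_on_compose2[OF crv_ode(3)[OF s e]] continuous_intros) (use m t in blast)
    then show "(\<lambda>u. ?X (t * u)) integrable_on cbox 0 1" unfolding cbox_interval by (rule integrable_continuous_real)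
  next
    have X: "continuous_on ({0..1} \<times> {0..1}) (\<lambda>z::real \<times> real. ?X (fst z * snd z))"
    proof (rule continuous_on_compose2[OF crv_ode(3)[OF s e]])
      show "(\<lambda>z::real \<times> real. fst z * snd z) ` ({0..1} \<times> {0..1}) \<subseteq> {0..1}"
        using m by (metis (no_types, lifting) SigmaE fst_conv image_subsetI snd_conv)
    qed (intro continuous_intros)
    have "(\<lambda>z::real \<times> real. ?X (fst z * snd z)) ` ({0..1} \<times> {0..1}) \<subseteq> ball q (R q)"
      using crv_ball[OF s e m] by (metis (no_types, lifting) SigmaE fst_conv image_subsetI snd_conv)
    then have "continuous_on ({0..1} \<times> {0..1}) (\<lambda>z::real \<times> real. \<alpha> (?X (fst z * snd z)) *v p)"
      by (rule continuous_on_compose2[OF field_cont_at[OF q] X])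
    then show "continuous_on ({0..1} \<times> cbox 0 1) (\<lambda>(t, u). u *\<^sub>R ((2 * e) *\<^sub>R (\<alpha> (?X (t * u)) *v p)))"
      unfolding cbox_interval case_prod_beta by (intro continuous_intros)
  qed (use \<tau> in auto)
  moreover have "integral {0..1} (\<lambda>u. u *\<^sub>R ((2 * e) *\<^sub>R (\<alpha> (?X (\<tau> * u)) *v p))) =
      integral {0..1} (\<lambda>u. (2 * e) *\<^sub>R (u *\<^sub>R (\<alpha> (crv e (\<tau> *\<^sub>R p) (barycenter e p q \<tau>) u) *v p)))"
    by (rule Henstock_Kurzweil_Integration.integral_cong) (simp only: crv_rescaled(2)[OF g e \<tau>] scaleR_scaleR mult.commute)
  moreover have "\<dots> = (2 * e) *\<^sub>R moment e p (\<tau> *\<^sub>R p) (barycenter e p q \<tau>)"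
    unfolding moment_def by (rule integral_cmul)
  moreover have "(\<lambda>t. integral {0..1} (\<lambda>u. ?X (t * u))) = barycenter e p q" by (simp add: barycenter_def fun_eq_iff)
  ultimately show ?thesis unfolding cbox_interval by (simp only:)
qed

lemma hamilton_exists:
  assumes g: "(pb, qb) \<in> good e" and e: "\<bar>e\<bar> \<le> 1"
  shows "hamilton_solution (good e) (\<lambda>p q. - (pb \<bullet> target_map e \<alpha> p q)) (0, crv e pb qb 0) (\<lambda>\<tau>. \<tau> *\<^sub>R pb) (barycenter e pb qb)"
  unfolding hamilton_solution_def
proof (intro conjI ballI)
  show "(0 *\<^sub>R pb, barycenter e pb qb 0) = (0, crv e pb qb 0)" by (simp add: barycenter_def)
  fix \<tau> :: real assume \<tau>: "\<tau> \<in> {0..1}"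
  let ?b = "barycenter e pb qb \<tau>" and ?H = "\<lambda>p q. - (pb \<bullet> target_map e \<alpha> p q)"
  show gd: "(\<tau> *\<^sub>R pb, ?b) \<in> good e" by (rule crv_rescaled(1)[OF g e \<tau>])
  then have s: "small (\<tau> *\<^sub>R pb) ?b" by (simp add: good_def)
  note gq = GDERIV_minus[OF target_gradient_q[OF s e]] and gp = GDERIV_minus[OF target_gradient_p[OF s e]]
  show "has_gradient_at (\<lambda>q. ?H (\<tau> *\<^sub>R pb) q) ?b" "has_gradient_at (\<lambda>p. ?H p ?b) (\<tau> *\<^sub>R pb)"
    unfolding has_gradient_at_def using gq gp by blast+
  show "((\<lambda>\<tau>. \<tau> *\<^sub>R pb) has_vector_derivative - gradient (\<lambda>q. ?H (\<tau> *\<^sub>R pb) q) ?b) (at \<tau> within {0..1})"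
    unfolding gradient_eq[OF gq] by (auto intro!: derivative_eq_intros)
  show "(barycenter e pb qb has_vector_derivative gradient (\<lambda>p. ?H p ?b) (\<tau> *\<^sub>R pb)) (at \<tau> within {0..1})"
    unfolding gradient_eq[OF gp] using barycenter_derivative[OF g e \<tau>] by simp
qed

text \<open>The deviation from uniform motion vanishes at time 0, and
  \<open>target_gradient_distance\<close> bounds its derivative by a multiple of itself, with a
  constant local in \<open>Q\<close>.\<close>

lemma hamilton_momentum:
  assumes e: "\<bar>e\<bar> \<le> 1" and sol: "hamilton_solution (good e) (\<lambda>p q. - (pb \<bullet> target_map e \<alpha> p q)) (0, x0) P Q"
    and u: "u \<in> {0..1}"
  shows "P u = u *\<^sub>R pb"
proof -
  let ?H = "\<lambda>p q. - (pb \<bullet> target_map e \<alpha> p q)"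
  note sol' = sol[unfolded hamilton_solution_def]
  have sm: "small (P s) (Q s)" if "s \<in> {0..1}" for s using sol' that by (auto simp: good_def)
  have cQ: "continuous_on {0..1} Q" using sol' by (intro continuous_on_vector_derivative) blast
  define D where "D s = - gradient (\<lambda>q. ?H (P s) q) (Q s)" for s
  have D: "GDERIV (\<lambda>q. pb \<bullet> target_map e \<alpha> (P s) q) (Q s) :> D s" if "s \<in> {0..1}" for s
  proof -
    have "has_gradient_at (\<lambda>q. ?H (P s) q) (Q s)" using sol' that by blast
    then obtain D' where D': "GDERIV (\<lambda>q. ?H (P s) q) (Q s) :> D'" unfolding has_gradient_at_def ..
    from GDERIV_minus[OF D'] show ?thesis unfolding D_def gradient_eq[OF D'] by simp
  qed
  have "P u - u *\<^sub>R pb = 0"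
  proof (rule vanishing_of_local_bound[where w = "\<lambda>s. P s - s *\<^sub>R pb" and w' = "\<lambda>s. D s - pb"])
    show "((\<lambda>s. P s - s *\<^sub>R pb) has_vector_derivative D s - pb) (at s within {0..1})" if "s \<in> {0..1}" for s
    proof (rule has_vector_derivative_diff)
      show "(P has_vector_derivative D s) (at s within {0..1})" using sol' that unfolding D_def by blast
      show "((\<lambda>s. s *\<^sub>R pb) has_vector_derivative pb) (at s within {0..1})" by (auto intro!: derivative_eq_intros)
    qed
    show "P 0 - 0 *\<^sub>R pb = 0" using sol' by simp
    fix t :: real assume "t \<in> {0..<1}"
    then have t: "t \<in> {0..1}" by simp
    have b: "Q t \<in> U" using sm[OF t] by (simp add: small_def)
    have "0 < R (Q t) / 4" using Rpos[OF b] by simp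
    from stays_near[OF cQ t this] obtain \<delta> where \<delta>: "\<delta> > 0" "\<forall>s\<in>{t..t+\<delta>} \<inter> {0..1}. dist (Q t) (Q s) < R (Q t) / 4"
      by blast
    have "\<forall>s\<in>{t..t+\<delta>} \<inter> {0..1}. norm (D s - pb) \<le> (4 * A / (R (Q t))\<^sup>2 * norm pb) * norm (P s - s *\<^sub>R pb)"
      using \<delta>(2) target_gradient_distance[OF b sm _ e D] by blast
    then show "\<exists>\<delta>>0. \<exists>L. \<forall>s\<in>{t..t+\<delta>} \<inter> {0..1}. norm (D s - pb) \<le> L * norm (P s - s *\<^sub>R pb)"
      using \<delta>(1) by blast
  qed (rule u)
  then show ?thesis by simp
qed

text \<open>With the momentum known, \<open>Q\<close> solves an ordinary differential equation
  driven by the moment, which is locally Lipschitz in \<open>Q\<close>.\<close>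

lemma hamilton_unique:
  assumes g: "(pb, qb) \<in> good e" and e: "\<bar>e\<bar> \<le> 1"
    and sol: "hamilton_solution (good e) (\<lambda>p q. - (pb \<bullet> target_map e \<alpha> p q)) (0, crv e pb qb 0) P Q"
    and u: "u \<in> {0..1}"
  shows "Q u = barycenter e pb qb u"
proof -
  let ?b = "barycenter e pb qb"
  have ode: "small (s *\<^sub>R pb) (Q s) \<and> (Q has_vector_derivative (2 * e) *\<^sub>R moment e pb (s *\<^sub>R pb) (Q s)) (at s within {0..1})"
    if sol: "hamilton_solution (good e) (\<lambda>p q. - (pb \<bullet> target_map e \<alpha> p q)) (0, crv e pb qb 0) P Q" and s: "s \<in> {0..1}" for P Q s
  proof
    note sol' = sol[unfolded hamilton_solution_def]
    have P: "P s = s *\<^sub>R pb" by (rule hamilton_momentum[OF e sol s])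
    show sm: "small (s *\<^sub>R pb) (Q s)" using sol' s P[symmetric] by (auto simp: good_def)
    have "gradient (\<lambda>p. - (pb \<bullet> target_map e \<alpha> p (Q s))) (P s) = (2 * e) *\<^sub>R moment e pb (s *\<^sub>R pb) (Q s)"
      using gradient_eq[OF GDERIV_minus[OF target_gradient_p[OF sm e]]] unfolding P by simp
    then show "(Q has_vector_derivative (2 * e) *\<^sub>R moment e pb (s *\<^sub>R pb) (Q s)) (at s within {0..1})"
      using sol' s by metis
  qed
  note odeQ = ode[OF sol] and odeb = ode[OF hamilton_exists[OF g e]]
  have cQ: "continuous_on {0..1} Q" and cb: "continuous_on {0..1} ?b"
    by (rule continuous_on_vector_derivative, rule conjunct2, erule odeQ odeb)+
  define d where "d s = (2 * e) *\<^sub>R moment e pb (s *\<^sub>R pb) (Q s) - (2 * e) *\<^sub>R moment e pb (s *\<^sub>R pb) (?b s)" for s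
  have "Q u - ?b u = 0"
  proof (rule vanishing_of_local_bound[where w = "\<lambda>s. Q s - ?b s" and w' = d])
    show "((\<lambda>s. Q s - ?b s) has_vector_derivative d s) (at s within {0..1})" if "s \<in> {0..1}" for s
      unfolding d_def using odeQ[OF that] odeb[OF that] by (intro has_vector_derivative_diff) auto
    show "Q 0 - ?b 0 = 0" using sol hamilton_exists[OF g e] unfolding hamilton_solution_def by simp
    fix t :: real assume t': "t \<in> {0..<1}" and z: "\<And>s. s \<in> {0..t} \<Longrightarrow> Q s - ?b s = 0"
    have t: "t \<in> {0..1}" using t' by simp
    have b: "Q t \<in> U" using odeQ[OF t] by (simp add: small_def)
    have bt: "?b t = Q t" using z[of t] t by simp
    have r: "0 < R (Q t) / 4" using Rpos[OF b] by simp
    obtain \<delta>1 where \<delta>1: "\<delta>1 > 0" "\<forall>s\<in>{t..t+\<delta>1} \<inter> {0..1}. dist (Q t) (Q s) < R (Q t) / 4"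
      using stays_near[OF cQ t r] by blast
    obtain \<delta>2 where \<delta>2: "\<delta>2 > 0" "\<forall>s\<in>{t..t+\<delta>2} \<inter> {0..1}. dist (Q t) (?b s) < R (Q t) / 4"
      using stays_near[OF cb t r] unfolding bt by blast
    have "norm (d s) \<le> (4 * (A / (R (Q t))\<^sup>2 * norm pb)) * norm (Q s - ?b s)" if "s \<in> {t..t+min \<delta>1 \<delta>2} \<inter> {0..1}" for s
    proof -
      have s: "s \<in> {0..1}" "dist (Q t) (Q s) \<le> R (Q t) / 4" "dist (Q t) (?b s) \<le> R (Q t) / 4"
        using \<delta>1(2) \<delta>2(2) that by (auto intro: less_imp_le)
      let ?m = "moment e pb (s *\<^sub>R pb) (Q s) - moment e pb (s *\<^sub>R pb) (?b s)"
      have m: "norm ?m \<le> A / (R (Q t))\<^sup>2 * norm pb * (2 * norm (Q s - ?b s))"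
        using moment_lipschitz[OF b e conjunct1[OF odeQ[OF s(1)]] s(2) conjunct1[OF odeb[OF s(1)]] s(3), of pb] by simp
      have "norm (d s) = 2 * \<bar>e\<bar> * norm ?m"
        by (simp add: d_def scaleR_diff_right[symmetric] abs_mult del: scaleR_diff_right)
      also have "\<dots> \<le> 2 * 1 * (A / (R (Q t))\<^sup>2 * norm pb * (2 * norm (Q s - ?b s)))" using e m by (intro mult_mono) auto
      finally show ?thesis by simp
    qed
    then show "\<exists>\<delta>>0. \<exists>L. \<forall>s\<in>{t..t+\<delta>} \<inter> {0..1}. norm (d s) \<le> L * norm (Q s - ?b s)"
      using \<delta>1(1) \<delta>2(1) by (metis min_less_iff_conj)
  qed (rule u)
  then show ?thesis by simp
qed

lemma generating_function_flow:
  assumes e: "\<bar>e\<bar> \<le> 1"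
  shows "\<exists>N. genfun_domain e \<alpha> U N \<and>
           {0} \<times> U \<subseteq> interior (G_S e \<alpha> U N) \<and>
           (\<forall>x\<in>U. B_field e \<alpha> x = (2 * e) *\<^sub>R \<alpha> x) \<and>
           (\<forall>(pb, qb) \<in> G_S e \<alpha> U N.
              (let x0 = source_map e \<alpha> pb qb;
                   sol = poisson_solution U (B_field e \<alpha>) pb x0
               in (\<exists>x. sol x) \<and> (\<forall>x. sol x \<longrightarrow> x 1 = target_map e \<alpha> pb qb)) \<and>
              (let y0 = (0, source_map e \<alpha> pb qb);
                   H = (\<lambda>p q. - (pb \<bullet> target_map e \<alpha> p q));
                   sol = hamilton_solution (G_S e \<alpha> U N) H y0
               in (\<exists>p q. sol p q) \<and> (\<forall>p q. sol p q \<longrightarrow> (p 1, q 1) = (pb, qb))))"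
    (is "\<exists>N. _ \<and> _ \<and> _ \<and> (\<forall>(pb, qb) \<in> _. ?flow N pb qb)")
proof -
  have "?flow (neighborhood e) pb qb" if g: "(pb, qb) \<in> good e" for pb qb
  proof -
    have s: "small pb qb" using g by (simp add: good_def)
    note X = crv_poisson[OF s e] and Y = hamilton_exists[OF g e]
    have x1: "x 1 = crv e pb qb 1" if "poisson_solution U (B_field e \<alpha>) pb (crv e pb qb 0) x" for x
      by (rule poisson_unique[OF e that X]) simp
    \<comment> \<open>At time 1 the barycenter is the mean of the whole curve, which is
      \<open>qb\<close>.\<close>
    have y1: "p 1 = pb \<and> q 1 = qb"
      if sol: "hamilton_solution (good e) (\<lambda>p q. - (pb \<bullet> target_map e \<alpha> p q)) (0, crv e pb qb 0) p q" for p q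
      using hamilton_momentum[OF e sol, of 1] hamilton_unique[OF g e sol, of 1] crv_ode(2)[OF s e] by (simp add: barycenter_def)
    show ?thesis
      unfolding G_S_good[OF e] source_crv(1)[OF s e] target_crv(1)[OF s e] Let_def prod.inject using X x1 Y y1 by blast
  qed
  moreover have "{0} \<times> U \<subseteq> interior (good e)"
    unfolding interior_open[OF open_good[OF e]] using good_0[OF e] by auto
  ultimately show ?thesis
    using neighborhood_domain[OF e] B_field_eq[OF e] by (intro exI[of _ "neighborhood e"]) (auto simp only: G_S_good[OF e])
qed

end

theorem proposition2:
  fixes A :: "('m::{t2_space, second_countable_topology}, 'd::finite) chart set"
    and P :: "('m, 'd) chart \<Rightarrow> real^'d \<Rightarrow> real^'d^'d"
    and c :: "('m, 'd) chart"
    and U :: "(real^'d) set"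
    and \<alpha> :: "real^'d \<Rightarrow> real^'d^'d"
    and \<epsilon> :: real
  assumes "smooth_atlas A"
    and "poisson_structure A P"
    and "\<forall>c'\<in>A. \<exists>M. derivative_bound (chart_image c') (P c') M"
    and "c \<in> A" and "U = chart_image c" and "\<alpha> = P c"
    and "0 \<le> \<epsilon>" and "\<epsilon> < 1"
  shows "\<exists>N. genfun_domain \<epsilon> \<alpha> U N \<and>
           {0} \<times> U \<subseteq> interior (G_S \<epsilon> \<alpha> U N) \<and>
           (\<forall>x\<in>U. B_field \<epsilon> \<alpha> x = (2 * \<epsilon>) *\<^sub>R \<alpha> x) \<and>
           (\<forall>(pb, qb) \<in> G_S \<epsilon> \<alpha> U N.
              (let x0 = source_map \<epsilon> \<alpha> pb qb;
                   sol = poisson_solution U (B_field \<epsilon> \<alpha>) pb x0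
               in (\<exists>x. sol x) \<and> (\<forall>x. sol x \<longrightarrow> x 1 = target_map \<epsilon> \<alpha> pb qb)) \<and>
              (let y0 = (0, source_map \<epsilon> \<alpha> pb qb);
                   H = (\<lambda>p q. - (pb \<bullet> target_map \<epsilon> \<alpha> p q));
                   sol = hamilton_solution (G_S \<epsilon> \<alpha> U N) H y0
               in (\<exists>p q. sol p q) \<and> (\<forall>p q. sol p q \<longrightarrow> (p 1, q 1) = (pb, qb))))"
proof -
  have U: "open U" using assms by (auto simp: smooth_atlas_def)
  have lp: "local_poisson U \<alpha>" using assms by (auto simp: poisson_structure_def)
  then have sm: "smooth_on U (\<lambda>y. \<alpha> y $ i $ j)" for i j unfolding local_poisson_def by blast
  then have smc: "smooth_on U f" if "f \<in> comps \<alpha>" for f using that unfolding comps_def by blast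
  have anti: "\<alpha> x $ i $ j = - \<alpha> x $ j $ i" if "x \<in> U" for x i j using lp that unfolding local_poisson_def by blast
  obtain M where M: "derivative_bound U \<alpha> M" using assms by blast
  have bnd: "\<exists>K>0. deriv_bnd (comps \<alpha>) K x" if x: "x \<in> U" for x
  proof (intro exI conjI)
    show "0 < M x" using M x unfolding derivative_bound_def by blast
    have "\<bar>iter_partial is (\<lambda>y. \<alpha> y $ i $ j) x\<bar> \<le> M x ^ (length is + 1)" for i j "is"
    proof -
      have "(\<Sum>r\<in>UNIV. count_list is r) = length is" by (rule sum_count_set) auto
      moreover have "\<bar>iter_partial is (\<lambda>y. \<alpha> y $ i $ j) x\<bar> \<le> M x ^ ((\<Sum>r\<in>UNIV. count_list is r) + 1)"
        using M x unfolding derivative_bound_def by blast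
      ultimately show ?thesis by simp
    qed
    then show "deriv_bnd (comps \<alpha>) (M x) x" unfolding deriv_bnd_def comps_def by blast
  qed
  have e: "\<bar>\<epsilon>\<bar> \<le> 1" using assms by simp
  \<comment> \<open>The pointwise bounds \<open>M\<close> enter only through \<open>radius\<close>,
    which plays the part of \<open>R\<close>.\<close>
  note r = radius_facts[OF U smc bnd]
  show ?thesis by (rule generating_function_flow[OF refl U sm anti r(1,2,3,4,5) e])
qed

end
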